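(* Let $(M,L)$ be a globally hyperbolic Lorentz-Finsler manifold with fixed splitting $\tau$ and let $(\mu,\nu)\in\mathcal{P}^+_\tau(M)$. Assume that the supports of $\mu$ and $\nu$ are disjoint and that the dual Kantorovich problem (DKP) for $(\mu,\nu)$ admits a solution $\psi\colon M\to\mathbb{R}\cup\{\infty\}$. Further assume that $\mu$ is either (i) supported on a spacelike hypersurface $H$ and absolutely continuous with respect to the Lebesgue measure $\mathcal{L}_H$ on $H$, or (ii) absolutely continuous with respect to the Lebesgue measure $\mathcal{L}$ on $M$. Let $\Pi$ be a dynamical optimal coupling of $\mu$ and $\nu$ and let $\Gamma_0$ be the set of lightlike minimizers in $\Gamma$. Then $\Pi(\Gamma_0)=0$.
   Context: Setting. $M$ is a smooth manifold with a fixed complete Riemannian metric $h$ (norm $|\cdot|$); $T^0M$ is the zero section of $TM$. Lebesgue measures on $M$ and on hypersurfaces are those induced by $h$. $\mathbb{L}\colon TM\to\mathbb{R}$ is continuous, smooth on $TM\setminus T^0M$, positively homogeneous of degree $2$ on fibres, and its second fibre derivative is non-degenerate with index $\dim M-1$ (exactly $\dim M-1$ negative eigenvalues). A causal structure $\mathcal{C}\subset TM$ is a closed set such that each $\mathcal{C}_x=\mathcal{C}\cap T_xM$ is the closure of a connected component of $\{v\in T_xM: \mathbb{L}(v)>0\}$, the choice of component depending continuously on $x$. Fix such a $\mathcal{C}$ and set $L(v)=-\sqrt{\mathbb{L}(v)}$ for $v\in\mathcal{C}$ and $L(v)=\infty$ otherwise. $(M,L)$ is called a Lorentz-Finsler manifold.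 A hypersurface $H$ is spacelike if $T_xH\cap\mathcal{C}_x=\{0\}$ for all $x\in H$. Causality. An absolutely continuous curve $\gamma\colon I\to M$ is causal if $\dot\gamma(t)\in\mathcal{C}$ for almost all $t$ (constant curves are causal). $J^+(x)$ is the set of $y$ such that a causal curve $\gamma\colon[a,b]\to M$ with $\gamma(a)=x,\gamma(b)=y$ exists; $J^-(y)=\{x: y\in J^+(x)\}$; $J^+=\{(x,y): y\in J^+(x)\}$. $(M,L)$ is causal if there is no nonconstant closed causal curve, and globally hyperbolic if it is causal and all $J^+(x)\cap J^-(y)$ are compact. A splitting is a diffeomorphism $M\cong\mathbb{R}\times N$ such that the projection $\tau\colon M\to\mathbb{R}$ to the first factor satisfies $-d\tau(v)\le\min\{L(v),-|v|\}$ for all $v\in\mathcal{C}$; one is fixed. Cost. $\mathcal{A}(\gamma)=\int_a^bL(\dot\gamma)\,dt$ for absolutely continuous $\gamma\colon[a,b]\to M$; $c_L(x,y)=\min\{\mathcal{A}(\gamma):\gamma\text{ connects }x\text{ to }y\}\in\mathbb{R}\cup\{\infty\}$ ($\infty$ iff $(x,y)\notin J^+$; $c_L(x,x)=0$). $\mathcal{P}^+_\tau(M)$ is the set of pairs $(\mu_0,\mu_1)$ of Borel probability measures on $M$ with $\tau\in L^1(\mu_0)\cap L^1(\mu_1)$ admitting a coupling $\pi$ with $\pi(J^+)=1$. An optimal coupling of $(\mu_0,\mu_1)$ is a minimizer of $\int c_L\,d\pi$ among all couplings. Duality. $\psi\colon M\to\mathbb{R}\cup\{\infty\}$, $\psi\not\equiv\infty$,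 is $c_L$-convex if $\psi(x)=\sup_{y\in M}\{\zeta(y)-c_L(x,y)\}$ for all $x\in M$, for some $\zeta\colon M\to\mathbb{R}\cup\{\pm\infty\}$ (with $\infty-\infty=-\infty$). Its $c_L$-transform is $\psi^{c_L}(y)=\inf_{x\in M}\{\psi(x)+c_L(x,y)\}$. A $c_L$-convex $\psi$ is a solution to the DKP for $(\mu,\nu)$ if $\psi$ is $\mu$-almost surely finite and $\psi^{c_L}(y)-\psi(x)=c_L(x,y)$ $\pi$-almost surely for every optimal coupling $\pi$ of $\mu$ and $\nu$. Geodesics. $\Gamma$ is the set of causal minimizers $\gamma\colon[0,1]\to M$ of $\mathcal{A}$ (between their endpoints) with $d\tau(\dot\gamma)$ constant along $\gamma$ (time-affinely parametrized geodesics), with the topology of uniform convergence; $\mathrm{ev}_t(\gamma)=\gamma(t)$. $\gamma\in\Gamma$ is lightlike if $L(\dot\gamma)\equiv0$. A Borel measure $\Pi$ on $\Gamma$ is a dynamical optimal coupling of $\mu_0:=(\mathrm{ev}_0)_\sharp\Pi$ and $\mu_1:=(\mathrm{ev}_1)_\sharp\Pi$ if $(\mathrm{ev}_0,\mathrm{ev}_1)_\sharp\Pi$ is an optimal coupling of $\mu_0$ and $\mu_1$. *)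

theory Defs
  imports "HOL-Probability.Probability_Measure" "HOL-Combinatorics.Permutations"
begin

section \<open>Smooth manifolds\<close>

text \<open>\<open>C\<^sup>k\<close> maps on an open subset of a finite-dimensional normed space. Model spaces are only
  required to be normed, because the type class of Euclidean spaces excludes dimension 0.\<close>

primrec Ck_on :: "nat \<Rightarrow> 'a::real_normed_vector set \<Rightarrow> ('a \<Rightarrow> 'b::real_normed_vector) \<Rightarrow> bool" where
  "Ck_on 0 S f \<longleftrightarrow> continuous_on S f"
| "Ck_on (Suc k) S f \<longleftrightarrow>
     (\<forall>x\<in>S. f differentiable (at x)) \<and> (\<forall>v. Ck_on k S (\<lambda>x. frechet_derivative f (at x) v))"

definition smooth_on :: "'a::real_normed_vector set \<Rightarrow> ('a \<Rightarrow> 'b::real_normed_vector) \<Rightarrow> bool" where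
  "smooth_on S f \<longleftrightarrow> (\<forall>k. Ck_on k S f)"

text \<open>A chart is a pair of a domain and a coordinate map; the values of the coordinate map outside
  its domain are irrelevant.\<close>

type_synonym ('m, 'e) chart = "'m set \<times> ('m \<Rightarrow> 'e)"

abbreviation dom_of :: "('m, 'e) chart \<Rightarrow> 'm set" where "dom_of \<equiv> fst"
abbreviation map_of_chart :: "('m, 'e) chart \<Rightarrow> 'm \<Rightarrow> 'e" where "map_of_chart \<equiv> snd"

definition range_of :: "('m, 'e) chart \<Rightarrow> 'e set" where
  "range_of c = map_of_chart c ` dom_of c"

definition inv_of :: "('m, 'e) chart \<Rightarrow> 'e \<Rightarrow> 'm" where
  "inv_of c = inv_into (dom_of c) (map_of_chart c)"

definition is_chart :: "('m::topological_space, 'e::real_normed_vector) chart \<Rightarrow> bool" where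
  "is_chart c \<longleftrightarrow> open (dom_of c) \<and> open (range_of c) \<and>
     homeomorphism (dom_of c) (range_of c) (map_of_chart c) (inv_of c)"

definition smoothly_related ::
    "('m::topological_space, 'e::real_normed_vector) chart \<Rightarrow> ('m, 'e) chart \<Rightarrow> bool" where
  "smoothly_related c d \<longleftrightarrow>
     smooth_on (map_of_chart c ` (dom_of c \<inter> dom_of d)) (map_of_chart d \<circ> inv_of c) \<and>
     smooth_on (map_of_chart d ` (dom_of c \<inter> dom_of d)) (map_of_chart c \<circ> inv_of d)"

text \<open>The manifold is the whole type \<open>'m\<close>; the Hausdorff and second countability axioms are imposed
  through the type classes of \<open>'m\<close>. The atlas need not be maximal.\<close>

definition smooth_atlas ::
    "('m::{t2_space,second_countable_topology}, 'e::real_normed_vector) chart set \<Rightarrow> bool" where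
  "smooth_atlas A \<longleftrightarrow>
     (\<forall>c\<in>A. is_chart c) \<and> (\<Union>c\<in>A. dom_of c) = UNIV \<and> (\<forall>c\<in>A. \<forall>d\<in>A. smoothly_related c d)"

definition compatible_chart ::
    "('m::topological_space, 'e::real_normed_vector) chart set \<Rightarrow> ('m, 'e) chart \<Rightarrow> bool" where
  "compatible_chart A c \<longleftrightarrow> is_chart c \<and> (\<forall>d\<in>A. smoothly_related c d)"

definition smooth_map ::
    "('m::topological_space, 'e::real_normed_vector) chart set \<Rightarrow>
     ('n::topological_space, 'f::real_normed_vector) chart set \<Rightarrow> ('m \<Rightarrow> 'n) \<Rightarrow> bool" where
  "smooth_map A B f \<longleftrightarrow> continuous_on UNIV f \<and>
     (\<forall>c\<in>A. \<forall>d\<in>B. smooth_on (map_of_chart c ` (dom_of c \<inter> f -` dom_of d))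
                            (map_of_chart d \<circ> f \<circ> inv_of c))"

definition diffeomorphism ::
    "('m::topological_space, 'e::real_normed_vector) chart set \<Rightarrow>
     ('n::topological_space, 'f::real_normed_vector) chart set \<Rightarrow> ('m \<Rightarrow> 'n) \<Rightarrow> bool" where
  "diffeomorphism A B f \<longleftrightarrow> bij f \<and> smooth_map A B f \<and> smooth_map B A (inv f)"

definition real_times_atlas :: "('n, 'f) chart set \<Rightarrow> (real \<times> 'n, real \<times> 'f) chart set" where
  "real_times_atlas B = (\<lambda>d. (UNIV \<times> dom_of d, \<lambda>(t, q). (t, map_of_chart d q))) ` B"


section \<open>The tangent bundle\<close>

text \<open>Every point \<open>x\<close> gets a preferred chart of the atlas, and the tangent space at \<open>x\<close> is the model
  space \<open>'e\<close>, a vector being identified with its coordinates in the preferred chart at \<open>x\<close>. Hence the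
  tangent bundle is \<open>'m \<times> 'e\<close> as a set, but its topology and smooth structure are those given by the
  bundle charts \<open>bundle_chart A c\<close> below, in general not those of the product.\<close>

definition chart_at :: "('m, 'e) chart set \<Rightarrow> 'm \<Rightarrow> ('m, 'e) chart" where
  "chart_at A x = (SOME c. c \<in> A \<and> x \<in> dom_of c)"

definition differential ::
    "('m, 'e::real_normed_vector) chart set \<Rightarrow> ('m \<Rightarrow> 'b::real_normed_vector) \<Rightarrow> 'm \<Rightarrow> 'e \<Rightarrow> 'b" where
  "differential A f x =
     frechet_derivative (f \<circ> inv_of (chart_at A x)) (at (map_of_chart (chart_at A x) x))"

definition bundle_chart ::
    "('m, 'e::real_normed_vector) chart set \<Rightarrow> ('m, 'e) chart \<Rightarrow> 'm \<times> 'e \<Rightarrow> 'e \<times> 'e" where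
  "bundle_chart A c = (\<lambda>(x, v). (map_of_chart c x, differential A (map_of_chart c) x v))"

definition bundle_inv ::
    "('m, 'e::real_normed_vector) chart set \<Rightarrow> ('m, 'e) chart \<Rightarrow> 'e \<times> 'e \<Rightarrow> 'm \<times> 'e" where
  "bundle_inv A c = inv_into (dom_of c \<times> UNIV) (bundle_chart A c)"

definition bundle_open ::
    "('m, 'e::real_normed_vector) chart set \<Rightarrow> ('m \<times> 'e) set \<Rightarrow> bool" where
  "bundle_open A S \<longleftrightarrow> (\<forall>c\<in>A. open (bundle_chart A c ` (S \<inter> dom_of c \<times> UNIV)))"

definition velocity ::
    "('m, 'e::real_normed_vector) chart set \<Rightarrow> (real \<Rightarrow> 'm) \<Rightarrow> real \<Rightarrow> 'e" where
  "velocity A \<gamma> t = vector_derivative (map_of_chart (chart_at A (\<gamma> t)) \<circ> \<gamma>) (at t)"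


section \<open>Absolutely continuous curves\<close>

definition AC_on :: "real \<Rightarrow> real \<Rightarrow> (real \<Rightarrow> 'e::real_normed_vector) \<Rightarrow> bool" where
  "AC_on a b f \<longleftrightarrow>
     (\<forall>\<epsilon>>0. \<exists>\<delta>>0. \<forall>I :: (real \<times> real) set.
        finite I \<and> (\<forall>(s, t)\<in>I. a \<le> s \<and> s \<le> t \<and> t \<le> b) \<and>
        pairwise (\<lambda>p q. disjnt {fst p<..<snd p} {fst q<..<snd q}) I \<and>
        (\<Sum>(s, t)\<in>I. t - s) < \<delta>
        \<longrightarrow> (\<Sum>(s, t)\<in>I. norm (f t - f s)) < \<epsilon>)"

definition AC_curve ::
    "('m::topological_space, 'e::real_normed_vector) chart set \<Rightarrow> real \<Rightarrow> real \<Rightarrow> (real \<Rightarrow> 'm) \<Rightarrow> bool" where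
  "AC_curve A a b \<gamma> \<longleftrightarrow> a < b \<and> continuous_on {a..b} \<gamma> \<and>
     (\<forall>c\<in>A. \<forall>s t. a \<le> s \<and> s \<le> t \<and> t \<le> b \<and> \<gamma> ` {s..t} \<subseteq> dom_of c
        \<longrightarrow> AC_on s t (map_of_chart c \<circ> \<gamma>))"


section \<open>Lorentz-Finsler manifolds\<close>

record ('m, 'e) lf_manifold =
  atlas :: "('m, 'e) chart set"
  metric :: "'m \<Rightarrow> 'e \<Rightarrow> 'e \<Rightarrow> real"
  LL :: "'m \<times> 'e \<Rightarrow> real"
  cone :: "('m \<times> 'e) set"

subsection \<open>The auxiliary Riemannian metric\<close>

definition local_metric ::
    "('m, 'e::real_normed_vector) lf_manifold \<Rightarrow> ('m, 'e) chart \<Rightarrow> 'e \<Rightarrow> 'e \<Rightarrow> 'e \<Rightarrow> real" where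
  "local_metric M c y u w =
     (let T = (\<lambda>z. snd (bundle_inv (atlas M) c (y, z))) in metric M (inv_of c y) (T u) (T w))"

definition riemannian_metric :: "('m, 'e::real_normed_vector) lf_manifold \<Rightarrow> bool" where
  "riemannian_metric M \<longleftrightarrow>
     (\<forall>x. bilinear (metric M x) \<and> (\<forall>u w. metric M x u w = metric M x w u) \<and>
          (\<forall>u. u \<noteq> 0 \<longrightarrow> metric M x u u > 0)) \<and>
     (\<forall>c\<in>atlas M. \<forall>u w. smooth_on (range_of c) (\<lambda>y. local_metric M c y u w))"

definition hnorm :: "('m, 'e) lf_manifold \<Rightarrow> 'm \<Rightarrow> 'e \<Rightarrow> real" where
  "hnorm M x v = sqrt (metric M x v v)"

text \<open>The Riemannian distance; it is infinite between different connected components.\<close>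

definition hdist ::
    "('m::topological_space, 'e::real_normed_vector) lf_manifold \<Rightarrow> 'm \<Rightarrow> 'm \<Rightarrow> ennreal" where
  "hdist M x y =
     (INF \<gamma>\<in>{\<gamma>. AC_curve (atlas M) 0 1 \<gamma> \<and> \<gamma> 0 = x \<and> \<gamma> 1 = y}.
        \<integral>\<^sup>+t. ennreal (hnorm M (\<gamma> t) (velocity (atlas M) \<gamma> t)) \<partial>lebesgue_on {0..1})"

definition complete_metric ::
    "('m::topological_space, 'e::real_normed_vector) lf_manifold \<Rightarrow> bool" where
  "complete_metric M \<longleftrightarrow>
     (\<forall>X :: nat \<Rightarrow> 'm. (\<forall>\<epsilon>>0. \<exists>k. \<forall>i\<ge>k. \<forall>j\<ge>k. hdist M (X i) (X j) < \<epsilon>) \<longrightarrow> convergent X)"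

subsection \<open>The Lebesgue measures induced by the Riemannian metric\<close>

text \<open>Lebesgue measure on the coordinate subspace spanned by \<open>S \<subseteq> Basis\<close>, as a measure on the whole
  space; it is \<open>lborel\<close> for \<open>S = Basis\<close>.\<close>

definition coord_lborel :: "'e::euclidean_space set \<Rightarrow> 'e measure" where
  "coord_lborel S = distr (\<Pi>\<^sub>M i\<in>S. lborel) borel (\<lambda>f. \<Sum>i\<in>S. f i *\<^sub>R i)"

definition gram_det :: "'e set \<Rightarrow> ('e \<Rightarrow> 'e \<Rightarrow> real) \<Rightarrow> real" where
  "gram_det S g = (\<Sum>p | p permutes S. of_int (sign p) * (\<Prod>i\<in>S. g i (p i)))"

text \<open>In a chart, the volume measure has density \<open>sqrt (det g\<^sub>i\<^sub>j)\<close>. This determines the measure.\<close>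

definition is_lebesgue_measure ::
    "('m::topological_space, 'e::euclidean_space) lf_manifold \<Rightarrow> 'm measure \<Rightarrow> bool" where
  "is_lebesgue_measure M m \<longleftrightarrow> sets m = sets borel \<and>
     (\<forall>c\<in>atlas M. \<forall>S\<in>sets borel. S \<subseteq> dom_of c \<longrightarrow>
        emeasure m S =
          (\<integral>\<^sup>+y. indicator (map_of_chart c ` S) y *
                 ennreal (sqrt (gram_det Basis (local_metric M c y))) \<partial>lborel))"

text \<open>Embedded smooth hypersurfaces, through charts of the smooth structure in which the hypersurface
  is the coordinate hyperplane orthogonal to the basis vector \<open>b\<close>.\<close>

definition slice_chart ::
    "('m::topological_space, 'e::euclidean_space) chart set \<Rightarrow> 'm set \<Rightarrow> ('m, 'e) chart \<Rightarrow> 'e \<Rightarrow> bool" where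
  "slice_chart A H c b \<longleftrightarrow> compatible_chart A c \<and> b \<in> Basis \<and>
     map_of_chart c ` (H \<inter> dom_of c) = range_of c \<inter> {y. y \<bullet> b = 0}"

definition hypersurface ::
    "('m::topological_space, 'e::euclidean_space) chart set \<Rightarrow> 'm set \<Rightarrow> bool" where
  "hypersurface A H \<longleftrightarrow> (\<forall>x\<in>H. \<exists>c b. slice_chart A H c b \<and> x \<in> dom_of c)"

definition hyp_tangent ::
    "('m::topological_space, 'e::euclidean_space) chart set \<Rightarrow> 'm set \<Rightarrow> 'm \<Rightarrow> 'e set" where
  "hyp_tangent A H x =
     {v. \<exists>c b. slice_chart A H c b \<and> x \<in> dom_of c \<and> differential A (map_of_chart c) x v \<bullet> b = 0}"

text \<open>The volume measure of the metric induced on the hypersurface, as a measure on the manifold.\<close>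

definition is_hyp_lebesgue_measure ::
    "('m::topological_space, 'e::euclidean_space) lf_manifold \<Rightarrow> 'm set \<Rightarrow> 'm measure \<Rightarrow> bool" where
  "is_hyp_lebesgue_measure M H m \<longleftrightarrow> sets m = sets borel \<and> emeasure m (UNIV - H) = 0 \<and>
     (\<forall>c b. slice_chart (atlas M) H c b \<longrightarrow> (\<forall>S\<in>sets borel. S \<subseteq> dom_of c \<longrightarrow>
        emeasure m S =
          (\<integral>\<^sup>+y. indicator (map_of_chart c ` (S \<inter> H)) y *
                 ennreal (sqrt (gram_det (Basis - {b}) (local_metric M c y)))
               \<partial>coord_lborel (Basis - {b}))))"

subsection \<open>The Lorentz-Finsler structure\<close>

definition fibre_hessian :: "('m \<times> 'e::real_normed_vector \<Rightarrow> real) \<Rightarrow> 'm \<Rightarrow> 'e \<Rightarrow> 'e \<Rightarrow> 'e \<Rightarrow> real" where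
  "fibre_hessian F x v u w =
     frechet_derivative (\<lambda>z. frechet_derivative (\<lambda>z'. F (x, z')) (at z) u) (at v) w"

definition nondegenerate :: "('e::real_vector \<Rightarrow> 'e \<Rightarrow> real) \<Rightarrow> bool" where
  "nondegenerate g \<longleftrightarrow> (\<forall>u. u \<noteq> 0 \<longrightarrow> (\<exists>w. g u w \<noteq> 0))"

text \<open>Number of negative eigenvalues, with multiplicity, of the matrix of the symmetric bilinear form
  \<open>g\<close> with respect to the standard basis (by Sylvester's law any basis gives the same number).\<close>

definition form_op :: "('e::euclidean_space \<Rightarrow> 'e \<Rightarrow> real) \<Rightarrow> 'e \<Rightarrow> 'e" where
  "form_op g w = (\<Sum>b\<in>Basis. g b w *\<^sub>R b)"

definition neg_eigenvalue_count :: "('e::euclidean_space \<Rightarrow> 'e \<Rightarrow> real) \<Rightarrow> nat" where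
  "neg_eigenvalue_count g =
     (\<Sum>l | l < 0 \<and> (\<exists>w. w \<noteq> 0 \<and> form_op g w = l *\<^sub>R w). dim {w. form_op g w = l *\<^sub>R w})"

definition lf_function ::
    "('m::topological_space, 'e::euclidean_space) lf_manifold \<Rightarrow> bool" where
  "lf_function M \<longleftrightarrow>
     (\<forall>c\<in>atlas M. continuous_on (range_of c \<times> UNIV) (LL M \<circ> bundle_inv (atlas M) c)) \<and>
     (\<forall>c\<in>atlas M. smooth_on (range_of c \<times> (UNIV - {0})) (LL M \<circ> bundle_inv (atlas M) c)) \<and>
     (\<forall>x v. \<forall>r>0. LL M (x, r *\<^sub>R v) = r\<^sup>2 * LL M (x, v)) \<and>
     (\<forall>x v. v \<noteq> 0 \<longrightarrow> nondegenerate (fibre_hessian (LL M) x v) \<and>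
        neg_eigenvalue_count (fibre_hessian (LL M) x v) = DIM('e) - 1)"

text \<open>The continuous dependence of the component on the base point is expressed by the openness in
  the tangent bundle of the union of the chosen components.\<close>

definition causal_structure ::
    "('m::topological_space, 'e::euclidean_space) lf_manifold \<Rightarrow> bool" where
  "causal_structure M \<longleftrightarrow> bundle_open (atlas M) (UNIV - cone M) \<and>
     (\<exists>K :: 'm \<Rightarrow> 'e set.
        (\<forall>x. K x \<in> components {v. LL M (x, v) > 0} \<and> {v. (x, v) \<in> cone M} = closure (K x)) \<and>
        bundle_open (atlas M) (SIGMA x:UNIV. K x))"

definition lorentz_finsler ::
    "('m::{t2_space,second_countable_topology}, 'e::euclidean_space) lf_manifold \<Rightarrow> bool" where
  "lorentz_finsler M \<longleftrightarrow> smooth_atlas (atlas M) \<and> riemannian_metric M \<and> complete_metric M \<and>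
     lf_function M \<and> causal_structure M"

definition Lag :: "('m, 'e) lf_manifold \<Rightarrow> 'm \<Rightarrow> 'e \<Rightarrow> ereal" where
  "Lag M x v = (if (x, v) \<in> cone M then ereal (- sqrt (LL M (x, v))) else \<infinity>)"

definition spacelike_hypersurface ::
    "('m::topological_space, 'e::euclidean_space) lf_manifold \<Rightarrow> 'm set \<Rightarrow> bool" where
  "spacelike_hypersurface M H \<longleftrightarrow> hypersurface (atlas M) H \<and>
     (\<forall>x\<in>H. hyp_tangent (atlas M) H x \<inter> {v. (x, v) \<in> cone M} = {0})"

subsection \<open>Causality\<close>

definition causal_curve ::
    "('m::topological_space, 'e::real_normed_vector) lf_manifold \<Rightarrow> real \<Rightarrow> real \<Rightarrow> (real \<Rightarrow> 'm) \<Rightarrow> bool" where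
  "causal_curve M a b \<gamma> \<longleftrightarrow> AC_curve (atlas M) a b \<gamma> \<and>
     (AE t in lebesgue_on {a..b}. (\<gamma> t, velocity (atlas M) \<gamma> t) \<in> cone M)"

definition Jplus :: "('m::topological_space, 'e::real_normed_vector) lf_manifold \<Rightarrow> ('m \<times> 'm) set" where
  "Jplus M = {(x, y). \<exists>a b \<gamma>. causal_curve M a b \<gamma> \<and> \<gamma> a = x \<and> \<gamma> b = y}"

definition causal :: "('m::topological_space, 'e::real_normed_vector) lf_manifold \<Rightarrow> bool" where
  "causal M \<longleftrightarrow>
     (\<forall>a b \<gamma>. causal_curve M a b \<gamma> \<and> \<gamma> a = \<gamma> b \<longrightarrow> \<gamma> constant_on {a..b})"

definition globally_hyperbolic ::
    "('m::topological_space, 'e::real_normed_vector) lf_manifold \<Rightarrow> bool" where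
  "globally_hyperbolic M \<longleftrightarrow> causal M \<and>
     (\<forall>x y. compact ({z. (x, z) \<in> Jplus M} \<inter> {z. (z, y) \<in> Jplus M}))"

text \<open>\<open>\<Phi>\<close> is a diffeomorphism onto \<open>\<real> \<times> N\<close>, where \<open>B\<close> is an atlas of \<open>N\<close>, and \<open>\<tau>\<close> is its first
  component.\<close>

definition splitting ::
    "('m::topological_space, 'e::real_normed_vector) lf_manifold \<Rightarrow>
     ('n::{t2_space,second_countable_topology}, 'f::real_normed_vector) chart set \<Rightarrow>
     ('m \<Rightarrow> real \<times> 'n) \<Rightarrow> ('m \<Rightarrow> real) \<Rightarrow> bool" where
  "splitting M B \<Phi> \<tau> \<longleftrightarrow> smooth_atlas B \<and> diffeomorphism (atlas M) (real_times_atlas B) \<Phi> \<and>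
     \<tau> = fst \<circ> \<Phi> \<and>
     (\<forall>x v. (x, v) \<in> cone M \<longrightarrow>
        ereal (- differential (atlas M) \<tau> x v) \<le> min (Lag M x v) (ereal (- hnorm M x v)))"


section \<open>Optimal transport\<close>

text \<open>Integral of an extended real-valued function that is bounded below, up to an integrable function.\<close>

definition ereal_integral :: "'a measure \<Rightarrow> ('a \<Rightarrow> ereal) \<Rightarrow> ereal" where
  "ereal_integral N f =
     enn2ereal (\<integral>\<^sup>+x. e2ennreal (f x) \<partial>N) - enn2ereal (\<integral>\<^sup>+x. e2ennreal (- f x) \<partial>N)"

definition action ::
    "('m, 'e::real_normed_vector) lf_manifold \<Rightarrow> real \<Rightarrow> real \<Rightarrow> (real \<Rightarrow> 'm) \<Rightarrow> ereal" where
  "action M a b \<gamma> = ereal_integral (lebesgue_on {a..b}) (\<lambda>t. Lag M (\<gamma> t) (velocity (atlas M) \<gamma> t))"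

definition cost ::
    "('m::topological_space, 'e::real_normed_vector) lf_manifold \<Rightarrow> 'm \<Rightarrow> 'm \<Rightarrow> ereal" where
  "cost M x y =
     Inf {action M a b \<gamma> | a b \<gamma>. AC_curve (atlas M) a b \<gamma> \<and> \<gamma> a = x \<and> \<gamma> b = y}"

definition coupling :: "'m::topological_space measure \<Rightarrow> 'm measure \<Rightarrow> ('m \<times> 'm) measure \<Rightarrow> bool" where
  "coupling \<mu> \<nu> \<pi> \<longleftrightarrow> sets \<pi> = sets borel \<and> distr \<pi> borel fst = \<mu> \<and> distr \<pi> borel snd = \<nu>"

definition causal_pairs ::
    "('m::topological_space, 'e::real_normed_vector) lf_manifold \<Rightarrow> ('m \<Rightarrow> real) \<Rightarrow>
     ('m measure \<times> 'm measure) set" where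
  "causal_pairs M \<tau> =
     {(\<mu>, \<nu>). sets \<mu> = sets borel \<and> prob_space \<mu> \<and> sets \<nu> = sets borel \<and> prob_space \<nu> \<and>
        integrable \<mu> \<tau> \<and> integrable \<nu> \<tau> \<and> (\<exists>\<pi>. coupling \<mu> \<nu> \<pi> \<and> emeasure \<pi> (Jplus M) = 1)}"

definition optimal_coupling ::
    "('m::topological_space, 'e::real_normed_vector) lf_manifold \<Rightarrow> 'm measure \<Rightarrow> 'm measure \<Rightarrow>
     ('m \<times> 'm) measure \<Rightarrow> bool" where
  "optimal_coupling M \<mu> \<nu> \<pi> \<longleftrightarrow> coupling \<mu> \<nu> \<pi> \<and>
     (\<forall>\<pi>'. coupling \<mu> \<nu> \<pi>' \<longrightarrow>
        ereal_integral \<pi> (\<lambda>(x, y). cost M x y) \<le> ereal_integral \<pi>' (\<lambda>(x, y). cost M x y))"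

definition msupport :: "'m::topological_space measure \<Rightarrow> 'm set" where
  "msupport \<mu> = {x. \<forall>U. open U \<and> x \<in> U \<longrightarrow> emeasure \<mu> U > 0}"

subsection \<open>The dual problem\<close>

text \<open>Subtraction with \<open>\<infinity> - \<infinity> = -\<infinity>\<close>; for the library's subtraction on \<open>ereal\<close> it is \<open>\<infinity>\<close>.\<close>

definition ereal_diff :: "ereal \<Rightarrow> ereal \<Rightarrow> ereal" where
  "ereal_diff a b = (if a = \<infinity> \<and> b = \<infinity> then - \<infinity> else a - b)"

definition c_convex ::
    "('m::topological_space, 'e::real_normed_vector) lf_manifold \<Rightarrow> ('m \<Rightarrow> ereal) \<Rightarrow> bool" where
  "c_convex M \<psi> \<longleftrightarrow> (\<forall>x. \<psi> x \<noteq> - \<infinity>) \<and> (\<exists>x. \<psi> x \<noteq> \<infinity>) \<and>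
     (\<exists>\<zeta> :: 'm \<Rightarrow> ereal. \<forall>x. \<psi> x = (SUP y. ereal_diff (\<zeta> y) (cost M x y)))"

definition c_transform ::
    "('m::topological_space, 'e::real_normed_vector) lf_manifold \<Rightarrow> ('m \<Rightarrow> ereal) \<Rightarrow> 'm \<Rightarrow> ereal" where
  "c_transform M \<psi> y = (INF x. \<psi> x + cost M x y)"

definition DKP_solution ::
    "('m::topological_space, 'e::real_normed_vector) lf_manifold \<Rightarrow> 'm measure \<Rightarrow> 'm measure \<Rightarrow>
     ('m \<Rightarrow> ereal) \<Rightarrow> bool" where
  "DKP_solution M \<mu> \<nu> \<psi> \<longleftrightarrow> c_convex M \<psi> \<and> (AE x in \<mu>. \<psi> x \<noteq> \<infinity>) \<and>
     (\<forall>\<pi>. optimal_coupling M \<mu> \<nu> \<pi> \<longrightarrow>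
        (AE p in \<pi>. c_transform M \<psi> (snd p) - \<psi> (fst p) = cost M (fst p) (snd p)))"

subsection \<open>Geodesics and dynamical couplings\<close>

text \<open>Curves on \<open>[0,1]\<close> are functions on \<open>real\<close> with a fixed arbitrary value outside \<open>[0,1]\<close>.\<close>

definition geodesics ::
    "('m::topological_space, 'e::real_normed_vector) lf_manifold \<Rightarrow> ('m \<Rightarrow> real) \<Rightarrow> (real \<Rightarrow> 'm) set" where
  "geodesics M \<tau> =
     {\<gamma> \<in> extensional {0..1}. causal_curve M 0 1 \<gamma> \<and> action M 0 1 \<gamma> = cost M (\<gamma> 0) (\<gamma> 1) \<and>
        (\<exists>k. AE t in lebesgue_on {0..1}.
           differential (atlas M) \<tau> (\<gamma> t) (velocity (atlas M) \<gamma> t) = k)}"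

definition uniformly_open ::
    "('m::topological_space, 'e::real_normed_vector) lf_manifold \<Rightarrow> (real \<Rightarrow> 'm) set \<Rightarrow>
     (real \<Rightarrow> 'm) set \<Rightarrow> bool" where
  "uniformly_open M G S \<longleftrightarrow> S \<subseteq> G \<and>
     (\<forall>\<gamma>\<in>S. \<exists>\<epsilon>>0. \<forall>\<sigma>\<in>G. (\<forall>t\<in>{0..1}. hdist M (\<gamma> t) (\<sigma> t) < \<epsilon>) \<longrightarrow> \<sigma> \<in> S)"

definition geodesic_borel ::
    "('m::topological_space, 'e::real_normed_vector) lf_manifold \<Rightarrow> ('m \<Rightarrow> real) \<Rightarrow> (real \<Rightarrow> 'm) measure" where
  "geodesic_borel M \<tau> = sigma (geodesics M \<tau>) {S. uniformly_open M (geodesics M \<tau>) S}"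

definition lightlike_geodesics ::
    "('m::topological_space, 'e::real_normed_vector) lf_manifold \<Rightarrow> ('m \<Rightarrow> real) \<Rightarrow> (real \<Rightarrow> 'm) set" where
  "lightlike_geodesics M \<tau> =
     {\<gamma> \<in> geodesics M \<tau>.
        AE t in lebesgue_on {0..1}. Lag M (\<gamma> t) (velocity (atlas M) \<gamma> t) = 0}"

definition dynamical_optimal_coupling ::
    "('m::topological_space, 'e::real_normed_vector) lf_manifold \<Rightarrow> ('m \<Rightarrow> real) \<Rightarrow>
     'm measure \<Rightarrow> 'm measure \<Rightarrow> (real \<Rightarrow> 'm) measure \<Rightarrow> bool" where
  "dynamical_optimal_coupling M \<tau> \<mu> \<nu> \<Xi> \<longleftrightarrow>
     sets \<Xi> = sets (geodesic_borel M \<tau>) \<and>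
     distr \<Xi> borel (\<lambda>\<gamma>. \<gamma> 0) = \<mu> \<and> distr \<Xi> borel (\<lambda>\<gamma>. \<gamma> 1) = \<nu> \<and>
     optimal_coupling M \<mu> \<nu> (distr \<Xi> borel (\<lambda>\<gamma>. (\<gamma> 0, \<gamma> 1)))"

end

theory Submission
  imports Defs
begin

text \<open>
  The theorem holds because a solution of the dual problem grows like a square root at the starting
  point of a tight lightlike minimizer, and a function can do so only on a null set.

  Let \<open>\<gamma>\<close> be a lightlike minimizer from \<open>x\<close> to \<open>y \<noteq> x\<close> along which the duality inequality is an
  equality. As the cost from \<open>x\<close> to \<open>y\<close> is zero, the transform of \<open>\<psi>\<close> at \<open>y\<close> equals \<open>\<psi> x\<close>, so that
  \<open>\<psi> x \<le> \<psi> x' + cost x' y\<close> for all points \<open>x'\<close>. Move the starting point to \<open>x' = x + \<delta> w\<close> in a chart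
  and bend a short initial piece of \<open>\<gamma>\<close> so that it starts at \<open>x'\<close>. If \<open>w\<close> points to the right side,
  the first variation of the Lorentz-Finsler function along that piece is positive; the bent piece is
  then timelike, the function being of order \<open>\<delta>\<close> on it, and its action is at most \<open>- C \<surd>\<delta>\<close>, since the
  Lagrangian is a square root. The rest of \<open>\<gamma>\<close> costs nothing. Hence \<open>\<psi> x' \<ge> \<psi> x + C \<surd>\<delta>\<close>, and this holds
  uniformly for \<open>w\<close> in a small ball (\<open>tight_start_growth\<close>).

  To see that such points form a null set, cut the space into cells of side \<open>r\<close> in all coordinates but
  one, and the range of the function into intervals of length \<open>\<surd>r\<close>. Two points with growth in the
  same cell and with values in the same interval can differ by at most a multiple of \<open>r\<close> in the
  remaining coordinate. The number of cells and intervals is of order \<open>r\<close> to the power \<open>- (n - 1) - 1/2\<close>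
  and each contributes a volume of order \<open>r\<close> to the power \<open>n\<close>; the total tends to zero with \<open>r\<close>
  (\<open>growth_null\<close>). For the volume of a spacelike hypersurface the same argument applies inside the
  hypersurface: the fibre gradient of the function at a lightlike vector annihilates that vector,
  which is transversal to the hypersurface, and therefore does not annihilate all tangent directions
  (\<open>tight_start_local_null\<close>).

  The variation uses two local facts. The fibre derivative of the Lorentz-Finsler function does not
  vanish outside the zero section, by homogeneity and nondegeneracy (\<open>fibre_derivative_nonzero\<close>);
  and near a lightlike vector of the cone all vectors with a positive value belong to the cone
  (\<open>cone_locally_positive\<close>). They make the first variation effective for curves that are merely
  absolutely continuous (\<open>variation_cost\<close>). The role of the initial velocity is played by an
  essential cluster value of the velocities at the start. If the velocities did not
  agree with it about the sign of \<open>w\<close>, the disagreement could be used to bend \<open>\<gamma>\<close> with both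
  endpoints fixed, which would make the cost negative (\<open>essential_gradient_sign\<close>).

  Finally, disjoint supports ensure that almost every curve is nonconstant, and the set of lightlike
  geodesics is measurable because its members are described by difference quotients of the jointly
  measurable evaluation map (\<open>lightlike_measurable\<close>).
\<close>

section \<open>Absolutely continuous functions\<close>

subsection \<open>Monotone functions\<close>

text \<open>Degenerate intervals are excluded, so that different members of a family are different as open
  sets and maps on the family are injective as soon as they shrink its members to nonempty intervals.\<close>

definition nonoverlapping :: "(real \<times> real) set \<Rightarrow> bool" where
  "nonoverlapping I \<longleftrightarrow> finite I \<and> (\<forall>i\<in>I. fst i < snd i) \<and>
     pairwise (\<lambda>p q. disjnt {fst p<..<snd p} {fst q<..<snd q}) I"

text \<open>Absolute continuity on the whole line. A function on a compact interval is brought to this form by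
  extending it constantly.\<close>

definition abs_cont :: "(real \<Rightarrow> real) \<Rightarrow> bool" where
  "abs_cont f \<longleftrightarrow> (\<forall>\<epsilon>>0. \<exists>\<delta>>0. \<forall>I. nonoverlapping I \<longrightarrow> (\<Sum>i\<in>I. snd i - fst i) < \<delta> \<longrightarrow>
     (\<Sum>i\<in>I. \<bar>f (snd i) - f (fst i)\<bar>) \<le> \<epsilon>)"

lemma abs_contD:
  assumes "abs_cont f" "\<epsilon> > 0"
  obtains \<delta> where "\<delta> > 0" "\<And>I. nonoverlapping I \<Longrightarrow> (\<Sum>i\<in>I. snd i - fst i) < \<delta> \<Longrightarrow>
     (\<Sum>i\<in>I. \<bar>f (snd i) - f (fst i)\<bar>) \<le> \<epsilon>"
  using assms unfolding abs_cont_def by metis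

lemma nonoverlapping_single: "s < t \<Longrightarrow> nonoverlapping {(s, t)}"
  by (auto simp: nonoverlapping_def)

lemma abs_cont_increment:
  assumes "abs_cont f" "\<epsilon> > 0"
  obtains \<delta> where "\<delta> > 0" "\<And>s t. \<bar>t - s\<bar> < \<delta> \<Longrightarrow> \<bar>f t - f s\<bar> \<le> \<epsilon>"
proof -
  obtain \<delta> where d: "\<delta> > 0" "\<And>I. nonoverlapping I \<Longrightarrow> (\<Sum>i\<in>I. snd i - fst i) < \<delta> \<Longrightarrow>
     (\<Sum>i\<in>I. \<bar>f (snd i) - f (fst i)\<bar>) \<le> \<epsilon>" using abs_contD[OF assms] by metis
  have "\<bar>f t - f s\<bar> \<le> \<epsilon>" if "\<bar>t - s\<bar> < \<delta>" for s t
  proof (cases s t rule: linorder_cases)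
    case less
    show ?thesis using d(2)[OF nonoverlapping_single[OF less]] that less by simp
  next
    case greater
    show ?thesis using d(2)[OF nonoverlapping_single[OF greater]] that greater
      by (simp add: abs_minus_commute)
  qed (use assms in simp)
  then show ?thesis using d that by blast
qed

lemma abs_cont_imp_continuous: "abs_cont f \<Longrightarrow> isCont f x"
proof -
  assume f: "abs_cont f"
  show "isCont f x"
    unfolding continuous_at_eps_delta
  proof (intro allI impI)
    fix e :: real assume "e > 0"
    then obtain \<delta> where "\<delta> > 0" "\<And>s t. \<bar>t - s\<bar> < \<delta> \<Longrightarrow> \<bar>f t - f s\<bar> \<le> e/2"
      using abs_cont_increment[OF f, of "e/2"] by auto
    then show "\<exists>d>0. \<forall>x'. dist x' x < d \<longrightarrow> dist (f x') (f x) < e"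
      using \<open>e > 0\<close> by (intro exI[of _ \<delta>]) (force simp: dist_real_def)
  qed
qed

text \<open>A null set lies in an open set of measure less than \<open>\<delta>\<close>. Inside the open set countably many
  nonoverlapping intervals cover a bounded part of the null set; their total length is below \<open>\<delta>\<close>, so
  absolute continuity bounds the sum of the increments of \<open>F\<close>, which is their Stieltjes measure.\<close>

lemma null_set_monotone_abs_cont:
  assumes f: "abs_cont F" and mono: "mono F" and N: "N \<in> null_sets lborel"
  shows "N \<in> null_sets (interval_measure F)"
proof -
  let ?m = "interval_measure F"
  have mF: "\<And>x y. x \<le> y \<Longrightarrow> F x \<le> F y" using mono by (auto simp: mono_def)
  have cF: "\<And>a. isCont F a" using abs_cont_imp_continuous[OF f] .
  have Nb: "N \<in> sets borel" using N by auto
  have Icc: "emeasure ?m {a..b} = ennreal (F b - F a)" if "a \<le> b" for a b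
    using emeasure_interval_measure_Icc[OF that, of F] mF cF
    by (simp add: continuous_at_imp_continuous_on)
  have small: "emeasure ?m (N \<inter> {-real n..real n}) \<le> ennreal \<epsilon>" if e: "\<epsilon> > 0" and n: "n > 0" for \<epsilon> n
  proof -
    obtain \<delta> where d: "\<delta> > 0" "\<And>I. nonoverlapping I \<Longrightarrow> (\<Sum>i\<in>I. snd i - fst i) < \<delta> \<Longrightarrow>
      (\<Sum>i\<in>I. \<bar>F (snd i) - F (fst i)\<bar>) \<le> \<epsilon>" using abs_contD[OF f e] by metis
    obtain U where U: "open U" "N \<subseteq> U" "emeasure lborel (U - N) < ennreal \<delta>"
      using outer_regular_lborel[OF Nb d(1)] by metis
    have "emeasure lborel U \<le> emeasure lborel (U - N) + emeasure lborel N"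
      using U Nb by (subst plus_emeasure) (auto intro!: emeasure_mono)
    then have Ud: "emeasure lborel U < ennreal \<delta>" using U(3) N by (auto simp: null_sets_def)
    let ?S = "N \<inter> cbox (-real n) (real n)"
    \<comment> \<open>This gauge makes the covering lemma return intervals inside U only.\<close>
    have g: "gauge (\<lambda>x. if x \<in> U then U else ball x 1)"
      using U(1) by (auto simp: gauge_def)
    obtain D where D: "countable D" "\<And>K. K \<in> D \<Longrightarrow> interior K \<noteq> {} \<and> (\<exists>c d. K = cbox c d)"
      "pairwise (\<lambda>A B. interior A \<inter> interior B = {}) D"
      "\<And>K. K \<in> D \<Longrightarrow> \<exists>x\<in>?S \<inter> K. K \<subseteq> (if x \<in> U then U else ball x 1)" "?S \<subseteq> \<Union>D"
    proof (rule covering_lemma[OF _ _ g, of ?S "-real n" "real n"])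
      show "box (- real n) (real n) \<noteq> {}" using n by auto
    qed (simp, blast intro: that)
    have DU: "K \<subseteq> U" if KD: "K \<in> D" for K
    proof -
      obtain x where "x \<in> N" "K \<subseteq> (if x \<in> U then U else ball x 1)" using D(4)[OF KD] by blast
      then show ?thesis using U(2) by (auto split: if_splits)
    qed
    have K: "\<exists>c d. c < d \<and> K = {c..d}" if "K \<in> D" for K
      using D(2)[OF that] by (metis box_real(2) greaterThanLessThan_empty interior_atLeastAtMost_real not_le)
    define h where "h K = (Inf K, Sup K)" for K :: "real set"
    have hK: "fst (h K) < snd (h K) \<and> K = {fst (h K)..snd (h K)}" if "K \<in> D" for K
      using K[OF that] by (auto simp: h_def)
    have fin: "emeasure ?m (\<Union>D') \<le> ennreal \<epsilon>" if D': "finite D'" "D' \<subseteq> D" for D'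
    proof -
      have inj: "inj_on h D'" by (rule inj_onI) (metis D'(2) hK subsetD)
      have pw: "disjnt {fst (h A)<..<snd (h A)} {fst (h B)<..<snd (h B)}"
        if "A \<in> D'" "B \<in> D'" "A \<noteq> B" for A B
      proof -
        have "interior A \<inter> interior B = {}" using D(3) that D' unfolding pairwise_def by blast
        moreover have "interior A = {fst (h A)<..<snd (h A)}"
          using hK[of A] that D' by (metis interior_atLeastAtMost_real subsetD)
        moreover have "interior B = {fst (h B)<..<snd (h B)}"
          using hK[of B] that D' by (metis interior_atLeastAtMost_real subsetD)
        ultimately show ?thesis by (auto simp: disjnt_def)
      qed
      have no: "nonoverlapping (h ` D')"
        unfolding nonoverlapping_def
      proof (intro conjI ballI)
        show "pairwise (\<lambda>p q. disjnt {fst p<..<snd p} {fst q<..<snd q}) (h ` D')"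
          unfolding pairwise_def using pw by auto
      qed (use D' hK in auto)
      have "ennreal (\<Sum>K\<in>D'. snd (h K) - fst (h K)) = (\<Sum>K\<in>D'. emeasure lborel {fst (h K)<..<snd (h K)})"
        using hK D'(2) by (subst sum_ennreal[symmetric]) (auto intro!: sum.cong simp: less_imp_le subset_iff)
      also have "\<dots> = emeasure lborel (\<Union>K\<in>D'. {fst (h K)<..<snd (h K)})"
        using D'(1) pw by (intro sum_emeasure) (auto simp: disjoint_family_on_def disjnt_def)
      also have "\<dots> \<le> emeasure lborel U"
        using DU hK D'(2) U(1) by (intro emeasure_mono) (fastforce simp: subset_iff)+
      also note Ud
      finally have len: "(\<Sum>i\<in>h ` D'. snd i - fst i) < \<delta>"
        using hK D'(2) by (subst (asm) ennreal_less_iff) (auto simp: sum.reindex[OF inj] less_imp_le subset_iff intro!: sum_nonneg)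
      have s: "(\<Sum>K\<in>D'. F (snd (h K)) - F (fst (h K))) \<le> \<epsilon>"
      proof -
        have "(\<Sum>K\<in>D'. F (snd (h K)) - F (fst (h K))) \<le> (\<Sum>K\<in>D'. \<bar>F (snd (h K)) - F (fst (h K))\<bar>)"
          by (intro sum_mono) simp
        then show ?thesis using d(2)[OF no len] by (simp add: sum.reindex[OF inj])
      qed
      have "emeasure ?m (\<Union>D') \<le> (\<Sum>K\<in>D'. emeasure ?m K)"
        using emeasure_subadditive_finite[of D' "\<lambda>x. x" ?m] D' K by fastforce
      also have "\<dots> = (\<Sum>K\<in>D'. ennreal (F (snd (h K)) - F (fst (h K))))"
      proof (rule sum.cong[OF refl])
        fix K assume "K \<in> D'"
        then have "fst (h K) \<le> snd (h K)" "K = {fst (h K)..snd (h K)}" using hK D'(2) by (auto simp: less_imp_le)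
        then show "emeasure ?m K = ennreal (F (snd (h K)) - F (fst (h K)))" using Icc by metis
      qed
      also have "\<dots> = ennreal (\<Sum>K\<in>D'. F (snd (h K)) - F (fst (h K)))"
        using mF hK D'(2) by (intro sum_ennreal) (auto simp: subset_iff less_imp_le)
      also have "\<dots> \<le> ennreal \<epsilon>" using s by (rule ennreal_leI)
      finally show ?thesis .
    qed
    have "emeasure ?m (\<Union>D) \<le> ennreal \<epsilon>"
    proof (cases "D = {}")
      case False
      define A where "A k = \<Union> (from_nat_into D ` {..k::nat})" for k
      have UA: "\<Union>D = (\<Union>k. A k)"
        unfolding A_def by (subst (1) range_from_nat_into[OF False D(1), symmetric]) auto
      have SA: "(SUP k. emeasure ?m (A k)) = emeasure ?m (\<Union>k. A k)"
      proof (rule SUP_emeasure_incseq)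
        have "from_nat_into D i \<in> sets borel" for i

        proof -
          obtain c d where "from_nat_into D i = {c..d}" using K[OF from_nat_into[OF False]] by metis
          then show ?thesis by simp
        qed
        then show "range A \<subseteq> sets ?m" unfolding A_def by auto
        show "incseq A" unfolding A_def incseq_def by (auto intro!: Union_mono image_mono)
      qed
      have "emeasure ?m (A k) \<le> ennreal \<epsilon>" for k
        unfolding A_def using from_nat_into[OF False] by (intro fin) auto
      then have "(SUP k. emeasure ?m (A k)) \<le> ennreal \<epsilon>" by (intro SUP_least)
      then show ?thesis using SA UA by simp
    qed simp
    moreover have "emeasure ?m ?S \<le> emeasure ?m (\<Union>D)"
    proof (rule emeasure_mono[OF D(5)])
      have "K \<in> sets borel" if "K \<in> D" for K using K[OF that] by auto
      then show "\<Union>D \<in> sets ?m" using D(1) by auto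
    qed
    ultimately show ?thesis by (auto simp: order_trans)
  qed
  have "emeasure ?m (N \<inter> {-real n..real n}) = 0" if "n > 0" for n
    using small[OF _ that] by (metis ennreal_le_epsilon add_0 zero_le_numeral le_zero_eq)
  then have "N \<inter> {-real (Suc n)..real (Suc n)} \<in> null_sets ?m" for n
    using Nb by (auto simp: null_sets_def simp del: of_nat_Suc)
  then have "(\<Union>n. N \<inter> {-real (Suc n)..real (Suc n)}) \<in> null_sets ?m" by (rule null_sets_UN)
  moreover have "(\<Union>n. N \<inter> {-real (Suc n)..real (Suc n)}) = N"
  proof -
    have "\<exists>n. - real (Suc n) \<le> x \<and> x \<le> real (Suc n)" for x
    proof -
      obtain n where "\<bar>x\<bar> < real n" using reals_Archimedean2 by blast
      then show ?thesis by (intro exI[of _ n]) auto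
    qed
    then show ?thesis by auto
  qed
  ultimately show ?thesis by simp
qed

text \<open>The density is the Radon-Nikodym derivative of the Stieltjes measure, which the previous lemma makes
  absolutely continuous.\<close>

lemma monotone_abs_cont_density:
  assumes f: "abs_cont F" and mono: "mono F"
  obtains h :: "real \<Rightarrow> real" where "h \<in> borel_measurable borel" "\<And>x. 0 \<le> h x"
    "\<And>s t. s \<le> t \<Longrightarrow> (h has_integral (F t - F s)) {s..t}"
proof -
  let ?m = "interval_measure F"
  have mF: "\<And>x y. x \<le> y \<Longrightarrow> F x \<le> F y" using mono by (auto simp: mono_def)
  have cF: "\<And>a. isCont F a" using abs_cont_imp_continuous[OF f] .
  have Icc: "emeasure ?m {a..b} = ennreal (F b - F a)" if "a \<le> b" for a b
    using emeasure_interval_measure_Icc[OF that, of F] mF cF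
    by (simp add: continuous_at_imp_continuous_on)
  have "absolutely_continuous lborel ?m"
    unfolding absolutely_continuous_def using null_set_monotone_abs_cont[OF f mono] by auto
  then obtain g where g: "g \<in> borel_measurable lborel" "density lborel g = ?m"
    using sigma_finite_measure.Radon_Nikodym[OF sigma_finite_lborel] by force
  have gi: "(\<integral>\<^sup>+x\<in>{s..t}. g x \<partial>lborel) = ennreal (F t - F s)" if "s \<le> t" for s t
    using Icc[OF that] g emeasure_density[of g lborel "{s..t}"] by simp
  define h where "h x = enn2real (g x)" for x
  have gf: "AE x in lborel. g x \<noteq> \<infinity>"
  proof -
    have "AE x in lborel. x \<in> {-real n..real n} \<longrightarrow> g x \<noteq> \<infinity>" for n
    proof -
      have "AE x in lborel. g x * indicator {-real n..real n} x \<noteq> \<infinity>"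
        using gi[of "-real n" "real n"] g by (intro nn_integral_PInf_AE) auto
      then show ?thesis by eventually_elim (auto split: split_indicator_asm)
    qed
    then have "AE x in lborel. \<forall>n. x \<in> {-real n..real n} \<longrightarrow> g x \<noteq> \<infinity>" unfolding AE_all_countable by blast
    then show ?thesis
    proof eventually_elim
      case (elim x)
      obtain n where "\<bar>x\<bar> < real n" using reals_Archimedean2 by blast
      then show ?case using elim[rule_format, of n] by (auto simp: abs_less_iff)
    qed
  qed
  have hb: "h \<in> borel_measurable borel" using g unfolding h_def by auto
  have hn: "0 \<le> h x" for x by (simp add: h_def)
  show ?thesis
  proof (rule that[of h])
    fix s t :: real assume st: "s \<le> t"
    have "(\<integral>\<^sup>+x. ennreal (h x * indicator {s..t} x) \<partial>lborel) = (\<integral>\<^sup>+x\<in>{s..t}. g x \<partial>lborel)"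
      using gf by (intro nn_integral_cong_AE) (auto simp: h_def less_top[symmetric] split: split_indicator)
    then have "((\<lambda>x. h x * indicator {s..t} x) has_integral (F t - F s)) UNIV"
      using gi[OF st] hb mF[OF st] by (intro nn_integral_has_integral) (simp_all add: hn)
    moreover have "(\<lambda>x. h x * indicator {s..t} x) = (\<lambda>x. if x \<in> {s..t} then h x else 0)"
      by (auto split: split_indicator)
    ultimately show "(h has_integral (F t - F s)) {s..t}" by (simp only: has_integral_restrict_UNIV)
  qed (use hb in \<open>auto simp: h_def\<close>)
qed

subsection \<open>Total variation\<close>

text \<open>Total variation, with values in \<open>ennreal\<close> because its finiteness is a consequence of absolute
  continuity and not known in advance.\<close>

definition variation :: "(real \<Rightarrow> real) \<Rightarrow> real \<Rightarrow> real \<Rightarrow> ennreal" where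
  "variation f s t = (SUP I\<in>{I. nonoverlapping I \<and> (\<forall>i\<in>I. s \<le> fst i \<and> snd i \<le> t)}.
     \<Sum>i\<in>I. ennreal \<bar>f (snd i) - f (fst i)\<bar>)"

text \<open>Suprema in finitely many summands can be approached simultaneously by independent choices. This is
  how a subdivision is selected in all members of a family of intervals at once.\<close>

lemma sum_SUP_le:
  fixes g :: "'a \<Rightarrow> 'b \<Rightarrow> ennreal"
  assumes "finite I" "\<And>i. i \<in> I \<Longrightarrow> A i \<noteq> {}"
    "\<And>J. (\<forall>i\<in>I. J i \<in> A i) \<Longrightarrow> c + (\<Sum>i\<in>I. g i (J i)) \<le> e"
  shows "c + (\<Sum>i\<in>I. SUP x\<in>A i. g i x) \<le> e"
  using assms
proof (induction I arbitrary: c)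
  case (insert i I)
  have "c + g i x + (\<Sum>i\<in>I. SUP x\<in>A i. g i x) \<le> e" if x: "x \<in> A i" for x
  proof (rule insert.IH)
    fix J assume J: "\<forall>j\<in>I. J j \<in> A j"
    have "c + (\<Sum>j\<in>insert i I. g j ((J(i := x)) j)) \<le> e"
      using J x by (intro insert.prems) auto
    moreover have "(\<Sum>j\<in>I. g j ((J(i := x)) j)) = (\<Sum>j\<in>I. g j (J j))"
      using insert.hyps by (intro sum.cong) auto
    ultimately show "c + g i x + (\<Sum>j\<in>I. g j (J j)) \<le> e"
      using insert.hyps by (simp add: add.assoc)
  qed (use insert.prems in auto)
  then have "(SUP x\<in>A i. g i x + (c + (\<Sum>i\<in>I. SUP x\<in>A i. g i x))) \<le> e"
    by (intro SUP_least) (simp add: add_ac)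
  then show ?case using insert.hyps insert.prems(1)[of i]
    by (subst (asm) ennreal_SUP_add_left) (auto simp: add_ac)
qed (use assms in simp)

lemma nonoverlapping_length:
  assumes "nonoverlapping I" "\<And>i. i \<in> I \<Longrightarrow> s \<le> fst i \<and> snd i \<le> t" "s \<le> t"
  shows "(\<Sum>i\<in>I. snd i - fst i) \<le> t - s"
proof -
  have I: "finite I" "\<And>i. i \<in> I \<Longrightarrow> fst i < snd i"
    "pairwise (\<lambda>p q. disjnt {fst p<..<snd p} {fst q<..<snd q}) I"
    using assms(1) by (auto simp: nonoverlapping_def)
  have "ennreal (\<Sum>i\<in>I. snd i - fst i) = (\<Sum>i\<in>I. emeasure lborel {fst i<..<snd i})"
    using I(2) by (subst sum_ennreal[symmetric]) (auto intro!: sum.cong simp: less_imp_le)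
  also have "\<dots> = emeasure lborel (\<Union>i\<in>I. {fst i<..<snd i})"
    using I by (intro sum_emeasure) (auto simp: disjoint_family_on_def disjnt_def pairwise_def)
  also have "\<dots> \<le> emeasure lborel {s..t}"
    using assms(2) by (intro emeasure_mono) fastforce+
  finally show ?thesis using assms(3) by simp
qed

text \<open>Subdividing every member of a nonoverlapping family gives a nonoverlapping family.\<close>

lemma nonoverlapping_UN:
  assumes I: "nonoverlapping I" and J: "\<And>i. i \<in> I \<Longrightarrow> nonoverlapping (J i)"
    and sub: "\<And>i j. i \<in> I \<Longrightarrow> j \<in> J i \<Longrightarrow> fst i \<le> fst j \<and> snd j \<le> snd i"
  shows "nonoverlapping (\<Union>i\<in>I. J i)" and "(\<Sum>j\<in>(\<Union>i\<in>I. J i). g j) = (\<Sum>i\<in>I. \<Sum>j\<in>J i. g j)"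
proof -
  have I': "finite I" "\<And>i i'. i \<in> I \<Longrightarrow> i' \<in> I \<Longrightarrow> i \<noteq> i' \<Longrightarrow> {fst i<..<snd i} \<inter> {fst i'<..<snd i'} = {}"
    using I by (auto simp: nonoverlapping_def disjnt_def pairwise_def)
  have J': "finite (J i)" "j \<in> J i \<Longrightarrow> fst j < snd j"
    "j \<in> J i \<Longrightarrow> j' \<in> J i \<Longrightarrow> j \<noteq> j' \<Longrightarrow> {fst j<..<snd j} \<inter> {fst j'<..<snd j'} = {}" if "i \<in> I" for i j j'
    using J[OF that] unfolding nonoverlapping_def disjnt_def pairwise_def by blast+
  have s: "{fst j<..<snd j} \<subseteq> {fst i<..<snd i}" if "i \<in> I" "j \<in> J i" for i j
    using sub[OF that] by auto
  have dis: "{fst j<..<snd j} \<inter> {fst j'<..<snd j'} = {}"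
    if "i \<in> I" "j \<in> J i" "i' \<in> I" "j' \<in> J i'" "i \<noteq> i'" for i j i' j'
    using I'(2)[OF that(1,3,5)] s[OF that(1,2)] s[OF that(3,4)] by blast
  show "nonoverlapping (\<Union>i\<in>I. J i)"
    unfolding nonoverlapping_def
  proof (intro conjI)
    show "finite (\<Union>i\<in>I. J i)" using I' J' by auto
    show "\<forall>i\<in>\<Union>i\<in>I. J i. fst i < snd i" using J'(2) by blast
    show "pairwise (\<lambda>p q. disjnt {fst p<..<snd p} {fst q<..<snd q}) (\<Union>i\<in>I. J i)"
      unfolding pairwise_def disjnt_def using dis J'(3) by (metis UN_E)
  qed
  show "(\<Sum>j\<in>(\<Union>i\<in>I. J i). g j) = (\<Sum>i\<in>I. \<Sum>j\<in>J i. g j)"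
  proof (rule sum.UNION_disjoint)
    show "\<forall>i\<in>I. \<forall>j\<in>I. i \<noteq> j \<longrightarrow> J i \<inter> J j = {}"
    proof (intro ballI impI)
      fix i i' assume i: "i \<in> I" "i' \<in> I" "i \<noteq> i'"
      show "J i \<inter> J i' = {}"
      proof (rule ccontr)
        assume "J i \<inter> J i' \<noteq> {}"
        then obtain j where j: "j \<in> J i" "j \<in> J i'" by blast
        show False using dis[OF i(1) j(1) i(2) j(2) i(3)] J'(2)[OF i(1) j(1)] by simp
      qed
    qed
  qed (use I' J' in auto)
qed

text \<open>The pair \<open>\<epsilon>\<close>, \<open>\<delta>\<close> that works for \<open>f\<close> also works for its variation, since subdivisions of the
  members of a family form one family of no larger total length.\<close>

lemma variation_small:
  assumes d: "\<And>I. nonoverlapping I \<Longrightarrow> (\<Sum>i\<in>I. snd i - fst i) < \<delta> \<Longrightarrow>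
     (\<Sum>i\<in>I. \<bar>f (snd i) - f (fst i)\<bar>) \<le> \<epsilon>"
    and I: "nonoverlapping I" "(\<Sum>i\<in>I. snd i - fst i) < \<delta>"
  shows "(\<Sum>i\<in>I. variation f (fst i) (snd i)) \<le> ennreal \<epsilon>"
proof -
  have "0 + (\<Sum>i\<in>I. variation f (fst i) (snd i)) \<le> ennreal \<epsilon>"
    unfolding variation_def
  proof (rule sum_SUP_le)
    show "finite I" using I by (auto simp: nonoverlapping_def)
    show "{J. nonoverlapping J \<and> (\<forall>j\<in>J. fst i \<le> fst j \<and> snd j \<le> snd i)} \<noteq> {}" for i
      by (auto simp: nonoverlapping_def intro!: exI[of _ "{}"])
    fix J assume "\<forall>i\<in>I. J i \<in> {J. nonoverlapping J \<and> (\<forall>j\<in>J. fst i \<le> fst j \<and> snd j \<le> snd i)}"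
    then have J: "\<And>i. i \<in> I \<Longrightarrow> nonoverlapping (J i)"
      "\<And>i j. i \<in> I \<Longrightarrow> j \<in> J i \<Longrightarrow> fst i \<le> fst j \<and> snd j \<le> snd i" by auto
    have U: "nonoverlapping (\<Union>i\<in>I. J i)" using J by (intro nonoverlapping_UN(1)[OF I(1)])
    have "(\<Sum>j\<in>(\<Union>i\<in>I. J i). snd j - fst j) = (\<Sum>i\<in>I. \<Sum>j\<in>J i. snd j - fst j)"
      by (rule nonoverlapping_UN(2)[OF I(1) J])
    also have "\<dots> \<le> (\<Sum>i\<in>I. snd i - fst i)"
    proof (rule sum_mono)
      fix i assume i: "i \<in> I"
      show "(\<Sum>j\<in>J i. snd j - fst j) \<le> snd i - fst i"
        using J[OF i] I(1) i by (intro nonoverlapping_length) (auto simp: nonoverlapping_def less_imp_le)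
    qed
    also note I(2)
    finally have len: "(\<Sum>j\<in>(\<Union>i\<in>I. J i). snd j - fst j) < \<delta>" .
    have "(\<Sum>j\<in>(\<Union>i\<in>I. J i). \<bar>f (snd j) - f (fst j)\<bar>) \<le> \<epsilon>" using d[OF U len] .
    also have "(\<Sum>j\<in>(\<Union>i\<in>I. J i). \<bar>f (snd j) - f (fst j)\<bar>) = (\<Sum>i\<in>I. \<Sum>j\<in>J i. \<bar>f (snd j) - f (fst j)\<bar>)"
      by (rule nonoverlapping_UN(2)[OF I(1) J])
    finally have "(\<Sum>i\<in>I. \<Sum>j\<in>J i. \<bar>f (snd j) - f (fst j)\<bar>) \<le> \<epsilon>" .
    then show "0 + (\<Sum>i\<in>I. \<Sum>j\<in>J i. ennreal \<bar>f (snd j) - f (fst j)\<bar>) \<le> ennreal \<epsilon>"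
      by (simp add: sum_nonneg ennreal_leI)
  qed
  then show ?thesis by simp
qed

lemma variation_mono: "s' \<le> s \<Longrightarrow> t \<le> t' \<Longrightarrow> variation f s t \<le> variation f s' t'"
  unfolding variation_def by (intro SUP_subset_mono) force+

lemma variation_superadd:
  assumes "s \<le> t" "t < u"
  shows "variation f s t + ennreal \<bar>f u - f t\<bar> \<le> variation f s u"
proof -
  let ?F = "\<lambda>s t. {I. nonoverlapping I \<and> (\<forall>i\<in>I. s \<le> fst i \<and> snd i \<le> t)}"
  have "(SUP I\<in>?F s t. (\<Sum>i\<in>I. ennreal \<bar>f (snd i) - f (fst i)\<bar>) + ennreal \<bar>f u - f t\<bar>) \<le> variation f s u"
  proof (rule SUP_least)
    fix I assume I: "I \<in> ?F s t"
    then have nin: "(t, u) \<notin> I" "finite I" using assms by (auto simp: nonoverlapping_def)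
    have "nonoverlapping (insert (t, u) I)"
      using I assms by (fastforce simp: nonoverlapping_def pairwise_insert disjnt_def)
    then have "insert (t, u) I \<in> ?F s u" using I assms by fastforce
    then have "(\<Sum>i\<in>insert (t, u) I. ennreal \<bar>f (snd i) - f (fst i)\<bar>) \<le> variation f s u"
      unfolding variation_def by (rule SUP_upper)
    then show "(\<Sum>i\<in>I. ennreal \<bar>f (snd i) - f (fst i)\<bar>) + ennreal \<bar>f u - f t\<bar> \<le> variation f s u"
      using nin by (simp add: add.commute)
  qed
  moreover have "?F s t \<noteq> {}" by (auto simp: nonoverlapping_def intro!: exI[of _ "{}"])
  ultimately show ?thesis unfolding variation_def[of f s t] by (subst (asm) ennreal_SUP_add_left) auto
qed

text \<open>A member of a family that contains \<open>t\<close> in its interior is split there; the pieces on the two sides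
  of \<open>t\<close> form two families.\<close>

lemma variation_subadd:
  assumes "s \<le> t" "t \<le> u"
  shows "variation f s u \<le> variation f s t + variation f t u"
  unfolding variation_def[of f s u]
proof (rule SUP_least)
  fix I assume "I \<in> {I. nonoverlapping I \<and> (\<forall>i\<in>I. s \<le> fst i \<and> snd i \<le> u)}"
  then have I: "nonoverlapping I" "finite I" "\<And>i. i \<in> I \<Longrightarrow> s \<le> fst i \<and> snd i \<le> u"
    "\<And>i. i \<in> I \<Longrightarrow> fst i < snd i"
    and dis: "\<And>i j. i \<in> I \<Longrightarrow> j \<in> I \<Longrightarrow> i \<noteq> j \<Longrightarrow> {fst i<..<snd i} \<inter> {fst j<..<snd j} = {}"
    by (auto simp: nonoverlapping_def pairwise_def disjnt_def)
  \<comment> \<open>Two members that overlap in an open interval are equal, since different ones are disjoint.\<close>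
  have ov: "i = j" if i: "i \<in> I" and j: "j \<in> I" and lt: "max (fst i) (fst j) < min (snd i) (snd j)" for i j
  proof (rule ccontr)
    assume "i \<noteq> j"
    obtain x where "max (fst i) (fst j) < x" "x < min (snd i) (snd j)" using dense[OF lt] by blast
    then have "x \<in> {fst i<..<snd i} \<inter> {fst j<..<snd j}" by auto
    then show False using dis[OF i j \<open>i \<noteq> j\<close>] by blast
  qed
  define l r where "l i = (min (fst i) t, min (snd i) t)" and "r i = (max (fst i) t, max (snd i) t)" for i :: "real \<times> real"
  define L R where "L = {i\<in>I. fst i < t}" and "R = {i\<in>I. t < snd i}"
  let ?d = "\<lambda>i. ennreal \<bar>f (snd i) - f (fst i)\<bar>"
  have injl: "inj_on l L"
  proof (rule inj_onI)
    fix i j assume ij: "i \<in> L" "j \<in> L" "l i = l j"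
    then have "fst i = fst j" by (auto simp: l_def L_def)
    then show "i = j" using ij I(4)[of i] I(4)[of j] by (intro ov) (simp_all add: L_def)
  qed
  have injr: "inj_on r R"
  proof (rule inj_onI)
    fix i j assume ij: "i \<in> R" "j \<in> R" "r i = r j"
    then have "snd i = snd j" by (auto simp: r_def R_def)
    then show "i = j" using ij I(4)[of i] I(4)[of j] by (intro ov) (simp_all add: R_def)
  qed
  have nl: "nonoverlapping (l ` L)"
    unfolding nonoverlapping_def
  proof (intro conjI)
    show "finite (l ` L)" using I(2) by (auto simp: L_def)
    show "\<forall>i\<in>l ` L. fst i < snd i" using I(4) by (auto simp: l_def L_def)
    show "pairwise (\<lambda>p q. disjnt {fst p<..<snd p} {fst q<..<snd q}) (l ` L)"
      unfolding pairwise_def disjnt_def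
    proof (intro ballI impI)
      fix p q assume "p \<in> l ` L" "q \<in> l ` L" "p \<noteq> q"
      then obtain i j where ij: "i \<in> I" "j \<in> I" "i \<noteq> j" "p = l i" "q = l j" by (auto simp: L_def)
      have "{fst p<..<snd p} \<subseteq> {fst i<..<snd i}" "{fst q<..<snd q} \<subseteq> {fst j<..<snd j}"
        unfolding ij l_def by auto
      then show "{fst p<..<snd p} \<inter> {fst q<..<snd q} = {}" using dis[OF ij(1,2,3)] by blast
    qed
  qed
  have nr: "nonoverlapping (r ` R)"
    unfolding nonoverlapping_def
  proof (intro conjI)
    show "finite (r ` R)" using I(2) by (auto simp: R_def)
    show "\<forall>i\<in>r ` R. fst i < snd i" using I(4) by (auto simp: r_def R_def)
    show "pairwise (\<lambda>p q. disjnt {fst p<..<snd p} {fst q<..<snd q}) (r ` R)"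
      unfolding pairwise_def disjnt_def
    proof (intro ballI impI)
      fix p q assume "p \<in> r ` R" "q \<in> r ` R" "p \<noteq> q"
      then obtain i j where ij: "i \<in> I" "j \<in> I" "i \<noteq> j" "p = r i" "q = r j" by (auto simp: R_def)
      have "{fst p<..<snd p} \<subseteq> {fst i<..<snd i}" "{fst q<..<snd q} \<subseteq> {fst j<..<snd j}"
        unfolding ij r_def by auto
      then show "{fst p<..<snd p} \<inter> {fst q<..<snd q} = {}" using dis[OF ij(1,2,3)] by blast
    qed
  qed
  have "(\<Sum>i\<in>I. ?d i) \<le> (\<Sum>i\<in>I. ?d (l i) + ?d (r i))"
  proof (rule sum_mono)
    fix i :: "real \<times> real"
    have "\<bar>f (snd i) - f (fst i)\<bar> \<le> \<bar>f (snd (l i)) - f (fst (l i))\<bar> + \<bar>f (snd (r i)) - f (fst (r i))\<bar>"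
      unfolding l_def r_def by (auto simp: min_def max_def)
    then show "?d i \<le> ?d (l i) + ?d (r i)" by (simp flip: ennreal_plus add: ennreal_leI)
  qed
  also have "\<dots> = (\<Sum>i\<in>I. ?d (l i)) + (\<Sum>i\<in>I. ?d (r i))" by (rule sum.distrib)
  also have "(\<Sum>i\<in>I. ?d (l i)) = (\<Sum>i\<in>L. ?d (l i))"
  proof (rule sum.mono_neutral_right)
    show "\<forall>i\<in>I - L. ?d (l i) = 0"
    proof
      fix i assume "i \<in> I - L"
      then have "t \<le> fst i" "t \<le> snd i" using I(4)[of i] by (auto simp: L_def)
      then show "?d (l i) = 0" by (simp add: l_def min_def)
    qed
  qed (use I(2) in \<open>auto simp: L_def\<close>)
  also have "(\<Sum>i\<in>I. ?d (r i)) = (\<Sum>i\<in>R. ?d (r i))"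
  proof (rule sum.mono_neutral_right)
    show "\<forall>i\<in>I - R. ?d (r i) = 0"
    proof
      fix i assume "i \<in> I - R"
      then have "fst i \<le> t" "snd i \<le> t" using I(4)[of i] by (auto simp: R_def)
      then show "?d (r i) = 0" by (simp add: r_def max_def)
    qed
  qed (use I(2) in \<open>auto simp: R_def\<close>)
  also have "(\<Sum>i\<in>L. ?d (l i)) = (\<Sum>i\<in>l ` L. ?d i)" by (simp add: sum.reindex[OF injl])
  also have "(\<Sum>i\<in>R. ?d (r i)) = (\<Sum>i\<in>r ` R. ?d i)" by (simp add: sum.reindex[OF injr])
  also have "(\<Sum>i\<in>l ` L. ?d i) + (\<Sum>i\<in>r ` R. ?d i) \<le> variation f s t + variation f t u"
  proof (rule add_mono)
    show "(\<Sum>i\<in>l ` L. ?d i) \<le> variation f s t"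
      unfolding variation_def using nl I(3) assms by (intro SUP_upper) (auto simp: l_def L_def)
    show "(\<Sum>i\<in>r ` R. ?d i) \<le> variation f t u"
      unfolding variation_def using nr I(3) assms by (intro SUP_upper) (auto simp: r_def R_def)
  qed
  finally show "(\<Sum>i\<in>I. ?d i) \<le> variation f s t + variation f t u" .
qed

lemma variation_degenerate:
  assumes "t \<le> s" shows "variation f s t = 0"
proof -
  have "{I. nonoverlapping I \<and> (\<forall>i\<in>I. s \<le> fst i \<and> snd i \<le> t)} = {{}}"
    using assms by (force simp: nonoverlapping_def)
  then show ?thesis unfolding variation_def by simp
qed

text \<open>An interval of length \<open>\<delta>/2\<close> has variation at most 1, for the \<open>\<delta>\<close> that belongs to \<open>\<epsilon> = 1\<close>, and
  finitely many of them cover the given interval.\<close>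

lemma variation_finite:
  assumes "abs_cont f"
  shows "variation f s t < \<infinity>"
proof -
  obtain \<delta> where d: "\<delta> > 0" "\<And>I. nonoverlapping I \<Longrightarrow> (\<Sum>i\<in>I. snd i - fst i) < \<delta> \<Longrightarrow>
    (\<Sum>i\<in>I. \<bar>f (snd i) - f (fst i)\<bar>) \<le> 1" using abs_contD[OF assms zero_less_one] by blast
  have one: "variation f p (p + \<delta>/2) \<le> 1" for p
    using variation_small[OF d(2) nonoverlapping_single[of p "p + \<delta>/2"]] d(1) by simp
  have "variation f s (s + real n * (\<delta>/2)) \<le> of_nat n" for n
  proof (induction n)
    case 0
    show ?case by (simp add: variation_degenerate)
  next
    case (Suc n)
    have eq: "s + real (Suc n) * (\<delta>/2) = s + real n * (\<delta>/2) + \<delta>/2" by (simp add: algebra_simps add_divide_distrib)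
    have "variation f s (s + real (Suc n) * (\<delta>/2)) \<le> variation f s (s + real n * (\<delta>/2)) +
        variation f (s + real n * (\<delta>/2)) (s + real (Suc n) * (\<delta>/2))"
      unfolding eq using d(1) by (intro variation_subadd) auto
    also have "\<dots> \<le> of_nat n + 1"
      unfolding eq using one[of "s + real n * (\<delta>/2)"] Suc.IH by (intro add_mono)
    finally show ?case by (simp add: add.commute)
  qed
  then have le: "variation f s (s + real n * (\<delta>/2)) \<le> of_nat n" for n .
  obtain n where n: "t - s < real n * (\<delta>/2)"
    using ex_less_of_nat_mult[of "\<delta>/2" "t - s"] d(1) by auto
  have "variation f s t \<le> variation f s (s + real n * (\<delta>/2))"
    using n by (intro variation_mono) auto
  also note le[of n]
  also have "of_nat n < (\<infinity>::ennreal)" by (simp add: of_nat_less_top)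
  finally show ?thesis .
qed

lemma abs_cont_diff:
  assumes "abs_cont f" "abs_cont g" shows "abs_cont (\<lambda>x. f x - g x)"
  unfolding abs_cont_def
proof (intro allI impI)
  fix \<epsilon> :: real assume "\<epsilon> > 0"
  then have e: "\<epsilon>/2 > 0" by simp
  obtain d1 where d1: "d1 > 0" "\<And>I. nonoverlapping I \<Longrightarrow> (\<Sum>i\<in>I. snd i - fst i) < d1 \<Longrightarrow>
    (\<Sum>i\<in>I. \<bar>f (snd i) - f (fst i)\<bar>) \<le> \<epsilon>/2" using abs_contD[OF assms(1) e] by metis
  obtain d2 where d2: "d2 > 0" "\<And>I. nonoverlapping I \<Longrightarrow> (\<Sum>i\<in>I. snd i - fst i) < d2 \<Longrightarrow>
    (\<Sum>i\<in>I. \<bar>g (snd i) - g (fst i)\<bar>) \<le> \<epsilon>/2" using abs_contD[OF assms(2) e] by metis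
  show "\<exists>\<delta>>0. \<forall>I. nonoverlapping I \<longrightarrow> (\<Sum>i\<in>I. snd i - fst i) < \<delta> \<longrightarrow>
    (\<Sum>i\<in>I. \<bar>(f (snd i) - g (snd i)) - (f (fst i) - g (fst i))\<bar>) \<le> \<epsilon>"
  proof (intro exI[of _ "min d1 d2"] conjI allI impI)
    fix I assume I: "nonoverlapping I" "(\<Sum>i\<in>I. snd i - fst i) < min d1 d2"
    have "(\<Sum>i\<in>I. \<bar>(f (snd i) - g (snd i)) - (f (fst i) - g (fst i))\<bar>) \<le>
      (\<Sum>i\<in>I. \<bar>f (snd i) - f (fst i)\<bar> + \<bar>g (snd i) - g (fst i)\<bar>)" by (intro sum_mono) linarith
    also have "\<dots> \<le> \<epsilon>/2 + \<epsilon>/2" unfolding sum.distrib using I d1(2) d2(2) by (intro add_mono) auto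
    finally show "(\<Sum>i\<in>I. \<bar>(f (snd i) - g (snd i)) - (f (fst i) - g (fst i))\<bar>) \<le> \<epsilon>" by simp
  qed (use d1 d2 in auto)
qed

text \<open>Jordan decomposition: \<open>f\<close> is the difference of its variation function \<open>V\<close> and of \<open>V - f\<close>, both of
  which are monotone and absolutely continuous. The variation is counted from \<open>a\<close>, left of which \<open>f\<close> is
  constant.\<close>

lemma abs_cont_density:
  assumes f: "abs_cont f" and a: "\<And>x. x \<le> a \<Longrightarrow> f x = f a"
  obtains h where "\<And>s t. s \<le> t \<Longrightarrow> (h has_integral (f t - f s)) {s..t}" "\<And>s t. h absolutely_integrable_on {s..t}"
     "h \<in> borel_measurable borel"
proof -
  define V where "V t = enn2real (variation f a t)" for t
  have eV: "ennreal (V t) = variation f a t" for t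
    using variation_finite[OF f, of a t] unfolding V_def by (simp add: less_top)
  have inc: "\<bar>f t - f s\<bar> \<le> V t - V s" if st: "s < t" for s t
  proof -
    have *: "\<bar>f t - f s\<bar> \<le> V t - V s" if "a \<le> s" "s < t" for s t
    proof -
      have "ennreal (V s + \<bar>f t - f s\<bar>) \<le> ennreal (V t)"
        using variation_superadd[OF that, of f] eV by (simp add: V_def)
      then show ?thesis by (subst (asm) ennreal_le_iff) (auto simp: V_def)
    qed
    have z: "V s = 0" if "s \<le> a" for s
      by (simp add: V_def variation_degenerate that)
    consider "a \<le> s" | "s < a" "a < t" | "t \<le> a" by linarith
    then show ?thesis
    proof cases
      case 2
      then show ?thesis using *[of a t] z[of s] z[of a] a[of s] by simp
    next
      case 3
      then show ?thesis using z[of s] z[of t] a[of s] a[of t] st by simp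
    qed (use * st in auto)
  qed
  have up: "V t - V s \<le> enn2real (variation f s t)" if st: "s < t" for s t
  proof -
    have "ennreal (V t) \<le> ennreal (V s) + variation f s t"
    proof (cases "a \<le> s")
      case True
      then show ?thesis using variation_subadd[of a s t f] st eV by simp
    next
      case False
      then have "variation f a t \<le> variation f s t" by (intro variation_mono) auto
      then show ?thesis using eV[of t] by (simp add: add_increasing)
    qed
    then have "ennreal (V t) \<le> ennreal (V s + enn2real (variation f s t))"
      using variation_finite[OF f, of s t] by (simp add: V_def less_top)
    then show ?thesis by (subst (asm) ennreal_le_iff) (auto simp: V_def)
  qed
  have acV: "abs_cont V"
    unfolding abs_cont_def
  proof (intro allI impI)
    fix \<epsilon> :: real assume e: "\<epsilon> > 0"
    obtain \<delta> where d: "\<delta> > 0" "\<And>I. nonoverlapping I \<Longrightarrow> (\<Sum>i\<in>I. snd i - fst i) < \<delta> \<Longrightarrow>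
      (\<Sum>i\<in>I. \<bar>f (snd i) - f (fst i)\<bar>) \<le> \<epsilon>" using abs_contD[OF f e] by metis
    show "\<exists>\<delta>>0. \<forall>I. nonoverlapping I \<longrightarrow> (\<Sum>i\<in>I. snd i - fst i) < \<delta> \<longrightarrow> (\<Sum>i\<in>I. \<bar>V (snd i) - V (fst i)\<bar>) \<le> \<epsilon>"
    proof (intro exI[of _ \<delta>] conjI allI impI d(1))
      fix I assume I: "nonoverlapping I" "(\<Sum>i\<in>I. snd i - fst i) < \<delta>"
      have lt: "fst i < snd i" if "i \<in> I" for i using I(1) that by (auto simp: nonoverlapping_def)
      have "ennreal (\<Sum>i\<in>I. \<bar>V (snd i) - V (fst i)\<bar>) = (\<Sum>i\<in>I. ennreal \<bar>V (snd i) - V (fst i)\<bar>)"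
        by simp
      also have "\<dots> \<le> (\<Sum>i\<in>I. variation f (fst i) (snd i))"
      proof (rule sum_mono)
        fix i assume i: "i \<in> I"
        have "\<bar>V (snd i) - V (fst i)\<bar> \<le> enn2real (variation f (fst i) (snd i))"
          using inc[OF lt[OF i]] up[OF lt[OF i]] by simp
        then have "ennreal \<bar>V (snd i) - V (fst i)\<bar> \<le> ennreal (enn2real (variation f (fst i) (snd i)))"
          by (rule ennreal_leI)
        then show "ennreal \<bar>V (snd i) - V (fst i)\<bar> \<le> variation f (fst i) (snd i)"
          using variation_finite[OF f, of "fst i" "snd i"] by (metis ennreal_enn2real infinity_ennreal_def)
      qed
      also have "\<dots> \<le> ennreal \<epsilon>" by (rule variation_small[OF d(2) I])
      finally show "(\<Sum>i\<in>I. \<bar>V (snd i) - V (fst i)\<bar>) \<le> \<epsilon>" using e by simp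
    qed
  qed
  have mV: "mono V" using inc by (intro monoI) (metis abs_ge_zero diff_ge_0_iff_ge order_trans order.order_iff_strict)
  have mW: "mono (\<lambda>x. V x - f x)"
  proof (rule monoI)
    fix x y :: real assume "x \<le> y"
    then show "V x - f x \<le> V y - f y" using inc[of x y] by (cases "x = y") auto
  qed
  obtain h1 where h1: "h1 \<in> borel_measurable borel" "\<And>x. 0 \<le> h1 x"
     "\<And>s t. s \<le> t \<Longrightarrow> (h1 has_integral (V t - V s)) {s..t}"
    using monotone_abs_cont_density[OF acV mV] by metis
  obtain h2 where h2: "h2 \<in> borel_measurable borel" "\<And>x. 0 \<le> h2 x"
     "\<And>s t. s \<le> t \<Longrightarrow> (h2 has_integral ((V t - f t) - (V s - f s))) {s..t}"
    using monotone_abs_cont_density[OF abs_cont_diff[OF acV f] mW] by metis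
  have ai: "h absolutely_integrable_on {s..t}" if "\<And>x. 0 \<le> h x" "\<And>s t. s \<le> t \<Longrightarrow> (h has_integral (W s t)) {s..t}"
    for h :: "real \<Rightarrow> real" and W s t
  proof (cases "s \<le> t")
    case True
    show ?thesis using that True by (intro nonnegative_absolutely_integrable_1) (auto simp: has_integral_integrable)
  next
    case False
    then show ?thesis by (simp add: absolutely_integrable_on_def)
  qed
  show ?thesis
  proof (rule that[of "\<lambda>x. h1 x - h2 x"])
    show "((\<lambda>x. h1 x - h2 x) has_integral (f t - f s)) {s..t}" if "s \<le> t" for s t
      using has_integral_diff[OF h1(3)[OF that] h2(3)[OF that]] by simp
    show "(\<lambda>x. h1 x - h2 x) absolutely_integrable_on {s..t}" for s t
      using ai[OF h1(2,3)] ai[OF h2(2,3)] by (intro set_integral_diff)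
  qed (use h1 h2 in auto)
qed

text \<open>Lebesgue differentiation. The averages over the intervals to the right of a point converge to \<open>h\<close>
  almost everywhere; those over the intervals to the left are handled by reflection.\<close>

lemma AE_has_derivative_integral:
  fixes h :: "real \<Rightarrow> 'a::euclidean_space"
  assumes h: "\<And>s t. s \<le> t \<Longrightarrow> (h has_integral (F t - F s)) {s..t}"
  shows "AE x in lebesgue. (F has_vector_derivative h x) (at x)"
proof -
  obtain N1 where N1: "negligible N1" "\<And>x e. \<lbrakk>x \<notin> N1; 0 < e\<rbrakk> \<Longrightarrow> \<exists>d>0. \<forall>k. 0 < k \<and> k < d \<longrightarrow>
       norm (integral (cbox x (x + k *\<^sub>R One)) h /\<^sub>R k ^ DIM(real) - h x) < e"
  proof (rule integrable_ccontinuous_explicit[of h])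
    show "h integrable_on cbox s t" for s t
      using h[of s t] by (cases "s \<le> t") (auto simp: has_integral_integrable)
  qed (blast intro: that)
  have hr: "((\<lambda>x. h (-x)) has_integral (F (-s) - F (-t))) {s..t}" if "s \<le> t" for s t
  proof -
    have "(h has_integral (F (-s) - F (-t))) {-t..-s}" using h[of "-t" "-s"] that by simp
    then show ?thesis using has_integral_reflect_lemma_real[of h _ "-t" "-s"] by simp
  qed
  obtain N2 where N2: "negligible N2" "\<And>x e. \<lbrakk>x \<notin> N2; 0 < e\<rbrakk> \<Longrightarrow> \<exists>d>0. \<forall>k. 0 < k \<and> k < d \<longrightarrow>
       norm (integral (cbox x (x + k *\<^sub>R One)) (\<lambda>x. h (-x)) /\<^sub>R k ^ DIM(real) - h (-x)) < e"
  proof (rule integrable_ccontinuous_explicit[of "\<lambda>x. h (-x)"])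
    show "(\<lambda>x. h (-x)) integrable_on cbox s t" for s t
      using hr[of s t] by (cases "s \<le> t") (auto simp: has_integral_integrable)
  qed (blast intro: that)
  have neg: "negligible (N1 \<union> uminus ` N2)"
    using N1(1) N2(1) by (intro negligible_Un negligible_differentiable_image_negligible)
      (auto intro!: derivative_intros)
  have "(F has_vector_derivative h x) (at x)" if x: "x \<notin> N1 \<union> uminus ` N2" for x
    unfolding has_vector_derivative_def has_derivative_within_alt
  proof (intro conjI allI impI)
    show "bounded_linear (\<lambda>r. r *\<^sub>R h x)" by (rule bounded_linear_scaleR_left)
    fix e :: real assume e: "e > 0"
    obtain d1 where d1: "d1 > 0" "\<And>k. 0 < k \<Longrightarrow> k < d1 \<Longrightarrow> norm (integral {x..x+k} h /\<^sub>R k - h x) < e"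
      using N1(2)[of x, OF _ e] x by auto
    have "-x \<notin> N2" using x by force
    then obtain d2 where d2: "d2 > 0" "\<And>k. 0 < k \<Longrightarrow> k < d2 \<Longrightarrow> norm (integral {-x..-x+k} (\<lambda>x. h (-x)) /\<^sub>R k - h x) < e"
      using N2(2)[of "-x", OF _ e] by auto
    show "\<exists>d>0. \<forall>y\<in>UNIV. norm (y - x) < d \<longrightarrow> norm (F y - F x - (y - x) *\<^sub>R h x) \<le> e * norm (y - x)"
    proof (intro exI[of _ "min d1 d2"] conjI ballI impI)
      fix y assume y: "norm (y - x) < min d1 d2"
      have sc: "norm (v - k *\<^sub>R h x) \<le> e * k" if "norm (v /\<^sub>R k - h x) < e" "k > 0" for v k
      proof -
        have "v - k *\<^sub>R h x = k *\<^sub>R (v /\<^sub>R k - h x)" using that by (simp add: scaleR_diff_right)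
        then have "norm (v - k *\<^sub>R h x) = k * norm (v /\<^sub>R k - h x)" using that(2) by simp
        then show ?thesis using that by (simp add: mult.commute[of e] mult_left_mono)
      qed
      consider "y = x" | "x < y" | "y < x" by linarith
      then show "norm (F y - F x - (y - x) *\<^sub>R h x) \<le> e * norm (y - x)"
      proof cases
        case 2
        have "integral {x..x+(y-x)} h = F y - F x" using h[of x y] 2 by (simp add: integral_unique)
        then show ?thesis using sc[where v="F y - F x" and k="y - x"] d1(2)[of "y - x"] y 2 by simp
      next
        case 3
        have "integral {-x..-x+(x-y)} (\<lambda>x. h (-x)) = F x - F y" using hr[of "-x" "-y"] 3 by (simp add: integral_unique)
        then have "norm (F x - F y - (x - y) *\<^sub>R h x) \<le> e * (x - y)"
          using sc[where v="F x - F y" and k="x - y"] d2(2)[of "x - y"] y 3 by simp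
        moreover have "F x - F y - (x - y) *\<^sub>R h x = - (F y - F x - (y - x) *\<^sub>R h x)" by (simp add: algebra_simps)
        ultimately show ?thesis using 3 by (metis abs_minus_commute abs_of_pos diff_gt_0_iff_gt norm_minus_cancel real_norm_def)
      qed simp
    qed (use d1 d2 in auto)
  qed
  then have "{x. \<not> (F has_vector_derivative h x) (at x)} \<subseteq> N1 \<union> uminus ` N2" by blast
  then show ?thesis using neg by (intro AE_I'[of "N1 \<union> uminus ` N2"]) (auto simp: negligible_iff_null_sets)
qed

subsection \<open>Curves in Euclidean spaces\<close>

lemma AC_onD:
  assumes "AC_on a b f" "\<epsilon> > 0"
  obtains \<delta> where "\<delta> > 0" "\<And>I. finite I \<Longrightarrow> (\<And>i. i \<in> I \<Longrightarrow> a \<le> fst i \<and> fst i \<le> snd i \<and> snd i \<le> b) \<Longrightarrow>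
     pairwise (\<lambda>p q. disjnt {fst p<..<snd p} {fst q<..<snd q}) I \<Longrightarrow> (\<Sum>i\<in>I. snd i - fst i) < \<delta> \<Longrightarrow>
     (\<Sum>i\<in>I. norm (f (snd i) - f (fst i))) < \<epsilon>"
proof -
  obtain \<delta> where d: "\<delta> > 0" "\<forall>I :: (real \<times> real) set.
        finite I \<and> (\<forall>(s, t)\<in>I. a \<le> s \<and> s \<le> t \<and> t \<le> b) \<and>
        pairwise (\<lambda>p q. disjnt {fst p<..<snd p} {fst q<..<snd q}) I \<and>
        (\<Sum>(s, t)\<in>I. t - s) < \<delta>
        \<longrightarrow> (\<Sum>(s, t)\<in>I. norm (f t - f s)) < \<epsilon>"
    using assms unfolding AC_on_def by blast
  show ?thesis
  proof (rule that[OF d(1)])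
    fix I :: "(real \<times> real) set"
    assume I: "finite I" "\<And>i. i \<in> I \<Longrightarrow> a \<le> fst i \<and> fst i \<le> snd i \<and> snd i \<le> b"
     "pairwise (\<lambda>p q. disjnt {fst p<..<snd p} {fst q<..<snd q}) I" "(\<Sum>i\<in>I. snd i - fst i) < \<delta>"
    show "(\<Sum>i\<in>I. norm (f (snd i) - f (fst i))) < \<epsilon>"
      using d(2)[rule_format, of I] I by (auto simp: case_prod_unfold)
  qed
qed

lemma AC_onI:
  assumes "\<And>\<epsilon>. \<epsilon> > 0 \<Longrightarrow> \<exists>\<delta>>0. \<forall>I. finite I \<longrightarrow> (\<forall>i\<in>I. a \<le> fst i \<and> fst i \<le> snd i \<and> snd i \<le> b) \<longrightarrow>
     pairwise (\<lambda>p q. disjnt {fst p<..<snd p} {fst q<..<snd q}) I \<longrightarrow> (\<Sum>i\<in>I. snd i - fst i) < \<delta> \<longrightarrow>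
     (\<Sum>i\<in>I. norm (f (snd i) - f (fst i))) < \<epsilon>"
  shows "AC_on a b f"
  unfolding AC_on_def
proof (intro allI impI)
  fix \<epsilon> :: real assume "\<epsilon> > 0"
  then obtain \<delta> where d: "\<delta> > 0" "\<forall>I. finite I \<longrightarrow> (\<forall>i\<in>I. a \<le> fst i \<and> fst i \<le> snd i \<and> snd i \<le> b) \<longrightarrow>
     pairwise (\<lambda>p q. disjnt {fst p<..<snd p} {fst q<..<snd q}) I \<longrightarrow> (\<Sum>i\<in>I. snd i - fst i) < \<delta> \<longrightarrow>
     (\<Sum>i\<in>I. norm (f (snd i) - f (fst i))) < \<epsilon>" using assms by blast
  then show "\<exists>\<delta>>0. \<forall>I :: (real \<times> real) set.
        finite I \<and> (\<forall>(s, t)\<in>I. a \<le> s \<and> s \<le> t \<and> t \<le> b) \<and>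
        pairwise (\<lambda>p q. disjnt {fst p<..<snd p} {fst q<..<snd q}) I \<and>
        (\<Sum>(s, t)\<in>I. t - s) < \<delta>
        \<longrightarrow> (\<Sum>(s, t)\<in>I. norm (f t - f s)) < \<epsilon>"
    by (intro exI[of _ \<delta>]) (auto simp: case_prod_unfold)
qed

lemma AC_on_subinterval: "AC_on a b f \<Longrightarrow> a \<le> s \<Longrightarrow> t \<le> b \<Longrightarrow> AC_on s t f"
proof (rule AC_onI)
  fix \<epsilon> :: real assume *: "AC_on a b f" "a \<le> s" "t \<le> b" and "\<epsilon> > 0"
  then obtain \<delta> where d: "\<delta> > 0" "\<And>I. finite I \<Longrightarrow> (\<And>i. i \<in> I \<Longrightarrow> a \<le> fst i \<and> fst i \<le> snd i \<and> snd i \<le> b) \<Longrightarrow>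
     pairwise (\<lambda>p q. disjnt {fst p<..<snd p} {fst q<..<snd q}) I \<Longrightarrow> (\<Sum>i\<in>I. snd i - fst i) < \<delta> \<Longrightarrow>
     (\<Sum>i\<in>I. norm (f (snd i) - f (fst i))) < \<epsilon>" using AC_onD by blast
  show "\<exists>\<delta>>0. \<forall>I. finite I \<longrightarrow> (\<forall>i\<in>I. s \<le> fst i \<and> fst i \<le> snd i \<and> snd i \<le> t) \<longrightarrow>
     pairwise (\<lambda>p q. disjnt {fst p<..<snd p} {fst q<..<snd q}) I \<longrightarrow> (\<Sum>i\<in>I. snd i - fst i) < \<delta> \<longrightarrow>
     (\<Sum>i\<in>I. norm (f (snd i) - f (fst i))) < \<epsilon>"
    using *(2,3) by (intro exI[of _ \<delta>] conjI d(1) allI impI d(2)) force+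
qed

text \<open>The increments of \<open>F\<close> are controlled by those of \<open>f\<close> and of the parameter. This covers both
  compositions with Lipschitz maps and perturbations by Lipschitz functions.\<close>

lemma AC_on_dominated:
  fixes f :: "real \<Rightarrow> 'a::real_normed_vector" and F :: "real \<Rightarrow> 'b::real_normed_vector"
  assumes f: "AC_on a b f"
    and F: "\<And>s t. a \<le> s \<Longrightarrow> s \<le> t \<Longrightarrow> t \<le> b \<Longrightarrow> norm (F t - F s) \<le> C * norm (f t - f s) + D * (t - s)"
    and CD: "C \<ge> 0" "D \<ge> 0"
  shows "AC_on a b F"
proof (rule AC_onI)
  fix \<epsilon> :: real assume e: "\<epsilon> > 0"
  then have "\<epsilon> / (2 * (C + 1)) > 0" using CD by simp
  then obtain \<delta> where d: "\<delta> > 0" "\<And>I. finite I \<Longrightarrow> (\<And>i. i \<in> I \<Longrightarrow> a \<le> fst i \<and> fst i \<le> snd i \<and> snd i \<le> b) \<Longrightarrow>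
     pairwise (\<lambda>p q. disjnt {fst p<..<snd p} {fst q<..<snd q}) I \<Longrightarrow> (\<Sum>i\<in>I. snd i - fst i) < \<delta> \<Longrightarrow>
     (\<Sum>i\<in>I. norm (f (snd i) - f (fst i))) < \<epsilon> / (2 * (C + 1))" using AC_onD[OF f] by blast
  show "\<exists>\<delta>>0. \<forall>I. finite I \<longrightarrow> (\<forall>i\<in>I. a \<le> fst i \<and> fst i \<le> snd i \<and> snd i \<le> b) \<longrightarrow>
     pairwise (\<lambda>p q. disjnt {fst p<..<snd p} {fst q<..<snd q}) I \<longrightarrow> (\<Sum>i\<in>I. snd i - fst i) < \<delta> \<longrightarrow>
     (\<Sum>i\<in>I. norm (F (snd i) - F (fst i))) < \<epsilon>"
  proof (intro exI[of _ "min \<delta> (\<epsilon> / (2 * (D + 1)))"] conjI allI impI)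
    fix I assume I: "finite I" "\<forall>i\<in>I. a \<le> fst i \<and> fst i \<le> snd i \<and> snd i \<le> b"
     "pairwise (\<lambda>p q. disjnt {fst p<..<snd p} {fst q<..<snd q}) I" "(\<Sum>i\<in>I. snd i - fst i) < min \<delta> (\<epsilon> / (2 * (D + 1)))"
    have 1: "(\<Sum>i\<in>I. norm (f (snd i) - f (fst i))) < \<epsilon> / (2 * (C + 1))" (is "?x < _")
      using I by (intro d(2)) auto
    have 2: "(\<Sum>i\<in>I. snd i - fst i) < \<epsilon> / (2 * (D + 1))" (is "?y < _") using I(4) by simp
    have nn: "?x \<ge> 0" "?y \<ge> 0" using I(2) by (auto intro!: sum_nonneg)
    have "(\<Sum>i\<in>I. norm (F (snd i) - F (fst i))) \<le> (\<Sum>i\<in>I. C * norm (f (snd i) - f (fst i)) + D * (snd i - fst i))"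
      using I(2) by (intro sum_mono F) auto
    also have "\<dots> = C * ?x + D * ?y" by (simp add: sum.distrib sum_distrib_left)
    also have "\<dots> \<le> (C + 1) * ?x + (D + 1) * ?y" using nn by (simp add: algebra_simps)
    also have "\<dots> < \<epsilon>/2 + \<epsilon>/2"
      using 1 2 CD by (intro add_strict_mono) (auto simp: field_simps)
    finally show "(\<Sum>i\<in>I. norm (F (snd i) - F (fst i))) < \<epsilon>" by simp
  qed (use d CD e in auto)
qed

text \<open>Extension by clamping the parameter to \<open>[a, b]\<close>. Members of a family that the clamp does not collapse
  stay disjoint and become no longer.\<close>

lemma AC_on_imp_abs_cont:
  fixes f :: "real \<Rightarrow> 'a::euclidean_space"
  assumes f: "AC_on a b f" and ab: "a \<le> b" and i: "e \<in> Basis"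
  shows "abs_cont (\<lambda>t. f (max a (min b t)) \<bullet> e)"
  unfolding abs_cont_def
proof (intro allI impI)
  fix \<epsilon> :: real assume e: "\<epsilon> > 0"
  obtain \<delta> where d: "\<delta> > 0" "\<And>I. finite I \<Longrightarrow> (\<And>i. i \<in> I \<Longrightarrow> a \<le> fst i \<and> fst i \<le> snd i \<and> snd i \<le> b) \<Longrightarrow>
     pairwise (\<lambda>p q. disjnt {fst p<..<snd p} {fst q<..<snd q}) I \<Longrightarrow> (\<Sum>i\<in>I. snd i - fst i) < \<delta> \<Longrightarrow>
     (\<Sum>i\<in>I. norm (f (snd i) - f (fst i))) < \<epsilon>" using AC_onD[OF f e] by blast
  define c where "c t = max a (min b t)" for t
  have cab: "a \<le> c t" "c t \<le> b" for t using ab by (auto simp: c_def)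
  have cm: "s \<le> t \<Longrightarrow> c s \<le> c t" for s t by (auto simp: c_def)
  have cs: "c s < c t \<Longrightarrow> s \<le> c s \<and> c t \<le> t" for s t by (auto simp: c_def min_def max_def split: if_splits)
  have cl: "s \<le> t \<Longrightarrow> c t - c s \<le> t - s" for s t by (auto simp: c_def min_def max_def)
  define h where "h i = (c (fst i), c (snd i))" for i :: "real \<times> real"
  show "\<exists>\<delta>>0. \<forall>I. nonoverlapping I \<longrightarrow> (\<Sum>i\<in>I. snd i - fst i) < \<delta> \<longrightarrow>
     (\<Sum>i\<in>I. \<bar>f (max a (min b (snd i))) \<bullet> e - f (max a (min b (fst i))) \<bullet> e\<bar>) \<le> \<epsilon>"
  proof (intro exI[of _ \<delta>] conjI d(1) allI impI)
    fix I assume I: "nonoverlapping I" "(\<Sum>i\<in>I. snd i - fst i) < \<delta>"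
    have fI: "finite I" and ltI: "\<And>i. i \<in> I \<Longrightarrow> fst i < snd i"
      and dis: "\<And>i j. i \<in> I \<Longrightarrow> j \<in> I \<Longrightarrow> i \<noteq> j \<Longrightarrow> {fst i<..<snd i} \<inter> {fst j<..<snd j} = {}"
      using I(1) by (auto simp: nonoverlapping_def pairwise_def disjnt_def)
    define I0 where "I0 = {i\<in>I. c (fst i) < c (snd i)}"
    have fI0: "finite I0" using fI by (simp add: I0_def)
    have sub: "{fst (h i)<..<snd (h i)} \<subseteq> {fst i<..<snd i}" "{fst (h i)<..<snd (h i)} \<noteq> {}" if "i \<in> I0" for i
      using cs[of "fst i" "snd i"] that by (auto simp: I0_def h_def)
    have inj: "inj_on h I0"
    proof (rule inj_onI, rule ccontr)
      fix i j assume ij: "i \<in> I0" "j \<in> I0" "h i = h j" "i \<noteq> j"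
      have "{fst i<..<snd i} \<inter> {fst j<..<snd j} = {}" using dis ij by (auto simp: I0_def)
      then show False using sub[OF ij(1)] sub(1)[OF ij(2), folded ij(3)] by blast
    qed
    have "(\<Sum>i\<in>h ` I0. norm (f (snd i) - f (fst i))) < \<epsilon>"
    proof (rule d(2))
      show "finite (h ` I0)" using fI0 by simp
      show "a \<le> fst i \<and> fst i \<le> snd i \<and> snd i \<le> b" if "i \<in> h ` I0" for i
        using that cab by (auto simp: h_def I0_def)
      show "pairwise (\<lambda>p q. disjnt {fst p<..<snd p} {fst q<..<snd q}) (h ` I0)"
        unfolding pairwise_def disjnt_def
      proof (intro ballI impI)
        fix p q assume "p \<in> h ` I0" "q \<in> h ` I0" "p \<noteq> q"
        then obtain i j where ij: "i \<in> I0" "j \<in> I0" "i \<noteq> j" "p = h i" "q = h j" by auto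
        have "{fst i<..<snd i} \<inter> {fst j<..<snd j} = {}" using dis ij by (auto simp: I0_def)
        then show "{fst p<..<snd p} \<inter> {fst q<..<snd q} = {}" using sub(1)[OF ij(1)] sub(1)[OF ij(2)] ij by blast
      qed
      have "(\<Sum>i\<in>h ` I0. snd i - fst i) = (\<Sum>i\<in>I0. c (snd i) - c (fst i))"
        by (subst sum.reindex[OF inj]) (simp add: h_def)
      also have "\<dots> \<le> (\<Sum>i\<in>I0. snd i - fst i)" using ltI by (intro sum_mono cl) (auto simp: I0_def less_imp_le)
      also have "\<dots> \<le> (\<Sum>i\<in>I. snd i - fst i)" using ltI fI
        by (intro sum_mono2) (auto simp: I0_def less_imp_le)
      finally show "(\<Sum>i\<in>h ` I0. snd i - fst i) < \<delta>" using I(2) by simp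
    qed
    then have s: "(\<Sum>i\<in>I0. norm (f (c (snd i)) - f (c (fst i)))) < \<epsilon>" by (subst (asm) sum.reindex[OF inj]) (simp add: h_def)
    have "(\<Sum>i\<in>I. \<bar>f (c (snd i)) \<bullet> e - f (c (fst i)) \<bullet> e\<bar>) = (\<Sum>i\<in>I0. \<bar>f (c (snd i)) \<bullet> e - f (c (fst i)) \<bullet> e\<bar>)"
    proof (rule sum.mono_neutral_right[OF fI])
      show "\<forall>i\<in>I - I0. \<bar>f (c (snd i)) \<bullet> e - f (c (fst i)) \<bullet> e\<bar> = 0"
      proof
        fix i assume i: "i \<in> I - I0"
        then have "c (snd i) = c (fst i)" using cm[of "fst i" "snd i"] ltI[of i] by (auto simp: I0_def)
        then show "\<bar>f (c (snd i)) \<bullet> e - f (c (fst i)) \<bullet> e\<bar> = 0" by simp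
      qed
    qed (simp add: I0_def)
    also have "\<dots> \<le> (\<Sum>i\<in>I0. norm (f (c (snd i)) - f (c (fst i))))"
      by (intro sum_mono) (metis Basis_le_norm i inner_diff_left)
    finally show "(\<Sum>i\<in>I. \<bar>f (max a (min b (snd i))) \<bullet> e - f (max a (min b (fst i))) \<bullet> e\<bar>) \<le> \<epsilon>"
      using s unfolding c_def by linarith
  qed
qed

text \<open>The fundamental theorem of calculus for absolutely continuous curves: one Borel function is both the
  derivative almost everywhere and integrates to the increments.\<close>

theorem AC_on_density:
  fixes f :: "real \<Rightarrow> 'a::euclidean_space"
  assumes f: "AC_on a b f" and ab: "a \<le> b"
  obtains h where "\<And>s t. a \<le> s \<Longrightarrow> s \<le> t \<Longrightarrow> t \<le> b \<Longrightarrow> (h has_integral (f t - f s)) {s..t}"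
    "\<And>s t. h absolutely_integrable_on {s..t}" "h \<in> borel_measurable borel"
    "AE t in lebesgue. a < t \<and> t < b \<longrightarrow> (f has_vector_derivative h t) (at t)"
proof -
  define c where "c t = max a (min b t)" for t
  have "\<exists>h. (\<forall>s t. s \<le> t \<longrightarrow> (h has_integral (f (c t) \<bullet> e - f (c s) \<bullet> e)) {s..t}) \<and>
      (\<forall>s t. h absolutely_integrable_on {s..t}) \<and> h \<in> borel_measurable borel" if e: "e \<in> Basis" for e
  proof -
    have ac: "abs_cont (\<lambda>t. f (c t) \<bullet> e)" unfolding c_def by (rule AC_on_imp_abs_cont[OF f ab e])
    have "f (c x) \<bullet> e = f (c a) \<bullet> e" if "x \<le> a" for x using that ab by (simp add: c_def min_def)
    from abs_cont_density[OF ac this] show ?thesis by metis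
  qed
  then obtain h where h: "\<And>e s t. e \<in> Basis \<Longrightarrow> s \<le> t \<Longrightarrow> (h e has_integral (f (c t) \<bullet> e - f (c s) \<bullet> e)) {s..t}"
    "\<And>e s t. e \<in> Basis \<Longrightarrow> h e absolutely_integrable_on {s..t}" "\<And>e. e \<in> Basis \<Longrightarrow> h e \<in> borel_measurable borel"
    by metis
  define H where "H t = (\<Sum>e\<in>Basis. h e t *\<^sub>R e)" for t
  have Hc: "H t \<bullet> e = h e t" if "e \<in> Basis" for e t unfolding H_def using that by simp
  have int: "(H has_integral (f (c t) - f (c s))) {s..t}" if "s \<le> t" for s t
    by (subst has_integral_componentwise_iff) (use h(1)[OF _ that] in \<open>simp add: Hc inner_diff_left\<close>)
  show ?thesis
  proof (rule that[of H])
    show "(H has_integral (f t - f s)) {s..t}" if "a \<le> s" "s \<le> t" "t \<le> b" for s t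
      using int[OF that(2)] that by (simp add: c_def)
    show "H absolutely_integrable_on {s..t}" for s t
      by (subst absolutely_integrable_componentwise_iff) (use h(2) in \<open>simp add: Hc\<close>)
    show "H \<in> borel_measurable borel" unfolding H_def using h(3) by (intro borel_measurable_sum borel_measurable_scaleR borel_measurable_const)
    have "AE t in lebesgue. ((\<lambda>t. f (c t)) has_vector_derivative H t) (at t)"
      using AE_has_derivative_integral[OF int] .
    then show "AE t in lebesgue. a < t \<and> t < b \<longrightarrow> (f has_vector_derivative H t) (at t)"
    proof eventually_elim
      case (elim t)
      show ?case
      proof
        assume t: "a < t \<and> t < b"
        show "(f has_vector_derivative H t) (at t)"
        proof (rule has_vector_derivative_transform_within_open[OF elim])
          show "open {a<..<b}" "t \<in> {a<..<b}" using t by auto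
          show "f (c x) = f x" if "x \<in> {a<..<b}" for x using that by (simp add: c_def)
        qed
      qed
    qed
  qed
qed

text \<open>Intervals across \<open>b\<close> are split there.\<close>

lemma AC_on_combine:
  assumes 1: "AC_on a b f" and 2: "AC_on b c f" and "a \<le> b" "b \<le> c"
  shows "AC_on a c (f :: real \<Rightarrow> 'a::real_normed_vector)"
proof (rule AC_onI)
  fix \<epsilon> :: real assume "\<epsilon> > 0"
  then have e: "\<epsilon>/2 > 0" by simp
  obtain d1 where d1: "d1 > 0" "\<And>I. finite I \<Longrightarrow> (\<And>i. i \<in> I \<Longrightarrow> a \<le> fst i \<and> fst i \<le> snd i \<and> snd i \<le> b) \<Longrightarrow>
     pairwise (\<lambda>p q. disjnt {fst p<..<snd p} {fst q<..<snd q}) I \<Longrightarrow> (\<Sum>i\<in>I. snd i - fst i) < d1 \<Longrightarrow>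
     (\<Sum>i\<in>I. norm (f (snd i) - f (fst i))) < \<epsilon>/2" using AC_onD[OF 1 e] by blast
  obtain d2 where d2: "d2 > 0" "\<And>I. finite I \<Longrightarrow> (\<And>i. i \<in> I \<Longrightarrow> b \<le> fst i \<and> fst i \<le> snd i \<and> snd i \<le> c) \<Longrightarrow>
     pairwise (\<lambda>p q. disjnt {fst p<..<snd p} {fst q<..<snd q}) I \<Longrightarrow> (\<Sum>i\<in>I. snd i - fst i) < d2 \<Longrightarrow>
     (\<Sum>i\<in>I. norm (f (snd i) - f (fst i))) < \<epsilon>/2" using AC_onD[OF 2 e] by blast
  show "\<exists>\<delta>>0. \<forall>I. finite I \<longrightarrow> (\<forall>i\<in>I. a \<le> fst i \<and> fst i \<le> snd i \<and> snd i \<le> c) \<longrightarrow>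
     pairwise (\<lambda>p q. disjnt {fst p<..<snd p} {fst q<..<snd q}) I \<longrightarrow> (\<Sum>i\<in>I. snd i - fst i) < \<delta> \<longrightarrow>
     (\<Sum>i\<in>I. norm (f (snd i) - f (fst i))) < \<epsilon>"
  proof (intro exI[of _ "min d1 d2"] conjI allI impI)
    fix I assume I: "finite I" "\<forall>i\<in>I. a \<le> fst i \<and> fst i \<le> snd i \<and> snd i \<le> c"
     "pairwise (\<lambda>p q. disjnt {fst p<..<snd p} {fst q<..<snd q}) I" "(\<Sum>i\<in>I. snd i - fst i) < min d1 d2"
    have dis: "{fst i<..<snd i} \<inter> {fst j<..<snd j} = {}" if "i \<in> I" "j \<in> I" "i \<noteq> j" for i j
      using I(3) that by (auto simp: pairwise_def disjnt_def)
    define l r where "l i = (min (fst i) b, min (snd i) b)" and "r i = (max (fst i) b, max (snd i) b)" for i :: "real \<times> real"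
    define L R where "L = {i\<in>I. min (fst i) b < min (snd i) b}" and "R = {i\<in>I. max (fst i) b < max (snd i) b}"
    have subl: "{fst (l i)<..<snd (l i)} \<subseteq> {fst i<..<snd i}" for i unfolding l_def by auto
    have subr: "{fst (r i)<..<snd (r i)} \<subseteq> {fst i<..<snd i}" for i unfolding r_def by auto
    have injl: "inj_on l L"
    proof (rule inj_onI, rule ccontr)
      fix i j assume ij: "i \<in> L" "j \<in> L" "l i = l j" "i \<noteq> j"
      have "{fst (l i)<..<snd (l i)} \<noteq> {}" using ij(1) by (auto simp: L_def l_def)
      moreover have "i \<in> I" "j \<in> I" using ij by (auto simp: L_def)
      ultimately show False using dis[of i j] ij(4) subl[of i] subl[of j, folded ij(3)] by blast
    qed
    have injr: "inj_on r R"
    proof (rule inj_onI, rule ccontr)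
      fix i j assume ij: "i \<in> R" "j \<in> R" "r i = r j" "i \<noteq> j"
      have "{fst (r i)<..<snd (r i)} \<noteq> {}" using ij(1) by (auto simp: R_def r_def)
      moreover have "i \<in> I" "j \<in> I" using ij by (auto simp: R_def)
      ultimately show False using dis[of i j] ij(4) subr[of i] subr[of j, folded ij(3)] by blast
    qed
    have L: "(\<Sum>i\<in>l ` L. norm (f (snd i) - f (fst i))) < \<epsilon>/2"
    proof (rule d1(2))
      show "finite (l ` L)" using I(1) by (simp add: L_def)
      show "a \<le> fst i \<and> fst i \<le> snd i \<and> snd i \<le> b" if "i \<in> l ` L" for i
        using that I(2) assms(3) by (auto simp: L_def l_def)
      show "pairwise (\<lambda>p q. disjnt {fst p<..<snd p} {fst q<..<snd q}) (l ` L)"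
        unfolding pairwise_def disjnt_def
      proof (intro ballI impI)
        fix p q assume "p \<in> l ` L" "q \<in> l ` L" "p \<noteq> q"
        then obtain i j where ij: "i \<in> I" "j \<in> I" "i \<noteq> j" "p = l i" "q = l j" by (auto simp: L_def)
        then show "{fst p<..<snd p} \<inter> {fst q<..<snd q} = {}" using dis[OF ij(1,2,3)] subl[of i] subl[of j] by blast
      qed
      have "(\<Sum>i\<in>l ` L. snd i - fst i) = (\<Sum>i\<in>L. snd (l i) - fst (l i))" by (simp add: sum.reindex[OF injl])
      also have "\<dots> \<le> (\<Sum>i\<in>L. snd i - fst i)" using I(2) by (intro sum_mono) (auto simp: L_def l_def min_def)
      also have "\<dots> \<le> (\<Sum>i\<in>I. snd i - fst i)" using I(1,2) by (intro sum_mono2) (auto simp: L_def)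
      finally show "(\<Sum>i\<in>l ` L. snd i - fst i) < d1" using I(4) by simp
    qed
    have R: "(\<Sum>i\<in>r ` R. norm (f (snd i) - f (fst i))) < \<epsilon>/2"
    proof (rule d2(2))
      show "finite (r ` R)" using I(1) by (simp add: R_def)
      show "b \<le> fst i \<and> fst i \<le> snd i \<and> snd i \<le> c" if "i \<in> r ` R" for i
        using that I(2) assms(4) by (auto simp: R_def r_def)
      show "pairwise (\<lambda>p q. disjnt {fst p<..<snd p} {fst q<..<snd q}) (r ` R)"
        unfolding pairwise_def disjnt_def
      proof (intro ballI impI)
        fix p q assume "p \<in> r ` R" "q \<in> r ` R" "p \<noteq> q"
        then obtain i j where ij: "i \<in> I" "j \<in> I" "i \<noteq> j" "p = r i" "q = r j" by (auto simp: R_def)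
        then show "{fst p<..<snd p} \<inter> {fst q<..<snd q} = {}" using dis[OF ij(1,2,3)] subr[of i] subr[of j] by blast
      qed
      have "(\<Sum>i\<in>r ` R. snd i - fst i) = (\<Sum>i\<in>R. snd (r i) - fst (r i))" by (simp add: sum.reindex[OF injr])
      also have "\<dots> \<le> (\<Sum>i\<in>R. snd i - fst i)" using I(2) by (intro sum_mono) (auto simp: R_def r_def max_def)
      also have "\<dots> \<le> (\<Sum>i\<in>I. snd i - fst i)" using I(1,2) by (intro sum_mono2) (auto simp: R_def)
      finally show "(\<Sum>i\<in>r ` R. snd i - fst i) < d2" using I(4) by simp
    qed
    have "(\<Sum>i\<in>I. norm (f (snd i) - f (fst i))) \<le>
        (\<Sum>i\<in>I. norm (f (snd (l i)) - f (fst (l i))) + norm (f (snd (r i)) - f (fst (r i))))"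
    proof (rule sum_mono)
      fix i assume "i \<in> I"
      have "f (snd i) - f (fst i) = (f (snd (l i)) - f (fst (l i))) + (f (snd (r i)) - f (fst (r i)))"
        unfolding l_def r_def by (auto simp: min_def max_def)
      then show "norm (f (snd i) - f (fst i)) \<le> norm (f (snd (l i)) - f (fst (l i))) + norm (f (snd (r i)) - f (fst (r i)))"
        by (metis norm_triangle_ineq)
    qed
    also have "\<dots> = (\<Sum>i\<in>I. norm (f (snd (l i)) - f (fst (l i)))) + (\<Sum>i\<in>I. norm (f (snd (r i)) - f (fst (r i))))"
      by (rule sum.distrib)
    also have "(\<Sum>i\<in>I. norm (f (snd (l i)) - f (fst (l i)))) = (\<Sum>i\<in>L. norm (f (snd (l i)) - f (fst (l i))))"
    proof (rule sum.mono_neutral_right[OF I(1)])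
      show "\<forall>i\<in>I - L. norm (f (snd (l i)) - f (fst (l i))) = 0"
      proof
        fix i assume "i \<in> I - L"
        then have "min (snd i) b = min (fst i) b" using I(2) by (force simp: L_def min_def)
        then show "norm (f (snd (l i)) - f (fst (l i))) = 0" by (simp add: l_def)
      qed
    qed (auto simp: L_def)
    also have "\<dots> = (\<Sum>i\<in>l ` L. norm (f (snd i) - f (fst i)))" by (simp add: sum.reindex[OF injl])
    also have "(\<Sum>i\<in>I. norm (f (snd (r i)) - f (fst (r i)))) = (\<Sum>i\<in>R. norm (f (snd (r i)) - f (fst (r i))))"
    proof (rule sum.mono_neutral_right[OF I(1)])
      show "\<forall>i\<in>I - R. norm (f (snd (r i)) - f (fst (r i))) = 0"
      proof
        fix i assume "i \<in> I - R"
        then have "max (snd i) b = max (fst i) b" using I(2) by (force simp: R_def max_def)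
        then show "norm (f (snd (r i)) - f (fst (r i))) = 0" by (simp add: r_def)
      qed
    qed (auto simp: R_def)
    also have "\<dots> = (\<Sum>i\<in>r ` R. norm (f (snd i) - f (fst i)))" by (simp add: sum.reindex[OF injr])
    finally show "(\<Sum>i\<in>I. norm (f (snd i) - f (fst i))) < \<epsilon>" using L R by linarith
  qed (use d1 d2 in auto)
qed

text \<open>Absolute continuity can be tested near each parameter value. Coordinate changes are only locally
  Lipschitz, so this is needed to pass from one chart to another.\<close>

lemma AC_on_local:
  fixes f :: "real \<Rightarrow> 'a::real_normed_vector"
  assumes "a \<le> b" and loc: "\<And>x. a \<le> x \<Longrightarrow> x \<le> b \<Longrightarrow>
    \<exists>d>0. \<forall>s t. a \<le> s \<and> s \<le> x \<and> x \<le> t \<and> t \<le> b \<and> t - s < d \<longrightarrow> AC_on s t f"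
  shows "AC_on a b f"
proof -
  have "a \<le> a \<and> b \<le> b \<longrightarrow> AC_on a b f"
  proof (rule Bolzano[where P = "\<lambda>s t. a \<le> s \<and> t \<le> b \<longrightarrow> AC_on s t f", OF assms(1)])
    fix p q r assume "a \<le> p \<and> q \<le> b \<longrightarrow> AC_on p q f" "a \<le> q \<and> r \<le> b \<longrightarrow> AC_on q r f" "p \<le> q" "q \<le> r"
    then show "a \<le> p \<and> r \<le> b \<longrightarrow> AC_on p r f" using AC_on_combine[of p q f r] by auto
  next
    fix x assume "a \<le> x" "x \<le> b"
    from loc[OF this] show "\<exists>d>0. \<forall>s t. s \<le> x \<and> x \<le> t \<and> t - s < d \<longrightarrow> (a \<le> s \<and> t \<le> b \<longrightarrow> AC_on s t f)"
      by blast
  qed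
  then show ?thesis by simp
qed

section \<open>Null sets from square-root growth\<close>

lemma coord_lborel_sum_measurable:
  "(\<lambda>f. \<Sum>i\<in>S. f i *\<^sub>R i) \<in> borel_measurable (\<Pi>\<^sub>M i\<in>S. lborel :: real measure)"
  for S :: "'e::euclidean_space set"
  by (intro borel_measurable_sum borel_measurable_scaleR borel_measurable_const measurable_component_singleton[where M="\<lambda>_. lborel", simplified])

lemma sets_coord_lborel [simp]: "sets (coord_lborel S) = sets borel"
  by (simp add: coord_lborel_def)

text \<open>The measure is carried by the span of \<open>S\<close>, so a cylinder over a box in the coordinates of \<open>S\<close> has the
  volume of the box.\<close>

lemma emeasure_coord_lborel_box:
  fixes S :: "'e::euclidean_space set"
  assumes S: "S \<subseteq> Basis" and ab: "\<And>i. i \<in> S \<Longrightarrow> a i \<le> b i"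
  shows "emeasure (coord_lborel S) {y. \<forall>i\<in>S. a i \<le> y \<bullet> i \<and> y \<bullet> i \<le> b i} = ennreal (\<Prod>i\<in>S. b i - a i)"
    and "closed {y. \<forall>i\<in>S. a i \<le> y \<bullet> i \<and> y \<bullet> i \<le> b i}"
proof -
  let ?B = "{y. \<forall>i\<in>S. a i \<le> y \<bullet> i \<and> y \<bullet> i \<le> b i}"
  have fS: "finite S" using S finite_Basis finite_subset by blast
  interpret product_sigma_finite "\<lambda>_ :: 'e. lborel :: real measure" by standard
  have "?B = (\<Inter>i\<in>S. {y. a i \<le> y \<bullet> i} \<inter> {y. y \<bullet> i \<le> b i})" by auto
  also have "closed \<dots>" by (intro closed_INT ballI closed_Int closed_Collect_le continuous_intros)
  finally show c: "closed ?B" .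
  have comp: "(\<Sum>j\<in>S. f j *\<^sub>R j) \<bullet> i = f i" if "i \<in> S" for f i
  proof -
    have "(\<Sum>j\<in>S. f j *\<^sub>R j) \<bullet> i = (\<Sum>j\<in>S. if j = i then f i else 0)"
      unfolding inner_sum_left using S that by (intro sum.cong) (auto simp: inner_Basis subset_iff)
    then show ?thesis using that fS by simp
  qed
  have "emeasure (coord_lborel S) ?B = emeasure (\<Pi>\<^sub>M i\<in>S. lborel)
      ((\<lambda>f. \<Sum>i\<in>S. f i *\<^sub>R i) -` ?B \<inter> space (\<Pi>\<^sub>M i\<in>S. lborel :: real measure))"
    unfolding coord_lborel_def using c by (intro emeasure_distr coord_lborel_sum_measurable) auto
  also have "(\<lambda>f. \<Sum>i\<in>S. f i *\<^sub>R i) -` ?B \<inter> space (\<Pi>\<^sub>M i\<in>S. lborel :: real measure) = (\<Pi>\<^sub>E i\<in>S. {a i..b i})"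
    by (auto simp: space_PiM comp PiE_def Pi_def)
  also have "emeasure (\<Pi>\<^sub>M i\<in>S. lborel) (\<Pi>\<^sub>E i\<in>S. {a i..b i}) = (\<Prod>i\<in>S. emeasure lborel {a i..b i})"
    by (rule emeasure_PiM[OF fS]) auto
  also have "\<dots> = (\<Prod>i\<in>S. ennreal (b i - a i))" using ab by (intro prod.cong) auto
  also have "\<dots> = ennreal (\<Prod>i\<in>S. b i - a i)" using ab by (intro prod_ennreal) auto
  finally show "emeasure (coord_lborel S) ?B = ennreal (\<Prod>i\<in>S. b i - a i)" .
qed

lemma norm_coord_le:
  fixes v :: "'e::euclidean_space"
  assumes S: "S \<subseteq> Basis" and v: "\<And>i. i \<in> Basis - S \<Longrightarrow> v \<bullet> i = 0"
  shows "norm v \<le> (\<Sum>i\<in>S. \<bar>v \<bullet> i\<bar>)"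
proof -
  have "norm v \<le> (\<Sum>i\<in>Basis. \<bar>v \<bullet> i\<bar>)" by (rule norm_le_l1)
  also have "\<dots> = (\<Sum>i\<in>S. \<bar>v \<bullet> i\<bar>)"
    using S v by (intro sum.mono_neutral_right) auto
  finally show ?thesis .
qed

text \<open>If two points of \<open>E\<close> differ much more in direction \<open>b\<close> than in the other coordinates, then their
  difference lies in the growth cone, and \<open>f\<close> differs by \<open>C \<surd>|q - p|\<close>. When \<open>f\<close> differs by at most
  \<open>\<surd>r\<close>, this confines the points to a multiple of \<open>r\<close> in direction \<open>b\<close>.\<close>

lemma width_bound_from_growth:
  fixes E :: "'e::euclidean_space set" and f :: "'e \<Rightarrow> real"
  assumes S: "S \<subseteq> Basis" and b: "b \<in> S" and E: "\<And>y i. y \<in> E \<Longrightarrow> i \<in> Basis - S \<Longrightarrow> y \<bullet> i = 0"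
    and C: "C > 0" "\<theta> > 0"
    and growth: "\<And>p q. p \<in> E \<Longrightarrow> q \<in> E \<Longrightarrow> norm (q - p - norm (q - p) *\<^sub>R b) \<le> \<theta> * norm (q - p) \<Longrightarrow>
       f q \<ge> f p + C * sqrt (norm (q - p))"
    and pq: "p \<in> E" "q \<in> E" and r: "r > 0" "\<And>i. i \<in> S - {b} \<Longrightarrow> \<bar>(q - p) \<bullet> i\<bar> \<le> r" "\<bar>f q - f p\<bar> \<le> sqrt r"
  shows "(q - p) \<bullet> b \<le> (2 * card S / \<theta> + 1 / C\<^sup>2) * r"
proof (rule ccontr)
  define D where "D = (q - p) \<bullet> b"
  let ?n = "real (card S)"
  assume "\<not> ?thesis"
  then have D: "D > (2 * ?n / \<theta> + 1 / C\<^sup>2) * r" by (simp add: D_def)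
  have pos: "2 * ?n / \<theta> * r \<ge> 0" "1 / C\<^sup>2 * r \<ge> 0" using C r by auto
  have D1: "D > 2 * ?n / \<theta> * r" and D2: "D > 1 / C\<^sup>2 * r" and D0: "D > 0"
    using D pos by (auto simp: distrib_right)
  have bB: "b \<in> Basis" using b S by auto
  have "norm (q - p - D *\<^sub>R b) \<le> (\<Sum>i\<in>S. \<bar>(q - p - D *\<^sub>R b) \<bullet> i\<bar>)"
  proof (rule norm_coord_le[OF S])
    fix i assume i: "i \<in> Basis - S"
    then have "b \<bullet> i = 0" using bB b by (auto simp: inner_Basis)
    then show "(q - p - D *\<^sub>R b) \<bullet> i = 0" using E[OF pq(1) i] E[OF pq(2) i] by (simp add: inner_diff_left)
  qed
  also have "\<dots> \<le> (\<Sum>i\<in>S. r)"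
  proof (rule sum_mono)
    fix i assume i: "i \<in> S"
    show "\<bar>(q - p - D *\<^sub>R b) \<bullet> i\<bar> \<le> r"
    proof (cases "i = b")
      case True
      then show ?thesis using r(1) bB by (simp add: inner_diff_left D_def inner_Basis)
    next
      case False
      then have "b \<bullet> i = 0" using i S bB by (auto simp: inner_Basis)
      then show ?thesis using r(2)[of i] False i by (simp add: inner_diff_left)
    qed
  qed
  also have "\<dots> = ?n * r" by simp
  finally have 1: "norm (q - p - D *\<^sub>R b) \<le> ?n * r" .
  have nb: "norm b = 1" using bB by simp
  have Dn: "D \<le> norm (q - p)" unfolding D_def using Basis_le_norm[OF bB, of "q - p"] by linarith
  have "norm (q - p) \<le> norm (q - p - D *\<^sub>R b) + norm (D *\<^sub>R b)" by (metis diff_add_cancel norm_triangle_ineq)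
  then have 2: "norm (q - p) - D \<le> ?n * r" using 1 nb D0 by simp
  have "q - p - norm (q - p) *\<^sub>R b = (q - p - D *\<^sub>R b) + (D - norm (q - p)) *\<^sub>R b"
    by (simp add: algebra_simps)
  then have "norm (q - p - norm (q - p) *\<^sub>R b) \<le> norm (q - p - D *\<^sub>R b) + norm ((D - norm (q - p)) *\<^sub>R b)"
    by (metis norm_triangle_ineq)
  also have "\<dots> \<le> 2 * ?n * r" using 1 2 Dn nb by simp
  also have "\<dots> \<le> \<theta> * D" using D1 C(2) by (simp add: field_simps)
  also have "\<dots> \<le> \<theta> * norm (q - p)" using Dn C by simp
  finally have "f q \<ge> f p + C * sqrt (norm (q - p))" by (rule growth[OF pq])
  then have "C * sqrt (norm (q - p)) \<le> sqrt r" using r(3) by linarith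
  moreover have "C * sqrt D \<le> C * sqrt (norm (q - p))" using C Dn by simp
  ultimately have "C * sqrt D \<le> sqrt r" by linarith
  then have "(C * sqrt D)\<^sup>2 \<le> (sqrt r)\<^sup>2" using C D0 by (intro power_mono) auto
  then have "C\<^sup>2 * D \<le> r" using D0 r(1) by (simp add: power_mult_distrib)
  then show False using D2 C by (simp add: field_simps)
qed

text \<open>For \<open>r = 1/m\<^sup>2\<close>, the set \<open>E\<close> is cut into cells of side \<open>r\<close> in the \<open>k\<close> coordinates other than \<open>b\<close>
  and \<open>\<surd>r = 1/m\<close> in the value of \<open>f\<close>. By \<open>width_bound_from_growth\<close> the part of \<open>E\<close> in a cell lies in a
  box of volume of order \<open>r^(k+1) = m^(-2k-2)\<close>, and there are of order \<open>m^(2k+1)\<close> cells. Hence \<open>E\<close> has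
  measurable supersets of measure of order \<open>1/m\<close>.\<close>

lemma growth_null_fixed_direction:
  fixes E :: "'e::euclidean_space set" and f :: "'e \<Rightarrow> real"
  assumes S: "S \<subseteq> Basis" and b: "b \<in> S" and E: "\<And>y i. y \<in> E \<Longrightarrow> i \<in> Basis - S \<Longrightarrow> y \<bullet> i = 0"
    and bd: "\<And>y. y \<in> E \<Longrightarrow> \<bar>f y\<bar> \<le> K" "\<And>y. y \<in> E \<Longrightarrow> norm y \<le> R"
    and C: "C > 0" "\<theta> > 0"
    and growth: "\<And>p q. p \<in> E \<Longrightarrow> q \<in> E \<Longrightarrow> norm (q - p - norm (q - p) *\<^sub>R b) \<le> \<theta> * norm (q - p) \<Longrightarrow>
       f q \<ge> f p + C * sqrt (norm (q - p))"
  shows "\<exists>N\<in>null_sets (coord_lborel S). E \<subseteq> N"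
proof -
  define W where "W = 2 * card S / \<theta> + 1 / C\<^sup>2"
  have W: "W \<ge> 0" unfolding W_def using C by simp
  define k where "k = card (S - {b})"
  have fS: "finite S" using S finite_Basis finite_subset by blast
  define R' where "R' = \<bar>R\<bar> + 1"
  define K' where "K' = \<bar>K\<bar> + 1"
  have "\<exists>U. U \<in> sets borel \<and> E \<subseteq> U \<and> emeasure (coord_lborel S) U \<le>
     ennreal ((12 * R') ^ k * (12 * K' * W) / real m)" if m: "m > 0" for m :: nat
  proof -
    let ?m = "real m"
    have m1: "?m \<ge> 1" using m by simp
    \<comment> \<open>The side is 1/m^2 in the coordinates but only 1/m in the values.\<close>
    define cell where "cell y = (restrict (\<lambda>i. \<lfloor>?m\<^sup>2 * (y \<bullet> i)\<rfloor>) (S - {b}), \<lfloor>?m * f y\<rfloor>)" for y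
    define A where "A = {- \<lceil>?m\<^sup>2 * R'\<rceil> .. \<lceil>?m\<^sup>2 * R'\<rceil>}"
    define A' where "A' = {- \<lceil>?m * K'\<rceil> .. \<lceil>?m * K'\<rceil>}"
    have m2: "?m\<^sup>2 \<ge> 1" using m1 by simp
    have flo: "\<lfloor>c * x\<rfloor> \<in> {- \<lceil>c * y\<rceil> .. \<lceil>c * y\<rceil>}" if "\<bar>x\<bar> \<le> y" "c \<ge> 0" for c x y :: real
    proof -
      have "\<bar>c * x\<bar> \<le> c * y" using that by (simp add: abs_mult mult_left_mono)
      then have "c * x \<le> c * y" "- (c * y) \<le> c * x" by linarith+
      then have "\<lfloor>c * x\<rfloor> \<le> \<lceil>c * y\<rceil>" "\<lfloor>- (c * y)\<rfloor> \<le> \<lfloor>c * x\<rfloor>"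
        by (linarith, intro floor_mono)
      then show ?thesis by (simp add: floor_minus)
    qed
    have cellA: "cell ` E \<subseteq> (\<Pi>\<^sub>E i\<in>S - {b}. A) \<times> A'"
    proof
      fix c assume "c \<in> cell ` E"
      then obtain y where y: "y \<in> E" "c = cell y" by auto
      have "\<bar>y \<bullet> i\<bar> \<le> R'" if "i \<in> S" for i
        using Basis_le_norm[of i y] bd(2)[OF y(1)] S that unfolding R'_def by (auto simp: subset_iff)
      moreover have "\<bar>f y\<bar> \<le> K'" using bd(1)[OF y(1)] unfolding K'_def by auto
      ultimately show "c \<in> (\<Pi>\<^sub>E i\<in>S - {b}. A) \<times> A'"
        unfolding y(2) cell_def A_def A'_def using flo by auto
    qed
    have finA: "finite ((\<Pi>\<^sub>E i\<in>S - {b}. A) \<times> A')" using fS by (auto simp: A_def A'_def intro!: finite_PiE)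
    have fin: "finite (cell ` E)" using finite_subset[OF cellA finA] .
    have cA: "real (card A) \<le> 6 * ?m\<^sup>2 * R'"
    proof -
      have "1 * 1 \<le> ?m\<^sup>2 * R'" using m2 by (intro mult_mono) (auto simp: R'_def)
      then show ?thesis unfolding A_def by (simp add: algebra_simps) linarith
    qed
    have cA': "real (card A') \<le> 6 * ?m * K'"
    proof -
      have "1 * 1 \<le> ?m * K'" using m1 by (intro mult_mono) (auto simp: K'_def)
      then show ?thesis unfolding A'_def by (simp add: algebra_simps) linarith
    qed
    have "card (cell ` E) \<le> card A ^ k * card A'"
      using card_mono[OF finA cellA] fS by (simp add: card_cartesian_product card_PiE k_def)
    then have "real (card (cell ` E)) \<le> real (card A) ^ k * real (card A')"
      by (metis of_nat_le_iff of_nat_mult of_nat_power)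
    also have "\<dots> \<le> (6 * ?m\<^sup>2 * R') ^ k * (6 * ?m * K')"
      using cA cA' by (intro mult_mono power_mono) (auto simp: R'_def)
    finally have card: "real (card (cell ` E)) \<le> (6 * ?m\<^sup>2 * R') ^ k * (6 * ?m * K')" .
    define r where "r = 1 / ?m\<^sup>2"
    have r: "r > 0" "sqrt r = 1 / ?m" using m1 by (auto simp: r_def real_sqrt_divide)
    define pt where "pt c = (SOME y. y \<in> E \<and> cell y = c)" for c
    have pt: "pt c \<in> E" "cell (pt c) = c" if "c \<in> cell ` E" for c
      using someI_ex[of "\<lambda>y. y \<in> E \<and> cell y = c"] that unfolding pt_def by auto
    define w where "w i = (if i = b then W * r else r)" for i
    define B where "B c = {y. \<forall>i\<in>S. pt c \<bullet> i - w i \<le> y \<bullet> i \<and> y \<bullet> i \<le> pt c \<bullet> i + w i}" for c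
    have w0: "w i \<ge> 0" for i using W r by (simp add: w_def)
    have emB: "emeasure (coord_lborel S) (B c) = ennreal ((2 * r) ^ k * (2 * W * r))" and clB: "closed (B c)" for c
    proof -
      have "emeasure (coord_lborel S) (B c) = ennreal (\<Prod>i\<in>S. (pt c \<bullet> i + w i) - (pt c \<bullet> i - w i))"
        unfolding B_def using w0 by (intro emeasure_coord_lborel_box S) (simp add: add_increasing2 diff_le_eq)
      also have "(\<Prod>i\<in>S. (pt c \<bullet> i + w i) - (pt c \<bullet> i - w i)) = (\<Prod>i\<in>S. 2 * w i)"
        by (intro prod.cong) auto
      also have "\<dots> = 2 * w b * (\<Prod>i\<in>S - {b}. 2 * w i)" using fS b by (rule prod.remove)
      also have "(\<Prod>i\<in>S - {b}. 2 * w i) = (\<Prod>i\<in>S - {b}. 2 * r)" by (intro prod.cong) (auto simp: w_def)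
      also have "\<dots> = (2 * r) ^ k" by (simp add: k_def)
      finally show "emeasure (coord_lborel S) (B c) = ennreal ((2 * r) ^ k * (2 * W * r))"
        by (simp add: w_def mult_ac)
      show "closed (B c)"
        unfolding B_def using w0 by (intro emeasure_coord_lborel_box S) (simp add: add_increasing2 diff_le_eq)
    qed
    have bB: "B c \<in> sets borel" for c using clB by (rule borel_closed)
    have EB: "E \<subseteq> (\<Union>c\<in>cell ` E. B c)"
    proof
      fix y assume y: "y \<in> E"
      define p where "p = pt (cell y)"
      have p: "p \<in> E" "cell p = cell y" using pt[of "cell y"] y by (auto simp: p_def)
      have fl: "\<bar>x - x'\<bar> \<le> 1 / c" if "\<lfloor>c * x\<rfloor> = \<lfloor>c * x'\<rfloor>" "c > 0" for c x x' :: real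
      proof -
        have "\<bar>c * x - c * x'\<bar> \<le> 1" using that(1) by linarith
        then have "c * \<bar>x - x'\<bar> \<le> 1" using that(2) by (simp add: abs_mult flip: right_diff_distrib)
        then show ?thesis using that(2) by (simp add: field_simps)
      qed
      have c1: "\<bar>(y - p) \<bullet> i\<bar> \<le> r" if "i \<in> S - {b}" for i
      proof -
        have "restrict (\<lambda>i. \<lfloor>?m\<^sup>2 * (y \<bullet> i)\<rfloor>) (S - {b}) i = restrict (\<lambda>i. \<lfloor>?m\<^sup>2 * (p \<bullet> i)\<rfloor>) (S - {b}) i"
          using p(2) by (simp add: cell_def)
        then show ?thesis unfolding inner_diff_left r_def using that m1 by (intro fl) auto
      qed
      have c2: "\<bar>f y - f p\<bar> \<le> sqrt r" unfolding r(2) using p(2) m1 by (intro fl) (auto simp: cell_def)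
      have c1': "\<bar>(p - y) \<bullet> i\<bar> \<le> r" if "i \<in> S - {b}" for i
        using c1[OF that] by (simp add: inner_diff_left abs_minus_commute)
      have c2': "\<bar>f p - f y\<bar> \<le> sqrt r" using c2 by (simp add: abs_minus_commute)
      have "(y - p) \<bullet> b \<le> W * r" unfolding W_def
        by (rule width_bound_from_growth[OF S b E C growth p(1) y r(1) c1 c2])
      moreover have "(p - y) \<bullet> b \<le> W * r" unfolding W_def
        by (rule width_bound_from_growth[OF S b E C growth y p(1) r(1) c1' c2'])
      ultimately have "\<bar>(y - p) \<bullet> i\<bar> \<le> w i" if "i \<in> S" for i
        using c1 that by (cases "i = b") (auto simp: w_def inner_diff_left)
      then have "y \<in> B (cell y)"
        unfolding B_def p_def[symmetric] by (fastforce simp: inner_diff_left abs_le_iff)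
      then show "y \<in> (\<Union>c\<in>cell ` E. B c)" using y by blast
    qed
    have "emeasure (coord_lborel S) (\<Union>c\<in>cell ` E. B c) \<le> (\<Sum>c\<in>cell ` E. emeasure (coord_lborel S) (B c))"
      using bB fin by (intro emeasure_subadditive_finite) auto
    also have "\<dots> = ennreal (real (card (cell ` E)) * ((2 * r) ^ k * (2 * W * r)))"
      by (simp add: emB ennreal_mult ennreal_of_nat_eq_real_of_nat r(1) less_imp_le W)
    also have "\<dots> \<le> ennreal ((12 * R') ^ k * (12 * K' * W) / ?m)"
    proof (rule ennreal_leI)
      have "real (card (cell ` E)) * ((2 * r) ^ k * (2 * W * r)) \<le>
          ((6 * ?m\<^sup>2 * R') ^ k * (6 * ?m * K')) * ((2 * r) ^ k * (2 * W * r))"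
        using card W r by (intro mult_right_mono) auto
      also have "\<dots> = ((6 * ?m\<^sup>2 * R') * (2 * r)) ^ k * ((6 * ?m * K') * (2 * W * r))"
        by (simp only: power_mult_distrib mult_ac)
      also have "(6 * ?m\<^sup>2 * R') * (2 * r) = 12 * R'" unfolding r_def using m1 by simp
      also have "(6 * ?m * K') * (2 * W * r) = (12 * K' * W) / ?m"
        unfolding r_def using m1 by (simp add: power2_eq_square)
      finally show "real (card (cell ` E)) * ((2 * r) ^ k * (2 * W * r)) \<le> (12 * R') ^ k * (12 * K' * W) / ?m" by simp
    qed
    finally have le: "emeasure (coord_lborel S) (\<Union>c\<in>cell ` E. B c) \<le> ennreal ((12 * R') ^ k * (12 * K' * W) / ?m)" .
    have "(\<Union>c\<in>cell ` E. B c) \<in> sets borel" using fin bB by (intro sets.finite_UN) auto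
    then show ?thesis using EB le by blast
  qed
  then obtain U where U: "\<And>m. m > 0 \<Longrightarrow> U m \<in> sets borel" "\<And>m. m > 0 \<Longrightarrow> E \<subseteq> U m"
    "\<And>m. m > 0 \<Longrightarrow> emeasure (coord_lborel S) (U m) \<le> ennreal ((12 * R') ^ k * (12 * K' * W) / real m)"
    by metis
  define N where "N = (\<Inter>m. U (Suc m))"
  have Nb: "N \<in> sets borel" unfolding N_def using U(1) by auto
  define c where "c = (12 * R') ^ k * (12 * K' * W)"
  have "emeasure (coord_lborel S) N = 0"
  proof (rule ccontr)
    assume "emeasure (coord_lborel S) N \<noteq> 0"
    then have pos: "emeasure (coord_lborel S) N > 0" by (simp add: zero_less_iff_neq_zero)
    have le: "emeasure (coord_lborel S) N \<le> ennreal (c / real (Suc m))" for m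
    proof -
      have "emeasure (coord_lborel S) N \<le> emeasure (coord_lborel S) (U (Suc m))"
        using U(1)[of "Suc m"] by (intro emeasure_mono) (auto simp: N_def)
      then show ?thesis using U(3)[of "Suc m"] by (simp add: c_def)
    qed
    have "(\<lambda>m. ennreal (c / real (Suc m))) \<longlonglongrightarrow> ennreal 0"
      using LIMSEQ_Suc[OF lim_const_over_n[of c]] by (intro tendsto_ennrealI) simp
    then have "emeasure (coord_lborel S) N \<le> ennreal 0"
      by (rule LIMSEQ_le_const) (use le in auto)
    then show False using pos by simp
  qed
  then show ?thesis using U(2) Nb by (intro bexI[of _ N]) (auto simp: N_def null_sets_def)
qed

text \<open>A function that increases at each point of \<open>E\<close> at least like a square root along some cone around a
  signed coordinate direction. Countably many pieces have common direction, sign, constants, bound and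
  location; on each piece all points are close enough for the growth condition to apply. The
  conclusion is about a measurable superset, because \<open>E\<close> is arbitrary.\<close>

theorem growth_null:
  fixes E :: "'e::euclidean_space set" and f :: "'e \<Rightarrow> real"
  assumes S: "S \<subseteq> Basis" and E: "\<And>y i. y \<in> E \<Longrightarrow> i \<in> Basis - S \<Longrightarrow> y \<bullet> i = 0"
    and growth: "\<And>p. p \<in> E \<Longrightarrow> \<exists>b\<in>S. \<exists>\<sigma>\<in>{1,-1::real}. \<exists>n::nat. n > 0 \<and> (\<forall>q\<in>E. norm (q - p) < 1 / real n \<longrightarrow>
       norm (q - p - (norm (q - p) * \<sigma>) *\<^sub>R b) \<le> 1 / real n * norm (q - p) \<longrightarrow> f q \<ge> f p + 1 / real n * sqrt (norm (q - p)))"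
  shows "\<exists>N\<in>null_sets (coord_lborel S). E \<subseteq> N"
proof -
  obtain D :: "'e set" where D: "countable D" "\<And>X. open X \<Longrightarrow> X \<noteq> {} \<Longrightarrow> \<exists>d\<in>D. d \<in> X"
    using countable_dense_exists by metis
  define G where "G b \<sigma> n p \<longleftrightarrow> (\<forall>q\<in>E. norm (q - p) < 1 / real n \<longrightarrow>
       norm (q - p - (norm (q - p) * \<sigma>) *\<^sub>R b) \<le> 1 / real n * norm (q - p) \<longrightarrow> f q \<ge> f p + 1 / real n * sqrt (norm (q - p)))"
    for b :: 'e and \<sigma> :: real and n p
  define Q where "Q = (\<lambda>(b, \<sigma>, n, k, z). {p\<in>E. G b \<sigma> n p \<and> \<bar>f p\<bar> \<le> real k \<and> p \<in> ball z (1 / (2 * real n))})"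
  define J where "J = S \<times> {1, -1 :: real} \<times> {n::nat. n > 0} \<times> (UNIV :: nat set) \<times> D"
  have fS: "finite S" using S finite_Basis finite_subset by blast
  have cJ: "countable J" unfolding J_def using D(1) countable_finite[OF fS] by (intro countable_SIGMA) auto
  have null: "\<exists>N\<in>null_sets (coord_lborel S). Q j \<subseteq> N" if j: "j \<in> J" for j
  proof -
    obtain b \<sigma> n k z where j': "j = (b, \<sigma>, n, k, z)" by (metis prod_cases5)
    have jj: "b \<in> S" "\<sigma> = 1 \<or> \<sigma> = -1" "n > 0" using j unfolding j' J_def by auto
    let ?E = "Q j"
    have QE: "p \<in> E" "G b \<sigma> n p" "\<bar>f p\<bar> \<le> real k" "dist z p < 1 / (2 * real n)" if "p \<in> ?E" for p
      using that unfolding j' Q_def by auto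
    have near: "norm (q - p) < 1 / real n" if "p \<in> ?E" "q \<in> ?E" for p q
    proof -
      have "dist q p \<le> dist z q + dist z p" by (metis dist_commute dist_triangle)
      also have "\<dots> < 1 / (2 * real n) + 1 / (2 * real n)" using QE(4)[OF that(1)] QE(4)[OF that(2)] by simp
      finally show ?thesis by (simp add: dist_norm field_simps)
    qed
    have gr: "f q \<ge> f p + 1 / real n * sqrt (norm (q - p))"
      if "p \<in> ?E" "q \<in> ?E" "norm (q - p - (norm (q - p) * \<sigma>) *\<^sub>R b) \<le> 1 / real n * norm (q - p)" for p q
      using QE(2)[OF that(1)] QE(1)[OF that(2)] near[OF that(1,2)] that(3) unfolding G_def by blast
    have R: "norm y \<le> norm z + 1 / (2 * real n)" if "y \<in> ?E" for y
    proof -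
      have "norm y \<le> norm z + dist z y" by (metis dist_commute dist_norm norm_triangle_sub)
      then show ?thesis using QE(4)[OF that] by linarith
    qed
    have n0: "1 / real n > 0" using jj(3) by simp
    show ?thesis
    proof (cases "\<sigma> = 1")
      case True
      show ?thesis
        by (rule growth_null_fixed_direction[OF S jj(1), where f=f and K="real k" and C="1 / real n" and \<theta>="1 / real n"])
           (use E QE(1,3) R n0 gr True in auto)
    next
      case False
      then have s: "\<sigma> = -1" using jj(2) by simp
      show ?thesis
      \<comment> \<open>Exchanging p and q turns a cone around -b into one around b and f into - f.\<close>
      proof (rule growth_null_fixed_direction[OF S jj(1), where f="\<lambda>y. - f y" and K="real k" and C="1 / real n" and \<theta>="1 / real n"])
        fix p q assume pq: "p \<in> ?E" "q \<in> ?E" "norm (q - p - norm (q - p) *\<^sub>R b) \<le> 1 / real n * norm (q - p)"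
        have "p - q - (norm (p - q) * \<sigma>) *\<^sub>R b = - (q - p - norm (q - p) *\<^sub>R b)"
          unfolding s by (simp add: norm_minus_commute)
        then have "norm (p - q - (norm (p - q) * \<sigma>) *\<^sub>R b) \<le> 1 / real n * norm (p - q)"
          using pq(3) by (metis norm_minus_cancel norm_minus_commute)
        from gr[OF pq(2,1) this] show "- f q \<ge> - f p + 1 / real n * sqrt (norm (q - p))"
          by (simp add: norm_minus_commute)
      qed (use E QE(1,3) R n0 in auto)
    qed
  qed
  then obtain N where N: "\<And>j. j \<in> J \<Longrightarrow> N j \<in> null_sets (coord_lborel S)" "\<And>j. j \<in> J \<Longrightarrow> Q j \<subseteq> N j" by metis
  have "(\<Union>j\<in>J. N j) \<in> null_sets (coord_lborel S)" using cJ N(1) by (rule null_sets_UN')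
  moreover have "E \<subseteq> (\<Union>j\<in>J. N j)"
  proof
    fix p assume p: "p \<in> E"
    obtain b \<sigma> n where g: "b \<in> S" "\<sigma> \<in> {1, -1}" "n > 0" "G b \<sigma> n p"
    proof -
      have "\<exists>b\<in>S. \<exists>\<sigma>\<in>{1,-1}. \<exists>n::nat. n > 0 \<and> G b \<sigma> n p" unfolding G_def by (rule growth[OF p])
      then show thesis by (elim bexE exE conjE) (rule that; assumption)
    qed
    obtain k :: nat where k: "\<bar>f p\<bar> \<le> real k" using real_arch_simple by blast
    obtain z where z: "z \<in> D" "z \<in> ball p (1 / (2 * real n))" using D(2)[of "ball p (1 / (2 * real n))"] g(3) by auto
    have "(b, \<sigma>, n, k, z) \<in> J" "p \<in> Q (b, \<sigma>, n, k, z)"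
      using g k z p unfolding J_def Q_def by (auto simp: dist_commute)
    then show "p \<in> (\<Union>j\<in>J. N j)" using N(2) by blast
  qed
  ultimately show ?thesis by blast
qed

section \<open>Smooth maps\<close>

lemma smooth_on_continuous: "smooth_on S f \<Longrightarrow> continuous_on S f"
  unfolding smooth_on_def by (metis Ck_on.simps(1))

lemma smooth_on_differentiable: "smooth_on S f \<Longrightarrow> x \<in> S \<Longrightarrow> f differentiable (at x)"
  unfolding smooth_on_def by (metis Ck_on.simps(2))

lemma smooth_on_derivative: "smooth_on S f \<Longrightarrow> smooth_on S (\<lambda>x. frechet_derivative f (at x) v)"
  unfolding smooth_on_def by (metis Ck_on.simps(2))

lemma smooth_on_has_derivative:
  "smooth_on S f \<Longrightarrow> x \<in> S \<Longrightarrow> (f has_derivative frechet_derivative f (at x)) (at x)"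
  using smooth_on_differentiable frechet_derivative_works by blast

lemma linear_frechet_derivative:
  "f differentiable (at x) \<Longrightarrow> linear (frechet_derivative f (at x))"
  using frechet_derivative_works has_derivative_linear by blast

text \<open>Continuity of the derivative, tested on the finitely many basis vectors, together with the mean value
  inequality gives an estimate of increments that is uniform in both points.\<close>

lemma smooth_on_strictly_differentiable:
  fixes f :: "'a::euclidean_space \<Rightarrow> 'b::real_normed_vector"
  assumes S: "open S" and f: "smooth_on S f" and p0: "p0 \<in> S" and e: "\<eta> > 0"
  obtains r where "r > 0" "ball p0 r \<subseteq> S"
    "\<And>p v. p \<in> ball p0 r \<Longrightarrow> norm (frechet_derivative f (at p) v - frechet_derivative f (at p0) v) \<le> \<eta> * norm v"
    "\<And>p q. p \<in> ball p0 r \<Longrightarrow> q \<in> ball p0 r \<Longrightarrow> norm (f q - f p - frechet_derivative f (at p0) (q - p)) \<le> \<eta> * norm (q - p)"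
proof -
  let ?D = "\<lambda>p. frechet_derivative f (at p)"
  define e' where "e' = \<eta> / (real DIM('a))"
  have e': "e' > 0" using e by (simp add: e'_def)
  have "\<forall>i\<in>Basis. \<forall>\<^sub>F p in at p0. dist (?D p i) (?D p0 i) < e'"
  proof
    fix i :: 'a
    have "continuous_on S (\<lambda>p. ?D p i)" using smooth_on_continuous[OF smooth_on_derivative[OF f]] .
    then have "isCont (\<lambda>p. ?D p i) p0" using S p0 by (simp add: continuous_on_eq_continuous_at)
    then show "\<forall>\<^sub>F p in at p0. dist (?D p i) (?D p0 i) < e'"
      using e' unfolding isCont_def by (rule tendstoD)
  qed
  then have "\<forall>\<^sub>F p in at p0. \<forall>i\<in>Basis. dist (?D p i) (?D p0 i) < e'"
    by (simp add: eventually_ball_finite)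
  then obtain r1 where r1: "r1 > 0" "\<And>p. p \<noteq> p0 \<Longrightarrow> dist p p0 < r1 \<Longrightarrow> \<forall>i\<in>Basis. dist (?D p i) (?D p0 i) < e'"
    unfolding eventually_at by auto
  obtain r2 where r2: "r2 > 0" "ball p0 r2 \<subseteq> S" using S p0 open_contains_ball by blast
  define r where "r = min r1 r2"
  have rS: "ball p0 r \<subseteq> S" using r2 by (auto simp: r_def)
  have lin: "linear (?D p)" if "p \<in> S" for p using linear_frechet_derivative smooth_on_differentiable[OF f that] by blast
  have D: "norm (?D p v - ?D p0 v) \<le> \<eta> * norm v" if p: "p \<in> ball p0 r" for p v
  proof -
    have b: "norm (?D p i - ?D p0 i) \<le> e'" if "i \<in> Basis" for i
    proof (cases "p = p0")
      case False
      have "dist p p0 < r1" using p by (simp add: r_def dist_commute)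
      then show ?thesis using r1(2)[OF False] that by (auto simp: dist_norm less_imp_le)
    qed (use e' in simp)
    have l: "linear (\<lambda>v. ?D p v - ?D p0 v)"
      using lin p rS p0 by (intro linear_compose_sub) auto
    have eq: "?D p v - ?D p0 v = (\<Sum>i\<in>Basis. (v \<bullet> i) *\<^sub>R (?D p i - ?D p0 i))"
      using linear_sum[OF l, of "\<lambda>i. (v \<bullet> i) *\<^sub>R i" Basis] linear_scale[OF l] by (simp add: euclidean_representation)
    have "norm (?D p v - ?D p0 v) \<le> (\<Sum>i\<in>(Basis :: 'a set). norm v * e')"
      unfolding eq
    proof (rule sum_norm_le)
      fix i :: 'a assume i: "i \<in> Basis"
      show "norm ((v \<bullet> i) *\<^sub>R (?D p i - ?D p0 i)) \<le> norm v * e'"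
        using Basis_le_norm[OF i, of v] b[OF i] by (simp add: mult_mono)
    qed
    also have "\<dots> = \<eta> * norm v" by (simp add: e'_def)
    finally show ?thesis .
  qed
  show ?thesis
  proof (rule that[of r, OF _ rS D])
    show "r > 0" using r1 r2 by (simp add: r_def)
    fix p q assume pq: "p \<in> ball p0 r" "q \<in> ball p0 r"
    have "norm ((\<lambda>x. f x - ?D p0 x) q - (\<lambda>x. f x - ?D p0 x) p) \<le> \<eta> * norm (q - p)"
    proof (rule differentiable_bound[OF convex_ball[of p0 r], where f' = "\<lambda>p v. ?D p v - ?D p0 v"])
      fix x assume x: "x \<in> ball p0 r"
      have "bounded_linear (?D p0)" using lin[OF p0] by (simp add: linear_conv_bounded_linear)
      then have d2: "((\<lambda>x. ?D p0 x) has_derivative ?D p0) (at x within ball p0 r)"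
        by (rule bounded_linear_imp_has_derivative)
      have d1: "(f has_derivative ?D x) (at x within ball p0 r)"
        by (rule has_derivative_at_withinI[OF smooth_on_has_derivative[OF f subsetD[OF rS x]]])
      show "((\<lambda>x. f x - ?D p0 x) has_derivative (\<lambda>v. ?D x v - ?D p0 v)) (at x within ball p0 r)"
        by (rule has_derivative_diff[OF d1 d2])
      show "onorm (\<lambda>v. ?D x v - ?D p0 v) \<le> \<eta>" using D[OF x] e by (intro onorm_bound) auto
    qed (use pq in auto)
    moreover have "(f q - ?D p0 q) - (f p - ?D p0 p) = f q - f p - ?D p0 (q - p)"
      using linear_diff[OF lin[OF p0], of q p] by simp
    ultimately show "norm (f q - f p - ?D p0 (q - p)) \<le> \<eta> * norm (q - p)" by simp
  qed auto
qed

lemma smooth_on_locally_lipschitz: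
  fixes f :: "'a::euclidean_space \<Rightarrow> 'b::real_normed_vector"
  assumes S: "open S" and f: "smooth_on S f" and p0: "p0 \<in> S"
  obtains r L where "r > 0" "L \<ge> 0" "ball p0 r \<subseteq> S"
    "\<And>p q. p \<in> ball p0 r \<Longrightarrow> q \<in> ball p0 r \<Longrightarrow> norm (f q - f p) \<le> L * norm (q - p)"
proof -
  obtain r where r: "r > 0" "ball p0 r \<subseteq> S"
    "\<And>p q. p \<in> ball p0 r \<Longrightarrow> q \<in> ball p0 r \<Longrightarrow> norm (f q - f p - frechet_derivative f (at p0) (q - p)) \<le> 1 * norm (q - p)"
    using smooth_on_strictly_differentiable[OF S f p0, of 1] by (metis zero_less_one)
  let ?D = "frechet_derivative f (at p0)"
  have bl: "bounded_linear ?D" using smooth_on_has_derivative[OF f p0] has_derivative_bounded_linear by blast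
  show ?thesis
  proof (rule that[OF r(1) _ r(2), of "1 + onorm ?D"])
    show "0 \<le> 1 + onorm ?D" using onorm_pos_le[OF bl] by simp
    fix p q assume pq: "p \<in> ball p0 r" "q \<in> ball p0 r"
    have "norm (f q - f p) \<le> norm (f q - f p - ?D (q - p)) + norm (?D (q - p))"
      by (metis diff_add_cancel norm_triangle_ineq)
    also have "\<dots> \<le> 1 * norm (q - p) + onorm ?D * norm (q - p)" by (intro add_mono r(3) pq onorm bl)
    finally show "norm (f q - f p) \<le> (1 + onorm ?D) * norm (q - p)" by (simp add: algebra_simps)
  qed
qed

text \<open>A Lebesgue number of the covering by the balls of strict differentiability makes first-order
  approximation uniform on a compact set.\<close>

lemma smooth_on_uniformly_differentiable:
  fixes f :: "'a::euclidean_space \<Rightarrow> 'b::real_normed_vector"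
  assumes S: "open S" and f: "smooth_on S f" and K: "compact K" "K \<subseteq> S" and e: "\<eta> > 0"
  obtains r where "r > 0" "\<And>p v. p \<in> K \<Longrightarrow> norm v < r \<Longrightarrow> p + v \<in> S"
    "\<And>p v. p \<in> K \<Longrightarrow> norm v < r \<Longrightarrow> norm (f (p + v) - f p - frechet_derivative f (at p) v) \<le> \<eta> * norm v"
proof -
  let ?D = "\<lambda>p. frechet_derivative f (at p)"
  let ?ok = "\<lambda>p0 r. r > 0 \<and> ball p0 r \<subseteq> S \<and> (\<forall>p\<in>ball p0 r. \<forall>v. norm (?D p v - ?D p0 v) \<le> (\<eta>/2) * norm v) \<and>
    (\<forall>p\<in>ball p0 r. \<forall>q\<in>ball p0 r. norm (f q - f p - ?D p0 (q - p)) \<le> (\<eta>/2) * norm (q - p))"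
  have "\<exists>r. ?ok p r" if "p \<in> S" for p
    using smooth_on_strictly_differentiable[OF S f that half_gt_zero[OF e]] by metis
  then obtain r where r: "\<And>p. p \<in> S \<Longrightarrow> ?ok p (r p)" by metis
  obtain e0 where e0: "e0 > 0" "\<And>p. p \<in> K \<Longrightarrow> \<exists>G\<in>(\<lambda>p. ball p (r p)) ` K. ball p e0 \<subseteq> G"
  proof (rule Heine_Borel_lemma[OF K(1)])
    have "p \<in> ball p (r p)" if "p \<in> K" for p using r[of p] K that by auto
    then show "K \<subseteq> \<Union> ((\<lambda>p. ball p (r p)) ` K)" by blast
    show "open G" if "G \<in> (\<lambda>p. ball p (r p)) ` K" for G using that by auto
  qed (use that in blast)
  show ?thesis
  proof (rule that[OF e0(1)])
    fix p and v :: 'a assume p: "p \<in> K" and v: "norm v < e0"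
    obtain p0 where p0: "p0 \<in> K" "ball p e0 \<subseteq> ball p0 (r p0)" using e0(2)[OF p] by blast
    have in_b: "p \<in> ball p0 (r p0)" "p + v \<in> ball p0 (r p0)"
      using p0(2) e0(1) v by (auto simp: subset_iff dist_norm)
    note ok = r[of p0]
    have p0S: "p0 \<in> S" using p0 K by auto
    show "p + v \<in> S" using ok[OF p0S] in_b by blast
    have "norm (f (p + v) - f p - ?D p0 (p + v - p)) \<le> (\<eta>/2) * norm (p + v - p)"
      using ok[OF p0S] in_b by blast
    moreover have "norm (?D p v - ?D p0 v) \<le> (\<eta>/2) * norm v" using ok[OF p0S] in_b by blast
    moreover have "norm (f (p + v) - f p - ?D p v) \<le> norm (f (p + v) - f p - ?D p0 v) + norm (?D p v - ?D p0 v)"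
      using norm_triangle_ineq4[of "f (p + v) - f p - ?D p0 v" "?D p v - ?D p0 v"] by simp
    ultimately show "norm (f (p + v) - f p - ?D p v) \<le> \<eta> * norm v" by simp
  qed
qed

section \<open>Charts and the coordinates of tangent vectors\<close>

lemma chart_open: "is_chart c \<Longrightarrow> open (dom_of c)" "is_chart c \<Longrightarrow> open (range_of c)"
  by (auto simp: is_chart_def)

lemma chart_inv [simp]:
  assumes "is_chart c"
  shows "x \<in> dom_of c \<Longrightarrow> inv_of c (map_of_chart c x) = x"
    and "y \<in> range_of c \<Longrightarrow> map_of_chart c (inv_of c y) = y"
    and "x \<in> dom_of c \<Longrightarrow> map_of_chart c x \<in> range_of c"
    and "y \<in> range_of c \<Longrightarrow> inv_of c y \<in> dom_of c"
proof -
  have h: "homeomorphism (dom_of c) (range_of c) (map_of_chart c) (inv_of c)"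
    using assms by (simp add: is_chart_def)
  show "x \<in> dom_of c \<Longrightarrow> inv_of c (map_of_chart c x) = x" by (rule homeomorphism_apply1[OF h])
  show "y \<in> range_of c \<Longrightarrow> map_of_chart c (inv_of c y) = y" by (rule homeomorphism_apply2[OF h])
  show "x \<in> dom_of c \<Longrightarrow> map_of_chart c x \<in> range_of c" using homeomorphism_image1[OF h] by blast
  show "y \<in> range_of c \<Longrightarrow> inv_of c y \<in> dom_of c" using homeomorphism_image2[OF h] by blast
qed

lemma chart_continuous:
  assumes "is_chart c"
  shows "continuous_on (dom_of c) (map_of_chart c)" "continuous_on (range_of c) (inv_of c)"
  using assms unfolding is_chart_def homeomorphism_def by auto

lemma chart_image_open:
  assumes c: "is_chart c" and U: "open U"
  shows "open (map_of_chart c ` (dom_of c \<inter> U))"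
proof -
  have "map_of_chart c ` (dom_of c \<inter> U) = range_of c \<inter> inv_of c -` U"
  proof (intro equalityI subsetI)
    fix y assume "y \<in> range_of c \<inter> inv_of c -` U"
    then have "y = map_of_chart c (inv_of c y)" "inv_of c y \<in> dom_of c \<inter> U" using chart_inv[OF c] by auto
    then show "y \<in> map_of_chart c ` (dom_of c \<inter> U)" by (rule image_eqI)
  qed (use chart_inv[OF c] in auto)
  then show ?thesis using chart_continuous(2)[OF c] chart_open(2)[OF c] U by (simp add: continuous_on_open_vimage Int_commute)
qed

lemma chart_vimage_open:
  assumes c: "is_chart c" and V: "open V"
  shows "open (dom_of c \<inter> map_of_chart c -` V)"
  using chart_continuous(1)[OF c] chart_open(1)[OF c] V by (simp add: continuous_on_open_vimage Int_commute)

lemma smoothly_related_sym: "smoothly_related c d \<Longrightarrow> smoothly_related d c"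
  unfolding smoothly_related_def by (simp add: Int_commute)

lemma transition_derivative:
  assumes c: "is_chart c" and d: "is_chart d" and r: "smoothly_related c d"
    and x: "x \<in> dom_of c" "x \<in> dom_of d"
  shows "((map_of_chart d \<circ> inv_of c) has_derivative
     frechet_derivative (map_of_chart d \<circ> inv_of c) (at (map_of_chart c x))) (at (map_of_chart c x))"
  using r x unfolding smoothly_related_def by (intro smooth_on_has_derivative) auto

text \<open>The differential at \<open>x\<close> of the change of coordinates from \<open>c\<close> to \<open>d\<close>. Starting from the preferred
  chart it gives the coordinates of tangent vectors in \<open>d\<close>.\<close>

definition transition :: "('m, 'e::real_normed_vector) chart \<Rightarrow> ('m, 'e) chart \<Rightarrow> 'm \<Rightarrow> 'e \<Rightarrow> 'e" where
  "transition c d x = frechet_derivative (map_of_chart d \<circ> inv_of c) (at (map_of_chart c x))"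

lemma derivative_change_chart:
  fixes f :: "'m::topological_space \<Rightarrow> 'b::real_normed_vector"
  assumes c: "is_chart c" and d: "is_chart d" and r: "smoothly_related c d"
    and x: "x \<in> dom_of c" "x \<in> dom_of d"
    and f: "((f \<circ> inv_of d) has_derivative D) (at (map_of_chart d x))"
  shows "((f \<circ> inv_of c) has_derivative (D \<circ> transition c d x)) (at (map_of_chart c x))"
proof -
  have "((f \<circ> inv_of d) \<circ> (map_of_chart d \<circ> inv_of c) has_derivative (D \<circ> transition c d x)) (at (map_of_chart c x))"
    unfolding transition_def
    using transition_derivative[OF c d r x] f x c by (intro diff_chain_at) simp_all
  then show ?thesis
  proof (rule has_derivative_transform_within_open)
    show "open (map_of_chart c ` (dom_of c \<inter> dom_of d))" by (rule chart_image_open[OF c chart_open(1)[OF d]])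
    show "map_of_chart c x \<in> map_of_chart c ` (dom_of c \<inter> dom_of d)" using x by auto
    show "((f \<circ> inv_of d) \<circ> (map_of_chart d \<circ> inv_of c)) y = (f \<circ> inv_of c) y"
      if "y \<in> map_of_chart c ` (dom_of c \<inter> dom_of d)" for y
      using that c d by auto
  qed
qed

lemma transition_linear:
  assumes "is_chart c" "is_chart d" "smoothly_related c d" "x \<in> dom_of c" "x \<in> dom_of d"
  shows "bounded_linear (transition c d x)" "linear (transition c d x)"
  using transition_derivative[OF assms] has_derivative_bounded_linear has_derivative_linear unfolding transition_def by blast+

lemma transition_self:
  assumes c: "is_chart c" and x: "x \<in> dom_of c"
  shows "transition c c x = id"
proof -
  have "((map_of_chart c \<circ> inv_of c) has_derivative id) (at (map_of_chart c x))"
  proof (rule has_derivative_transform_within_open[of id])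
    show "open (range_of c)" "map_of_chart c x \<in> range_of c" using c x chart_open(2)[OF c] by auto
  qed (use c in \<open>auto simp: has_derivative_id\<close>)
  then show ?thesis unfolding transition_def by (metis frechet_derivative_at)
qed

lemma transition_trans:
  assumes c: "is_chart c" and d: "is_chart d" and e: "is_chart e"
    and r: "smoothly_related c d" "smoothly_related d e"
    and x: "x \<in> dom_of c" "x \<in> dom_of d" "x \<in> dom_of e"
  shows "transition d e x (transition c d x v) = transition c e x v"
proof -
  have "((map_of_chart e \<circ> inv_of c) has_derivative (transition d e x \<circ> transition c d x)) (at (map_of_chart c x))"
    using transition_derivative[OF d e r(2) x(2,3)]
    by (intro derivative_change_chart[OF c d r(1) x(1,2)]) (simp add: transition_def)
  then have "transition d e x \<circ> transition c d x = transition c e x"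
    unfolding transition_def by (metis frechet_derivative_at)
  then show ?thesis by (metis comp_apply)
qed

lemma transition_inverse:
  assumes c: "is_chart c" and d: "is_chart d" and r: "smoothly_related c d"
    and x: "x \<in> dom_of c" "x \<in> dom_of d"
  shows "transition d c x (transition c d x v) = v"
  using transition_trans[OF c d c r smoothly_related_sym[OF r] x(1,2,1)] transition_self[OF c x(1)] by simp

lemma atlasD:
  assumes A: "smooth_atlas A"
  shows "c \<in> A \<Longrightarrow> is_chart c" "c \<in> A \<Longrightarrow> d \<in> A \<Longrightarrow> smoothly_related c d"
    "chart_at A x \<in> A" "x \<in> dom_of (chart_at A x)"
proof -
  show "c \<in> A \<Longrightarrow> is_chart c" "c \<in> A \<Longrightarrow> d \<in> A \<Longrightarrow> smoothly_related c d"
    using A by (auto simp: smooth_atlas_def)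
  have "x \<in> (\<Union>c\<in>A. dom_of c)" using A by (simp add: smooth_atlas_def)
  then have "\<exists>c. c \<in> A \<and> x \<in> dom_of c" by blast
  then show "chart_at A x \<in> A" "x \<in> dom_of (chart_at A x)"
    unfolding chart_at_def by (metis (mono_tags, lifting) someI_ex)+
qed

lemma differential_chart: "differential A (map_of_chart d) x = transition (chart_at A x) d x"
  by (simp add: differential_def transition_def)

lemma differential_in_chart:
  assumes A: "smooth_atlas A" and d: "d \<in> A" "x \<in> dom_of d"
    and f: "((f \<circ> inv_of d) has_derivative D) (at (map_of_chart d x))"
  shows "differential A f x v = D (differential A (map_of_chart d) x v)"
proof -
  note [simp] = atlasD[OF A]
  have "((f \<circ> inv_of (chart_at A x)) has_derivative (D \<circ> transition (chart_at A x) d x)) (at (map_of_chart (chart_at A x) x))"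
    using d f by (intro derivative_change_chart) auto
  then have "differential A f x = D \<circ> transition (chart_at A x) d x"
    unfolding differential_def by (metis frechet_derivative_at)
  then show ?thesis by (simp add: differential_chart)
qed

text \<open>The bundle chart is invertible over the domain of \<open>d\<close>, its inverse being the transition back to the
  preferred chart.\<close>

lemma bundle_chart_inv:
  assumes A: "smooth_atlas A" and d: "d \<in> A"
  shows "x \<in> dom_of d \<Longrightarrow> bundle_inv A d (bundle_chart A d (x, v)) = (x, v)"
    and "y \<in> range_of d \<Longrightarrow> bundle_inv A d (y, z) = (inv_of d y, transition d (chart_at A (inv_of d y)) (inv_of d y) z)"
    and "y \<in> range_of d \<Longrightarrow> bundle_chart A d (bundle_inv A d (y, z)) = (y, z)"
proof -
  note [simp] = atlasD[OF A]
  have inj: "inj_on (bundle_chart A d) (dom_of d \<times> UNIV)"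
  proof (rule inj_onI, clarsimp simp: bundle_chart_def)
    fix x v x' v' assume x: "x \<in> dom_of d" "x' \<in> dom_of d" "map_of_chart d x = map_of_chart d x'"
      and v: "differential A (map_of_chart d) x v = differential A (map_of_chart d) x' v'"
    have xx: "x = x'" using x d chart_inv(1)[of d] by (metis atlasD(1)[OF A])
    have "v = transition d (chart_at A x) x (transition (chart_at A x) d x v)"
      using x d by (subst transition_inverse) auto
    also have "\<dots> = v'" using v x d unfolding xx differential_chart by (simp add: transition_inverse)
    finally show "x = x' \<and> v = v'" using xx by simp
  qed
  show 1: "bundle_inv A d (bundle_chart A d (x, v)) = (x, v)" if "x \<in> dom_of d" for x v
    unfolding bundle_inv_def using inj that by (intro inv_into_f_f) auto
  show 2: "bundle_inv A d (y, z) = (inv_of d y, transition d (chart_at A (inv_of d y)) (inv_of d y) z)" if "y \<in> range_of d" for y z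
  proof -
    have "bundle_chart A d (inv_of d y, transition d (chart_at A (inv_of d y)) (inv_of d y) z) = (y, z)"
      using that d by (simp add: bundle_chart_def differential_chart transition_inverse)
    then show ?thesis using 1[of "inv_of d y" "transition d (chart_at A (inv_of d y)) (inv_of d y) z"] that d by simp
  qed
  show "bundle_chart A d (bundle_inv A d (y, z)) = (y, z)" if "y \<in> range_of d"
    using that d by (simp add: 2 bundle_chart_def differential_chart transition_inverse)
qed

lemma differential_linear:
  assumes A: "smooth_atlas A" and d: "d \<in> A" "x \<in> dom_of d"
  shows "linear (differential A (map_of_chart d) x)" "bij (differential A (map_of_chart d) x)"
proof -
  note [simp] = atlasD[OF A]
  show "linear (differential A (map_of_chart d) x)"
    unfolding differential_chart using d by (intro transition_linear) auto
  show "bij (differential A (map_of_chart d) x)"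
    unfolding differential_chart
    by (rule o_bij[of "transition d (chart_at A x) x"]) (use d in \<open>auto simp: fun_eq_iff transition_inverse\<close>)
qed

text \<open>Velocities are defined through the preferred chart at the point of the curve; by the chain rule they
  can be computed in any chart of the atlas.\<close>

lemma velocity_in_chart:
  assumes A: "smooth_atlas A" and d: "d \<in> A" "\<gamma> t \<in> dom_of d" and cont: "isCont \<gamma> t"
    and w: "((map_of_chart d \<circ> \<gamma>) has_vector_derivative w) (at t)"
  shows "differential A (map_of_chart d) (\<gamma> t) (velocity A \<gamma> t) = w"
    "bundle_inv A d (map_of_chart d (\<gamma> t), w) = (\<gamma> t, velocity A \<gamma> t)"
proof -
  note [simp] = atlasD[OF A]
  define c where "c = chart_at A (\<gamma> t)"
  have c: "c \<in> A" "\<gamma> t \<in> dom_of c" by (simp_all add: c_def)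
  have "\<forall>\<^sub>F s in at t. \<gamma> s \<in> dom_of c \<inter> dom_of d"
    using cont c d unfolding isCont_def by (intro topological_tendstoD) (auto intro!: chart_open)
  then obtain e where e: "e > 0" "\<And>s. s \<noteq> t \<Longrightarrow> dist s t < e \<Longrightarrow> \<gamma> s \<in> dom_of c \<inter> dom_of d"
    unfolding eventually_at by blast
  then have near: "\<gamma> s \<in> dom_of c \<and> \<gamma> s \<in> dom_of d" if "s \<in> ball t e" for s
    using that c d by (cases "s = t") (auto simp: dist_commute)
  have "((map_of_chart c \<circ> inv_of d) \<circ> (map_of_chart d \<circ> \<gamma>) has_derivative (transition d c (\<gamma> t) \<circ> (\<lambda>h. h *\<^sub>R w))) (at t)"
    using w transition_derivative[of d c "\<gamma> t"] c d unfolding has_vector_derivative_def transition_def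
    by (intro diff_chain_at) auto
  then have "((map_of_chart c \<circ> \<gamma>) has_derivative (transition d c (\<gamma> t) \<circ> (\<lambda>h. h *\<^sub>R w))) (at t)"
    by (rule has_derivative_transform_within_open[of _ _ _ _ "ball t e"]) (use e near d in auto)
  moreover have "transition d c (\<gamma> t) \<circ> (\<lambda>h. h *\<^sub>R w) = (\<lambda>h. h *\<^sub>R transition d c (\<gamma> t) w)"
    using transition_linear(2)[of d c "\<gamma> t"] c d by (auto simp: fun_eq_iff linear_scale)
  ultimately have "((map_of_chart c \<circ> \<gamma>) has_vector_derivative transition d c (\<gamma> t) w) (at t)"
    unfolding has_vector_derivative_def by simp
  then have v: "velocity A \<gamma> t = transition d c (\<gamma> t) w"
    unfolding velocity_def c_def[symmetric] by (rule vector_derivative_at)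
  show 1: "differential A (map_of_chart d) (\<gamma> t) (velocity A \<gamma> t) = w"
    unfolding differential_chart v c_def[symmetric] using c d by (intro transition_inverse) auto
  show "bundle_inv A d (map_of_chart d (\<gamma> t), w) = (\<gamma> t, velocity A \<gamma> t)"
    using bundle_chart_inv(1)[OF A d(1,2), of "velocity A \<gamma> t"] by (simp add: bundle_chart_def 1)
qed

section \<open>The Lorentz-Finsler function and the cone in a chart\<close>

definition LL_chart :: "('m, 'e::real_normed_vector) lf_manifold \<Rightarrow> ('m, 'e) chart \<Rightarrow> 'e \<times> 'e \<Rightarrow> real" where
  "LL_chart M d p = LL M (bundle_inv (atlas M) d p)"

definition cone_chart :: "('m, 'e::real_normed_vector) lf_manifold \<Rightarrow> ('m, 'e) chart \<Rightarrow> ('e \<times> 'e) set" where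
  "cone_chart M d = {p. fst p \<in> range_of d \<and> bundle_inv (atlas M) d p \<in> cone M}"

abbreviation slit_bundle :: "('m, 'e::real_normed_vector) chart \<Rightarrow> ('e \<times> 'e) set" where
  "slit_bundle d \<equiv> range_of d \<times> (UNIV - {0})"

text \<open>All local arguments take place in one chart \<open>d\<close> of the atlas. There \<open>F\<close> is the Lorentz-Finsler
  function in the coordinates \<open>(y, z)\<close> of the tangent bundle, and \<open>T y\<close> and \<open>D y\<close> are the mutually
  inverse isomorphisms between coordinate vectors \<open>z\<close> and tangent vectors.\<close>

locale lf_chart =
  fixes M :: "('m::{t2_space,second_countable_topology}, 'e::euclidean_space) lf_manifold" and d
  assumes lf: "lorentz_finsler M" and d: "d \<in> atlas M"
begin

abbreviation "F \<equiv> LL_chart M d"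

lemma A: "smooth_atlas (atlas M)" using lf by (simp add: lorentz_finsler_def)
lemma ch: "is_chart d" using atlasD(1)[OF A d] .

lemma open_slit: "open (slit_bundle d)"
  using chart_open(2)[OF ch] by (intro open_Times) auto

lemma smooth_F: "smooth_on (slit_bundle d) F"
proof -
  have "F = LL M \<circ> bundle_inv (atlas M) d" by (auto simp: LL_chart_def fun_eq_iff)
  then show ?thesis using lf d by (simp add: lorentz_finsler_def lf_function_def)
qed

definition "T y = transition d (chart_at (atlas M) (inv_of d y)) (inv_of d y)"
definition "D y = transition (chart_at (atlas M) (inv_of d y)) d (inv_of d y)"

lemma tangent_coordinates:
  assumes "y \<in> range_of d"
  shows "bundle_inv (atlas M) d (y, z) = (inv_of d y, T y z)" "linear (T y)" "linear (D y)" "T y (D y v) = v" "D y (T y v) = v"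
proof -
  note [simp] = atlasD[OF A]
  have x: "inv_of d y \<in> dom_of d" using ch assms by simp
  show "bundle_inv (atlas M) d (y, z) = (inv_of d y, T y z)"
    unfolding T_def using bundle_chart_inv(2)[OF A d assms] .
  show "linear (T y)" "linear (D y)" unfolding T_def D_def using x d by (intro transition_linear; simp)+
  show "T y (D y v) = v" "D y (T y v) = v" unfolding T_def D_def using x d by (intro transition_inverse; simp)+
qed

lemma F_eq: "y \<in> range_of d \<Longrightarrow> F (y, z) = LL M (inv_of d y, T y z)"
  by (simp add: LL_chart_def tangent_coordinates)

lemma F_homogeneous:
  assumes "y \<in> range_of d" "r > 0" shows "F (y, r *\<^sub>R z) = r\<^sup>2 * F (y, z)"
  using assms lf by (simp add: F_eq linear_scale[OF tangent_coordinates(2)] lorentz_finsler_def lf_function_def)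

lemma F_derivative:
  assumes "y \<in> range_of d" "z \<noteq> 0"
  shows "(F has_derivative frechet_derivative F (at (y, z))) (at (y, z))"
  using smooth_F assms by (intro smooth_on_has_derivative) auto

lemma fibre_has_derivative:
  assumes y: "y \<in> range_of d" and v: "v \<noteq> 0"
  shows "((\<lambda>v'. LL M (inv_of d y, v')) has_derivative (\<lambda>u. frechet_derivative F (at (y, D y v)) (0, D y u))) (at v)"
proof -
  have nz: "D y v \<noteq> 0" using tangent_coordinates(4)[OF y, of v] linear_0[OF tangent_coordinates(2)[OF y]] v by auto
  have eq: "(\<lambda>v'. LL M (inv_of d y, v')) = F \<circ> (\<lambda>v'. (y, D y v'))"
    using y by (auto simp: F_eq tangent_coordinates)
  have "(D y has_derivative D y) (at v)"
    using tangent_coordinates(3)[OF y] by (simp add: linear_conv_bounded_linear bounded_linear_imp_has_derivative)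
  then have "((\<lambda>v'. (y, D y v')) has_derivative (\<lambda>u. (0, D y u))) (at v)" by (intro has_derivative_Pair has_derivative_const)
  then have "(F \<circ> (\<lambda>v'. (y, D y v')) has_derivative (frechet_derivative F (at (y, D y v)) \<circ> (\<lambda>u. (0, D y u)))) (at v)"
    by (rule diff_chain_at) (rule F_derivative[OF y nz])
  then show ?thesis unfolding eq by (simp add: comp_def)
qed

text \<open>If the fibre derivative vanished at \<open>v\<close>, then by its homogeneity of degree 1 it would vanish along the
  ray through \<open>v\<close>, and \<open>v\<close> would lie in the radical of the fibre Hessian. A nondegenerate form has no
  radical: it represents the functional \<open>w \<mapsto> v \<bullet> w\<close>, which gives \<open>v \<bullet> v = 0\<close>.\<close>

lemma fibre_derivative_nonzero:
  assumes y: "y \<in> range_of d" and z: "z \<noteq> 0"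
  shows "\<exists>u. frechet_derivative F (at (y, z)) (0, u) \<noteq> 0"
proof (rule ccontr)
  assume "\<not> ?thesis"
  then have zero: "frechet_derivative F (at (y, z)) (0, u) = 0" for u by blast
  define x where "x = inv_of d y"
  define v where "v = T y z"
  have Dv: "D y v = z" using tangent_coordinates(5)[OF y] by (simp add: v_def)
  have v: "v \<noteq> 0" using Dv linear_0[OF tangent_coordinates(3)[OF y]] z by auto
  define G where "G v' = LL M (x, v')" for v'
  have dG: "(G has_derivative (\<lambda>u. frechet_derivative F (at (y, D y v')) (0, D y u))) (at v')" if "v' \<noteq> 0" for v'
    using fibre_has_derivative[OF y that] unfolding G_def x_def .
  define h where "h v' u = frechet_derivative G (at v') u" for v' u
  have h: "h v' u = frechet_derivative F (at (y, D y v')) (0, D y u)" if "v' \<noteq> 0" for v' u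
    unfolding h_def using frechet_derivative_at[OF dG[OF that]] by metis
  \<comment> \<open>Homogeneity of degree 1 of the derivative, from differentiating G (r v) = r^2 G v.\<close>
  have hr: "h (r *\<^sub>R v) u = 0" if r: "r > 0" for r u
  proof -
    have rv: "r *\<^sub>R v \<noteq> 0" using r v by simp
    have "((\<lambda>v'. r *\<^sub>R v') has_derivative (\<lambda>u. r *\<^sub>R u)) (at v)" by (intro derivative_intros)
    then have "(G \<circ> (\<lambda>v'. r *\<^sub>R v') has_derivative (h (r *\<^sub>R v) \<circ> (\<lambda>u. r *\<^sub>R u))) (at v)"
    proof (rule diff_chain_at)
      show "(G has_derivative h (r *\<^sub>R v)) (at (r *\<^sub>R v))"
        using dG[OF rv] h[OF rv] by (metis (no_types, lifting) ext)
    qed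
    moreover have "G \<circ> (\<lambda>v'. r *\<^sub>R v') = (\<lambda>v'. r\<^sup>2 * G v')"
      using lf r by (auto simp: G_def fun_eq_iff lorentz_finsler_def lf_function_def)
    moreover have "((\<lambda>v'. r\<^sup>2 * G v') has_derivative (\<lambda>u. r\<^sup>2 * h v u)) (at v)"
      using dG[OF v] h[OF v] by (intro has_derivative_mult_right) simp
    ultimately have "h (r *\<^sub>R v) \<circ> (\<lambda>u. r *\<^sub>R u) = (\<lambda>u. r\<^sup>2 * h v u)"
      using has_derivative_unique by metis
    then have "h (r *\<^sub>R v) (r *\<^sub>R (u /\<^sub>R r)) = r\<^sup>2 * h v (u /\<^sub>R r)" by (metis comp_apply)
    moreover have "h v (u /\<^sub>R r) = 0" using h[OF v] zero Dv by simp
    ultimately show ?thesis using r by simp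
  qed
  define g where "g = fibre_hessian (LL M) x v"
  have g: "g u w = frechet_derivative (\<lambda>v'. h v' u) (at v) w" for u w
    unfolding g_def fibre_hessian_def h_def G_def ..
  have dh: "(\<lambda>v'. h v' u) differentiable (at v)" for u
  proof -
    define k where "k p = frechet_derivative F (at p) (0, D y u)" for p
    have k: "k differentiable (at (y, z))" unfolding k_def
      using smooth_on_differentiable[OF smooth_on_derivative[OF smooth_F]] y z by auto
    have "(D y has_derivative D y) (at v)"
      using tangent_coordinates(3)[OF y] by (simp add: linear_conv_bounded_linear bounded_linear_imp_has_derivative)
    then have "((\<lambda>v'. (y, D y v')) has_derivative (\<lambda>u. (0, D y u))) (at v)"
      by (intro has_derivative_Pair has_derivative_const)
    then have "(\<lambda>v'. (y, D y v')) differentiable (at v)"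
      by (rule differentiableI)
    then have "k \<circ> (\<lambda>v'. (y, D y v')) differentiable (at v)" using k Dv by (intro differentiable_chain_at) auto
    then obtain E where E: "(k \<circ> (\<lambda>v'. (y, D y v')) has_derivative E) (at v)" unfolding differentiable_def by blast
    have "((\<lambda>v'. h v' u) has_derivative E) (at v)"
      by (rule has_derivative_transform_within_open[OF E, of "UNIV - {0}"]) (use v h in \<open>auto simp: k_def\<close>)
    then show ?thesis unfolding differentiable_def by blast
  qed
  have glin: "linear (g u)" for u
    using linear_frechet_derivative[OF dh[of u]] unfolding g[abs_def] by (simp add: eta_contract_eq)
  have gl1: "linear (\<lambda>u. g u w)" for w
  proof (rule linearI)
    have hl: "linear (h v')" if "v' \<noteq> 0" for v'
    proof -
      have "h v' = (\<lambda>u. frechet_derivative F (at (y, D y v')) (0, D y u))" using h[OF that] by (rule ext)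
      then show ?thesis using has_derivative_linear[OF dG[OF that]] by simp
    qed
    fix u u' :: 'e and c :: real
    have "((\<lambda>v'. h v' u + h v' u') has_derivative (\<lambda>w. g u w + g u' w)) (at v)"
      unfolding g using dh by (intro has_derivative_add) (simp_all add: frechet_derivative_works[symmetric])
    then have "((\<lambda>v'. h v' (u + u')) has_derivative (\<lambda>w. g u w + g u' w)) (at v)"
      by (rule has_derivative_transform_within_open[where s = "UNIV - {0}"]) (use v linear_add[OF hl] in auto)
    then have "(\<lambda>w. g u w + g u' w) = frechet_derivative (\<lambda>v'. h v' (u + u')) (at v)" by (rule frechet_derivative_at)
    from fun_cong[OF this, of w] show "g (u + u') w = g u w + g u' w" by (simp add: g)
    have "((\<lambda>v'. c *\<^sub>R h v' u) has_derivative (\<lambda>w. c *\<^sub>R g u w)) (at v)"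
      unfolding g using dh by (intro has_derivative_scaleR_right) (simp_all add: frechet_derivative_works[symmetric])
    then have "((\<lambda>v'. h v' (c *\<^sub>R u)) has_derivative (\<lambda>w. c *\<^sub>R g u w)) (at v)"
      by (rule has_derivative_transform_within_open[where s = "UNIV - {0}"]) (use v linear_scale[OF hl] in auto)
    then have "(\<lambda>w. c *\<^sub>R g u w) = frechet_derivative (\<lambda>v'. h v' (c *\<^sub>R u)) (at v)" by (rule frechet_derivative_at)
    from fun_cong[OF this, of w] show "g (c *\<^sub>R u) w = c *\<^sub>R g u w" by (simp add: g)
  qed
  \<comment> \<open>The derivative of h along the ray through v, on which h vanishes.\<close>
  have gv: "g u v = 0" for u
  proof -
    have "((\<lambda>r. r *\<^sub>R v) has_derivative (\<lambda>r. r *\<^sub>R v)) (at 1)" by (intro derivative_eq_intros) auto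
    then have "((\<lambda>v'. h v' u) \<circ> (\<lambda>r. r *\<^sub>R v) has_derivative (g u \<circ> (\<lambda>r. r *\<^sub>R v))) (at (1::real))"
      using dh[of u] unfolding g[abs_def] by (intro diff_chain_at) (simp_all add: frechet_derivative_works[symmetric])
    then have "((\<lambda>r. 0) has_derivative (g u \<circ> (\<lambda>r. r *\<^sub>R v))) (at (1::real))"
      by (rule has_derivative_transform_within_open[where s = "{0<..}"]) (use hr in auto)
    then have "(g u \<circ> (\<lambda>r. r *\<^sub>R v)) = (\<lambda>_. 0)" using has_derivative_const has_derivative_unique by metis
    then have "g u (1 *\<^sub>R v) = 0" by (metis comp_apply)
    then show ?thesis by simp
  qed
  \<comment> \<open>The endomorphism that represents g; it is injective by nondegeneracy, hence onto.\<close>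
  define Q where "Q u = (\<Sum>b\<in>Basis. g u b *\<^sub>R b)" for u
  have Qi: "Q u \<bullet> w = g u w" for u w
  proof -
    have "g u w = g u (\<Sum>b\<in>Basis. (w \<bullet> b) *\<^sub>R b)" by (simp add: euclidean_representation)
    also have "\<dots> = (\<Sum>b\<in>Basis. (w \<bullet> b) * g u b)" by (subst linear_sum[OF glin]) (simp only: linear_scale[OF glin] real_scaleR_def)
    also have "\<dots> = Q u \<bullet> w" by (simp add: Q_def inner_sum_left inner_commute[of w] mult.commute)
    finally show ?thesis by simp
  qed
  have Ql: "linear Q"
    unfolding Q_def using gl1 by (intro linear_compose_sum ballI) (simp add: linear_iff scaleR_left_distrib)
  have nd: "nondegenerate g" using lf v by (simp add: g_def lorentz_finsler_def lf_function_def)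
  have "inj Q"
  proof -
    have "u = 0" if "Q u = 0" for u
      using nd Qi[of u] that unfolding nondegenerate_def by (metis inner_zero_left)
    then show ?thesis using linear_injective_0[OF Ql] by blast
  qed
  then have "surj Q" using linear_injective_imp_surjective[OF Ql] by simp
  then obtain u where "Q u = v" by (metis surjD)
  then have "v \<bullet> v = 0" using Qi[of u v] gv[of u] by simp
  then show False using v by simp
qed

text \<open>Euler's identity: \<open>F\<close> vanishes along the ray through a lightlike vector.\<close>

lemma fibre_derivative_lightlike:
  assumes y: "y \<in> range_of d" and z: "z \<noteq> 0" and F0: "F (y, z) = 0"
  shows "frechet_derivative F (at (y, z)) (0, z) = 0"
proof -
  let ?DF = "frechet_derivative F (at (y, z))"
  have "((\<lambda>r. (y, r *\<^sub>R z)) has_derivative (\<lambda>r. (0, r *\<^sub>R z))) (at (1::real))"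
    by (intro has_derivative_Pair has_derivative_const) (auto intro!: derivative_eq_intros)
  then have "(F \<circ> (\<lambda>r. (y, r *\<^sub>R z)) has_derivative (?DF \<circ> (\<lambda>r. (0, r *\<^sub>R z)))) (at (1::real))"
    using F_derivative[OF y z] by (intro diff_chain_at) auto
  then have "((\<lambda>r. 0) has_derivative (?DF \<circ> (\<lambda>r. (0, r *\<^sub>R z)))) (at (1::real))"
    by (rule has_derivative_transform_within_open[where s = "{0<..}"]) (use F0 F_homogeneous[OF y] in auto)
  then have "(?DF \<circ> (\<lambda>r. (0, r *\<^sub>R z))) = (\<lambda>_. 0)" using has_derivative_const has_derivative_unique by metis
  then have "?DF (0, 1 *\<^sub>R z) = 0" by (metis comp_apply)
  then show ?thesis by simp
qed

lemma cone_chart_complement_open: "open {p. fst p \<in> range_of d \<and> p \<notin> cone_chart M d}"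
proof -
  have "bundle_open (atlas M) (UNIV - cone M)" using lf by (simp add: lorentz_finsler_def causal_structure_def)
  then have "open (bundle_chart (atlas M) d ` ((UNIV - cone M) \<inter> dom_of d \<times> UNIV))" using d by (simp add: bundle_open_def)
  moreover have "bundle_chart (atlas M) d ` ((UNIV - cone M) \<inter> dom_of d \<times> UNIV) = {p. fst p \<in> range_of d \<and> p \<notin> cone_chart M d}"
  proof (intro equalityI subsetI)
    fix p assume "p \<in> {p. fst p \<in> range_of d \<and> p \<notin> cone_chart M d}"
    then have p: "fst p \<in> range_of d" "bundle_inv (atlas M) d p \<notin> cone M" by (auto simp: cone_chart_def)
    have "p = bundle_chart (atlas M) d (bundle_inv (atlas M) d p)"
      using bundle_chart_inv(3)[OF A d p(1), of "snd p"] by simp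
    moreover have "bundle_inv (atlas M) d p \<in> (UNIV - cone M) \<inter> dom_of d \<times> UNIV"
      using p tangent_coordinates(1)[OF p(1), of "snd p"] ch by simp
    ultimately show "p \<in> bundle_chart (atlas M) d ` ((UNIV - cone M) \<inter> dom_of d \<times> UNIV)" by (rule image_eqI)
  next
    fix p assume "p \<in> bundle_chart (atlas M) d ` ((UNIV - cone M) \<inter> dom_of d \<times> UNIV)"
    then obtain x v where xv: "(x, v) \<notin> cone M" "x \<in> dom_of d" "p = bundle_chart (atlas M) d (x, v)" by auto
    then show "p \<in> {p. fst p \<in> range_of d \<and> p \<notin> cone_chart M d}"
      using bundle_chart_inv(1)[OF A d xv(2), of v] ch by (auto simp: cone_chart_def bundle_chart_def)
  qed
  ultimately show ?thesis by simp
qed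

text \<open>The set where \<open>F\<close> is positive may have several components in each fibre, but near a lightlike vector
  \<open>z0\<close> of the cone only the chosen one is present. Indeed there is a direction \<open>u\<close> along which \<open>F\<close>
  increases strictly near \<open>(y0, z0)\<close>, and after a shift by \<open>l0 u\<close> all nearby vectors are positive. A
  positive vector is joined with any shifted vector of its fibre by a path of positive vectors: first
  up along \<open>u\<close>, then across. So all positive vectors over points near \<open>y0\<close> belong to the component of
  the shifted \<open>z0\<close>, and this is the chosen one, because it is so over \<open>y0\<close> and the chosen components
  form an open set.\<close>

lemma cone_locally_positive:
  assumes y0: "y0 \<in> range_of d" and z0: "z0 \<noteq> 0" and c0: "(y0, z0) \<in> cone_chart M d" and F0: "F (y0, z0) = 0"
  obtains \<epsilon> where "\<epsilon> > 0" "ball (y0, z0) \<epsilon> \<subseteq> slit_bundle d" "\<And>p. p \<in> ball (y0, z0) \<epsilon> \<Longrightarrow> F p > 0 \<Longrightarrow> p \<in> cone_chart M d"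
proof -
  obtain K :: "'m \<Rightarrow> 'e set" where K: "\<And>x. K x \<in> components {v. LL M (x, v) > 0}"
      "\<And>x. {v. (x, v) \<in> cone M} = closure (K x)" and Ko: "bundle_open (atlas M) (SIGMA x:UNIV. K x)"
    using lf unfolding lorentz_finsler_def causal_structure_def by blast
  define KK where "KK = {p. fst p \<in> range_of d \<and> T (fst p) (snd p) \<in> K (inv_of d (fst p))}"
  have KKo: "open KK"
  proof -
    have "open (bundle_chart (atlas M) d ` ((SIGMA x:UNIV. K x) \<inter> dom_of d \<times> UNIV))" using Ko d by (simp add: bundle_open_def)
    moreover have "bundle_chart (atlas M) d ` ((SIGMA x:UNIV. K x) \<inter> dom_of d \<times> UNIV) = KK"
    proof (intro equalityI subsetI)
      fix p assume "p \<in> KK"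
      then have p: "fst p \<in> range_of d" "T (fst p) (snd p) \<in> K (inv_of d (fst p))" by (auto simp: KK_def)
      have "p = bundle_chart (atlas M) d (bundle_inv (atlas M) d p)"
        using bundle_chart_inv(3)[OF A d p(1), of "snd p"] by simp
      moreover have "bundle_inv (atlas M) d p \<in> (SIGMA x:UNIV. K x) \<inter> dom_of d \<times> UNIV"
        using p tangent_coordinates(1)[OF p(1), of "snd p"] ch by simp
      ultimately show "p \<in> bundle_chart (atlas M) d ` ((SIGMA x:UNIV. K x) \<inter> dom_of d \<times> UNIV)" by (rule image_eqI)
    next
      fix p assume "p \<in> bundle_chart (atlas M) d ` ((SIGMA x:UNIV. K x) \<inter> dom_of d \<times> UNIV)"
      then obtain x v where xv: "v \<in> K x" "x \<in> dom_of d" "p = bundle_chart (atlas M) d (x, v)" by auto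
      have 1: "fst p = map_of_chart d x" "fst p \<in> range_of d" using xv ch by (auto simp: bundle_chart_def)
      have "bundle_inv (atlas M) d p = (x, v)" using bundle_chart_inv(1)[OF A d xv(2)] xv(3) by simp
      then show "p \<in> KK" using tangent_coordinates(1)[OF 1(2), of "snd p"] xv(1) 1(2) by (simp add: KK_def)
    qed
    ultimately show ?thesis by simp
  qed
  have KKc: "p \<in> cone_chart M d" if "p \<in> KK" for p
    using that K(2)[of "inv_of d (fst p)"] closure_subset[of "K (inv_of d (fst p))"] tangent_coordinates(1)[of "fst p" "snd p"]
    by (auto simp: KK_def cone_chart_def)
  \<comment> \<open>A connected set of positive vectors that meets the chosen component lies in it.\<close>
  have conn: "(y, b) \<in> KK" if "(y, a) \<in> KK" "connected C" "a \<in> C" "b \<in> C" "\<And>c. c \<in> C \<Longrightarrow> F (y, c) > 0" for y a b C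
  proof -
    have y: "y \<in> range_of d" "T y a \<in> K (inv_of d y)" using that(1) by (auto simp: KK_def)
    have "connected (T y ` C)"
      using tangent_coordinates(2)[OF y(1)] that(2) by (intro connected_continuous_image linear_continuous_on) (simp_all add: linear_conv_bounded_linear)
    moreover have "T y ` C \<subseteq> {v. LL M (inv_of d y, v) > 0}" using that(5) F_eq[OF y(1)] by auto
    ultimately have "T y ` C \<subseteq> K (inv_of d y)"
      using components_maximal[OF K(1)] y(2) that(3) by (metis disjoint_iff imageI)
    then show ?thesis using that(4) y(1) by (auto simp: KK_def)
  qed
  let ?p0 = "(y0, z0)" and ?DF = "frechet_derivative F (at (y0, z0))"
  have p0: "?p0 \<in> slit_bundle d" using y0 z0 by simp
  have linDF: "linear ?DF" using F_derivative[OF y0 z0] has_derivative_linear by blast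
  obtain u where u: "?DF (0, u) = 1"
  proof -
    obtain u where u: "?DF (0, u) \<noteq> 0" using fibre_derivative_nonzero[OF y0 z0] by blast
    define c where "c = 1 / ?DF (0, u)"
    have "?DF (c *\<^sub>R (0, u)) = c *\<^sub>R ?DF (0, u)" by (rule linear_scale[OF linDF])
    moreover have "c *\<^sub>R ((0::'e), u) = (0, c *\<^sub>R u)" by simp
    ultimately have "?DF (0, c *\<^sub>R u) = 1" using u by (simp add: c_def)
    then show thesis by (rule that)
  qed
  define \<eta> where "\<eta> = 1 / (2 * (norm u + 1))"
  have eta: "\<eta> > 0" "\<eta> * norm u \<le> 1/2" by (auto simp: \<eta>_def field_simps add_pos_nonneg)
  obtain r where r: "r > 0" "ball ?p0 r \<subseteq> slit_bundle d"
    "\<And>p q. p \<in> ball ?p0 r \<Longrightarrow> q \<in> ball ?p0 r \<Longrightarrow> norm (F q - F p - ?DF (q - p)) \<le> \<eta> * norm (q - p)"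
    using smooth_on_strictly_differentiable[OF open_slit smooth_F p0 eta(1)] by metis
  \<comment> \<open>F grows at rate at least 1/2 along u, the derivative in this direction being 1 at the centre.\<close>
  have incr: "F (y, z + l *\<^sub>R u) \<ge> F (y, z) + l / 2" if "(y, z) \<in> ball ?p0 r" "(y, z + l *\<^sub>R u) \<in> ball ?p0 r" "l \<ge> 0" for y z l
  proof -
    have "norm (F (y, z + l *\<^sub>R u) - F (y, z) - ?DF ((y, z + l *\<^sub>R u) - (y, z))) \<le> \<eta> * norm ((y, z + l *\<^sub>R u) - (y, z))"
      by (rule r(3)[OF that(1,2)])
    moreover have "(y, z + l *\<^sub>R u) - (y, z) = l *\<^sub>R (0, u)" by simp
    moreover have "?DF (l *\<^sub>R (0, u)) = l" using linear_scale[OF linDF, of l "(0, u)"] u by simp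
    moreover have "norm (l *\<^sub>R ((0::'e), u)) = l * norm u" using that(3) by (simp add: norm_Pair)
    ultimately have "\<bar>F (y, z + l *\<^sub>R u) - F (y, z) - l\<bar> \<le> \<eta> * (l * norm u)" by (simp only: real_norm_def)
    also have "\<dots> \<le> l / 2" using mult_left_mono[OF eta(2) that(3)] by (simp add: mult_ac)
    finally show ?thesis by linarith
  qed
  define l0 where "l0 = r / (4 * (norm u + 1))"
  have l0: "l0 > 0" "l0 * norm u \<le> r / 4" using r(1) by (auto simp: l0_def field_simps add_pos_nonneg)
  have "isCont F ?p0" using F_derivative[OF y0 z0] has_derivative_continuous by blast
  then obtain e1 where e1: "e1 > 0" "\<And>p. dist p ?p0 < e1 \<Longrightarrow> dist (F p) (F ?p0) < l0 / 2"
    using l0(1) unfolding continuous_at_eps_delta by (metis half_gt_zero)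
  define e where "e = min e1 (r/2)"
  have e: "e > 0" "e \<le> r/2" "e \<le> e1" using e1(1) r(1) by (auto simp: e_def)
  have shift: "(y, z + l *\<^sub>R u) \<in> ball ?p0 r" if "(y, z) \<in> ball ?p0 e" "0 \<le> l" "l \<le> l0" for y z l
  proof -
    have "dist ?p0 (y, z + l *\<^sub>R u) \<le> dist ?p0 (y, z) + dist (y, z) (y, z + l *\<^sub>R u)" by (rule dist_triangle)
    also have "dist (y, z) (y, z + l *\<^sub>R u) = l * norm u" using that(2) by (simp add: dist_Pair_Pair dist_norm)
    also have "\<dots> \<le> l0 * norm u" using that by (intro mult_right_mono) auto
    also have "dist ?p0 (y, z) + l0 * norm u < r" using that(1) e(2) l0(2) r(1) by simp
    finally show ?thesis by simp
  qed
  have pos: "F (y, z + l0 *\<^sub>R u) > 0" if "(y, z) \<in> ball ?p0 e" for y z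
  proof -
    have "dist (F (y, z)) (F ?p0) < l0 / 2" using e1(2)[of "(y, z)"] that e(3) by (simp add: dist_commute)
    then have "F (y, z) > - (l0 / 2)" using F0 by (simp add: dist_real_def)
    moreover have "(y, z) \<in> ball ?p0 r" using that e(2) r(1) by simp
    ultimately show ?thesis using incr[OF _ shift[OF that, of l0], of ] l0(1) by fastforce
  qed
  \<comment> \<open>Up along u, then across at height l0.\<close>
  define C where "C z z' = closed_segment z (z + l0 *\<^sub>R u) \<union> closed_segment (z + l0 *\<^sub>R u) (z' + l0 *\<^sub>R u)" for z z'
  have Cc: "connected (C z z')" for z z'
    unfolding C_def by (intro connected_Un connected_segment) auto
  have Cp: "F (y, c) > 0" if zz: "(y, z) \<in> ball ?p0 e" "(y, z') \<in> ball ?p0 e" "F (y, z) > 0" and c: "c \<in> C z z'" for y z z' c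
  proof -
    from c consider "c \<in> closed_segment z (z + l0 *\<^sub>R u)" | "c \<in> closed_segment (z + l0 *\<^sub>R u) (z' + l0 *\<^sub>R u)"
      by (auto simp: C_def)
    then show ?thesis
    proof cases
      case 1
      then obtain t where t: "0 \<le> t" "t \<le> 1" "c = (1 - t) *\<^sub>R z + t *\<^sub>R (z + l0 *\<^sub>R u)" by (auto simp: in_segment)
      have c: "c = z + (t * l0) *\<^sub>R u" unfolding t(3) by (simp add: algebra_simps)
      have tl: "0 \<le> t * l0" "t * l0 \<le> l0" using t l0 by (auto simp: mult_left_le_one_le)
      have "(y, z) \<in> ball ?p0 r" using zz(1) e(2) r(1) by simp
      from incr[OF this shift[OF zz(1) tl] tl(1)] show ?thesis using zz(3) tl(1) c by simp
    next
      case 2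
      then obtain t where t: "0 \<le> t" "t \<le> 1" "c = (1 - t) *\<^sub>R (z + l0 *\<^sub>R u) + t *\<^sub>R (z' + l0 *\<^sub>R u)" by (auto simp: in_segment)
      define z'' where "z'' = (1 - t) *\<^sub>R z + t *\<^sub>R z'"
      have c: "c = z'' + l0 *\<^sub>R u" unfolding t(3) z''_def by (simp add: algebra_simps)
      have "(y, z'') = (1 - t) *\<^sub>R (y, z) + t *\<^sub>R (y, z')" by (simp add: z''_def algebra_simps)
      then have "(y, z'') \<in> ball ?p0 e" using convexD_alt[OF convex_ball zz(1,2) t(1,2)] by simp
      from pos[OF this] show ?thesis by (simp add: c)
    qed
  qed
  have end1: "z \<in> C z z'" "z' + l0 *\<^sub>R u \<in> C z z'" for z z' by (auto simp: C_def)
  \<comment> \<open>The vector z0 itself is only in the closure of the component; a nearby member z1 is joined to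
      z0 + l0 u.\<close>
  have lift: "(y0, z0 + l0 *\<^sub>R u) \<in> KK"
  proof -
    have "T y0 z0 \<in> closure (K (inv_of d y0))"
      using c0 K(2)[of "inv_of d y0"] tangent_coordinates(1)[OF y0] by (auto simp: cone_chart_def)
    have "isCont (D y0) (T y0 z0)" using tangent_coordinates(3)[OF y0] by (simp add: linear_conv_bounded_linear linear_continuous_at)
    then obtain s where s: "s > 0" "\<And>v. dist v (T y0 z0) < s \<Longrightarrow> dist (D y0 v) (D y0 (T y0 z0)) < e"
      using e(1) unfolding continuous_at_eps_delta by metis
    obtain v where v: "v \<in> K (inv_of d y0)" "dist v (T y0 z0) < s"
      using \<open>T y0 z0 \<in> closure _\<close> s(1) by (meson closure_approachable)
    define z1 where "z1 = D y0 v"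
    have "dist z0 z1 < e" using s(2)[OF v(2)] tangent_coordinates(5)[OF y0] by (simp add: z1_def dist_commute)
    then have b1: "(y0, z1) \<in> ball ?p0 e" by (simp add: dist_Pair_Pair)
    have k1: "(y0, z1) \<in> KK" using v(1) tangent_coordinates(4)[OF y0] y0 by (simp add: KK_def z1_def)
    have "v \<in> {v. LL M (inv_of d y0, v) > 0}" using v(1) in_components_subset[OF K(1)] by blast
    then have F1: "F (y0, z1) > 0" using F_eq[OF y0] tangent_coordinates(4)[OF y0] by (simp add: z1_def)
    have b0: "?p0 \<in> ball ?p0 e" using e(1) by simp
    show ?thesis by (rule conn[OF k1 Cc end1(1) end1(2)]) (rule Cp[OF b1 b0 F1])
  qed
  then obtain e2 where e2: "e2 > 0" "ball (y0, z0 + l0 *\<^sub>R u) e2 \<subseteq> KK" using KKo open_contains_ball by blast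
  show ?thesis
  proof (rule that[of "min e e2"])
    show "min e e2 > 0" using e e2 by simp
    have "ball ?p0 (min e e2) \<subseteq> ball ?p0 r" using e r(1) by (intro subset_ball) auto
    then show "ball ?p0 (min e e2) \<subseteq> slit_bundle d" using r(2) by blast
    fix p assume p: "p \<in> ball ?p0 (min e e2)" "F p > 0"
    obtain y z where yz: "p = (y, z)" by (cases p)
    have "dist y0 y \<le> dist ?p0 p" unfolding yz by (simp add: dist_Pair_Pair)
    then have yd: "dist y0 y < e" "dist y0 y < e2" using p(1) by auto
    have b: "(y, z) \<in> ball ?p0 e" "(y, z0) \<in> ball ?p0 e" using p(1) yd by (auto simp: yz dist_Pair_Pair)
    have "(y, z0 + l0 *\<^sub>R u) \<in> KK" using e2(2) yd(2) by (auto simp: dist_Pair_Pair subset_iff)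
    then have "(y, z) \<in> KK"
      by (rule conn[OF _ Cc end1(2) end1(1)]) (use Cp[OF b] p(2) yz in blast)
    then show "p \<in> cone_chart M d" using KKc yz by simp
  qed
qed

end

section \<open>Varying a lightlike curve\<close>

lemma AC_on_cong:
  assumes "AC_on a b f" "\<And>t. a \<le> t \<Longrightarrow> t \<le> b \<Longrightarrow> F t = f t"
  shows "AC_on a b F"
  by (rule AC_on_dominated[OF assms(1), of _ 1 0]) (use assms(2) in auto)

lemma AC_on_chart_change:
  assumes A: "smooth_atlas A" and c: "c \<in> A" and d: "d \<in> A"
    and G: "AC_on a b G" "continuous_on {a..b} G" "a \<le> b"
    and sub: "G ` {a..b} \<subseteq> map_of_chart d ` (dom_of d \<inter> dom_of c)"
  shows "AC_on a b (\<lambda>t. map_of_chart c (inv_of d (G t)) :: 'e::euclidean_space)"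
proof (rule AC_on_local[OF G(3)])
  fix x assume x: "a \<le> x" "x \<le> b"
  let ?W = "map_of_chart d ` (dom_of d \<inter> dom_of c)"
  have W: "open ?W" using chart_image_open[OF atlasD(1)[OF A d] chart_open(1)[OF atlasD(1)[OF A c]]] .
  have sm: "smooth_on ?W (map_of_chart c \<circ> inv_of d)"
    using atlasD(2)[OF A d c] by (simp add: smoothly_related_def)
  have Gx: "G x \<in> ?W" using sub x by auto
  obtain r L where rL: "r > 0" "L \<ge> 0" "\<And>p q. p \<in> ball (G x) r \<Longrightarrow> q \<in> ball (G x) r \<Longrightarrow>
     norm ((map_of_chart c \<circ> inv_of d) q - (map_of_chart c \<circ> inv_of d) p) \<le> L * norm (q - p)"
    using smooth_on_locally_lipschitz[OF W sm Gx] by metis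
  obtain e where e: "e > 0" "\<And>t. t \<in> {a..b} \<Longrightarrow> dist t x < e \<Longrightarrow> dist (G t) (G x) < r"
    using G(2) x rL(1) unfolding continuous_on_iff by (metis atLeastAtMost_iff)
  show "\<exists>e>0. \<forall>s t. a \<le> s \<and> s \<le> x \<and> x \<le> t \<and> t \<le> b \<and> t - s < e \<longrightarrow> AC_on s t (\<lambda>t. map_of_chart c (inv_of d (G t)))"
  proof (intro exI[of _ e] conjI e(1) allI impI)
    fix s t assume st: "a \<le> s \<and> s \<le> x \<and> x \<le> t \<and> t \<le> b \<and> t - s < e"
    have near: "G p \<in> ball (G x) r" if "s \<le> p" "p \<le> t" for p
      using e(2)[of p] st that by (auto simp: dist_real_def dist_commute)
    show "AC_on s t (\<lambda>t. map_of_chart c (inv_of d (G t)))"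
    proof (rule AC_on_dominated[OF AC_on_subinterval[OF G(1)], of s t _ L 0])
      fix p q assume pq: "s \<le> p" "p \<le> q" "q \<le> t"
      show "norm (map_of_chart c (inv_of d (G q)) - map_of_chart c (inv_of d (G p))) \<le> L * norm (G q - G p) + 0 * (q - p)"
        using rL(3)[OF near[of p] near[of q]] pq by simp
    qed (use st rL in auto)
  qed
qed

context lf_chart begin

text \<open>An initial piece of a curve can be replaced by any absolutely continuous curve in the chart with the
  same end. Absolute continuity has to be checked in all charts, on intervals that may contain the
  junction.\<close>

lemma AC_curve_surgery:
  assumes \<gamma>: "AC_curve (atlas M) 0 1 \<gamma>" and s: "0 < s" "s < 1"
    and G: "AC_on 0 s G" "continuous_on {0..s} G" "G ` {0..s} \<subseteq> range_of d" "inv_of d (G s) = \<gamma> s"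
  shows "AC_curve (atlas M) 0 1 (\<lambda>t. if t \<le> s then inv_of d (G t) else \<gamma> t)" (is "AC_curve _ _ _ ?\<sigma>")
proof -
  have c\<gamma>: "continuous_on {0..1} \<gamma>" using \<gamma> by (simp add: AC_curve_def)
  have "continuous_on {0..s} (\<lambda>t. inv_of d (G t))"
    by (rule continuous_on_compose2[OF chart_continuous(2)[OF ch] G(2,3)])
  moreover have "continuous_on {s..1} \<gamma>" by (rule continuous_on_subset[OF c\<gamma>]) (use s in auto)
  ultimately have "continuous_on ({0..s} \<union> {s..1}) ?\<sigma>"
    by (rule continuous_on_cases[rotated 2]) (use s G(4) in auto)
  moreover have "{0..s} \<union> {s..1} = {0..1}" using s by auto
  ultimately have cont: "continuous_on {0..1} ?\<sigma>" by simp
  show ?thesis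
    unfolding AC_curve_def
  proof (intro conjI ballI allI impI cont)
    fix c p q assume c: "c \<in> atlas M" and pq: "0 \<le> p \<and> p \<le> q \<and> q \<le> 1 \<and> ?\<sigma> ` {p..q} \<subseteq> dom_of c"
    have left: "AC_on p' q' (map_of_chart c \<circ> ?\<sigma>)" if q': "p \<le> p'" "p' \<le> q'" "q' \<le> q" "q' \<le> s" for p' q'
    proof (rule AC_on_cong)
      show "AC_on p' q' (\<lambda>t. map_of_chart c (inv_of d (G t)))"
      proof (rule AC_on_chart_change[OF A c d])
        show "AC_on p' q' G" using G(1) q' pq by (auto intro: AC_on_subinterval)
        show "continuous_on {p'..q'} G" using G(2) by (rule continuous_on_subset) (use q' pq in auto)
        show "p' \<le> q'" by fact
        show "G ` {p'..q'} \<subseteq> map_of_chart d ` (dom_of d \<inter> dom_of c)"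
        proof
          fix y assume "y \<in> G ` {p'..q'}"
          then obtain t where t: "y = G t" "p' \<le> t" "t \<le> q'" by auto
          have y: "y \<in> range_of d" using G(3) t q' pq by auto
          have "?\<sigma> t \<in> dom_of c" using pq q' t by auto
          then have "inv_of d y \<in> dom_of d \<inter> dom_of c" using y t q' ch by auto
          moreover have "y = map_of_chart d (inv_of d y)" using y ch by simp
          ultimately show "y \<in> map_of_chart d ` (dom_of d \<inter> dom_of c)" by (metis image_eqI)
        qed
      qed
    qed (use q' in auto)
    have right: "AC_on p' q' (map_of_chart c \<circ> ?\<sigma>)" if q': "p \<le> p'" "p' \<le> q'" "q' \<le> q" "s \<le> p'" for p' q'
    proof (rule AC_on_cong)
      have eq: "?\<sigma> t = \<gamma> t" if "p' \<le> t" for t using q' that G(4) by (cases "t = s") auto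
      have "\<gamma> ` {p'..q'} \<subseteq> dom_of c"
      proof
        fix x assume "x \<in> \<gamma> ` {p'..q'}"
        then obtain t where t: "x = \<gamma> t" "p' \<le> t" "t \<le> q'" by auto
        then have "?\<sigma> t \<in> dom_of c" using pq q' by auto
        then show "x \<in> dom_of c" using eq t by simp
      qed
      then show "AC_on p' q' (map_of_chart c \<circ> \<gamma>)" using \<gamma> c q' pq unfolding AC_curve_def by auto
      show "(map_of_chart c \<circ> ?\<sigma>) t = (map_of_chart c \<circ> \<gamma>) t" if "p' \<le> t" for t using eq[OF that] by simp
    qed
    consider "q \<le> s" | "s \<le> p" | "p \<le> s" "s \<le> q" by linarith
    then show "AC_on p q (map_of_chart c \<circ> ?\<sigma>)"
    proof cases
      case 3
      show ?thesis by (rule AC_on_combine[OF left right]) (use 3 pq in auto)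
    qed (use left right pq in auto)
  qed simp
qed

text \<open>First-order Taylor expansion at lightlike vectors, uniformly on a compact set of them. The value of
  \<open>F\<close> becomes positive of order \<open>\<delta>\<close>, which by \<open>cone_locally_positive\<close> also keeps the vector in the cone.\<close>

lemma first_variation:
  assumes Z: "compact Z" "Z \<subseteq> slit_bundle d" "Z \<subseteq> cone_chart M d" "\<And>p. p \<in> Z \<Longrightarrow> F p = 0" and \<kappa>: "\<kappa> > 0"
  obtains \<delta>\<^sub>0 where "\<delta>\<^sub>0 > 0" "\<And>p w \<delta>. p \<in> Z \<Longrightarrow> norm w \<le> b \<Longrightarrow> frechet_derivative F (at p) w \<ge> \<kappa> \<Longrightarrow> 0 < \<delta> \<Longrightarrow> \<delta> \<le> \<delta>\<^sub>0 \<Longrightarrow>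
     F (p + \<delta> *\<^sub>R w) \<ge> \<delta> * \<kappa> / 2 \<and> p + \<delta> *\<^sub>R w \<in> cone_chart M d"
proof -
  define b' where "b' = \<bar>b\<bar> + 1"
  define \<eta> where "\<eta> = \<kappa> / (2 * b')"
  have eta: "\<eta> > 0" "\<eta> * b' = \<kappa> / 2" "b' > 0" using \<kappa> by (auto simp: \<eta>_def b'_def field_simps)
  obtain r1 where r1: "r1 > 0" "\<And>p v. p \<in> Z \<Longrightarrow> norm v < r1 \<Longrightarrow> norm (F (p + v) - F p - frechet_derivative F (at p) v) \<le> \<eta> * norm v"
    using smooth_on_uniformly_differentiable[OF open_slit smooth_F Z(1,2) eta(1)] by metis
  have "\<exists>\<epsilon>>0. \<forall>q\<in>ball p \<epsilon>. F q > 0 \<longrightarrow> q \<in> cone_chart M d" if "p \<in> Z" for p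
  proof -
    obtain y z where p: "p = (y, z)" by (cases p)
    have "y \<in> range_of d" "z \<noteq> 0" using Z(2) that p by auto
    moreover have "(y, z) \<in> cone_chart M d" "F (y, z) = 0" using Z(3,4) that p by auto
    ultimately show ?thesis unfolding p by (rule cone_locally_positive) blast
  qed
  then obtain \<epsilon> where \<epsilon>: "\<And>p. p \<in> Z \<Longrightarrow> \<epsilon> p > 0" "\<And>p q. p \<in> Z \<Longrightarrow> q \<in> ball p (\<epsilon> p) \<Longrightarrow> F q > 0 \<Longrightarrow> q \<in> cone_chart M d" by metis
  obtain r2 where r2: "r2 > 0" "\<And>p. p \<in> Z \<Longrightarrow> \<exists>G\<in>(\<lambda>p. ball p (\<epsilon> p)) ` Z. ball p r2 \<subseteq> G"
  proof (rule Heine_Borel_lemma[OF Z(1)])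
    have "p \<in> ball p (\<epsilon> p)" if "p \<in> Z" for p using \<epsilon>(1)[OF that] by simp
    then show "Z \<subseteq> \<Union> ((\<lambda>p. ball p (\<epsilon> p)) ` Z)" by blast
    show "open G" if "G \<in> (\<lambda>p. ball p (\<epsilon> p)) ` Z" for G using that by auto
  qed (use that in blast)
  show ?thesis
  proof (rule that[of "min r1 r2 / (2 * b')"])
    show "min r1 r2 / (2 * b') > 0" using r1 r2 eta by simp
    fix p w \<delta> assume p: "p \<in> Z" "norm w \<le> b" "frechet_derivative F (at p) w \<ge> \<kappa>" "0 < \<delta>" "\<delta> \<le> min r1 r2 / (2 * b')"
    have wb: "norm w \<le> b'" using p(2) by (simp add: b'_def)
    have "norm (\<delta> *\<^sub>R w) \<le> \<delta> * b'" using p(4) wb by simp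
    also have "\<dots> \<le> min r1 r2 / 2" using p(5) eta(3) by (simp add: field_simps)
    finally have small: "norm (\<delta> *\<^sub>R w) < r1" "norm (\<delta> *\<^sub>R w) < r2" using r1(1) r2(1) by auto
    have lin: "linear (frechet_derivative F (at p))"
      by (intro linear_frechet_derivative smooth_on_differentiable[OF smooth_F] subsetD[OF Z(2)] p(1))
    have "norm (F (p + \<delta> *\<^sub>R w) - F p - frechet_derivative F (at p) (\<delta> *\<^sub>R w)) \<le> \<eta> * norm (\<delta> *\<^sub>R w)"
      using r1(2)[OF p(1) small(1)] .
    then have "\<bar>F (p + \<delta> *\<^sub>R w) - \<delta> * frechet_derivative F (at p) w\<bar> \<le> \<eta> * (\<delta> * norm w)"
      using Z(4)[OF p(1)] p(4) linear_scale[OF lin] by simp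
    also have "\<dots> \<le> \<eta> * (\<delta> * b')" using wb eta p(4) by (intro mult_left_mono) auto
    also have "\<dots> = \<delta> * \<kappa> / 2" using eta(2) by (simp add: mult_ac)
    finally have "F (p + \<delta> *\<^sub>R w) \<ge> \<delta> * frechet_derivative F (at p) w - \<delta> * \<kappa> / 2" by linarith
    moreover have "\<delta> * frechet_derivative F (at p) w \<ge> \<delta> * \<kappa>" using p by simp
    ultimately have Fp: "F (p + \<delta> *\<^sub>R w) \<ge> \<delta> * \<kappa> / 2" by simp
    then have pos: "F (p + \<delta> *\<^sub>R w) > 0" using p(4) \<kappa> by (smt (verit) divide_pos_pos mult_pos_pos)
    obtain p1 where p1: "p1 \<in> Z" "ball p r2 \<subseteq> ball p1 (\<epsilon> p1)" using r2(2)[OF p(1)] by blast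
    have "p + \<delta> *\<^sub>R w \<in> ball p r2" using small(2) by (simp add: dist_norm)
    then have "p + \<delta> *\<^sub>R w \<in> cone_chart M d" using \<epsilon>(2)[OF p1(1) _ pos] p1(2) by blast
    then show "F (p + \<delta> *\<^sub>R w) \<ge> \<delta> * \<kappa> / 2 \<and> p + \<delta> *\<^sub>R w \<in> cone_chart M d" using Fp by blast
  qed
qed

lemma LL_velocity:
  assumes t: "\<gamma> t \<in> dom_of d" "isCont \<gamma> t" and w: "((map_of_chart d \<circ> \<gamma>) has_vector_derivative w) (at t)"
  shows "LL M (\<gamma> t, velocity (atlas M) \<gamma> t) = F (map_of_chart d (\<gamma> t), w)"
    "(\<gamma> t, velocity (atlas M) \<gamma> t) \<in> cone M \<longleftrightarrow> (map_of_chart d (\<gamma> t), w) \<in> cone_chart M d"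
  using velocity_in_chart(2)[OF A d t w] t(1) ch by (auto simp: LL_chart_def cone_chart_def)

text \<open>The positive part of the Lagrangian vanishes almost everywhere, and its negative part is at least \<open>m\<close>
  on an interval of length \<open>s\<close>.\<close>

lemma action_upper_bound:
  assumes s: "0 < s" "s \<le> 1" and m: "m \<ge> 0"
    and AE: "AE t in lebesgue_on {0..1}. Lag M (\<sigma> t) (velocity (atlas M) \<sigma> t) \<le> (if t < s then ereal (- m) else 0)"
  shows "action M 0 1 \<sigma> \<le> ereal (- (s * m))"
proof -
  let ?L = "\<lambda>t. Lag M (\<sigma> t) (velocity (atlas M) \<sigma> t)"
  have "(\<integral>\<^sup>+t. e2ennreal (?L t) \<partial>lebesgue_on {0..1}) = (\<integral>\<^sup>+t. 0 \<partial>lebesgue_on {0..1::real})"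
  proof (rule nn_integral_cong_AE)
    show "AE t in lebesgue_on {0..1}. e2ennreal (?L t) = 0"
      using AE
    proof eventually_elim
      case (elim t)
      then have "?L t \<le> 0" using m by (auto split: if_splits intro: order_trans)
      then show ?case by (simp add: e2ennreal_neg)
    qed
  qed
  then have 1: "(\<integral>\<^sup>+t. e2ennreal (?L t) \<partial>lebesgue_on {0..1}) = 0" by simp
  have "ennreal (s * m) = (\<integral>\<^sup>+t. ennreal m * indicator {0..<s} t \<partial>lebesgue_on {0..1})"
  proof -
    have S: "{0..<s} \<in> sets (lebesgue_on {0..1})" using s by (auto simp: sets_restrict_space)
    have "emeasure (lebesgue_on {0..1}) {0..<s} = ennreal s"
      using s by (subst emeasure_restrict_space) (auto simp: emeasure_lborel_Ico)
    then show ?thesis using S m s by (simp add: nn_integral_cmult_indicator ennreal_mult mult.commute)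
  qed
  also have "\<dots> \<le> (\<integral>\<^sup>+t. e2ennreal (- ?L t) \<partial>lebesgue_on {0..1})"
  proof (rule nn_integral_mono_AE)
    show "AE t in lebesgue_on {0..1}. ennreal m * indicator {0..<s} t \<le> e2ennreal (- ?L t)"
      using AE
    proof eventually_elim
      case (elim t)
      show ?case
      proof (cases "t \<in> {0..<s}")
        case True
        then have "- ereal (- m) \<le> - ?L t" using elim unfolding ereal_minus_le_minus by simp
        then have "ereal m \<le> - ?L t" by simp
        then have "e2ennreal (ereal m) \<le> e2ennreal (- ?L t)" by (rule e2ennreal_mono)
        then show ?thesis using True by (simp add: ennreal.abs_eq e2ennreal_ereal)
      qed simp
    qed
  qed
  finally have "ennreal (s * m) \<le> (\<integral>\<^sup>+t. e2ennreal (- ?L t) \<partial>lebesgue_on {0..1})" .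
  then have "enn2ereal (ennreal (s * m)) \<le> enn2ereal (\<integral>\<^sup>+t. e2ennreal (- ?L t) \<partial>lebesgue_on {0..1})"
    by (simp add: less_eq_ennreal.rep_eq)
  then have "ereal (s * m) \<le> enn2ereal (\<integral>\<^sup>+t. e2ennreal (- ?L t) \<partial>lebesgue_on {0..1})"
    using s m by (simp add: enn2ereal_ennreal)
  then have "- enn2ereal (\<integral>\<^sup>+t. e2ennreal (- ?L t) \<partial>lebesgue_on {0..1}) \<le> - ereal (s * m)"
    by (simp only: ereal_minus_le_minus)
  then show ?thesis
    unfolding action_def ereal_integral_def 1 by (simp add: zero_ennreal.rep_eq)
qed

text \<open>The lightlike curve \<open>\<gamma>\<close> is replaced on \<open>[0, s]\<close> by \<open>\<gamma> + \<delta> \<phi>\<close>, where \<open>\<phi>\<close> has derivative \<open>u\<close> and vanishes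
  at \<open>s\<close>. If the first variation is at least \<open>\<kappa>\<close>, then \<open>F\<close> is at least \<open>\<delta> \<kappa> / 2\<close> on the new piece, so
  its action is at most \<open>- s \<surd>(\<delta> \<kappa> / 2)\<close>, and the rest has action 0. The bound on \<open>\<delta>\<close> depends only on a
  common bound of \<open>\<phi>\<close> and \<open>u\<close>.\<close>

lemma variation_cost:
  assumes \<gamma>: "AC_curve (atlas M) 0 1 \<gamma>"
    and ll: "AE t in lebesgue_on {0..1}. Lag M (\<gamma> t) (velocity (atlas M) \<gamma> t) = 0"
    and s: "0 < s" "s < 1" and dom: "\<gamma> ` {0..s} \<subseteq> dom_of d"
    and Z: "compact Z" "Z \<subseteq> slit_bundle d" "Z \<subseteq> cone_chart M d" "\<And>p. p \<in> Z \<Longrightarrow> F p = 0"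
    and h: "AE t in lebesgue. 0 < t \<and> t < s \<longrightarrow> ((map_of_chart d \<circ> \<gamma>) has_vector_derivative h t) (at t) \<and>
       (map_of_chart d (\<gamma> t), h t) \<in> Z"
    and \<kappa>: "\<kappa> > 0"
  obtains \<delta>\<^sub>0 where "\<delta>\<^sub>0 > 0" "\<And>u \<phi> \<delta>. (\<And>p q. p \<le> q \<Longrightarrow> (u has_integral (\<phi> q - \<phi> p)) {p..q}) \<Longrightarrow> \<phi> s = 0 \<Longrightarrow>
      (\<And>t. norm (u t) \<le> b) \<Longrightarrow> (\<And>t. 0 \<le> t \<Longrightarrow> t \<le> s \<Longrightarrow> norm (\<phi> t) \<le> b) \<Longrightarrow>
      (AE t in lebesgue. 0 < t \<and> t < s \<longrightarrow> frechet_derivative F (at (map_of_chart d (\<gamma> t), h t)) (\<phi> t, u t) \<ge> \<kappa>) \<Longrightarrow>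
      0 < \<delta> \<Longrightarrow> \<delta> \<le> \<delta>\<^sub>0 \<Longrightarrow>
      map_of_chart d (\<gamma> 0) + \<delta> *\<^sub>R \<phi> 0 \<in> range_of d \<and>
      cost M (inv_of d (map_of_chart d (\<gamma> 0) + \<delta> *\<^sub>R \<phi> 0)) (\<gamma> 1) \<le> ereal (- (s * sqrt (\<delta> * \<kappa> / 2)))"
proof -
  define g where "g = map_of_chart d \<circ> \<gamma>"
  have c\<gamma>: "continuous_on {0..1} \<gamma>" using \<gamma> by (simp add: AC_curve_def)
  have cg: "continuous_on {0..s} g"
    unfolding g_def using s dom by (intro continuous_on_compose continuous_on_subset[OF c\<gamma>] continuous_on_subset[OF chart_continuous(1)[OF ch]]) auto
  have acg: "AC_on 0 s g" unfolding g_def using \<gamma> d dom s by (auto simp: AC_curve_def)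
  have gr: "g ` {0..s} \<subseteq> range_of d" using dom ch by (auto simp: g_def)
  have "compact (g ` {0..s})" using cg by (rule compact_continuous_image) simp
  then obtain e where e: "e > 0" "(\<Union>y\<in>g ` {0..s}. ball y e) \<subseteq> range_of d"
    using compact_subset_open_imp_ball_epsilon_subset[OF _ chart_open(2)[OF ch] gr] by blast
  obtain \<delta>1 where \<delta>1: "\<delta>1 > 0" "\<And>p w \<delta>. p \<in> Z \<Longrightarrow> norm w \<le> 2 * b \<Longrightarrow> frechet_derivative F (at p) w \<ge> \<kappa> \<Longrightarrow> 0 < \<delta> \<Longrightarrow> \<delta> \<le> \<delta>1 \<Longrightarrow>
     F (p + \<delta> *\<^sub>R w) \<ge> \<delta> * \<kappa> / 2 \<and> p + \<delta> *\<^sub>R w \<in> cone_chart M d"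
    using first_variation[OF Z \<kappa>, where b="2 * b"] by metis
  define \<delta>0 where "\<delta>0 = min \<delta>1 (e / (2 * (\<bar>b\<bar> + 1)))"
  show ?thesis
  proof (rule that[of \<delta>0])
    show "\<delta>0 > 0" using \<delta>1 e by (auto simp: \<delta>0_def)
    fix u \<phi> \<delta>
    assume u: "\<And>p q. p \<le> q \<Longrightarrow> (u has_integral (\<phi> q - \<phi> p)) {p..q}" and \<phi>s: "\<phi> s = 0"
      and ub: "\<And>t. norm (u t) \<le> b" and \<phi>b: "\<And>t. 0 \<le> t \<Longrightarrow> t \<le> s \<Longrightarrow> norm (\<phi> t) \<le> b"
      and pos: "AE t in lebesgue. 0 < t \<and> t < s \<longrightarrow> frechet_derivative F (at (map_of_chart d (\<gamma> t), h t)) (\<phi> t, u t) \<ge> \<kappa>"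
      and \<delta>: "0 < \<delta>" "\<delta> \<le> \<delta>0"
    have b0: "b \<ge> 0" using ub[of 0] norm_ge_zero order_trans by blast
    have lip: "norm (\<phi> q - \<phi> p) \<le> b * (q - p)" if "p \<le> q" for p q
      using has_integral_bound[of b u "\<phi> q - \<phi> p" p q] u[OF that] ub b0 that by simp
    define G where "G t = g t + \<delta> *\<^sub>R \<phi> t" for t
    have c\<phi>: "continuous_on {0..s} \<phi>"
    proof (rule continuous_onI)
      fix x \<epsilon> :: real assume "\<epsilon> > 0"
      show "\<exists>da>0. \<forall>x'\<in>{0..s}. dist x' x < da \<longrightarrow> dist (\<phi> x') (\<phi> x) \<le> \<epsilon>"
      proof (intro exI[of _ "\<epsilon> / (b + 1)"] conjI ballI impI)
        fix x' assume x': "dist x' x < \<epsilon> / (b + 1)"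
        have "norm (\<phi> x' - \<phi> x) \<le> b * \<bar>x' - x\<bar>"
          using lip[of x x'] lip[of x' x] by (cases "x \<le> x'") (auto simp: norm_minus_commute)
        also have "\<dots> \<le> (b + 1) * \<bar>x' - x\<bar>" by (simp add: algebra_simps)
        also have "\<dots> \<le> \<epsilon>" using x' b0 by (simp add: dist_real_def field_simps)
        finally show "dist (\<phi> x') (\<phi> x) \<le> \<epsilon>" by (simp add: dist_norm)
      qed (use b0 \<open>\<epsilon> > 0\<close> in auto)
    qed
    have GAC: "AC_on 0 s G"
    proof (rule AC_on_dominated[OF acg, of _ 1 "\<delta> * b"])
      fix p q :: real assume pq: "0 \<le> p" "p \<le> q" "q \<le> s"
      have "G q - G p = (g q - g p) + \<delta> *\<^sub>R (\<phi> q - \<phi> p)" by (simp add: G_def algebra_simps)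
      also have "norm \<dots> \<le> norm (g q - g p) + norm (\<delta> *\<^sub>R (\<phi> q - \<phi> p))" by (rule norm_triangle_ineq)
      also have "norm (\<delta> *\<^sub>R (\<phi> q - \<phi> p)) \<le> \<delta> * (b * (q - p))" using lip[OF pq(2)] \<delta>(1) by simp
      finally show "norm (G q - G p) \<le> 1 * norm (g q - g p) + \<delta> * b * (q - p)" by simp
    qed (use \<delta> b0 in auto)
    have GC: "continuous_on {0..s} G" unfolding G_def using cg c\<phi> by (intro continuous_intros)
    have Gin: "G t \<in> range_of d" if "0 \<le> t" "t \<le> s" for t
    proof -
      have "norm (\<delta> *\<^sub>R \<phi> t) \<le> \<delta> * b" using \<phi>b[OF that] \<delta>(1) by simp
      also have "\<dots> \<le> (e / (2 * (\<bar>b\<bar> + 1))) * b" using \<delta> b0 by (intro mult_right_mono) (auto simp: \<delta>0_def)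
      also have "\<dots> < e" using e(1) b0 by (simp add: field_simps) (smt (verit) mult_nonneg_nonneg mult_pos_pos)
      finally have "G t \<in> ball (g t) e" by (simp add: G_def dist_norm)
      moreover have "g t \<in> g ` {0..s}" using that by simp
      ultimately show ?thesis using e(2) by blast
    qed
    have "\<gamma> s \<in> dom_of d" using dom s by auto
    then have Gs: "inv_of d (G s) = \<gamma> s" using \<phi>s ch by (simp add: G_def g_def)
    have Gr: "G ` {0..s} \<subseteq> range_of d" using Gin by auto
    define \<sigma> where "\<sigma> t = (if t \<le> s then inv_of d (G t) else \<gamma> t)" for t
    have AC\<sigma>: "AC_curve (atlas M) 0 1 \<sigma>"
      unfolding \<sigma>_def[abs_def] by (rule AC_curve_surgery[OF \<gamma> s GAC GC Gr Gs])
    have c\<sigma>: "continuous_on {0..1} \<sigma>" using AC\<sigma> by (simp add: AC_curve_def)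
    define m where "m = sqrt (\<delta> * \<kappa> / 2)"
    have "AE t in lebesgue. (\<phi> has_vector_derivative u t) (at t)" by (rule AE_has_derivative_integral[OF u])
    then have main: "AE t in lebesgue. 0 < t \<and> t < s \<longrightarrow> Lag M (\<sigma> t) (velocity (atlas M) \<sigma> t) \<le> ereal (- m)"
      using h pos
    proof eventually_elim
      case (elim t)
      show ?case
      proof
        assume t: "0 < t \<and> t < s"
        have tc: "isCont \<sigma> t" using c\<sigma> t s by (intro continuous_on_interior[OF c\<sigma>]) auto
        have dt: "\<sigma> t \<in> dom_of d" using t Gin[of t] ch by (simp add: \<sigma>_def)
        have "(G has_vector_derivative (h t + \<delta> *\<^sub>R u t)) (at t)"
          unfolding G_def g_def using elim t by (intro has_vector_derivative_add) (auto intro!: derivative_eq_intros simp: comp_def)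
        then have w: "((map_of_chart d \<circ> \<sigma>) has_vector_derivative (h t + \<delta> *\<^sub>R u t)) (at t)"
          by (rule has_vector_derivative_transform_within_open[of _ _ _ "{0<..<s}"]) (use t Gin ch in \<open>auto simp: \<sigma>_def\<close>)
        have ds: "map_of_chart d (\<sigma> t) = G t" using t Gin[of t] ch by (simp add: \<sigma>_def)
        define p where "p = (map_of_chart d (\<gamma> t), h t)"
        have pp: "p + \<delta> *\<^sub>R (\<phi> t, u t) = (G t, h t + \<delta> *\<^sub>R u t)" by (simp add: p_def G_def g_def)
        have "norm (\<phi> t, u t) \<le> norm (\<phi> t) + norm (u t)" by (rule norm_Pair_le)
        also have "\<dots> \<le> 2 * b" using ub[of t] \<phi>b[of t] t by simp
        finally have nb: "norm (\<phi> t, u t) \<le> 2 * b" .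
        have "F (p + \<delta> *\<^sub>R (\<phi> t, u t)) \<ge> \<delta> * \<kappa> / 2 \<and> p + \<delta> *\<^sub>R (\<phi> t, u t) \<in> cone_chart M d"
          using elim t \<delta> nb by (intro \<delta>1(2)) (auto simp: p_def \<delta>0_def)
        then have "LL M (\<sigma> t, velocity (atlas M) \<sigma> t) \<ge> \<delta> * \<kappa> / 2" "(\<sigma> t, velocity (atlas M) \<sigma> t) \<in> cone M"
          using LL_velocity[OF dt tc w] unfolding ds pp by auto
        then show "Lag M (\<sigma> t) (velocity (atlas M) \<sigma> t) \<le> ereal (- m)"
          by (simp add: Lag_def m_def real_sqrt_le_mono)
      qed
    qed
    have nullpts: "AE t in lebesgue. t \<notin> {0, s, 1}" by (rule AE_not_in) (simp add: negligible_iff_null_sets[symmetric])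
    have ll': "AE t in lebesgue. t \<in> {0..1} \<longrightarrow> Lag M (\<gamma> t) (velocity (atlas M) \<gamma> t) = 0"
      using ll by (subst (asm) AE_restrict_space_iff) auto
    have "AE t in lebesgue. t \<in> {0..1} \<longrightarrow> Lag M (\<sigma> t) (velocity (atlas M) \<sigma> t) \<le> (if t < s then ereal (- m) else 0)"
      using main nullpts ll'
    proof eventually_elim
      case (elim t)
      show ?case
      proof (cases "0 < t \<and> t < s")
        case False
        show ?thesis
        proof
          assume "t \<in> {0..1}"
          then have t: "s < t" "t \<le> 1" using False elim(2) by auto
          have "eventually (\<lambda>r. r \<in> {s<..}) (nhds t)" using t by (intro eventually_nhds_in_open) auto
          then have "eventually (\<lambda>r. r \<in> UNIV \<longrightarrow> (map_of_chart (chart_at (atlas M) (\<gamma> t)) \<circ> \<sigma>) r = (map_of_chart (chart_at (atlas M) (\<gamma> t)) \<circ> \<gamma>) r) (nhds t)"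
            by eventually_elim (auto simp: \<sigma>_def)
          then have "velocity (atlas M) \<sigma> t = velocity (atlas M) \<gamma> t"
            using t unfolding velocity_def by (simp add: \<sigma>_def vector_derivative_cong_eq)
          then show "Lag M (\<sigma> t) (velocity (atlas M) \<sigma> t) \<le> (if t < s then ereal (- m) else 0)"
            using elim(3) t s by (simp add: \<sigma>_def)
        qed
      qed (use elim in auto)
    qed
    then have "AE t in lebesgue_on {0..1}. Lag M (\<sigma> t) (velocity (atlas M) \<sigma> t) \<le> (if t < s then ereal (- m) else 0)"
      by (subst AE_restrict_space_iff) auto
    then have act: "action M 0 1 \<sigma> \<le> ereal (- (s * m))" using s \<delta>(1) \<kappa> by (intro action_upper_bound) (auto simp: m_def)
    have "cost M (\<sigma> 0) (\<sigma> 1) \<le> action M 0 1 \<sigma>"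
      unfolding cost_def using AC\<sigma> by (intro Inf_lower) blast
    moreover have "\<sigma> 0 = inv_of d (map_of_chart d (\<gamma> 0) + \<delta> *\<^sub>R \<phi> 0)" using s by (simp add: \<sigma>_def G_def g_def)
    moreover have "\<sigma> 1 = \<gamma> 1" using s by (simp add: \<sigma>_def)
    ultimately show "map_of_chart d (\<gamma> 0) + \<delta> *\<^sub>R \<phi> 0 \<in> range_of d \<and>
      cost M (inv_of d (map_of_chart d (\<gamma> 0) + \<delta> *\<^sub>R \<phi> 0)) (\<gamma> 1) \<le> ereal (- (s * sqrt (\<delta> * \<kappa> / 2)))"
      using act Gin[of 0] s unfolding m_def G_def g_def by (auto intro: order_trans)
  qed
qed

end

section \<open>Bounds for causal velocities\<close>

lemma hnorm_le_tau:
  assumes "splitting M B \<Phi> \<tau>" "(x, v) \<in> cone M"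
  shows "hnorm M x v \<le> differential (atlas M) \<tau> x v"
proof -
  have "ereal (- differential (atlas M) \<tau> x v) \<le> min (Lag M x v) (ereal (- hnorm M x v))"
    using assms unfolding splitting_def by blast
  then show ?thesis by simp
qed

context lf_chart begin

lemma local_metric_eq:
  "y \<in> range_of d \<Longrightarrow> local_metric M d y u w = metric M (inv_of d y) (T y u) (T y w)"
  by (simp add: local_metric_def Let_def tangent_coordinates)

text \<open>The quadratic form of the metric attains a positive minimum on the compact product of \<open>Y\<close> with the unit
  sphere.\<close>

lemma metric_lower_bound:
  assumes Y: "compact Y" "Y \<subseteq> range_of d"
  obtains c where "c > 0" "\<And>y z. y \<in> Y \<Longrightarrow> c * norm z \<le> hnorm M (inv_of d y) (T y z)"
proof (cases "Y = {}")
  case True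
  then show ?thesis using that[of 1] by simp
next
  case False
  have rm: "riemannian_metric M" using lf by (simp add: lorentz_finsler_def)
  have bil: "bilinear (metric M x)" and posd: "u \<noteq> 0 \<Longrightarrow> metric M x u u > 0" for x u
    using rm by (auto simp: riemannian_metric_def)
  let ?g = "local_metric M d"
  have ml: "linear (metric M x u)" "linear (\<lambda>u. metric M x u v)" for x u v
    using bil[of x] by (auto simp: bilinear_def)
  have exp: "?g y z z = (\<Sum>i\<in>Basis. \<Sum>j\<in>Basis. (z \<bullet> i) * (z \<bullet> j) * ?g y i j)" if y: "y \<in> range_of d" for y z
  proof -
    have Tz: "T y z = (\<Sum>i\<in>Basis. (z \<bullet> i) *\<^sub>R T y i)"
    proof -
      have "T y z = T y (\<Sum>i\<in>Basis. (z \<bullet> i) *\<^sub>R i)" by (simp add: euclidean_representation)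
      also have "\<dots> = (\<Sum>i\<in>Basis. T y ((z \<bullet> i) *\<^sub>R i))" by (rule linear_sum[OF tangent_coordinates(2)[OF y]])
      finally show ?thesis by (simp only: linear_scale[OF tangent_coordinates(2)[OF y]])
    qed
    have "metric M (inv_of d y) (T y z) (T y z) =
        (\<Sum>i\<in>Basis. metric M (inv_of d y) ((z \<bullet> i) *\<^sub>R T y i) (T y z))"
      by (subst (1) Tz) (rule linear_sum[OF ml(2)])
    also have "\<dots> = (\<Sum>i\<in>Basis. (z \<bullet> i) * metric M (inv_of d y) (T y i) (T y z))"
      by (simp only: linear_scale[OF ml(2)] real_scaleR_def)
    also have "\<dots> = (\<Sum>i\<in>Basis. (z \<bullet> i) * (\<Sum>j\<in>Basis. (z \<bullet> j) * metric M (inv_of d y) (T y i) (T y j)))"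
    proof (intro sum.cong refl arg_cong[where f="\<lambda>x. _ * x"])
      fix i
      have "metric M (inv_of d y) (T y i) (T y z) = (\<Sum>j\<in>Basis. metric M (inv_of d y) (T y i) ((z \<bullet> j) *\<^sub>R T y j))"
        by (subst Tz) (rule linear_sum[OF ml(1)])
      then show "metric M (inv_of d y) (T y i) (T y z) = (\<Sum>j\<in>Basis. (z \<bullet> j) * metric M (inv_of d y) (T y i) (T y j))"
        by (simp only: linear_scale[OF ml(1)] real_scaleR_def)
    qed
    finally show ?thesis using y by (simp add: local_metric_eq sum_distrib_left mult.assoc)
  qed
  define f where "f p = ?g (fst p) (snd p) (snd p)" for p
  have gc: "continuous_on Y (\<lambda>y. ?g y i j)" for i j
  proof -
    have "smooth_on (range_of d) (\<lambda>y. ?g y i j)" using rm d by (simp add: riemannian_metric_def)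
    then show ?thesis using smooth_on_continuous continuous_on_subset Y(2) by blast
  qed
  let ?K = "Y \<times> sphere (0::'e) 1"
  have "continuous_on ?K (\<lambda>p. \<Sum>i\<in>Basis. \<Sum>j\<in>Basis. (snd p \<bullet> i) * (snd p \<bullet> j) * ?g (fst p) i j)"
    by (intro continuous_on_sum continuous_on_mult continuous_on_compose2[OF gc]) (auto intro!: continuous_intros)
  then have fc: "continuous_on ?K f"
    by (rule continuous_on_eq) (use Y(2) in \<open>auto simp: f_def exp\<close>)
  have "compact ?K" "?K \<noteq> {}" using Y(1) False by (auto intro: compact_Times)
  then obtain p0 where p0: "p0 \<in> ?K" "\<And>p. p \<in> ?K \<Longrightarrow> f p0 \<le> f p"
    using continuous_attains_inf[OF _ _ fc] by blast
  have Tnz: "T y z \<noteq> 0" if "y \<in> range_of d" "z \<noteq> 0" for y z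
    using tangent_coordinates(5)[OF that(1), of z] linear_0[OF tangent_coordinates(3)[OF that(1)]] that(2) by auto
  have f0: "f p0 > 0"
  proof -
    obtain y z where p: "p0 = (y, z)" "y \<in> Y" "norm z = 1" using p0(1) by auto
    then have yz: "y \<in> range_of d" "z \<noteq> 0" using Y(2) by auto
    show ?thesis using posd[OF Tnz[OF yz]] yz(1) by (simp add: p(1) f_def local_metric_eq)
  qed
  show ?thesis
  proof (rule that[of "sqrt (f p0)"])
    fix y z assume y: "y \<in> Y"
    then have yr: "y \<in> range_of d" using Y by auto
    show "sqrt (f p0) * norm z \<le> hnorm M (inv_of d y) (T y z)"
    proof (cases "z = 0")
      case True
      then show ?thesis using linear_0[OF tangent_coordinates(2)[OF yr]] linear_0[OF ml(1)] by (simp add: hnorm_def)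
    next
      case False
      define e where "e = z /\<^sub>R norm z"
      have ze: "z = norm z *\<^sub>R e" "norm e = 1" using False by (auto simp: e_def)
      have "f p0 \<le> f (y, e)" using y ze(2) by (intro p0(2)) auto
      also have "\<dots> = metric M (inv_of d y) (T y e) (T y e)" using yr by (simp add: f_def local_metric_eq)
      finally have "f p0 * (norm z)\<^sup>2 \<le> metric M (inv_of d y) (T y e) (T y e) * (norm z)\<^sup>2" by (rule mult_right_mono) simp
      also have "\<dots> = metric M (inv_of d y) (T y (norm z *\<^sub>R e)) (T y (norm z *\<^sub>R e))"
        by (simp only: linear_scale[OF tangent_coordinates(2)[OF yr]] linear_scale[OF ml(1)] linear_scale[OF ml(2)]) (simp add: power2_eq_square)
      finally have "sqrt (f p0 * (norm z)\<^sup>2) \<le> hnorm M (inv_of d y) (T y z)"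
        unfolding hnorm_def ze(1)[symmetric] by (rule real_sqrt_le_mono)
      then show ?thesis by (simp add: real_sqrt_mult)
    qed
  qed (use f0 in simp)
qed

text \<open>In charts \<open>\<tau>\<close> is a component of a smooth map, so its differentials are bounded near a point.\<close>

lemma tau_upper_bound:
  assumes sp: "splitting M B \<Phi> \<tau>" and y0: "y0 \<in> range_of d"
  obtains r C where "r > 0" "C > 0" "ball y0 r \<subseteq> range_of d"
    "\<And>y z. y \<in> ball y0 r \<Longrightarrow> \<bar>differential (atlas M) \<tau> (inv_of d y) (T y z)\<bar> \<le> C * norm z"
proof -
  note [simp] = ch
  have BA: "smooth_atlas B" and diff: "diffeomorphism (atlas M) (real_times_atlas B) \<Phi>" and \<tau>: "\<tau> = fst \<circ> \<Phi>"
    using sp by (auto simp: splitting_def)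
  have sm: "smooth_map (atlas M) (real_times_atlas B) \<Phi>" using diff by (simp add: diffeomorphism_def)
  have \<Phi>c: "continuous_on UNIV \<Phi>" using sm by (simp add: smooth_map_def)
  obtain e where e: "e \<in> B" "snd (\<Phi> (inv_of d y0)) \<in> dom_of e"
    using BA unfolding smooth_atlas_def by (metis UNIV_I UN_E)
  define e' where "e' = ((UNIV :: real set) \<times> dom_of e, \<lambda>(t :: real, q). (t, map_of_chart e q))"
  have e': "e' \<in> real_times_atlas B" using e(1) by (auto simp: e'_def real_times_atlas_def)
  have od: "open (dom_of e')" using atlasD(1)[OF BA e(1)] by (auto simp: e'_def intro!: open_Times chart_open)
  define W where "W = map_of_chart d ` (dom_of d \<inter> \<Phi> -` dom_of e')"
  have oW: "open W" unfolding W_def using \<Phi>c od by (intro chart_image_open[OF ch] open_vimage)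
  define G where "G = map_of_chart e' \<circ> \<Phi> \<circ> inv_of d"
  have sG: "smooth_on W G" using sm d e' unfolding smooth_map_def W_def G_def by blast
  have "inv_of d y0 \<in> dom_of d \<inter> \<Phi> -` dom_of e'" using y0 e(2) by (simp add: e'_def mem_Times_iff)
  then have "map_of_chart d (inv_of d y0) \<in> W" unfolding W_def by blast
  then have y0W: "y0 \<in> W" using y0 by simp
  have WR: "W \<subseteq> range_of d" by (auto simp: W_def)
  obtain r where r: "r > 0" "ball y0 r \<subseteq> W"
    "\<And>p v. p \<in> ball y0 r \<Longrightarrow> norm (frechet_derivative G (at p) v - frechet_derivative G (at y0) v) \<le> 1 * norm v"
    using smooth_on_strictly_differentiable[OF oW sG y0W zero_less_one] by metis
  let ?D0 = "frechet_derivative G (at y0)"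
  have bl: "bounded_linear ?D0" using smooth_on_has_derivative[OF sG y0W] has_derivative_bounded_linear by blast
  show ?thesis
  proof (rule that[of r "2 + onorm ?D0"])
    show "2 + onorm ?D0 > 0" using onorm_pos_le[OF bl] by simp
    show "ball y0 r \<subseteq> range_of d" using r(2) WR by blast
    fix y z assume y: "y \<in> ball y0 r"
    then have yW: "y \<in> W" and yr: "y \<in> range_of d" using r(2) WR by auto
    let ?Dy = "frechet_derivative G (at y)"
    have "(fst \<circ> G has_derivative (fst \<circ> ?Dy)) (at y)"
      using smooth_on_has_derivative[OF sG yW] by (intro diff_chain_at) (auto intro!: derivative_eq_intros)
    then have "((\<tau> \<circ> inv_of d) has_derivative (fst \<circ> ?Dy)) (at y)"
      by (rule has_derivative_transform_within_open[OF _ oW yW]) (auto simp: G_def \<tau> e'_def split_beta)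
    then have "((\<tau> \<circ> inv_of d) has_derivative (fst \<circ> ?Dy)) (at (map_of_chart d (inv_of d y)))" using yr by simp
    from differential_in_chart[OF A d _ this, of "T y z"]
    have "differential (atlas M) \<tau> (inv_of d y) (T y z) = fst (?Dy z)"
      using yr tangent_coordinates(5)[OF yr, of z] by (simp add: differential_chart D_def)
    then have "\<bar>differential (atlas M) \<tau> (inv_of d y) (T y z)\<bar> \<le> norm (?Dy z)"
      using norm_fst_le[of "fst (?Dy z)" "snd (?Dy z)"] by simp
    also have "\<dots> \<le> norm (?Dy z - ?D0 z) + norm (?D0 z)" by (metis diff_add_cancel norm_triangle_ineq)
    also have "\<dots> \<le> 1 * norm z + onorm ?D0 * norm z" using r(3)[OF y, of z] onorm[OF bl, of z] by (rule add_mono)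
    also have "\<dots> \<le> (2 + onorm ?D0) * norm z" by (simp add: algebra_simps)
    finally show "\<bar>differential (atlas M) \<tau> (inv_of d y) (T y z)\<bar> \<le> (2 + onorm ?D0) * norm z" .
  qed (use r in auto)
qed

text \<open>The splitting bounds the metric norm of a causal vector by \<open>d\<tau>\<close>, and \<open>d\<tau>\<close> is bounded by the coordinate
  norm. Where \<open>d\<tau>\<close> has the value \<open>k > 0\<close>, coordinate vectors therefore stay in an annulus, away from 0
  and from infinity.\<close>

lemma velocity_bounds:
  assumes sp: "splitting M B \<Phi> \<tau>" and y0: "y0 \<in> range_of d" and k: "k > 0"
  obtains \<rho> c\<^sub>1 c\<^sub>2 where "\<rho> > 0" "c\<^sub>1 > 0" "cball y0 \<rho> \<subseteq> range_of d"
    "\<And>y z. y \<in> cball y0 \<rho> \<Longrightarrow> (y, z) \<in> cone_chart M d \<Longrightarrow> differential (atlas M) \<tau> (inv_of d y) (T y z) = k \<Longrightarrow>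
       c\<^sub>1 \<le> norm z \<and> norm z \<le> c\<^sub>2"
proof -
  obtain r C where rC: "r > 0" "C > 0" "ball y0 r \<subseteq> range_of d"
    "\<And>y z. y \<in> ball y0 r \<Longrightarrow> \<bar>differential (atlas M) \<tau> (inv_of d y) (T y z)\<bar> \<le> C * norm z"
    using tau_upper_bound[OF sp y0] by metis
  have sub: "cball y0 (r/2) \<subseteq> ball y0 r" using rC(1) by auto
  obtain c where c: "c > 0" "\<And>y z. y \<in> cball y0 (r/2) \<Longrightarrow> c * norm z \<le> hnorm M (inv_of d y) (T y z)"
    using metric_lower_bound[of "cball y0 (r/2)"] sub rC(3) by (metis compact_cball order_trans)
  show ?thesis
  proof (rule that[of "r/2" "k / C" "k / c"])
    fix y z assume yz: "y \<in> cball y0 (r/2)" "(y, z) \<in> cone_chart M d" "differential (atlas M) \<tau> (inv_of d y) (T y z) = k"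
    have "k \<le> C * norm z" using rC(4)[of y z] yz sub by auto
    moreover have "(inv_of d y, T y z) \<in> cone M" using yz(2) tangent_coordinates(1)[of y z] by (auto simp: cone_chart_def)
    then have "c * norm z \<le> k" using c(2)[OF yz(1), of z] hnorm_le_tau[OF sp] yz(3) by (metis order_trans)
    ultimately show "k / C \<le> norm z \<and> norm z \<le> k / c" using rC(2) c(1) by (simp add: field_simps)
  qed (use rC k sub in auto)
qed

end

text \<open>In a chart the curve is the integral of its derivative and so constant; constancy passes to the whole
  interval by bisection.\<close>

lemma zero_velocity_imp_equal_endpoints:
  assumes lf: "lorentz_finsler M" and \<gamma>: "AC_curve (atlas M) 0 1 \<gamma>"
    and v: "AE t in lebesgue_on {0..1}. velocity (atlas M) \<gamma> t = 0"
  shows "\<gamma> 0 = \<gamma> (1::real)"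
proof -
  have A: "smooth_atlas (atlas M)" using lf by (simp add: lorentz_finsler_def)
  have c\<gamma>: "continuous_on {0..1} \<gamma>" using \<gamma> by (simp add: AC_curve_def)
  have v': "AE t in lebesgue. t \<in> {0..1} \<longrightarrow> velocity (atlas M) \<gamma> t = 0"
    using v by (subst (asm) AE_restrict_space_iff) auto
  have const: "\<gamma> s = \<gamma> t" if c: "c \<in> atlas M" and st: "0 \<le> s" "s \<le> t" "t \<le> 1" "\<gamma> ` {s..t} \<subseteq> dom_of c" for c s t
  proof -
    have ac: "AC_on s t (map_of_chart c \<circ> \<gamma>)" using \<gamma> c st by (auto simp: AC_curve_def)
    obtain h where h: "\<And>p q. s \<le> p \<Longrightarrow> p \<le> q \<Longrightarrow> q \<le> t \<Longrightarrow> (h has_integral ((map_of_chart c \<circ> \<gamma>) q - (map_of_chart c \<circ> \<gamma>) p)) {p..q}"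
      "AE r in lebesgue. s < r \<and> r < t \<longrightarrow> ((map_of_chart c \<circ> \<gamma>) has_vector_derivative h r) (at r)"
    proof (rule AC_on_density[OF ac st(2)])
      fix h assume "\<And>p q. s \<le> p \<Longrightarrow> p \<le> q \<Longrightarrow> q \<le> t \<Longrightarrow> (h has_integral ((map_of_chart c \<circ> \<gamma>) q - (map_of_chart c \<circ> \<gamma>) p)) {p..q}"
        "AE r in lebesgue. s < r \<and> r < t \<longrightarrow> ((map_of_chart c \<circ> \<gamma>) has_vector_derivative h r) (at r)"
      then show thesis by (rule that)
    qed
    have nullpts: "AE r in lebesgue. r \<notin> {s, t}" by (rule AE_not_in) (simp add: negligible_iff_null_sets[symmetric])
    have "AE r in lebesgue. r \<in> {s..t} \<longrightarrow> h r = 0"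
      using h(2) v' nullpts
    proof eventually_elim
      case (elim r)
      show ?case
      proof
        assume "r \<in> {s..t}"
        then have r: "s < r" "r < t" using elim(3) by auto
        have "isCont \<gamma> r" using r st by (intro continuous_on_interior[OF c\<gamma>]) auto
        moreover have "\<gamma> r \<in> dom_of c" using st(4) r by auto
        ultimately have "h r = differential (atlas M) (map_of_chart c) (\<gamma> r) (velocity (atlas M) \<gamma> r)"
          using velocity_in_chart(1)[OF A c] elim(1) r by metis
        then show "h r = 0" using elim(2) r st differential_linear(1)[OF A c \<open>\<gamma> r \<in> dom_of c\<close>] by (simp add: linear_0)
      qed
    qed
    then obtain N where N: "{r \<in> space lebesgue. \<not> (r \<in> {s..t} \<longrightarrow> h r = 0)} \<subseteq> N" "emeasure lebesgue N = 0" "N \<in> sets lebesgue"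
      by (rule AE_E)
    then have "negligible N" by (simp add: negligible_iff_null_sets null_sets_def)
    then have "(h has_integral 0) {s..t}" by (rule has_integral_negligible) (use N(1) in auto)
    from has_integral_unique[OF h(1)[OF order_refl st(2) order_refl] this]
    have eq: "map_of_chart c (\<gamma> t) = map_of_chart c (\<gamma> s)" by simp
    have "\<gamma> s \<in> dom_of c" "\<gamma> t \<in> dom_of c" using st by auto
    then show ?thesis using chart_inv(1)[OF atlasD(1)[OF A c]] eq by metis
  qed
  have "0 \<le> (0::real) \<and> 1 \<le> (1::real) \<longrightarrow> \<gamma> 0 = \<gamma> (1::real)"
  proof (rule Bolzano[where P = "\<lambda>s t. 0 \<le> s \<and> t \<le> 1 \<longrightarrow> \<gamma> s = \<gamma> t"])
    fix x :: real assume x: "0 \<le> x" "x \<le> 1"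
    define c where "c = chart_at (atlas M) (\<gamma> x)"
    have c: "c \<in> atlas M" "\<gamma> x \<in> dom_of c" using atlasD[OF A] by (simp_all add: c_def)
    have "open (dom_of c)" using chart_open(1)[OF atlasD(1)[OF A c(1)]] .
    then obtain U where U: "open U" "x \<in> U" "\<And>t. t \<in> {0..1} \<Longrightarrow> t \<in> U \<Longrightarrow> \<gamma> t \<in> dom_of c"
      using c\<gamma>[unfolded continuous_on_topological, rule_format, of x "dom_of c"] c(2) x by auto
    obtain e where e: "e > 0" "ball x e \<subseteq> U" using U(1,2) open_contains_ball by blast
    show "\<exists>e>0. \<forall>s t. s \<le> x \<and> x \<le> t \<and> t - s < e \<longrightarrow> (0 \<le> s \<and> t \<le> 1 \<longrightarrow> \<gamma> s = \<gamma> t)"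
    proof (intro exI[of _ e] conjI e(1) allI impI)
      fix s t assume st: "s \<le> x \<and> x \<le> t \<and> t - s < e" "0 \<le> s \<and> t \<le> 1"
      have "\<gamma> ` {s..t} \<subseteq> dom_of c"
      proof
        fix y assume "y \<in> \<gamma> ` {s..t}"
        then obtain r where r: "y = \<gamma> r" "s \<le> r" "r \<le> t" by auto
        then have "r \<in> ball x e" using st by (auto simp: dist_real_def)
        then show "y \<in> dom_of c" unfolding r(1) using e(2) st r by (intro U(3)) auto
      qed
      then show "\<gamma> s = \<gamma> t" using st by (intro const[OF c(1)]) auto
    qed
  qed auto
  then show ?thesis by simp
qed

section \<open>The start of a lightlike minimizer\<close>

text \<open>The primitive is taken on the whole line, as the estimates for varied curves use it at all parameter
  values; integrals start at \<open>min q 0\<close> because \<open>u\<close> vanishes on the left half-line.\<close>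

lemma primitive_exists:
  fixes u :: "real \<Rightarrow> 'a::euclidean_space"
  assumes u: "integrable lborel u" and z: "\<And>t. t \<le> 0 \<Longrightarrow> u t = 0"
  obtains \<Phi> where "\<And>p q. p \<le> q \<Longrightarrow> (u has_integral (\<Phi> q - \<Phi> p)) {p..q}" "\<And>q. 0 \<le> q \<Longrightarrow> \<Phi> q = integral {0..q} u"
proof -
  define \<Phi> where "\<Phi> q = integral {min q 0..q} u" for q
  have "u integrable_on UNIV" using has_integral_integral_lborel[OF u] by (auto simp: has_integral_integrable)
  then have int: "u integrable_on {p..q}" for p q
    using integrable_on_subinterval[of u UNIV p q] by (simp add: cbox_interval)
  have zero: "integral {p..q} u = 0" if "q \<le> 0" for p q
    by (intro integral_unique has_integral_is_0) (use z that in auto)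
  have \<Phi>: "\<Phi> q = integral {p..q} u" if "p \<le> 0" "p \<le> q" for p q
  proof (cases "q \<le> 0")
    case True
    then show ?thesis using zero by (simp add: \<Phi>_def)
  next
    case False
    then have "integral {p..0} u + integral {0..q} u = integral {p..q} u"
      using that int by (intro Henstock_Kurzweil_Integration.integral_combine) auto
    then show ?thesis using zero[of 0 p] False by (simp add: \<Phi>_def)
  qed
  show ?thesis
  proof (rule that[of \<Phi>])
    fix p q :: real assume pq: "p \<le> q"
    define r where "r = min p 0"
    have "integral {r..p} u + integral {p..q} u = integral {r..q} u"
      using pq int by (intro Henstock_Kurzweil_Integration.integral_combine) (auto simp: r_def)
    moreover have "\<Phi> p = integral {r..p} u" "\<Phi> q = integral {r..q} u" using pq by (auto intro!: \<Phi> simp: r_def)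
    ultimately have "\<Phi> q - \<Phi> p = integral {p..q} u" by (simp add: algebra_simps)
    then show "(u has_integral (\<Phi> q - \<Phi> p)) {p..q}" using int by (simp add: integrable_integral)
  qed (simp add: \<Phi>_def min_def)
qed

lemma integral_over_bounded_set:
  fixes f :: "real \<Rightarrow> 'a::euclidean_space"
  assumes A: "A \<in> sets borel" "A \<subseteq> {0..s}" and f: "f \<in> borel_measurable borel" and b: "\<And>t. t \<in> A \<Longrightarrow> norm (f t) \<le> b" "b \<ge> 0"
  shows "integrable lborel (\<lambda>t. indicator A t *\<^sub>R f t)" "norm (LINT t|lborel. indicator A t *\<^sub>R f t) \<le> b * measure lborel A"
    "integrable lborel (indicat_real A)"
proof -
  have "emeasure lborel A \<le> emeasure lborel {0..s}" using A by (intro emeasure_mono) auto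
  also have "\<dots> < \<infinity>" by (simp add: emeasure_lborel_Icc_eq)
  finally have fin: "emeasure lborel A < \<infinity>" .
  show i: "integrable lborel (indicat_real A)" using A fin by (intro integrable_real_indicator) auto
  have i': "integrable lborel (\<lambda>t. b * indicat_real A t)" using i by (rule integrable_mult_right)
  show 1: "integrable lborel (\<lambda>t. indicator A t *\<^sub>R f t)"
    by (rule Bochner_Integration.integrable_bound[OF i']) (use A f b in \<open>auto split: split_indicator\<close>)
  have "norm (LINT t|lborel. indicator A t *\<^sub>R f t) \<le> (LINT t|lborel. norm (indicator A t *\<^sub>R f t))"
    by (rule integral_norm_bound)
  also have "\<dots> \<le> (LINT t|lborel. b * indicat_real A t)"
    using 1 i' b by (intro integral_mono integrable_norm) (auto split: split_indicator)
  also have "\<dots> = b * measure lborel A" using A by simp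
  finally show "norm (LINT t|lborel. indicator A t *\<^sub>R f t) \<le> b * measure lborel A" .
qed

context lf_chart begin

definition grad :: "'e \<times> 'e \<Rightarrow> 'e" where
  "grad p = (\<Sum>b\<in>Basis. frechet_derivative F (at p) (0, b) *\<^sub>R b)"

lemma DF_linear: "p \<in> slit_bundle d \<Longrightarrow> linear (frechet_derivative F (at p))"
  by (intro linear_frechet_derivative smooth_on_differentiable[OF smooth_F])

lemma grad_inner:
  assumes "p \<in> slit_bundle d" shows "frechet_derivative F (at p) (0, u) = grad p \<bullet> u"
proof -
  note l = DF_linear[OF assms]
  have "(0::'e, u) = (\<Sum>b\<in>Basis. (u \<bullet> b) *\<^sub>R (0, b))"
    by (intro prod_eqI) (simp_all add: fst_sum snd_sum euclidean_representation)
  then have "frechet_derivative F (at p) (0, u) = (\<Sum>b\<in>Basis. (u \<bullet> b) *\<^sub>R frechet_derivative F (at p) (0, b))"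
    by (simp only: linear_sum[OF l] linear_scale[OF l])
  then show ?thesis by (simp add: grad_def inner_sum_left inner_commute[of u] mult.commute)
qed

lemma grad_continuous: "continuous_on (slit_bundle d) grad"
  unfolding grad_def using smooth_on_continuous[OF smooth_on_derivative[OF smooth_F]]
  by (intro continuous_on_sum continuous_on_scaleR continuous_on_const) auto

lemma grad_nonzero: assumes "p \<in> slit_bundle d" shows "grad p \<noteq> 0"
proof -
  obtain y z where p: "p = (y, z)" "y \<in> range_of d" "z \<noteq> 0" using assms by auto
  obtain u where "frechet_derivative F (at (y, z)) (0, u) \<noteq> 0" using fibre_derivative_nonzero[OF p(2,3)] by blast
  then show ?thesis using grad_inner[OF assms, of u] p(1) by auto
qed

lemma DF_split:
  assumes "p \<in> slit_bundle d"
  shows "frechet_derivative F (at p) (\<phi>, u) = frechet_derivative F (at p) (\<phi>, 0) + grad p \<bullet> u"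
  using linear_add[OF DF_linear[OF assms], of "(\<phi>, 0)" "(0, u)"] grad_inner[OF assms] by simp

text \<open>The fibre gradient is continuous and nonzero, hence bounded and bounded away from zero on compact
  sets; the base derivative is bounded.\<close>

lemma derivative_bounds:
  assumes Z: "compact Z" "Z \<subseteq> slit_bundle d" "Z \<noteq> {}"
  obtains m M' K where "m > 0" "K \<ge> 0" "\<And>p. p \<in> Z \<Longrightarrow> m \<le> norm (grad p) \<and> norm (grad p) \<le> M'"
    "\<And>p \<phi>. p \<in> Z \<Longrightarrow> \<bar>frechet_derivative F (at p) (\<phi>, 0)\<bar> \<le> K * norm \<phi>"
proof -
  have c: "continuous_on Z (\<lambda>p. norm (grad p))"
    by (intro continuous_on_norm continuous_on_subset[OF grad_continuous Z(2)])
  obtain p1 where p1: "p1 \<in> Z" "\<And>p. p \<in> Z \<Longrightarrow> norm (grad p1) \<le> norm (grad p)"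
    using continuous_attains_inf[OF Z(1,3) c] by blast
  obtain p2 where p2: "p2 \<in> Z" "\<And>p. p \<in> Z \<Longrightarrow> norm (grad p) \<le> norm (grad p2)"
    using continuous_attains_sup[OF Z(1,3) c] by blast
  define f where "f p = (\<Sum>b\<in>Basis. \<bar>frechet_derivative F (at p) (b, 0)\<bar>)" for p
  have cf: "continuous_on Z f" unfolding f_def
    by (intro continuous_on_sum continuous_on_rabs continuous_on_subset[OF smooth_on_continuous[OF smooth_on_derivative[OF smooth_F]] Z(2)])
  obtain p3 where p3: "p3 \<in> Z" "\<And>p. p \<in> Z \<Longrightarrow> f p \<le> f p3"
    using continuous_attains_sup[OF Z(1,3) cf] by blast
  show ?thesis
  proof (rule that[of "norm (grad p1)" "f p3" "norm (grad p2)"])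
    show "norm (grad p1) > 0" using grad_nonzero[OF subsetD[OF Z(2) p1(1)]] by simp
    show "f p3 \<ge> 0" unfolding f_def by (intro sum_nonneg) auto
    fix p and \<phi> :: 'e assume p: "p \<in> Z"
    note l = DF_linear[OF subsetD[OF Z(2) p]]
    have "(\<phi>, 0::'e) = (\<Sum>b\<in>Basis. (\<phi> \<bullet> b) *\<^sub>R (b, 0))"
      by (intro prod_eqI) (simp_all add: fst_sum snd_sum euclidean_representation)
    then have "frechet_derivative F (at p) (\<phi>, 0) = (\<Sum>b\<in>Basis. (\<phi> \<bullet> b) *\<^sub>R frechet_derivative F (at p) (b, 0))"
      by (simp only: linear_sum[OF l] linear_scale[OF l])
    then have "\<bar>frechet_derivative F (at p) (\<phi>, 0)\<bar> \<le> (\<Sum>b\<in>Basis. \<bar>\<phi> \<bullet> b\<bar> * \<bar>frechet_derivative F (at p) (b, 0)\<bar>)"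
      by (simp add: abs_mult[symmetric] order_trans[OF sum_abs])
    also have "\<dots> \<le> (\<Sum>b\<in>Basis. norm \<phi> * \<bar>frechet_derivative F (at p) (b, 0)\<bar>)"
      by (intro sum_mono mult_right_mono Basis_le_norm) auto
    also have "\<dots> = norm \<phi> * f p" by (simp add: f_def sum_distrib_left)
    also have "\<dots> \<le> f p3 * norm \<phi>" using p3(2)[OF p] by (simp add: mult.commute mult_left_mono)
    finally show "\<bar>frechet_derivative F (at p) (\<phi>, 0)\<bar> \<le> f p3 * norm \<phi>" .
  qed (use p1 p2 in auto)
qed

text \<open>The coordinate velocity \<open>h\<close> is a measurable function, and \<open>z\<^sub>0\<close> is an essential cluster value of it
  at 0. The lemma says that all velocities near time 0 agree with \<open>z\<^sub>0\<close> about the sign of the gradient in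
  direction \<open>w\<close>.

  Let \<open>N t\<close> be the unit gradient at time \<open>t\<close> and \<open>n0\<close> the one at \<open>z\<^sub>0\<close>. If the claim fails, then every
  interval \<open>[0, s]\<close> contains a set \<open>Bd\<close> of positive measure \<open>b\<close> on which \<open>N\<close> stays away from \<open>n0\<close>, so
  that \<open>1 - N \<bullet> n0 \<ge> \<kappa>1\<close>. As \<open>z\<^sub>0\<close> is a cluster value, it also contains a set \<open>Gd\<close> of positive
  measure \<open>a\<close> on which \<open>N\<close> is close to \<open>n0\<close>. Let \<open>Rd\<close> be the remainder. The velocity variation

    \<open>u = (N - n0) / b\<close> on \<open>Bd\<close>, \<open>u = V / a\<close> on \<open>Gd\<close>, \<open>u = l N\<close> on \<open>Rd\<close>

  has integral 0 if \<open>V\<close> is minus the sum of the integrals \<open>S\<close> and \<open>R\<close> over \<open>Bd\<close> and \<open>Rd\<close>. It increases \<open>F\<close>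
  everywhere: \<open>N \<bullet> (N - n0) = 1 - N \<bullet> n0\<close> is positive on \<open>Bd\<close>, and \<open>V \<bullet> n0\<close> is positive because
  \<open>S \<bullet> n0 \<le> - \<kappa>1\<close> while \<open>R\<close> is small. For small \<open>s\<close> the gain, of order \<open>1/s\<close> on \<open>Bd\<close> and \<open>Gd\<close>, exceeds
  the loss from the displacement, whose norm is at most 6. Since \<open>u\<close> has integral 0, both endpoints
  are fixed, and \<open>variation_cost\<close> makes the cost between them negative.\<close>

lemma essential_gradient_sign:
  assumes \<gamma>: "AC_curve (atlas M) 0 1 \<gamma>"
    and ll: "AE t in lebesgue_on {0..1}. Lag M (\<gamma> t) (velocity (atlas M) \<gamma> t) = 0"
    and s0: "0 < s\<^sub>0" "s\<^sub>0 < 1" and dom: "\<gamma> ` {0..s\<^sub>0} \<subseteq> dom_of d"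
    and Z: "compact Z" "Z \<subseteq> slit_bundle d" "Z \<subseteq> cone_chart M d" "\<And>p. p \<in> Z \<Longrightarrow> F p = 0"
    and h: "AE t in lebesgue. 0 < t \<and> t < s\<^sub>0 \<longrightarrow> ((map_of_chart d \<circ> \<gamma>) has_vector_derivative h t) (at t) \<and>
       (map_of_chart d (\<gamma> t), h t) \<in> Z" and hb: "h \<in> borel_measurable borel"
    and c0: "cost M (\<gamma> 0) (\<gamma> 1) \<ge> 0"
    and z0: "(map_of_chart d (\<gamma> 0), z\<^sub>0) \<in> Z"
      "\<And>s e. 0 < s \<Longrightarrow> s \<le> s\<^sub>0 \<Longrightarrow> 0 < e \<Longrightarrow> \<not> (AE t in lebesgue. 0 < t \<and> t < s \<longrightarrow> e \<le> norm (h t - z\<^sub>0))"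
    and w: "grad (map_of_chart d (\<gamma> 0), z\<^sub>0) \<bullet> w < 0"
  shows "\<exists>c>0. \<exists>s. 0 < s \<and> s \<le> s\<^sub>0 \<and> (AE t in lebesgue. 0 < t \<and> t < s \<longrightarrow> grad (map_of_chart d (\<gamma> t), h t) \<bullet> w \<le> - c)"
proof (rule ccontr)
  assume contr: "\<not> ?thesis"
  define g where "g = map_of_chart d \<circ> \<gamma>"
  have c\<gamma>: "continuous_on {0..1} \<gamma>" using \<gamma> by (simp add: AC_curve_def)
  have cg: "continuous_on {0..s\<^sub>0} g"
    unfolding g_def using s0 dom by (intro continuous_on_compose continuous_on_subset[OF c\<gamma>] continuous_on_subset[OF chart_continuous(1)[OF ch]]) auto
  obtain m M' K where mK: "m > 0" "K \<ge> 0" "\<And>p. p \<in> Z \<Longrightarrow> m \<le> norm (grad p) \<and> norm (grad p) \<le> M'"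
    "\<And>p \<phi>. p \<in> Z \<Longrightarrow> \<bar>frechet_derivative F (at p) (\<phi>, 0)\<bar> \<le> K * norm \<phi>"
    using derivative_bounds[OF Z(1,2)] z0(1) by (metis empty_iff)
  let ?p0 = "(map_of_chart d (\<gamma> 0), z\<^sub>0)"
  \<comment> \<open>The unit gradient; cut off outside Z, it is a Borel function on the whole space.\<close>
  define H where "H p = indicator Z p *\<^sub>R sgn (grad p)" for p
  have H: "norm (H p) = 1" "grad p \<bullet> H p = norm (grad p)" "grad p = norm (grad p) *\<^sub>R H p" if "p \<in> Z" for p
  proof -
    have "grad p \<noteq> 0" using grad_nonzero Z(2) that by blast
    then show "norm (H p) = 1" "grad p \<bullet> H p = norm (grad p)" "grad p = norm (grad p) *\<^sub>R H p"
      using that by (auto simp: H_def norm_sgn sgn_div_norm dot_square_norm power2_eq_square)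
  qed
  define n0 where "n0 = H ?p0"
  have n0: "norm n0 = 1" using H(1)[OF z0(1)] by (simp add: n0_def)
  define \<beta> where "\<beta> = - (n0 \<bullet> w) / 2"
  have \<beta>: "\<beta> > 0"
  proof -
    have "norm (grad ?p0) * (n0 \<bullet> w) < 0" using w H(3)[OF z0(1)] by (metis inner_scaleR_left n0_def)
    then show ?thesis using mK(1,3)[OF ] z0(1) by (auto simp: \<beta>_def mult_less_0_iff)
  qed
  have wn: "norm w > 0" using \<beta> by (auto simp: \<beta>_def)
  define \<kappa>0 where "\<kappa>0 = \<beta> / norm w"
  define \<kappa>1 where "\<kappa>1 = \<kappa>0\<^sup>2 / 2"
  have k0: "\<kappa>0 > 0" and k1: "\<kappa>1 > 0" using \<beta> wn by (auto simp: \<kappa>0_def \<kappa>1_def)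
  \<comment> \<open>The radius of the neighbourhood of n0 that defines Gd: it keeps Gd disjoint from Bd and costs at
      most half of V \<bullet> n0.\<close>
  define \<eta> where "\<eta> = min \<kappa>0 (\<kappa>1 / 8)"
  have eta: "\<eta> > 0" "\<eta> \<le> \<kappa>0" "\<eta> \<le> \<kappa>1 / 8" using k0 k1 by (auto simp: \<eta>_def)
  \<comment> \<open>On Rd the gain is at least l m, which has to exceed the loss 6 K by 1.\<close>
  define l where "l = (6 * K + 1) / m"
  have l: "l > 0" "l * m = 6 * K + 1" using mK(1,2) by (auto simp: l_def)
  \<comment> \<open>The conditions on s: |R| is at most l s, to be dominated by 1/2 and \<kappa>1 / 4; and the gain
      m \<kappa>1 / (4 s) on Bd and Gd has to exceed 6 K + 1.\<close>
  define s where "s = Min {s\<^sub>0, 1 / (2 * l), \<kappa>1 / (4 * l), m * \<kappa>1 / (4 * (6 * K + 1))}"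
  have s: "s > 0" "s \<le> s\<^sub>0" "s \<le> 1 / (2 * l)" "s \<le> \<kappa>1 / (4 * l)" "s \<le> m * \<kappa>1 / (4 * (6 * K + 1))"
    using s0 l(1) k1 mK(1,2) by (auto simp: s_def)
  have ls: "l * s \<le> 1/2" "l * s \<le> \<kappa>1 / 4" using s(3,4) l(1) by (auto simp: field_simps)
  have msk: "m * \<kappa>1 / 4 / s \<ge> 6 * K + 1" using s(1,5) mK(1,2) by (auto simp: field_simps)
  have s1: "s < 1" using s(2) s0 by simp
  \<comment> \<open>The lifted curve; its base point is set to 0 outside the parameter interval, for measurability on
      the whole line.\<close>
  define P where "P t = ((if t \<in> {0..s\<^sub>0} then g t else 0), h t)" for t
  have Pm: "P \<in> borel_measurable borel"
  proof -
    have "(\<lambda>t. indicator {0..s\<^sub>0} t *\<^sub>R g t) \<in> borel_measurable borel"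
      using cg by (intro borel_measurable_continuous_on_indicator) auto
    moreover have "(\<lambda>t. indicator {0..s\<^sub>0} t *\<^sub>R g t) = (\<lambda>t. if t \<in> {0..s\<^sub>0} then g t else 0)" by auto
    ultimately show ?thesis unfolding P_def using hb by (simp add: borel_measurable_Pair)
  qed
  have Pg: "P t = (map_of_chart d (\<gamma> t), h t)" if "0 \<le> t" "t \<le> s" for t using that s(2) by (simp add: P_def g_def)
  have Zb: "Z \<in> sets borel" using Z(1) by (simp add: borel_closed compact_imp_closed)
  have Hm: "H \<in> borel_measurable borel"
    unfolding H_def using Z(2) grad_nonzero
    by (intro borel_measurable_continuous_on_indicator[OF Zb] continuous_on_sgn continuous_on_subset[OF grad_continuous Z(2)]) auto
  define N where "N t = H (P t)" for t
  have Nm: "N \<in> borel_measurable borel" unfolding N_def using Hm Pm by measurable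
  have ZPm: "{t. P t \<in> Z} \<in> sets borel" using measurable_sets_borel[OF Pm Zb] by (simp add: vimage_def)
  define Bd where "Bd = {t \<in> {0<..<s}. P t \<in> Z \<and> - (N t \<bullet> w) < \<beta>}"
  define Gd where "Gd = {t \<in> {0<..<s}. P t \<in> Z \<and> norm (N t - n0) < \<eta>}"
  define Rd where "Rd = {0<..<s} - Bd - Gd"
  have Bm: "Bd \<in> sets borel"
  proof -
    have "{t. - (N t \<bullet> w) < \<beta>} \<in> sets borel" using Nm by measurable
    then have "{0<..<s} \<inter> {t. P t \<in> Z} \<inter> {t. - (N t \<bullet> w) < \<beta>} \<in> sets borel" using ZPm by (intro sets.Int) auto
    then show ?thesis by (simp add: Bd_def Int_def conj_assoc)
  qed
  have Gm: "Gd \<in> sets borel"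
  proof -
    have "{t. norm (N t - n0) < \<eta>} \<in> sets borel" using Nm by measurable
    then have "{0<..<s} \<inter> {t. P t \<in> Z} \<inter> {t. norm (N t - n0) < \<eta>} \<in> sets borel" using ZPm by (intro sets.Int) auto
    then show ?thesis by (simp add: Gd_def Int_def conj_assoc)
  qed
  have Rm: "Rd \<in> sets borel" using Bm Gm by (simp add: Rd_def)
  have sub: "Bd \<subseteq> {0..s}" "Gd \<subseteq> {0..s}" "Rd \<subseteq> {0..s}" by (auto simp: Bd_def Gd_def Rd_def)
  have N1: "norm (N t) = 1" "P t \<in> Z" if "t \<in> Bd \<or> t \<in> Gd" for t
    using H(1)[of "P t"] that by (auto simp: N_def Bd_def Gd_def)
  have N1': "norm (N t) \<le> 1" for t using H(1)[of "P t"] by (cases "P t \<in> Z") (auto simp: N_def H_def)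
  have half: "1 - N t \<bullet> n0 = (norm (N t - n0))\<^sup>2 / 2" if "norm (N t) = 1" for t
  proof -
    have "(norm (N t - n0))\<^sup>2 = N t \<bullet> N t - 2 * (N t \<bullet> n0) + n0 \<bullet> n0"
      by (simp add: power2_norm_eq_inner inner_diff_left inner_diff_right inner_commute[of n0 "N t"])
    moreover have "N t \<bullet> N t = 1" "n0 \<bullet> n0 = 1" using that n0 by (simp_all add: norm_eq_1)
    ultimately show ?thesis by simp
  qed
  have bad: "norm (N t - n0) \<ge> \<kappa>0" "1 - N t \<bullet> n0 \<ge> \<kappa>1" if "t \<in> Bd" for t
  proof -
    have "\<beta> < (N t - n0) \<bullet> w" using that by (simp add: Bd_def \<beta>_def inner_diff_left)
    also have "\<dots> \<le> norm (N t - n0) * norm w" by (rule norm_cauchy_schwarz)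
    finally show 1: "norm (N t - n0) \<ge> \<kappa>0" using wn by (simp add: \<kappa>0_def field_simps)
    have "\<kappa>0\<^sup>2 \<le> (norm (N t - n0))\<^sup>2" using 1 k0 by (intro power_mono) auto
    then show "1 - N t \<bullet> n0 \<ge> \<kappa>1" using half N1(1) that by (simp add: \<kappa>1_def)
  qed
  have disj: "Bd \<inter> Gd = {}" using bad(1) eta(2) by (fastforce simp: Gd_def)
  have inZ: "AE t in lebesgue. 0 < t \<and> t < s \<longrightarrow> P t \<in> Z"
    using h by eventually_elim (use s(2) Pg in auto)
  \<comment> \<open>Otherwise the claim would hold with this s.\<close>
  have posB: "measure lborel Bd > 0"
  proof (rule ccontr)
    assume "\<not> measure lborel Bd > 0"
    then have "measure lborel Bd = 0" by (simp add: zero_less_measure_iff)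
    moreover have "emeasure lborel Bd \<le> emeasure lborel {0..s}" using Bm sub by (intro emeasure_mono) auto
    then have "emeasure lborel Bd \<noteq> \<infinity>" using s(1) by (auto simp: top_unique)
    ultimately have "Bd \<in> null_sets lborel" using Bm by (simp add: null_sets_def emeasure_eq_ennreal_measure)
    then have "AE t in lebesgue. t \<notin> Bd" by (intro AE_not_in null_sets_completionI)
    then have "AE t in lebesgue. 0 < t \<and> t < s \<longrightarrow> grad (map_of_chart d (\<gamma> t), h t) \<bullet> w \<le> - (m * \<beta>)"
      using inZ
    proof eventually_elim
      case (elim t)
      show ?case
      proof
        assume t: "0 < t \<and> t < s"
        then have pz: "P t \<in> Z" using elim by simp
        have "\<beta> \<le> - (N t \<bullet> w)" using elim t pz by (auto simp: Bd_def)
        moreover have "grad (P t) \<bullet> w = norm (grad (P t)) * (N t \<bullet> w)" using H(3)[OF pz] by (metis N_def inner_scaleR_left)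
        moreover have "m * \<beta> \<le> norm (grad (P t)) * \<beta>" using mK(3)[OF pz] \<beta> by (intro mult_right_mono) auto
        moreover have "norm (grad (P t)) * \<beta> \<le> norm (grad (P t)) * - (N t \<bullet> w)" using calculation(1) by (intro mult_left_mono) auto
        ultimately show "grad (map_of_chart d (\<gamma> t), h t) \<bullet> w \<le> - (m * \<beta>)" using Pg[of t] t by simp
      qed
    qed
    moreover have "m * \<beta> > 0" using mK(1) \<beta> by simp
    ultimately show False using contr s(1,2) by blast
  qed
  \<comment> \<open>Otherwise z0 would not be an essential cluster value.\<close>
  have posG: "measure lborel Gd > 0"
  proof (rule ccontr)
    assume "\<not> measure lborel Gd > 0"
    then have "measure lborel Gd = 0" by (simp add: zero_less_measure_iff)
    moreover have "emeasure lborel Gd \<le> emeasure lborel {0..s}" using Gm sub by (intro emeasure_mono) auto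
    then have "emeasure lborel Gd \<noteq> \<infinity>" using s(1) by (auto simp: top_unique)
    ultimately have "Gd \<in> null_sets lborel" using Gm by (simp add: null_sets_def emeasure_eq_ennreal_measure)
    then have AEG: "AE t in lebesgue. t \<notin> Gd" by (intro AE_not_in null_sets_completionI)
    have "continuous_on Z H"
    proof (rule continuous_on_eq)
      show "continuous_on Z (\<lambda>p. sgn (grad p))" using Z(2) grad_nonzero
        by (intro continuous_on_sgn continuous_on_subset[OF grad_continuous Z(2)]) auto
    qed (simp add: H_def)
    then obtain e where e: "e > 0" "\<And>p. p \<in> Z \<Longrightarrow> dist p ?p0 < e \<Longrightarrow> dist (H p) n0 < \<eta>"
      using z0(1) eta(1) unfolding continuous_on_iff n0_def by metis
    have "e / 2 > 0" using e(1) by simp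
    then obtain e1 where e1: "e1 > 0" "\<And>t. t \<in> {0..s\<^sub>0} \<Longrightarrow> dist t 0 < e1 \<Longrightarrow> dist (g t) (g 0) < e / 2"
      using cg s0 unfolding continuous_on_iff by (metis atLeastAtMost_iff less_imp_le order_refl)
    have "AE t in lebesgue. 0 < t \<and> t < min s e1 \<longrightarrow> e / 2 \<le> norm (h t - z\<^sub>0)"
      using AEG inZ
    proof eventually_elim
      case (elim t)
      show ?case
      proof
        assume t: "0 < t \<and> t < min s e1"
        then have pz: "P t \<in> Z" "t \<notin> Gd" using elim by auto
        then have "\<not> dist (H (P t)) n0 < \<eta>" using t by (auto simp: Gd_def N_def dist_norm)
        then have "dist (P t) ?p0 \<ge> e" using e(2)[OF pz(1)] by force
        also have "dist (P t) ?p0 \<le> dist (g t) (g 0) + dist (h t) z\<^sub>0"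
          using t s(2) norm_Pair_le[of "g t - g 0" "h t - z\<^sub>0"] by (simp add: P_def dist_norm g_def)
        finally show "e / 2 \<le> norm (h t - z\<^sub>0)" using e1(2)[of t] t s(2) by (simp add: dist_norm)
      qed
    qed
    moreover have "min s e1 > 0" "min s e1 \<le> s\<^sub>0" "e / 2 > 0" using s(1,2) e1(1) e(1) by auto
    ultimately show False using z0(2) by blast
  qed
  have leS: "measure lborel A \<le> s" if "A \<subseteq> {0..s}" "A \<in> sets borel" for A
  proof -
    have "measure lborel A \<le> measure lborel {0..s}" using that s(1) by (intro measure_mono_fmeasurable) (auto simp: fmeasurable_def)
    then show ?thesis using s(1) by simp
  qed
  have ind: "integrable lborel (indicat_real A)" if "A \<in> sets borel" "A \<subseteq> {0..s}" for A
    using integral_over_bounded_set(3)[OF that borel_measurable_const, of "0::real" 0] by simp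
  define a b where "a = measure lborel Gd" and "b = measure lborel Bd"
  have ab: "a > 0" "b > 0" "a \<le> s" "b \<le> s" using posB posG leS sub Bm Gm by (auto simp: a_def b_def)
  define S where "S = (LINT t|lborel. indicator Bd t *\<^sub>R ((N t - n0) /\<^sub>R b))"
  define R where "R = (LINT t|lborel. indicator Rd t *\<^sub>R (l *\<^sub>R N t))"
  define V where "V = - (S + R)"
  have nb2: "norm ((N t - n0) /\<^sub>R b) \<le> 2 / b" for t
  proof -
    have "norm (N t - n0) \<le> 2" using norm_triangle_ineq4[of "N t" n0] N1'[of t] n0 by simp
    then have "norm (N t - n0) / b \<le> 2 / b" using ab(2) by (intro divide_right_mono) auto
    then show ?thesis using ab(2) by (simp add: divide_inverse mult.commute)
  qed
  have mB: "(\<lambda>t. (N t - n0) /\<^sub>R b) \<in> borel_measurable borel" "(\<lambda>t. l *\<^sub>R N t) \<in> borel_measurable borel" using Nm by measurable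
  have iB: "integrable lborel (\<lambda>t. indicator Bd t *\<^sub>R ((N t - n0) /\<^sub>R b))" "norm S \<le> 2 / b * measure lborel Bd"
    unfolding S_def using integral_over_bounded_set[OF Bm sub(1) mB(1), of "2/b"] nb2 ab(2) by auto
  have iR: "integrable lborel (\<lambda>t. indicator Rd t *\<^sub>R (l *\<^sub>R N t))" "norm R \<le> l * measure lborel Rd"
    unfolding R_def using integral_over_bounded_set[OF Rm sub(3) mB(2), of l] N1' l(1) by auto
  have iG: "integrable lborel (\<lambda>t. indicator Gd t *\<^sub>R (V /\<^sub>R a))"
    using integral_over_bounded_set(1)[OF Gm sub(2), of "\<lambda>_. V /\<^sub>R a" "norm (V /\<^sub>R a)"] by simp
  have nS: "norm S \<le> 2" using iB(2) ab(2) by (simp add: b_def)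
  have nR: "norm R \<le> l * s" using iR(2) leS[OF sub(3) Rm] l(1) by (meson mult_left_mono less_imp_le order_trans)
  have nV: "norm V \<le> 3" unfolding V_def norm_minus_cancel using norm_triangle_ineq[of S R] nS nR ls(1) by linarith
  have Sn0: "S \<bullet> n0 \<le> - \<kappa>1"
  proof -
    have "S \<bullet> n0 = (LINT t|lborel. (indicator Bd t *\<^sub>R ((N t - n0) /\<^sub>R b)) \<bullet> n0)"
      unfolding S_def using iB(1) by (rule integral_inner_left[symmetric])
    also have "\<dots> \<le> (LINT t|lborel. (- \<kappa>1 / b) * indicat_real Bd t)"
    proof (rule integral_mono)
      show "integrable lborel (\<lambda>t. (indicator Bd t *\<^sub>R ((N t - n0) /\<^sub>R b)) \<bullet> n0)" using iB(1) by (rule integrable_inner_left)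
      show "integrable lborel (\<lambda>t. (- \<kappa>1 / b) * indicat_real Bd t)"
        using integral_over_bounded_set(3)[OF Bm sub(1) mB(1), of "2/b"] nb2 ab(2) by (intro integrable_mult_right) auto
      fix t
      show "(indicator Bd t *\<^sub>R ((N t - n0) /\<^sub>R b)) \<bullet> n0 \<le> (- \<kappa>1 / b) * indicat_real Bd t"
      proof (cases "t \<in> Bd")
        case True
        have "(N t - n0) \<bullet> n0 \<le> - \<kappa>1" using bad(2)[OF True] n0 by (simp add: inner_diff_left dot_square_norm)
        then have "((N t - n0) \<bullet> n0) / b \<le> - \<kappa>1 / b" using ab(2) by (intro divide_right_mono) auto
        then show ?thesis using True by (simp add: divide_inverse mult.commute)
      qed simp
    qed
    also have "\<dots> = - \<kappa>1" using ab(2) Bm by (simp add: b_def)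
    finally show ?thesis .
  qed
  have Vn0: "V \<bullet> n0 \<ge> 3 * \<kappa>1 / 4"
  proof -
    have "\<bar>R \<bullet> n0\<bar> \<le> norm R * norm n0" by (rule Cauchy_Schwarz_ineq2)
    then have "\<bar>R \<bullet> n0\<bar> \<le> \<kappa>1 / 4" using nR n0 ls(2) by simp
    then show ?thesis using Sn0 by (simp add: V_def inner_diff_left)
  qed
  define u where "u t = indicator Bd t *\<^sub>R ((N t - n0) /\<^sub>R b) + indicator Gd t *\<^sub>R (V /\<^sub>R a) + indicator Rd t *\<^sub>R (l *\<^sub>R N t)" for t
  have iu: "integrable lborel u" unfolding u_def using iB(1) iG iR(1) by (intro Bochner_Integration.integrable_add)
  have u0: "(LINT t|lborel. u t) = 0"
  proof -
    have "(LINT t|lborel. indicator Gd t *\<^sub>R (V /\<^sub>R a)) = (LINT t|lborel. indicat_real Gd t) *\<^sub>R (V /\<^sub>R a)"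
      using ind[OF Gm sub(2)] by (intro integral_scaleR_left) auto
    also have "(LINT t|lborel. indicat_real Gd t) = a" using Gm by (simp add: a_def)
    also have "a *\<^sub>R (V /\<^sub>R a) = V" using ab(1) by simp
    finally have VG: "(LINT t|lborel. indicator Gd t *\<^sub>R (V /\<^sub>R a)) = V" .
    have "(LINT t|lborel. u t) = S + (LINT t|lborel. indicator Gd t *\<^sub>R (V /\<^sub>R a)) + R"
      unfolding u_def S_def R_def using iB(1) iG iR(1)
      by (simp only: Bochner_Integration.integral_add Bochner_Integration.integrable_add)
    then show ?thesis unfolding VG by (simp add: V_def)
  qed
  have uout: "u t = 0" if "t \<notin> {0<..<s}" for t using that by (auto simp: u_def Bd_def Gd_def Rd_def)
  \<comment> \<open>A majorant of |u| with integral at most 2 + 3 + 1, which bounds the displacement.\<close>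
  define v where "v t = 2 / b * indicat_real Bd t + 3 / a * indicat_real Gd t + l * indicat_real Rd t" for t
  have uv: "norm (u t) \<le> v t" for t
  proof -
    have "norm (u t) \<le> norm (indicator Bd t *\<^sub>R ((N t - n0) /\<^sub>R b)) + norm (indicator Gd t *\<^sub>R (V /\<^sub>R a)) + norm (indicator Rd t *\<^sub>R (l *\<^sub>R N t))"
      unfolding u_def by (meson norm_triangle_le add_mono order_refl norm_triangle_ineq)
    also have "\<dots> \<le> v t"
      unfolding v_def
    proof (intro add_mono)
      show "norm (indicator Bd t *\<^sub>R ((N t - n0) /\<^sub>R b)) \<le> 2 / b * indicat_real Bd t" using nb2[of t] by (auto split: split_indicator)
      show "norm (indicator Gd t *\<^sub>R (V /\<^sub>R a)) \<le> 3 / a * indicat_real Gd t" using nV ab(1) by (auto split: split_indicator simp: field_simps)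
      show "norm (indicator Rd t *\<^sub>R (l *\<^sub>R N t)) \<le> l * indicat_real Rd t" using N1'[of t] l(1) by (auto split: split_indicator)
    qed
    finally show ?thesis .
  qed
  have iv: "integrable lborel v" unfolding v_def
    using ind Bm Gm Rm sub by (intro Bochner_Integration.integrable_add integrable_mult_right) auto
  have v6: "(LINT t|lborel. v t) \<le> 6"
  proof -
    have "(LINT t|lborel. v t) = 2 / b * measure lborel Bd + 3 / a * measure lborel Gd + l * measure lborel Rd"
      unfolding v_def using ind Bm Gm Rm sub by simp
    also have "\<dots> = 5 + l * measure lborel Rd" using ab by (simp add: a_def b_def)
    also have "l * measure lborel Rd \<le> l * s" using leS[OF sub(3) Rm] l(1) by simp
    finally show ?thesis using ls(1) by linarith
  qed
  have v0: "v t \<ge> 0" for t unfolding v_def using ab l(1) by (auto split: split_indicator)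
  obtain \<Phi> where \<Phi>: "\<And>p q. p \<le> q \<Longrightarrow> (u has_integral (\<Phi> q - \<Phi> p)) {p..q}" "\<And>q. 0 \<le> q \<Longrightarrow> \<Phi> q = integral {0..q} u"
    using primitive_exists[OF iu] uout by (metis greaterThanLessThan_iff not_le)
  define \<phi> where "\<phi> t = \<Phi> t - \<Phi> s" for t
  have \<phi>1: "\<And>p q. p \<le> q \<Longrightarrow> (u has_integral (\<phi> q - \<phi> p)) {p..q}" using \<Phi>(1) by (simp add: \<phi>_def)
  have \<phi>s: "\<phi> s = 0" by (simp add: \<phi>_def)
  have \<phi>0: "\<phi> 0 = 0"
  proof -
    have "(u has_integral 0) UNIV" using has_integral_integral_lborel[OF iu] u0 by simp
    moreover have "(\<lambda>x. if x \<in> {0..s} then u x else 0) = u" using uout by (force simp: fun_eq_iff)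
    ultimately have "(u has_integral 0) {0..s}" by (metis has_integral_restrict_UNIV)
    from has_integral_unique[OF \<Phi>(1)[OF less_imp_le[OF s(1)]] this]
    show ?thesis by (simp add: \<phi>_def)
  qed
  have \<phi>6: "norm (\<phi> t) \<le> 6" if "t \<le> s" for t
  proof -
    have "((\<lambda>x. if x \<in> {t..s} then u x else 0) has_integral (- \<phi> t)) UNIV"
      unfolding has_integral_restrict_UNIV using \<phi>1[OF that] \<phi>s by simp
    moreover have ii: "integrable lborel (\<lambda>x. indicator {t..s} x *\<^sub>R u x)"
      using iu by (intro integrable_mult_indicator) auto
    moreover have "(\<lambda>x. indicator {t..s} x *\<^sub>R u x) = (\<lambda>x. if x \<in> {t..s} then u x else 0)" by auto
    ultimately have "- \<phi> t = (LINT x|lborel. indicator {t..s} x *\<^sub>R u x)"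
      using has_integral_integral_lborel[OF ii] has_integral_unique by metis
    then have "norm (\<phi> t) = norm (LINT x|lborel. indicator {t..s} x *\<^sub>R u x)" by (metis norm_minus_cancel)
    also have "\<dots> \<le> (LINT x|lborel. norm (indicator {t..s} x *\<^sub>R u x))" by (rule integral_norm_bound)
    also have "\<dots> \<le> (LINT x|lborel. v x)"
      using ii iv uv v0 by (intro integral_mono integrable_norm) (auto split: split_indicator)
    finally show ?thesis using v6 by linarith
  qed
  define bb where "bb = 2 / b + 3 / a + l + 6"
  have ubb: "norm (u t) \<le> bb" for t
  proof -
    have "v t \<le> 2 / b + 3 / a + l" unfolding v_def using ab l(1) by (intro add_mono) (auto split: split_indicator)
    then show ?thesis using uv[of t] by (simp add: bb_def)
  qed
  have main: "AE t in lebesgue. 0 < t \<and> t < s \<longrightarrow> frechet_derivative F (at (map_of_chart d (\<gamma> t), h t)) (\<phi> t, u t) \<ge> 1"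
    using inZ
  proof eventually_elim
    case (elim t)
    show ?case
    proof
      assume t: "0 < t \<and> t < s"
      then have pz: "P t \<in> Z" using elim by simp
      have nu: "norm (N t) = 1" using H(1)[OF pz] by (simp add: N_def)
      have gm: "m \<le> norm (grad (P t))" using mK(3)[OF pz] by simp
      have gu: "grad (P t) \<bullet> x = norm (grad (P t)) * (N t \<bullet> x)" for x using H(3)[OF pz] by (metis N_def inner_scaleR_left)
      have "\<bar>frechet_derivative F (at (P t)) (\<phi> t, 0)\<bar> \<le> K * norm (\<phi> t)" by (rule mK(4)[OF pz])
      also have "\<dots> \<le> K * 6" using \<phi>6[of t] t mK(2) by (intro mult_left_mono) auto
      finally have low: "frechet_derivative F (at (P t)) (\<phi> t, 0) \<ge> - (6 * K)" by linarith
      have big: "m * (\<kappa>1 / 4) / s \<ge> 6 * K + 1" using msk by simp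
      have "grad (P t) \<bullet> u t \<ge> 6 * K + 1"
      proof -
        consider "t \<in> Bd" | "t \<in> Gd" | "t \<in> Rd" using t by (auto simp: Rd_def)
        then show ?thesis
        proof cases
          case 1
          then have "t \<notin> Gd" "t \<notin> Rd" using disj by (auto simp: Rd_def)
          then have u: "u t = (N t - n0) /\<^sub>R b" using 1 by (simp add: u_def)
          have "\<kappa>1 / 4 / s \<le> \<kappa>1 / b" using ab k1 by (intro frac_le) auto
          also have "\<dots> \<le> (1 - N t \<bullet> n0) / b" using bad(2)[OF 1] ab(2) by (intro divide_right_mono) auto
          also have "\<dots> = N t \<bullet> u t" using nu by (simp add: u inner_diff_right dot_square_norm divide_inverse_commute)
          finally have "\<kappa>1 / 4 / s \<le> N t \<bullet> u t" .
          then have "m * (\<kappa>1 / 4 / s) \<le> norm (grad (P t)) * (N t \<bullet> u t)" using gm mK(1) k1 s(1) by (intro mult_mono) auto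
          then show ?thesis using big gu by simp
        next
          case 2
          then have "t \<notin> Bd" "t \<notin> Rd" using disj by (auto simp: Rd_def)
          then have u: "u t = V /\<^sub>R a" using 2 by (simp add: u_def)
          have "\<bar>(N t - n0) \<bullet> V\<bar> \<le> norm (N t - n0) * norm V" by (rule Cauchy_Schwarz_ineq2)
          also have "\<dots> \<le> (\<kappa>1 / 8) * 3" using 2 eta(3) nV k1 by (intro mult_mono) (auto simp: Gd_def)
          finally have "\<bar>N t \<bullet> V - n0 \<bullet> V\<bar> \<le> 3 * \<kappa>1 / 8" by (simp add: inner_diff_left)
          moreover have "n0 \<bullet> V \<ge> 3 * \<kappa>1 / 4" using Vn0 by (simp add: inner_commute)
          ultimately have "N t \<bullet> V \<ge> \<kappa>1 / 4" using k1 by linarith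
          then have "\<kappa>1 / 4 / s \<le> (N t \<bullet> V) / a" using ab k1 by (intro frac_le) auto
          also have "\<dots> = N t \<bullet> u t" by (simp add: u divide_inverse_commute)
          finally have "m * (\<kappa>1 / 4 / s) \<le> norm (grad (P t)) * (N t \<bullet> u t)" using gm mK(1) k1 s(1) by (intro mult_mono) auto
          then show ?thesis using big gu by simp
        next
          case 3
          then have "t \<notin> Bd" "t \<notin> Gd" by (auto simp: Rd_def)
          then have u: "u t = l *\<^sub>R N t" using 3 by (simp add: u_def)
          have "6 * K + 1 = m * l" using l(2) by (simp add: mult.commute)
          also have "\<dots> \<le> norm (grad (P t)) * l" using gm l(1) by simp
          also have "\<dots> = grad (P t) \<bullet> u t" using nu by (simp add: gu u dot_square_norm)
          finally show ?thesis .
        qed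
      qed
      then have "frechet_derivative F (at (P t)) (\<phi> t, u t) \<ge> 1"
        using DF_split[OF subsetD[OF Z(2) pz], of "\<phi> t" "u t"] low by simp
      then show "frechet_derivative F (at (map_of_chart d (\<gamma> t), h t)) (\<phi> t, u t) \<ge> 1" using Pg[of t] t by simp
    qed
  qed
  have dom': "\<gamma> ` {0..s} \<subseteq> dom_of d" using dom s(2) by auto
  have h': "AE t in lebesgue. 0 < t \<and> t < s \<longrightarrow> ((map_of_chart d \<circ> \<gamma>) has_vector_derivative h t) (at t) \<and>
       (map_of_chart d (\<gamma> t), h t) \<in> Z"
    using h by eventually_elim (use s(2) in auto)
  have \<phi>bb: "norm (\<phi> t) \<le> bb" if "t \<le> s" for t
  proof -
    have "2 / b \<ge> 0" "3 / a \<ge> 0" using ab by auto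
    then show ?thesis using \<phi>6[OF that] l(1) unfolding bb_def by linarith
  qed
  show False
  proof (rule variation_cost[OF \<gamma> ll s(1) s1 dom' Z h' zero_less_one, of bb])
  fix \<delta>0 :: real assume "\<delta>0 > 0" and \<delta>0: "\<And>u \<phi> \<delta>. (\<And>p q. p \<le> q \<Longrightarrow> (u has_integral (\<phi> q - \<phi> p)) {p..q}) \<Longrightarrow> \<phi> s = 0 \<Longrightarrow>
      (\<And>t. norm (u t) \<le> bb) \<Longrightarrow> (\<And>t. 0 \<le> t \<Longrightarrow> t \<le> s \<Longrightarrow> norm (\<phi> t) \<le> bb) \<Longrightarrow>
      (AE t in lebesgue. 0 < t \<and> t < s \<longrightarrow> frechet_derivative F (at (map_of_chart d (\<gamma> t), h t)) (\<phi> t, u t) \<ge> 1) \<Longrightarrow>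
      0 < \<delta> \<Longrightarrow> \<delta> \<le> \<delta>0 \<Longrightarrow>
      map_of_chart d (\<gamma> 0) + \<delta> *\<^sub>R \<phi> 0 \<in> range_of d \<and>
      cost M (inv_of d (map_of_chart d (\<gamma> 0) + \<delta> *\<^sub>R \<phi> 0)) (\<gamma> 1) \<le> ereal (- (s * sqrt (\<delta> * 1 / 2)))"
  have "cost M (inv_of d (map_of_chart d (\<gamma> 0) + \<delta>0 *\<^sub>R \<phi> 0)) (\<gamma> 1) \<le> ereal (- (s * sqrt (\<delta>0 * 1 / 2)))"
    using \<delta>0[OF \<phi>1 \<phi>s ubb \<phi>bb main \<open>\<delta>0 > 0\<close> order_refl] by blast
  moreover have "\<gamma> 0 \<in> dom_of d" using dom s0 by auto
  ultimately have "cost M (\<gamma> 0) (\<gamma> 1) \<le> ereal (- (s * sqrt (\<delta>0 / 2)))" using ch by (simp add: \<phi>0)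
  then have "ereal 0 \<le> ereal (- (s * sqrt (\<delta>0 / 2)))" using c0 by (metis order_trans zero_ereal_def)
  moreover have "s * sqrt (\<delta>0 / 2) > 0" using s(1) \<open>\<delta>0 > 0\<close> by simp
  ultimately show False by simp
  qed
qed

end

lemma lightlike_geodesicD:
  assumes "\<gamma> \<in> lightlike_geodesics M \<tau>"
  shows "AC_curve (atlas M) 0 1 \<gamma>" "AE t in lebesgue_on {0..1}. (\<gamma> t, velocity (atlas M) \<gamma> t) \<in> cone M"
    "AE t in lebesgue_on {0..1}. Lag M (\<gamma> t) (velocity (atlas M) \<gamma> t) = 0" "cost M (\<gamma> 0) (\<gamma> 1) = 0"
    "\<exists>k. AE t in lebesgue_on {0..1}. differential (atlas M) \<tau> (\<gamma> t) (velocity (atlas M) \<gamma> t) = k"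
proof -
  show "AC_curve (atlas M) 0 1 \<gamma>" "AE t in lebesgue_on {0..1}. (\<gamma> t, velocity (atlas M) \<gamma> t) \<in> cone M"
    and ll: "AE t in lebesgue_on {0..1}. Lag M (\<gamma> t) (velocity (atlas M) \<gamma> t) = 0"
    and "\<exists>k. AE t in lebesgue_on {0..1}. differential (atlas M) \<tau> (\<gamma> t) (velocity (atlas M) \<gamma> t) = k"
    using assms by (auto simp: lightlike_geodesics_def geodesics_def causal_curve_def)
  have "(\<integral>\<^sup>+t. e2ennreal (Lag M (\<gamma> t) (velocity (atlas M) \<gamma> t)) \<partial>lebesgue_on {0..1}) = (\<integral>\<^sup>+t. 0 \<partial>lebesgue_on {0..1::real})"
    by (rule nn_integral_cong_AE) (use ll in \<open>eventually_elim, simp add: e2ennreal_neg\<close>)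
  moreover have "(\<integral>\<^sup>+t. e2ennreal (- Lag M (\<gamma> t) (velocity (atlas M) \<gamma> t)) \<partial>lebesgue_on {0..1}) = (\<integral>\<^sup>+t. 0 \<partial>lebesgue_on {0..1::real})"
    by (rule nn_integral_cong_AE) (use ll in \<open>eventually_elim, simp add: e2ennreal_neg\<close>)
  ultimately have "action M 0 1 \<gamma> = 0" by (simp add: action_def ereal_integral_def zero_ennreal.rep_eq)
  then show "cost M (\<gamma> 0) (\<gamma> 1) = 0" using assms by (simp add: lightlike_geodesics_def geodesics_def)
qed

text \<open>The constant value of \<open>d\<tau>\<close> bounds the norm of the velocity, so the curve would be constant if it were
  not positive.\<close>

lemma lightlike_tau_velocity_positive:
  assumes lf: "lorentz_finsler M" and sp: "splitting M B \<Phi> \<tau>" and \<gamma>: "\<gamma> \<in> lightlike_geodesics M \<tau>" and ne: "\<gamma> 0 \<noteq> \<gamma> 1"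
  obtains k where "k > 0" "AE t in lebesgue_on {0..1}. differential (atlas M) \<tau> (\<gamma> t) (velocity (atlas M) \<gamma> t) = k"
proof -
  note g = lightlike_geodesicD[OF \<gamma>]
  obtain k where k: "AE t in lebesgue_on {0..1}. differential (atlas M) \<tau> (\<gamma> t) (velocity (atlas M) \<gamma> t) = k" using g(5) by blast
  note le = hnorm_le_tau[OF sp]
  have "k > 0"
  proof (rule ccontr)
    assume k0: "\<not> k > 0"
    have "AE t in lebesgue_on {0..1}. velocity (atlas M) \<gamma> t = 0"
      using k g(2)
    proof eventually_elim
      case (elim t)
      let ?v = "velocity (atlas M) \<gamma> t"
      have "hnorm M (\<gamma> t) ?v \<le> 0" using le[OF elim(2)] elim(1) k0 by simp
      then have "\<not> metric M (\<gamma> t) ?v ?v > 0" by (simp add: hnorm_def not_less)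
      then show ?case using lf by (auto simp: lorentz_finsler_def riemannian_metric_def)
    qed
    from zero_velocity_imp_equal_endpoints[OF lf g(1) this] ne show False by simp
  qed
  then show ?thesis using that k by blast
qed

context lf_chart begin

text \<open>The vector \<open>z\<^sub>0\<close> replaces the initial velocity of \<open>\<gamma>\<close>. By \<open>velocity_bounds\<close> the coordinate velocities lie
  in a compact annulus, so they have an essential cluster value at 0, and it is lightlike since the
  lightlike cone is closed. The initial piece is varied linearly: displacement \<open>(s - t) w'\<close>, velocity
  \<open>- w'\<close>. The latter raises \<open>F\<close> by \<open>essential_gradient_sign\<close>, and the former is harmless for small \<open>s\<close>.\<close>

theorem cost_drop_at_lightlike_start:
  assumes sp: "splitting M B \<Phi> \<tau>" and \<gamma>: "\<gamma> \<in> lightlike_geodesics M \<tau>" and ne: "\<gamma> 0 \<noteq> \<gamma> 1" and \<gamma>0: "\<gamma> 0 \<in> dom_of d"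
  obtains z\<^sub>0 where "z\<^sub>0 \<noteq> 0" "(map_of_chart d (\<gamma> 0), z\<^sub>0) \<in> cone_chart M d" "F (map_of_chart d (\<gamma> 0), z\<^sub>0) = 0"
    "\<And>w. grad (map_of_chart d (\<gamma> 0), z\<^sub>0) \<bullet> w < 0 \<Longrightarrow> \<exists>\<theta>>0. \<exists>C>0. \<exists>\<delta>\<^sub>0>0. \<forall>w' \<delta>. norm (w' - w) \<le> \<theta> \<longrightarrow> 0 < \<delta> \<longrightarrow> \<delta> \<le> \<delta>\<^sub>0 \<longrightarrow>
       cost M (inv_of d (map_of_chart d (\<gamma> 0) + \<delta> *\<^sub>R w')) (\<gamma> 1) \<le> ereal (- (C * sqrt \<delta>))"
proof -
  note g = lightlike_geodesicD[OF \<gamma>]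
  define gg where "gg = map_of_chart d \<circ> \<gamma>"
  define y0 where "y0 = map_of_chart d (\<gamma> 0)"
  have y0: "y0 \<in> range_of d" using \<gamma>0 ch by (simp add: y0_def)
  obtain k where k: "k > 0" "AE t in lebesgue_on {0..1}. differential (atlas M) \<tau> (\<gamma> t) (velocity (atlas M) \<gamma> t) = k"
    using lightlike_tau_velocity_positive[OF lf sp \<gamma> ne] by blast
  obtain \<rho> c1 c2 where rc: "\<rho> > 0" "c1 > 0" "cball y0 \<rho> \<subseteq> range_of d"
    "\<And>y z. y \<in> cball y0 \<rho> \<Longrightarrow> (y, z) \<in> cone_chart M d \<Longrightarrow> differential (atlas M) \<tau> (inv_of d y) (T y z) = k \<Longrightarrow>
       c1 \<le> norm z \<and> norm z \<le> c2"
    using velocity_bounds[OF sp y0 k(1)] by metis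
  have c\<gamma>: "continuous_on {0..1} \<gamma>" using g(1) by (simp add: AC_curve_def)
  define U where "U = dom_of d \<inter> map_of_chart d -` ball y0 \<rho>"
  have "open U" unfolding U_def by (rule chart_vimage_open[OF ch]) simp
  moreover have "\<gamma> 0 \<in> U" using \<gamma>0 rc(1) by (simp add: U_def y0_def)
  ultimately obtain W where W: "open W" "0 \<in> W" "\<And>t. t \<in> {0..1} \<Longrightarrow> t \<in> W \<Longrightarrow> \<gamma> t \<in> U"
    using c\<gamma>[unfolded continuous_on_topological, rule_format, of 0 U] by auto
  obtain e where e: "e > 0" "ball 0 e \<subseteq> W" using W(1,2) open_contains_ball by blast
  define s0 where "s0 = min (e/2) (1/2)"
  have s0: "0 < s0" "s0 < 1" "s0 < e" using e(1) by (auto simp: s0_def)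
  have inU: "\<gamma> t \<in> U" if "0 \<le> t" "t \<le> s0" for t
  proof (rule W(3))
    have "t \<in> ball 0 e" using that s0 by (simp add: dist_real_def)
    then show "t \<in> W" using e(2) by blast
  qed (use that s0 in auto)
  have dom: "\<gamma> ` {0..s0} \<subseteq> dom_of d" using inU by (auto simp: U_def)
  have gb: "gg t \<in> ball y0 \<rho>" if "0 \<le> t" "t \<le> s0" for t using inU[OF that] by (simp add: U_def gg_def)
  have acg: "AC_on 0 s0 gg" unfolding gg_def using g(1) d dom s0 by (auto simp: AC_curve_def)
  have cgg: "continuous_on {0..s0} gg"
    unfolding gg_def using s0 dom by (intro continuous_on_compose continuous_on_subset[OF c\<gamma>] continuous_on_subset[OF chart_continuous(1)[OF ch]]) auto
  obtain h where hb: "h \<in> borel_measurable borel" and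
    hd: "AE t in lebesgue. 0 < t \<and> t < s0 \<longrightarrow> (gg has_vector_derivative h t) (at t)"
  proof (rule AC_on_density[OF acg less_imp_le[OF s0(1)]])
    fix h assume "h \<in> borel_measurable borel" "AE t in lebesgue. 0 < t \<and> t < s0 \<longrightarrow> (gg has_vector_derivative h t) (at t)"
    then show thesis by (rule that)
  qed
  define ann where "ann = {z::'e. c1 \<le> norm z \<and> norm z \<le> c2}"
  have annc: "compact ann"
  proof -
    have "ann = cball 0 c2 - ball 0 c1" by (auto simp: ann_def)
    then show ?thesis by (simp add: compact_diff)
  qed
  define Z where "Z = (cball y0 \<rho> \<times> ann) \<inter> {p. p \<in> cone_chart M d \<and> F p = 0}"
  have box: "compact (cball y0 \<rho> \<times> ann)" using annc by (intro compact_Times) auto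
  have boxs: "cball y0 \<rho> \<times> ann \<subseteq> slit_bundle d" using rc(2,3) by (auto simp: ann_def)
  have Zc: "compact Z"
  proof -
    have "continuous_on (cball y0 \<rho> \<times> ann) F"
      by (rule continuous_on_subset[OF smooth_on_continuous[OF smooth_F] boxs])
    then have c: "closed ((cball y0 \<rho> \<times> ann) \<inter> F -` {0})"
      using compact_imp_closed[OF box] by (intro continuous_closed_preimage) auto
    have "Z = (cball y0 \<rho> \<times> ann) \<inter> (((cball y0 \<rho> \<times> ann) \<inter> F -` {0}) - {p. fst p \<in> range_of d \<and> p \<notin> cone_chart M d})"
      using rc(3) by (auto simp: Z_def)
    also have "compact \<dots>" using c cone_chart_complement_open box by (intro compact_Int_closed closed_Diff) auto
    finally show ?thesis .
  qed
  have Zs: "Z \<subseteq> slit_bundle d" using boxs by (auto simp: Z_def)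
  have Zcone: "Z \<subseteq> cone_chart M d" and Z0: "\<And>p. p \<in> Z \<Longrightarrow> F p = 0" by (auto simp: Z_def)
  note Z = Zc Zs Zcone Z0
  have k': "AE t in lebesgue. t \<in> {0..1} \<longrightarrow> differential (atlas M) \<tau> (\<gamma> t) (velocity (atlas M) \<gamma> t) = k"
    using k(2) by (subst (asm) AE_restrict_space_iff) auto
  have g2': "AE t in lebesgue. t \<in> {0..1} \<longrightarrow> (\<gamma> t, velocity (atlas M) \<gamma> t) \<in> cone M"
    using g(2) by (subst (asm) AE_restrict_space_iff) auto
  have g3': "AE t in lebesgue. t \<in> {0..1} \<longrightarrow> Lag M (\<gamma> t) (velocity (atlas M) \<gamma> t) = 0"
    using g(3) by (subst (asm) AE_restrict_space_iff) auto
  have h: "AE t in lebesgue. 0 < t \<and> t < s0 \<longrightarrow> ((map_of_chart d \<circ> \<gamma>) has_vector_derivative h t) (at t) \<and>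
       (map_of_chart d (\<gamma> t), h t) \<in> Z"
    using hd k' g2' g3'
  proof eventually_elim
    case (elim t)
    show ?case
    proof
      assume t: "0 < t \<and> t < s0"
      then have t01: "t \<in> {0..1}" using s0 by simp
      have der: "((map_of_chart d \<circ> \<gamma>) has_vector_derivative h t) (at t)" using elim(1) t by (simp add: gg_def)
      have tc: "isCont \<gamma> t" using t s0 by (intro continuous_on_interior[OF c\<gamma>]) auto
      have dt: "\<gamma> t \<in> dom_of d" using dom t by auto
      note LV = LL_velocity[OF dt tc der]
      have cone: "(gg t, h t) \<in> cone_chart M d" using LV(2) elim(3) t01 by (simp add: gg_def)
      have "Lag M (\<gamma> t) (velocity (atlas M) \<gamma> t) = 0" using elim(4) t01 by simp
      then have F0: "F (gg t, h t) = 0" using elim(3) t01 LV(1) by (simp add: Lag_def gg_def zero_ereal_def)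
      have b: "gg t \<in> cball y0 \<rho>" using gb[of t] t by auto
      have "gg t \<in> range_of d" using b rc(3) by auto
      then have "(\<gamma> t, velocity (atlas M) \<gamma> t) = (inv_of d (gg t), T (gg t) (h t))"
        using velocity_in_chart(2)[OF A d dt tc der] tangent_coordinates(1)[of "gg t" "h t"] by (simp add: gg_def)
      then have "c1 \<le> norm (h t) \<and> norm (h t) \<le> c2" using rc(4)[OF b cone] elim(2) t01 by simp
      then show "((map_of_chart d \<circ> \<gamma>) has_vector_derivative h t) (at t) \<and> (map_of_chart d (\<gamma> t), h t) \<in> Z"
        using der cone F0 b by (simp add: Z_def ann_def gg_def)
    qed
  qed
  have posm: "\<not> (AE t in lebesgue. \<not> (0 < t \<and> t < s))" if "s > 0" for s :: real
  proof
    assume "AE t in lebesgue. \<not> (0 < t \<and> t < s)"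
    then obtain N where N: "{t \<in> space lebesgue. \<not> \<not> (0 < t \<and> t < s)} \<subseteq> N" "emeasure lebesgue N = 0" "N \<in> sets lebesgue" by (rule AE_E)
    then have "emeasure lebesgue {0<..<s} \<le> emeasure lebesgue N" by (intro emeasure_mono) auto
    then show False using N(2) that by simp
  qed
  \<comment> \<open>Otherwise finitely many balls, each avoided by h almost everywhere near 0, would cover the
      annulus.\<close>
  have "\<exists>z\<in>ann. \<forall>s e. 0 < s \<longrightarrow> s \<le> s0 \<longrightarrow> 0 < e \<longrightarrow> \<not> (AE t in lebesgue. 0 < t \<and> t < s \<longrightarrow> e \<le> norm (h t - z))"
  proof (rule ccontr)
    assume "\<not> ?thesis"
    then have ex: "\<forall>z\<in>ann. \<exists>s e. 0 < s \<and> s \<le> s0 \<and> 0 < e \<and> (AE t in lebesgue. 0 < t \<and> t < s \<longrightarrow> e \<le> norm (h t - z))" by blast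
    define Q where "Q z s e \<longleftrightarrow> 0 < s \<and> s \<le> s0 \<and> 0 < e \<and> (AE t in lebesgue. 0 < t \<and> t < s \<longrightarrow> e \<le> norm (h t - z))" for z s e
    have "\<forall>z\<in>ann. \<exists>s e. Q z s e" unfolding Q_def by (rule ex)
    then obtain s e where "\<And>z. z \<in> ann \<Longrightarrow> Q z (s z) (e z)" by metis
    then have se: "0 < s z \<and> s z \<le> s0 \<and> 0 < e z \<and> (AE t in lebesgue. 0 < t \<and> t < s z \<longrightarrow> e z \<le> norm (h t - z))" if "z \<in> ann" for z
      using that unfolding Q_def by blast
    have "ann \<subseteq> (\<Union>z\<in>ann. ball z (e z))" using se by force
    then obtain D where D: "D \<subseteq> ann" "finite D" "ann \<subseteq> (\<Union>z\<in>D. ball z (e z))"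
      using compactE_image[OF annc, of ann "\<lambda>z. ball z (e z)"] by blast
    define s' where "s' = Min (insert s0 (s ` D))"
    have s': "s' > 0" using D(1,2) se s0 by (auto simp: s'_def)
    have s'le: "s' \<le> s0" "\<And>z. z \<in> D \<Longrightarrow> s' \<le> s z" using D(2) by (auto simp: s'_def)
    have "AE t in lebesgue. \<forall>z\<in>D. 0 < t \<and> t < s z \<longrightarrow> e z \<le> norm (h t - z)"
      using D(1) se by (intro AE_finite_allI[OF D(2)]) blast
    then have "AE t in lebesgue. \<not> (0 < t \<and> t < s')"
      using h
    proof eventually_elim
      case (elim t)
      show ?case
      proof
        assume t: "0 < t \<and> t < s'"
        then have "h t \<in> ann" using elim(2) s'le(1) by (auto simp: Z_def)
        then obtain z where z: "z \<in> D" "h t \<in> ball z (e z)" using D(3) by blast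
        have "e z \<le> norm (h t - z)" using elim(1) z(1) t s'le(2)[OF z(1)] by auto
        then show False using z(2) by (simp add: dist_norm norm_minus_commute)
      qed
    qed
    then show False using posm[OF s'] by blast
  qed
  then obtain z0 where z0: "z0 \<in> ann"
    "\<And>s e. 0 < s \<Longrightarrow> s \<le> s0 \<Longrightarrow> 0 < e \<Longrightarrow> \<not> (AE t in lebesgue. 0 < t \<and> t < s \<longrightarrow> e \<le> norm (h t - z0))" by blast
  have z0Z: "(y0, z0) \<in> Z"
  proof -
    have "(y0, z0) \<in> closure Z"
      unfolding closure_approachable
    proof (intro allI impI)
      fix e :: real assume e: "e > 0"
      then have "e / 2 > 0" by simp
      then obtain e1 where e1: "e1 > 0" "\<And>t. t \<in> {0..s0} \<Longrightarrow> dist t 0 < e1 \<Longrightarrow> dist (gg t) (gg 0) < e / 2"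
        using cgg s0 unfolding continuous_on_iff by (metis atLeastAtMost_iff less_imp_le order_refl)
      have "\<exists>t. 0 < t \<and> t < min s0 e1 \<and> norm (h t - z0) < e / 2 \<and> (map_of_chart d (\<gamma> t), h t) \<in> Z"
      proof (rule ccontr)
        assume no: "\<not> ?thesis"
        have "AE t in lebesgue. 0 < t \<and> t < min s0 e1 \<longrightarrow> e / 2 \<le> norm (h t - z0)"
          using h by eventually_elim (use no in force)
        then show False using z0(2)[of "min s0 e1" "e/2"] s0 e1(1) e by auto
      qed
      then obtain t where t: "0 < t" "t < min s0 e1" "norm (h t - z0) < e / 2" "(map_of_chart d (\<gamma> t), h t) \<in> Z" by blast
      have "dist (gg t, h t) (y0, z0) \<le> dist (gg t) y0 + dist (h t) z0"
        using norm_Pair_le[of "gg t - y0" "h t - z0"] by (simp add: dist_norm)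
      also have "\<dots> < e" using e1(2)[of t] t by (simp add: gg_def y0_def dist_norm)
      finally show "\<exists>p\<in>Z. dist p (y0, z0) < e" using t(4) by (auto simp: gg_def)
    qed
    then show ?thesis using compact_imp_closed[OF Zc] by simp
  qed
  have c0: "cost M (\<gamma> 0) (\<gamma> 1) \<ge> 0" using g(4) by simp
  show ?thesis
  proof (rule that[of z0])
    show "z0 \<noteq> 0" using z0(1) rc(2) by (auto simp: ann_def)
    show "(map_of_chart d (\<gamma> 0), z0) \<in> cone_chart M d" "F (map_of_chart d (\<gamma> 0), z0) = 0"
      using z0Z by (auto simp: Z_def y0_def)
    fix w assume w: "grad (map_of_chart d (\<gamma> 0), z0) \<bullet> w < 0"
    obtain c s1 where c: "c > 0" and s1: "0 < s1" "s1 \<le> s0"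
      and dir: "AE t in lebesgue. 0 < t \<and> t < s1 \<longrightarrow> grad (map_of_chart d (\<gamma> t), h t) \<bullet> w \<le> - c"
      using essential_gradient_sign[OF g(1) g(3) s0(1,2) dom Z h hb c0 z0Z[unfolded y0_def] z0(2) w] by blast
    obtain m M' K where mK: "m > 0" "K \<ge> 0" "\<And>p. p \<in> Z \<Longrightarrow> m \<le> norm (grad p) \<and> norm (grad p) \<le> M'"
      "\<And>p \<phi>. p \<in> Z \<Longrightarrow> \<bar>frechet_derivative F (at p) (\<phi>, 0)\<bar> \<le> K * norm \<phi>"
      using derivative_bounds[OF Z(1,2)] z0Z by (metis empty_iff)
    have M'0: "M' > 0" using mK(1) mK(3)[OF z0Z] by linarith
    define b where "b = norm w + 1"
    have b: "b \<ge> 1" by (simp add: b_def)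
    \<comment> \<open>The gain c in direction w is reduced by at most c / 4 when w is replaced by w' and by at most
        c / 4 through the displacement, which leaves c / 2.\<close>
    define \<theta> where "\<theta> = min 1 (c / (4 * M'))"
    define s where "s = min s1 (c / (4 * (K + 1) * b))"
    have \<theta>: "\<theta> > 0" "\<theta> \<le> 1" "M' * \<theta> \<le> c / 4" using c M'0 by (auto simp: \<theta>_def min_def field_simps)
    have s: "s > 0" "s \<le> s1" using s1 c b mK(2) by (auto simp: s_def)
    have Ks: "K * (s * b) \<le> c / 4"
    proof -
      have "s \<le> c / (4 * (K + 1) * b)" by (simp add: s_def)
      then have "s * (4 * (K + 1) * b) \<le> c" using b mK(2) by (subst (asm) pos_le_divide_eq) auto
      moreover have "K * (s * b) \<le> (K + 1) * (s * b)" using s b by (intro mult_right_mono) auto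
      ultimately show ?thesis by (simp add: algebra_simps)
    qed
    have slt: "s < 1" "s \<le> s0" using s s1 s0 by auto
    have dom': "\<gamma> ` {0..s} \<subseteq> dom_of d" using dom slt(2) by auto
    have h': "AE t in lebesgue. 0 < t \<and> t < s \<longrightarrow> ((map_of_chart d \<circ> \<gamma>) has_vector_derivative h t) (at t) \<and>
         (map_of_chart d (\<gamma> t), h t) \<in> Z"
      using h by eventually_elim (use slt(2) in auto)
    have c2: "c / 2 > 0" using c by simp
    show "\<exists>\<theta>>0. \<exists>C>0. \<exists>\<delta>\<^sub>0>0. \<forall>w' \<delta>. norm (w' - w) \<le> \<theta> \<longrightarrow> 0 < \<delta> \<longrightarrow> \<delta> \<le> \<delta>\<^sub>0 \<longrightarrow>
       cost M (inv_of d (map_of_chart d (\<gamma> 0) + \<delta> *\<^sub>R w')) (\<gamma> 1) \<le> ereal (- (C * sqrt \<delta>))"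
    proof (rule variation_cost[OF g(1) g(3) s(1) slt(1) dom' Z h' c2, of b])
      fix \<delta>0 :: real assume \<delta>0p: "\<delta>0 > 0" and \<delta>0: "\<And>u \<phi> \<delta>. (\<And>p q. p \<le> q \<Longrightarrow> (u has_integral (\<phi> q - \<phi> p)) {p..q}) \<Longrightarrow> \<phi> s = 0 \<Longrightarrow>
        (\<And>t. norm (u t) \<le> b) \<Longrightarrow> (\<And>t. 0 \<le> t \<Longrightarrow> t \<le> s \<Longrightarrow> norm (\<phi> t) \<le> b) \<Longrightarrow>
        (AE t in lebesgue. 0 < t \<and> t < s \<longrightarrow> frechet_derivative F (at (map_of_chart d (\<gamma> t), h t)) (\<phi> t, u t) \<ge> c / 2) \<Longrightarrow>
        0 < \<delta> \<Longrightarrow> \<delta> \<le> \<delta>0 \<Longrightarrow>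
        map_of_chart d (\<gamma> 0) + \<delta> *\<^sub>R \<phi> 0 \<in> range_of d \<and>
        cost M (inv_of d (map_of_chart d (\<gamma> 0) + \<delta> *\<^sub>R \<phi> 0)) (\<gamma> 1) \<le> ereal (- (s * sqrt (\<delta> * (c / 2) / 2)))"
      define C where "C = s * sqrt (c / (4 * s))"
      have C: "C > 0" using s c by (simp add: C_def)
      have ds: "\<delta>0 * s > 0" using \<delta>0p s(1) by simp
      show ?thesis
      proof (rule exI[of _ \<theta>], rule conjI[OF \<theta>(1)], rule exI[of _ C], rule conjI[OF C], rule exI[of _ "\<delta>0 * s"], rule conjI[OF ds], intro allI impI)
        fix w' \<delta> assume w': "norm (w' - w) \<le> \<theta>" and \<delta>: "0 < \<delta>" "\<delta> \<le> \<delta>0 * s"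
        define u where "u t = - w'" for t :: real
        define \<phi> where "\<phi> t = (s - t) *\<^sub>R w'" for t
        have nw: "norm w' \<le> b" using w' \<theta>(2) norm_triangle_sub[of w' w] by (simp add: b_def)
        have 1: "(u has_integral (\<phi> q - \<phi> p)) {p..q}" if "p \<le> q" for p q
          using has_integral_const_real[of "- w'" p q] that by (simp add: u_def[abs_def] \<phi>_def algebra_simps)
        have 4: "norm (\<phi> t) \<le> s * b" if "0 \<le> t" "t \<le> s" for t
        proof -
          have "norm (\<phi> t) = (s - t) * norm w'" using that by (simp add: \<phi>_def)
          also have "\<dots> \<le> s * b" using that nw by (intro mult_mono) auto
          finally show ?thesis .
        qed
        have f4': "norm (\<phi> t) \<le> b" if "0 \<le> t" "t \<le> s" for t
        proof -
          have "s * b \<le> 1 * b" using slt(1) b by (intro mult_right_mono) auto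
          then show ?thesis using 4[OF that] by simp
        qed
        have 5: "AE t in lebesgue. 0 < t \<and> t < s \<longrightarrow> frechet_derivative F (at (map_of_chart d (\<gamma> t), h t)) (\<phi> t, u t) \<ge> c / 2"
          using dir h'
        proof eventually_elim
          case (elim t)
          show ?case
          proof
            assume t: "0 < t \<and> t < s"
            define p where "p = (map_of_chart d (\<gamma> t), h t)"
            have p: "p \<in> Z" using elim(2) t by (simp add: p_def)
            have "\<bar>frechet_derivative F (at p) (\<phi> t, 0)\<bar> \<le> K * norm (\<phi> t)" by (rule mK(4)[OF p])
            also have "\<dots> \<le> K * (s * b)" using 4[of t] t mK(2) by (intro mult_left_mono) auto
            finally have a1: "frechet_derivative F (at p) (\<phi> t, 0) \<ge> - (c / 4)" using Ks by linarith
            have "\<bar>grad p \<bullet> (w' - w)\<bar> \<le> norm (grad p) * norm (w' - w)" by (rule Cauchy_Schwarz_ineq2)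
            also have "\<dots> \<le> M' * \<theta>" using mK(3)[OF p] w' M'0 by (intro mult_mono) auto
            finally have a2: "\<bar>grad p \<bullet> w' - grad p \<bullet> w\<bar> \<le> c / 4" using \<theta>(3) by (simp add: inner_diff_right)
            have a3: "grad p \<bullet> w \<le> - c" using elim(1) t s(2) by (simp add: p_def)
            have "grad p \<bullet> u t = - (grad p \<bullet> w')" by (simp add: u_def)
            then have "frechet_derivative F (at p) (\<phi> t, u t) \<ge> c / 2"
              using DF_split[OF subsetD[OF Zs p], of "\<phi> t" "u t"] a1 a2 a3 by linarith
            then show "frechet_derivative F (at (map_of_chart d (\<gamma> t), h t)) (\<phi> t, u t) \<ge> c / 2" by (simp add: p_def)
          qed
        qed
        \<comment> \<open>The displacement at time 0 is s w', so the parameter of the variation is \<delta> / s.\<close>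
        have d6: "0 < \<delta> / s" "\<delta> / s \<le> \<delta>0" using \<delta> s(1) by (auto simp: field_simps)
        have "cost M (inv_of d (map_of_chart d (\<gamma> 0) + (\<delta> / s) *\<^sub>R \<phi> 0)) (\<gamma> 1) \<le> ereal (- (s * sqrt ((\<delta> / s) * (c / 2) / 2)))"
          using \<delta>0[of u \<phi> "\<delta> / s", OF 1 _ _ f4' 5 d6] nw by (simp add: \<phi>_def u_def)
        moreover have "(\<delta> / s) *\<^sub>R \<phi> 0 = \<delta> *\<^sub>R w'" using s(1) by (simp add: \<phi>_def)
        moreover have "s * sqrt ((\<delta> / s) * (c / 2) / 2) = C * sqrt \<delta>"
        proof -
          have "(\<delta> / s) * (c / 2) / 2 = c / (4 * s) * \<delta>" by simp
          then show ?thesis by (simp only: C_def real_sqrt_mult mult.assoc)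
        qed
        ultimately show "cost M (inv_of d (map_of_chart d (\<gamma> 0) + \<delta> *\<^sub>R w')) (\<gamma> 1) \<le> ereal (- (C * sqrt \<delta>))" by simp
      qed
    qed
  qed
qed

end

section \<open>Starting points of tight lightlike minimizers\<close>

text \<open>The starting points that have to be shown negligible: those of nonconstant lightlike geodesics along
  which \<open>\<psi>\<close> and its transform are tight. Finiteness of \<open>\<psi>\<close> makes the subtraction meaningful.\<close>

definition tight_start :: "('m::topological_space, 'e::real_normed_vector) lf_manifold \<Rightarrow> ('m \<Rightarrow> real) \<Rightarrow> ('m \<Rightarrow> ereal) \<Rightarrow> 'm set" where
  "tight_start M \<tau> \<psi> = {x. \<bar>\<psi> x\<bar> \<noteq> \<infinity> \<and> (\<exists>\<gamma>\<in>lightlike_geodesics M \<tau>. \<gamma> 0 = x \<and> \<gamma> 1 \<noteq> x \<and>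
     c_transform M \<psi> (\<gamma> 1) - \<psi> x = cost M x (\<gamma> 1))}"

text \<open>Tightness and zero cost give \<open>c_transform M \<psi> (\<gamma> 1) = \<psi> x\<close>, hence \<open>\<psi> x \<le> \<psi> x' + cost M x' (\<gamma> 1)\<close> for all
  \<open>x'\<close>, and the drop of the cost becomes growth of \<open>\<psi>\<close>.\<close>

lemma (in lf_chart) tight_start_growth:
  assumes sp: "splitting M B \<Phi> \<tau>" and x: "x \<in> tight_start M \<tau> \<psi>" "x \<in> dom_of d"
  obtains z\<^sub>0 where "z\<^sub>0 \<noteq> 0" "(map_of_chart d x, z\<^sub>0) \<in> cone_chart M d"
    "grad (map_of_chart d x, z\<^sub>0) \<bullet> z\<^sub>0 = 0" "grad (map_of_chart d x, z\<^sub>0) \<noteq> 0"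
    "\<And>w. grad (map_of_chart d x, z\<^sub>0) \<bullet> w < 0 \<Longrightarrow> \<exists>\<theta>>0. \<exists>C>0. \<exists>\<delta>\<^sub>0>0. \<forall>w' \<delta>. norm (w' - w) \<le> \<theta> \<longrightarrow> 0 < \<delta> \<longrightarrow> \<delta> \<le> \<delta>\<^sub>0 \<longrightarrow>
       \<psi> x + ereal (C * sqrt \<delta>) \<le> \<psi> (inv_of d (map_of_chart d x + \<delta> *\<^sub>R w'))"
proof -
  obtain \<gamma> where fin: "\<bar>\<psi> x\<bar> \<noteq> \<infinity>" and g: "\<gamma> \<in> lightlike_geodesics M \<tau>" "\<gamma> 0 = x" "\<gamma> 1 \<noteq> x"
    "c_transform M \<psi> (\<gamma> 1) - \<psi> x = cost M x (\<gamma> 1)" using x(1) by (auto simp: tight_start_def)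
  have "cost M x (\<gamma> 1) = 0" using lightlike_geodesicD(4)[OF g(1)] g(2) by simp
  then have ct: "c_transform M \<psi> (\<gamma> 1) = \<psi> x" using g(4) fin
    by (cases "c_transform M \<psi> (\<gamma> 1)"; cases "\<psi> x") (auto simp: zero_ereal_def)
  have ne: "\<gamma> 0 \<noteq> \<gamma> 1" and dom: "\<gamma> 0 \<in> dom_of d" using g x(2) by auto
  obtain z0 where z0: "z0 \<noteq> 0" "(map_of_chart d (\<gamma> 0), z0) \<in> cone_chart M d" "F (map_of_chart d (\<gamma> 0), z0) = 0"
    "\<And>w. grad (map_of_chart d (\<gamma> 0), z0) \<bullet> w < 0 \<Longrightarrow> \<exists>\<theta>>0. \<exists>C>0. \<exists>\<delta>\<^sub>0>0. \<forall>w' \<delta>. norm (w' - w) \<le> \<theta> \<longrightarrow> 0 < \<delta> \<longrightarrow> \<delta> \<le> \<delta>\<^sub>0 \<longrightarrow>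
       cost M (inv_of d (map_of_chart d (\<gamma> 0) + \<delta> *\<^sub>R w')) (\<gamma> 1) \<le> ereal (- (C * sqrt \<delta>))"
    by (rule cost_drop_at_lightlike_start[OF sp g(1) ne dom]) (rule that)
  have yr: "map_of_chart d x \<in> range_of d" using x(2) ch by simp
  then have sl: "(map_of_chart d x, z0) \<in> slit_bundle d" using z0(1) by simp
  show ?thesis
  proof (rule that[of z0])
    show "grad (map_of_chart d x, z0) \<bullet> z0 = 0"
      using fibre_derivative_lightlike[OF yr z0(1)] z0(3) grad_inner[OF sl] by (simp add: g(2))
    show "grad (map_of_chart d x, z0) \<noteq> 0" by (rule grad_nonzero[OF sl])
    fix w assume "grad (map_of_chart d x, z0) \<bullet> w < 0"
    then obtain \<theta> C \<delta>0 where tc: "\<theta> > 0" "C > 0" "\<delta>0 > 0" "\<forall>w' \<delta>. norm (w' - w) \<le> \<theta> \<longrightarrow> 0 < \<delta> \<longrightarrow> \<delta> \<le> \<delta>0 \<longrightarrow>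
       cost M (inv_of d (map_of_chart d x + \<delta> *\<^sub>R w')) (\<gamma> 1) \<le> ereal (- (C * sqrt \<delta>))"
      using z0(4)[of w] unfolding g(2) by blast
    have "\<psi> x + ereal (C * sqrt \<delta>) \<le> \<psi> (inv_of d (map_of_chart d x + \<delta> *\<^sub>R w'))"
      if "norm (w' - w) \<le> \<theta>" "0 < \<delta>" "\<delta> \<le> \<delta>0" for w' \<delta>
    proof -
      let ?x' = "inv_of d (map_of_chart d x + \<delta> *\<^sub>R w')"
      have "\<psi> x \<le> \<psi> ?x' + cost M ?x' (\<gamma> 1)" unfolding ct[symmetric] c_transform_def by (rule INF_lower) simp
      also have "\<dots> \<le> \<psi> ?x' + ereal (- (C * sqrt \<delta>))" using tc(4) that by (intro add_left_mono) blast
      finally have le: "\<psi> x \<le> \<psi> ?x' + ereal (- (C * sqrt \<delta>))" .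
      show ?thesis using le fin by (cases "\<psi> ?x'"; cases "\<psi> x") auto
    qed
    then show "\<exists>\<theta>>0. \<exists>C>0. \<exists>\<delta>\<^sub>0>0. \<forall>w' \<delta>. norm (w' - w) \<le> \<theta> \<longrightarrow> 0 < \<delta> \<longrightarrow> \<delta> \<le> \<delta>\<^sub>0 \<longrightarrow>
       \<psi> x + ereal (C * sqrt \<delta>) \<le> \<psi> (inv_of d (map_of_chart d x + \<delta> *\<^sub>R w'))"
      using tc(1,2,3) by blast
  qed (use z0 g(2) in auto)
qed

text \<open>Square-root growth in a cone is invariant under changes of coordinates, because a differentiable map
  sends a narrow cone around \<open>b\<close> into a given cone around the image of \<open>b\<close>. All constants are merged into
  one natural number.\<close>

lemma growth_transfer:
  fixes \<psi> :: "'m::t2_space \<Rightarrow> ereal" and c d :: "('m, 'e::euclidean_space) chart"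
  assumes c: "is_chart c" and d: "is_chart d" and r: "smoothly_related c d"
    and x: "x \<in> dom_of c" "x \<in> dom_of d" and w: "transition c d x b = w" "norm b = 1"
    and tc: "\<theta> > 0" "C > 0" "\<delta>\<^sub>0 > 0" and gr: "\<And>w' \<delta>. norm (w' - w) \<le> \<theta> \<Longrightarrow> 0 < \<delta> \<Longrightarrow> \<delta> \<le> \<delta>\<^sub>0 \<Longrightarrow>
       \<psi> x + ereal (C * sqrt \<delta>) \<le> \<psi> (inv_of d (map_of_chart d x + \<delta> *\<^sub>R w'))"
  obtains n :: nat where "n > 0" "\<And>x'. x' \<in> dom_of c \<Longrightarrow> norm (map_of_chart c x' - map_of_chart c x) < 1 / real n \<Longrightarrow>
     x' \<noteq> x \<Longrightarrow>
     norm (map_of_chart c x' - map_of_chart c x - norm (map_of_chart c x' - map_of_chart c x) *\<^sub>R b) \<le>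
       1 / real n * norm (map_of_chart c x' - map_of_chart c x) \<Longrightarrow>
     \<psi> x + ereal (1 / real n * sqrt (norm (map_of_chart c x' - map_of_chart c x))) \<le> \<psi> x'"
proof -
  define p where "p = map_of_chart c x"
  define \<Theta> where "\<Theta> = map_of_chart d \<circ> inv_of c"
  define L where "L = transition c d x"
  have L: "(\<Theta> has_derivative L) (at p)"
    using transition_derivative[OF c d r x] by (simp add: \<Theta>_def L_def p_def transition_def)
  have bl: "bounded_linear L" using L has_derivative_bounded_linear by blast
  have "\<theta> / 2 > 0" using tc by simp
  then obtain e1 where e1: "e1 > 0" "\<And>q. norm (q - p) < e1 \<Longrightarrow> norm (\<Theta> q - \<Theta> p - L (q - p)) \<le> \<theta> / 2 * norm (q - p)"
    using L unfolding has_derivative_at_alt by blast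
  define W where "W = map_of_chart c ` (dom_of c \<inter> dom_of d)"
  have "open W" unfolding W_def by (rule chart_image_open[OF c chart_open(1)[OF d]])
  moreover have "p \<in> W" using x by (simp add: W_def p_def)
  ultimately obtain e2 where e2: "e2 > 0" "ball p e2 \<subseteq> W" using open_contains_ball by blast
  define K where "K = onorm L + 1"
  have K: "K \<ge> 1" using onorm_pos_le[OF bl] by (simp add: K_def)
  have LK: "norm (L v) \<le> K * norm v" for v
  proof -
    have "norm (L v) \<le> onorm L * norm v" by (rule onorm[OF bl])
    also have "\<dots> \<le> K * norm v" by (intro mult_right_mono) (auto simp: K_def)
    finally show ?thesis .
  qed
  define e where "e = Min {e1, e2, \<delta>\<^sub>0, \<theta> / (2 * K), C}"
  have e: "e > 0" "e \<le> e1" "e \<le> e2" "e \<le> \<delta>\<^sub>0" "e \<le> \<theta> / (2 * K)" "e \<le> C"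
    using e1(1) e2(1) tc K by (auto simp: e_def)
  obtain n0 :: nat where n0: "inverse (real (Suc n0)) < e" using reals_Archimedean[OF e(1)] by blast
  define n where "n = Suc n0"
  have n: "n > 0" "1 / real n < e" using n0 by (auto simp: n_def inverse_eq_divide)
  show ?thesis
  proof (rule that[OF n(1)])
    fix x' assume x': "x' \<in> dom_of c" "norm (map_of_chart c x' - map_of_chart c x) < 1 / real n" "x' \<noteq> x"
      "norm (map_of_chart c x' - map_of_chart c x - norm (map_of_chart c x' - map_of_chart c x) *\<^sub>R b) \<le>
       1 / real n * norm (map_of_chart c x' - map_of_chart c x)"
    define q where "q = map_of_chart c x'"
    define \<delta> where "\<delta> = norm (q - p)"
    have "q \<noteq> p" using chart_inv(1)[OF c x(1)] chart_inv(1)[OF c x'(1)] x'(3) by (auto simp: q_def p_def)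
    then have \<delta>0: "\<delta> > 0" by (simp add: \<delta>_def)
    have \<delta>n: "\<delta> < 1 / real n" using x'(2) by (simp add: \<delta>_def q_def p_def)
    then have \<delta>e: "\<delta> < e" using n(2) by simp
    have "q \<in> ball p e2" using \<delta>e e(3) by (simp add: \<delta>_def dist_norm norm_minus_commute)
    then have "q \<in> W" using e2(2) by blast
    then obtain x'' where "x'' \<in> dom_of c" "x'' \<in> dom_of d" "q = map_of_chart c x''" by (auto simp: W_def)
    then have dx': "x' \<in> dom_of d" using chart_inv(1)[OF c] x'(1) by (metis q_def)
    define w' where "w' = (\<Theta> q - \<Theta> p) /\<^sub>R \<delta>"
    have "norm (\<delta> *\<^sub>R (w' - w)) \<le> norm (\<Theta> q - \<Theta> p - L (q - p)) + norm (L (q - p - \<delta> *\<^sub>R b))"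
    proof -
      have "\<delta> *\<^sub>R (w' - w) = (\<Theta> q - \<Theta> p - L (q - p)) + L (q - p - \<delta> *\<^sub>R b)"
        using \<delta>0 w(1) linear_diff[OF bounded_linear.linear[OF bl]] linear_scale[OF bounded_linear.linear[OF bl]]
        by (simp add: w'_def scaleR_diff_right L_def[symmetric])
      then show ?thesis by (metis norm_triangle_ineq)
    qed
    also have "norm (\<Theta> q - \<Theta> p - L (q - p)) \<le> \<theta> / 2 * \<delta>" using e1(2)[of q] \<delta>e e(2) by (simp add: \<delta>_def)
    also have "norm (L (q - p - \<delta> *\<^sub>R b)) \<le> K * (1 / real n * \<delta>)"
      using LK[of "q - p - \<delta> *\<^sub>R b"] x'(4) K unfolding q_def[symmetric] p_def[symmetric] \<delta>_def[symmetric]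
      by (meson mult_left_mono order_trans zero_le_one)
    also have "K * (1 / real n * \<delta>) \<le> K * (e * \<delta>)" using n(2) K \<delta>0 by (intro mult_left_mono mult_right_mono) auto
    also have "\<dots> \<le> \<theta> / 2 * \<delta>"
    proof -
      have "K * e \<le> \<theta> / 2" using e(5) K by (simp add: field_simps)
      then have "K * e * \<delta> \<le> \<theta> / 2 * \<delta>" using \<delta>0 by (intro mult_right_mono) auto
      then show ?thesis by (simp add: mult.assoc)
    qed
    finally have "norm (\<delta> *\<^sub>R (w' - w)) \<le> \<theta> / 2 * \<delta> + \<theta> / 2 * \<delta>" by simp
    then have "\<delta> * norm (w' - w) \<le> \<delta> * \<theta>" using \<delta>0 by simp
    then have nw: "norm (w' - w) \<le> \<theta>" using \<delta>0 by simp
    have "map_of_chart d x + \<delta> *\<^sub>R w' = map_of_chart d x'"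
      using \<delta>0 x x'(1) c by (simp add: w'_def \<Theta>_def p_def q_def)
    then have "inv_of d (map_of_chart d x + \<delta> *\<^sub>R w') = x'" using dx' d by simp
    then have "\<psi> x + ereal (C * sqrt \<delta>) \<le> \<psi> x'" using gr[OF nw \<delta>0] \<delta>e e(4) by simp
    moreover have "\<psi> x + ereal (1 / real n * sqrt \<delta>) \<le> \<psi> x + ereal (C * sqrt \<delta>)"
      using n(2) e(6) \<delta>0 by (intro add_left_mono) (simp add: mult_right_mono del: times_divide_eq_left)
    ultimately show "\<psi> x + ereal (1 / real n * sqrt (norm (map_of_chart c x' - map_of_chart c x))) \<le> \<psi> x'"
      unfolding \<delta>_def q_def p_def by (rule order_trans[rotated])
  qed
qed

text \<open>Growth holds in all directions of a half-space, given by the fibre gradient \<open>n0\<close> at a lightlike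
  vector \<open>z0\<close>. It remains to find a coordinate direction of \<open>c\<close> in \<open>S\<close> on which \<open>n0\<close> does not vanish. If
  \<open>S\<close> is the full basis, this is \<open>n0 \<noteq> 0\<close>. If \<open>S\<close> spans a hyperplane, then \<open>n0\<close> vanishes at \<open>z0\<close>, which is
  transversal to the hyperplane; were it to vanish on the hyperplane as well, it would be zero.\<close>

lemma tight_start_local_null:
  fixes M :: "('m::{t2_space,second_countable_topology}, 'e::euclidean_space) lf_manifold"
  assumes lf: "lorentz_finsler M" and sp: "splitting M B \<Phi> \<tau>" and c: "compatible_chart (atlas M) c"
    and S: "S \<subseteq> Basis" and X: "X \<subseteq> tight_start M \<tau> \<psi> \<inter> dom_of c"
    and flat: "\<And>x i. x \<in> X \<Longrightarrow> i \<in> Basis - S \<Longrightarrow> map_of_chart c x \<bullet> i = 0"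
    and transversal: "\<And>x v. x \<in> X \<Longrightarrow> (x, v) \<in> cone M \<Longrightarrow> v \<noteq> 0 \<Longrightarrow>
       S = Basis \<or> (\<exists>b. S = Basis - {b} \<and> differential (atlas M) (map_of_chart c) x v \<bullet> b \<noteq> 0)"
  shows "\<exists>N\<in>null_sets (coord_lborel S). map_of_chart c ` X \<subseteq> N"
proof (rule growth_null[OF S, of _ "\<lambda>y. real_of_ereal (\<psi> (inv_of c y))"])
  have A: "smooth_atlas (atlas M)" using lf by (simp add: lorentz_finsler_def)
  have cc: "is_chart c" using c by (simp add: compatible_chart_def)
  show "y \<bullet> i = 0" if "y \<in> map_of_chart c ` X" "i \<in> Basis - S" for y i using flat that by auto
  fix p assume "p \<in> map_of_chart c ` X"
  then obtain x where x: "x \<in> X" "p = map_of_chart c x" by blast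
  have xt: "x \<in> tight_start M \<tau> \<psi>" and xc: "x \<in> dom_of c" using x X by auto
  define d where "d = chart_at (atlas M) x"
  have dA: "d \<in> atlas M" and xd: "x \<in> dom_of d" using atlasD[OF A] by (simp_all add: d_def)
  interpret lf_chart M d by unfold_locales (use lf dA in auto)
  have r: "smoothly_related c d" using c dA by (simp add: compatible_chart_def)
  obtain z0 where z0: "z0 \<noteq> 0" "(map_of_chart d x, z0) \<in> cone_chart M d"
    "grad (map_of_chart d x, z0) \<bullet> z0 = 0" "grad (map_of_chart d x, z0) \<noteq> 0"
    "\<And>w. grad (map_of_chart d x, z0) \<bullet> w < 0 \<Longrightarrow> \<exists>\<theta>>0. \<exists>C>0. \<exists>\<delta>\<^sub>0>0. \<forall>w' \<delta>. norm (w' - w) \<le> \<theta> \<longrightarrow> 0 < \<delta> \<longrightarrow> \<delta> \<le> \<delta>\<^sub>0 \<longrightarrow>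
       \<psi> x + ereal (C * sqrt \<delta>) \<le> \<psi> (inv_of d (map_of_chart d x + \<delta> *\<^sub>R w'))"
    by (rule tight_start_growth[OF sp xt xd]) (rule that)
  define n0 where "n0 = grad (map_of_chart d x, z0)"
  have dr: "map_of_chart d x \<in> range_of d" using xd ch by simp
  have Tid: "T (map_of_chart d x) v = v" for v
    using xd ch transition_self[OF ch xd] by (simp add: T_def d_def[symmetric])
  have cone: "(x, z0) \<in> cone M"
    using z0(2) tangent_coordinates(1)[OF dr, of z0] Tid xd ch by (simp add: cone_chart_def)
  define L where "L = transition c d x"
  define L' where "L' = transition d c x"
  have lin: "linear L" unfolding L_def by (rule transition_linear(2)[OF cc ch r xc xd])
  have LL': "L (L' v) = v" for v
    unfolding L_def L'_def by (rule transition_inverse[OF ch cc smoothly_related_sym[OF r] xd xc])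
  have exp: "n0 \<bullet> v = (\<Sum>b\<in>Basis. (L' v \<bullet> b) * (n0 \<bullet> L b))" for v
  proof -
    have "v = L (\<Sum>b\<in>Basis. (L' v \<bullet> b) *\<^sub>R b)" using LL' by (simp add: euclidean_representation)
    also have "\<dots> = (\<Sum>b\<in>Basis. (L' v \<bullet> b) *\<^sub>R L b)" by (simp only: linear_sum[OF lin] linear_scale[OF lin])
    finally have "n0 \<bullet> v = n0 \<bullet> (\<Sum>b\<in>Basis. (L' v \<bullet> b) *\<^sub>R L b)" by simp
    then show ?thesis by (simp add: inner_sum_right)
  qed
  have "\<exists>b\<in>S. n0 \<bullet> L b \<noteq> 0"
  proof (rule ccontr)
    assume "\<not> ?thesis"
    then have zero: "n0 \<bullet> L b = 0" if "b \<in> S" for b using that by blast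
    have all: "n0 \<bullet> L b = 0" if b: "b \<in> Basis" for b
    proof (cases "S = Basis")
      case False
      then obtain b0 where b0: "S = Basis - {b0}" "differential (atlas M) (map_of_chart c) x z0 \<bullet> b0 \<noteq> 0"
        using transversal[OF x(1) cone z0(1)] by blast
      have b0B: "b0 \<in> Basis" using b0(1) False by auto
      have D: "L' z0 \<bullet> b0 \<noteq> 0" using b0(2) by (simp add: differential_chart L'_def d_def)
      have "0 = (\<Sum>b\<in>Basis. (L' z0 \<bullet> b) * (n0 \<bullet> L b))" using exp[of z0] z0(3) by (simp add: n0_def)
      also have "\<dots> = (L' z0 \<bullet> b0) * (n0 \<bullet> L b0) + (\<Sum>b\<in>Basis - {b0}. (L' z0 \<bullet> b) * (n0 \<bullet> L b))"
        using b0B by (intro sum.remove) auto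
      also have "(\<Sum>b\<in>Basis - {b0}. (L' z0 \<bullet> b) * (n0 \<bullet> L b)) = 0" using zero b0(1) by (intro sum.neutral) auto
      finally have "n0 \<bullet> L b0 = 0" using D by simp
      then show ?thesis using zero b b0(1) by (cases "b = b0") auto
    qed (use zero b in simp)
    have "n0 \<bullet> n0 = 0" unfolding exp[of n0] using all by (intro sum.neutral) auto
    then show False using z0(4) by (simp add: n0_def)
  qed
  then obtain b where b: "b \<in> S" "n0 \<bullet> L b \<noteq> 0" by blast
  define \<sigma> :: real where "\<sigma> = (if n0 \<bullet> L b < 0 then 1 else -1)"
  have neg: "n0 \<bullet> L (\<sigma> *\<^sub>R b) < 0" using b(2) linear_scale[OF lin, of \<sigma> b] by (auto simp: \<sigma>_def)
  have nb: "norm (\<sigma> *\<^sub>R b) = 1" using b(1) S by (auto simp: \<sigma>_def)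
  obtain \<theta> C \<delta>0 where tc: "\<theta> > 0" "C > 0" "\<delta>0 > 0" "\<And>w' \<delta>. norm (w' - L (\<sigma> *\<^sub>R b)) \<le> \<theta> \<Longrightarrow> 0 < \<delta> \<Longrightarrow> \<delta> \<le> \<delta>0 \<Longrightarrow>
       \<psi> x + ereal (C * sqrt \<delta>) \<le> \<psi> (inv_of d (map_of_chart d x + \<delta> *\<^sub>R w'))"
    using z0(5)[of "L (\<sigma> *\<^sub>R b)"] neg unfolding n0_def by blast
  obtain n :: nat where n: "n > 0" "\<And>x'. x' \<in> dom_of c \<Longrightarrow> norm (map_of_chart c x' - map_of_chart c x) < 1 / real n \<Longrightarrow>
     x' \<noteq> x \<Longrightarrow>
     norm (map_of_chart c x' - map_of_chart c x - norm (map_of_chart c x' - map_of_chart c x) *\<^sub>R (\<sigma> *\<^sub>R b)) \<le>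
       1 / real n * norm (map_of_chart c x' - map_of_chart c x) \<Longrightarrow>
     \<psi> x + ereal (1 / real n * sqrt (norm (map_of_chart c x' - map_of_chart c x))) \<le> \<psi> x'"
    by (rule growth_transfer[OF cc ch r xc xd L_def[symmetric, THEN fun_cong] nb tc]) (assumption+, rule that)
  have fin: "\<bar>\<psi> x'\<bar> \<noteq> \<infinity>" if "x' \<in> X" for x' using that X by (auto simp: tight_start_def)
  show "\<exists>b\<in>S. \<exists>\<sigma>\<in>{1, - 1::real}. \<exists>n::nat. 0 < n \<and> (\<forall>q\<in>map_of_chart c ` X. norm (q - p) < 1 / real n \<longrightarrow>
       norm (q - p - (norm (q - p) * \<sigma>) *\<^sub>R b) \<le> 1 / real n * norm (q - p) \<longrightarrow>
       real_of_ereal (\<psi> (inv_of c p)) + 1 / real n * sqrt (norm (q - p)) \<le> real_of_ereal (\<psi> (inv_of c q)))"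
  proof (rule bexI[OF _ b(1)], rule bexI[of _ \<sigma>], rule exI[of _ n], rule conjI[OF n(1)], intro ballI impI)
    show "\<sigma> \<in> {1, -1}" by (simp add: \<sigma>_def)
    fix q assume q: "q \<in> map_of_chart c ` X" "norm (q - p) < 1 / real n"
       "norm (q - p - (norm (q - p) * \<sigma>) *\<^sub>R b) \<le> 1 / real n * norm (q - p)"
    then obtain x' where x': "x' \<in> X" "q = map_of_chart c x'" by blast
    have ip: "inv_of c p = x" and iq: "inv_of c q = x'" using x x' xc X cc by auto
    show "real_of_ereal (\<psi> (inv_of c p)) + 1 / real n * sqrt (norm (q - p)) \<le> real_of_ereal (\<psi> (inv_of c q))"
    proof (cases "x' = x")
      case False
      have "\<psi> x + ereal (1 / real n * sqrt (norm (q - p))) \<le> \<psi> x'"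
        unfolding x'(2) x(2) using q(2,3) x' X False unfolding x'(2) x(2) by (intro n(2)) auto
      then show ?thesis unfolding ip iq using fin[OF x(1)] fin[OF x'(1)] by (cases "\<psi> x"; cases "\<psi> x'") auto
    qed (use x x' ip in simp)
  qed
qed

lemma chart_vimage_borel:
  assumes c: "is_chart c" and N: "N \<in> sets borel"
  shows "{x \<in> dom_of c. map_of_chart c x \<in> N} \<in> sets borel"
proof -
  have "map_of_chart c \<in> borel_measurable (restrict_space borel (dom_of c))"
    using chart_continuous(1)[OF c] by (rule borel_measurable_continuous_on_restrict)
  from measurable_sets[OF this N]
  have "map_of_chart c -` N \<inter> dom_of c \<in> sets (restrict_space borel (dom_of c))"
    by (simp add: space_restrict_space)
  then have "map_of_chart c -` N \<inter> dom_of c \<in> sets borel"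
    using chart_open(1)[OF c] by (subst (asm) sets_restrict_space_iff) auto
  then show ?thesis by (simp add: vimage_def Int_def conj_commute)
qed

lemma countable_cover:
  fixes U :: "'i \<Rightarrow> 'a::second_countable_topology set"
  assumes "\<And>i. i \<in> I \<Longrightarrow> open (U i)"
  obtains J where "countable J" "J \<subseteq> I" "(\<Union>i\<in>J. U i) = (\<Union>i\<in>I. U i)"
proof -
  obtain F where F: "F \<subseteq> U ` I" "countable F" "\<Union>F = (\<Union>i\<in>I. U i)"
    using Lindelof_openin[of "U ` I" UNIV] assms by (auto simp: subtopology_UNIV)
  have "\<forall>V\<in>F. \<exists>i\<in>I. V = U i" using F(1) by blast
  then obtain f where f: "\<And>V. V \<in> F \<Longrightarrow> f V \<in> I \<and> V = U (f V)" by metis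
  show ?thesis
  proof (rule that[of "f ` F"])
    show "countable (f ` F)" using F(2) by simp
    show "f ` F \<subseteq> I" using f by blast
    have "(\<Union>i\<in>f ` F. U i) = \<Union>F" using f by auto
    then show "(\<Union>i\<in>f ` F. U i) = (\<Union>i\<in>I. U i)" using F(3) by simp
  qed
qed

text \<open>Countably many charts cover the manifold, respectively countably many slice charts the hypersurface.
  In each of them the measure has a density with respect to the Lebesgue measure in the coordinates, so
  coordinate null sets pull back to null sets.\<close>

lemma tight_start_null:
  fixes M :: "('m::{t2_space,second_countable_topology}, 'e::euclidean_space) lf_manifold"
  assumes lf: "lorentz_finsler M" and sp: "splitting M B \<Phi> \<tau>" and \<mu>: "sets \<mu> = sets borel"
    and reg: "(\<exists>H m. spacelike_hypersurface M H \<and> is_hyp_lebesgue_measure M H m \<and>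
            emeasure \<mu> (UNIV - H) = 0 \<and> absolutely_continuous m \<mu>) \<or>
         (\<exists>m. is_lebesgue_measure M m \<and> absolutely_continuous m \<mu>)"
  shows "\<exists>N\<in>null_sets \<mu>. tight_start M \<tau> \<psi> \<subseteq> N"
  using reg
proof (elim disjE exE conjE)
  have A: "smooth_atlas (atlas M)" using lf by (simp add: lorentz_finsler_def)
  fix m assume m: "is_lebesgue_measure M m" "absolutely_continuous m \<mu>"
  have "\<exists>N\<in>null_sets \<mu>. tight_start M \<tau> \<psi> \<inter> dom_of c \<subseteq> N" if c: "c \<in> atlas M" for c
  proof -
    have cc: "is_chart c" using atlasD(1)[OF A c] .
    have "compatible_chart (atlas M) c" using atlasD(1,2)[OF A] c by (auto simp: compatible_chart_def)
    then obtain N where N: "N \<in> null_sets (coord_lborel Basis)" "map_of_chart c ` (tight_start M \<tau> \<psi> \<inter> dom_of c) \<subseteq> N"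
      using tight_start_local_null[OF lf sp, of c Basis "tight_start M \<tau> \<psi> \<inter> dom_of c" \<psi>] by auto
    have cl: "coord_lborel Basis = (lborel :: 'e measure)" unfolding coord_lborel_def lborel_eq_real by (simp only: lborel_def)
    have Nb: "N \<in> sets borel" using N(1) by (auto simp: null_sets_def)
    define X where "X = {x \<in> dom_of c. map_of_chart c x \<in> N}"
    have Xb: "X \<in> sets borel" unfolding X_def by (rule chart_vimage_borel[OF cc Nb])
    have "emeasure m X = (\<integral>\<^sup>+y. indicator (map_of_chart c ` X) y * ennreal (sqrt (gram_det Basis (local_metric M c y))) \<partial>lborel)"
      using m(1) c Xb unfolding is_lebesgue_measure_def by (auto simp: X_def)
    also have "\<dots> = (\<integral>\<^sup>+y. 0 \<partial>(lborel :: 'e measure))"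
    proof (rule nn_integral_cong_AE)
      have "AE y in lborel. y \<notin> N" using N(1) unfolding cl by (rule AE_not_in)
      then show "AE y in lborel. indicator (map_of_chart c ` X) y * ennreal (sqrt (gram_det Basis (local_metric M c y))) = 0"
        by eventually_elim (auto simp: X_def split: split_indicator)
    qed
    finally have "X \<in> null_sets m" using m(1) Xb by (simp add: null_sets_def is_lebesgue_measure_def)
    then have "X \<in> null_sets \<mu>" using m(2) by (auto simp: absolutely_continuous_def)
    moreover have "tight_start M \<tau> \<psi> \<inter> dom_of c \<subseteq> X" using N(2) by (auto simp: X_def)
    ultimately show ?thesis by blast
  qed
  then obtain N where N: "\<And>c. c \<in> atlas M \<Longrightarrow> N c \<in> null_sets \<mu>" "\<And>c. c \<in> atlas M \<Longrightarrow> tight_start M \<tau> \<psi> \<inter> dom_of c \<subseteq> N c" by metis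
  obtain J where J: "countable J" "J \<subseteq> atlas M" "(\<Union>c\<in>J. dom_of c) = (\<Union>c\<in>atlas M. dom_of c)"
    using countable_cover[of "atlas M" dom_of] chart_open(1)[OF atlasD(1)[OF A]] by blast
  have "(\<Union>c\<in>J. N c) \<in> null_sets \<mu>" using J(1,2) N(1) by (intro null_sets_UN') auto
  moreover have "tight_start M \<tau> \<psi> \<subseteq> (\<Union>c\<in>J. N c)"
  proof
    fix x assume x: "x \<in> tight_start M \<tau> \<psi>"
    have "x \<in> (\<Union>c\<in>atlas M. dom_of c)" using A by (simp add: smooth_atlas_def)
    then obtain c where "c \<in> J" "x \<in> dom_of c" unfolding J(3)[symmetric] by blast
    then show "x \<in> (\<Union>c\<in>J. N c)" using N(2)[of c] J(2) x by blast
  qed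
  ultimately show ?thesis by blast
next
  have A: "smooth_atlas (atlas M)" using lf by (simp add: lorentz_finsler_def)
  fix H m assume H: "spacelike_hypersurface M H" and m: "is_hyp_lebesgue_measure M H m"
    and \<mu>H: "emeasure \<mu> (UNIV - H) = 0" and ac: "absolutely_continuous m \<mu>"
  define I where "I = {(c, b). slice_chart (atlas M) H c b}"
  have I: "compatible_chart (atlas M) c" "is_chart c" "b \<in> Basis" "map_of_chart c ` (H \<inter> dom_of c) = range_of c \<inter> {y. y \<bullet> b = 0}"
    if "(c, b) \<in> I" for c b
    using that by (auto simp: I_def slice_chart_def compatible_chart_def)
  have cover: "H \<subseteq> (\<Union>i\<in>I. dom_of (fst i))"
    using H unfolding spacelike_hypersurface_def hypersurface_def I_def by force
  have "open (dom_of (fst i))" if "i \<in> I" for i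
    using I(2)[of "fst i" "snd i"] that chart_open(1) by (metis prod.collapse)
  then obtain J where J: "countable J" "J \<subseteq> I" "(\<Union>i\<in>J. dom_of (fst i)) = (\<Union>i\<in>I. dom_of (fst i))"
    using countable_cover[of I "\<lambda>i. dom_of (fst i)"] by blast
  have HJ: "H \<inter> dom_of c = {x \<in> dom_of c. map_of_chart c x \<in> {y. y \<bullet> b = 0}}" if cb: "(c, b) \<in> I" for c b
  proof (intro equalityI subsetI)
    fix x assume x: "x \<in> H \<inter> dom_of c"
    then have "map_of_chart c x \<in> range_of c \<inter> {y. y \<bullet> b = 0}" unfolding I(4)[OF cb, symmetric] by blast
    then show "x \<in> {x \<in> dom_of c. map_of_chart c x \<in> {y. y \<bullet> b = 0}}" using x by simp
  next
    fix x assume x: "x \<in> {x \<in> dom_of c. map_of_chart c x \<in> {y. y \<bullet> b = 0}}"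
    then have "map_of_chart c x \<in> range_of c \<inter> {y. y \<bullet> b = 0}" using I(2)[OF cb] by simp
    then obtain x' where x': "x' \<in> H" "x' \<in> dom_of c" "map_of_chart c x = map_of_chart c x'" unfolding I(4)[OF cb, symmetric] by blast
    then have "x = x'" using x chart_inv(1)[OF I(2)[OF cb]] by (metis (mono_tags, lifting) mem_Collect_eq)
    then show "x \<in> H \<inter> dom_of c" using x' by simp
  qed
  have Hc: "H \<inter> dom_of c \<in> sets borel" if "(c, b) \<in> I" for c b
    unfolding HJ[OF that] by (intro chart_vimage_borel[OF I(2)[OF that]] borel_closed closed_Collect_eq continuous_intros)
  have Hb: "H \<in> sets borel"
  proof -
    have "H = (\<Union>i\<in>J. H \<inter> dom_of (fst i))" using cover J(3) by blast
    also have "\<dots> \<in> sets borel"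
    proof (rule sets.countable_UN''[OF J(1)])
      fix i assume "i \<in> J"
      then have "(fst i, snd i) \<in> I" using J(2) by auto
      then show "H \<inter> dom_of (fst i) \<in> sets borel" by (rule Hc)
    qed
    finally show ?thesis .
  qed
  have null: "\<exists>N\<in>null_sets \<mu>. tight_start M \<tau> \<psi> \<inter> (H \<inter> dom_of c) \<subseteq> N" if cb: "(c, b) \<in> I" for c b
  proof -
    let ?X = "tight_start M \<tau> \<psi> \<inter> (H \<inter> dom_of c)"
    have "\<exists>N\<in>null_sets (coord_lborel (Basis - {b})). map_of_chart c ` ?X \<subseteq> N"
    proof (rule tight_start_local_null[OF lf sp I(1)[OF cb]])
      show "Basis - {b} \<subseteq> Basis" "?X \<subseteq> tight_start M \<tau> \<psi> \<inter> dom_of c" by auto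
      show "map_of_chart c x \<bullet> i = 0" if "x \<in> ?X" "i \<in> Basis - (Basis - {b})" for x i
        using that HJ[OF cb] by auto
      show "Basis - {b} = Basis \<or> (\<exists>b'. Basis - {b} = Basis - {b'} \<and> differential (atlas M) (map_of_chart c) x v \<bullet> b' \<noteq> 0)"
        if x: "x \<in> ?X" and v: "(x, v) \<in> cone M" "v \<noteq> 0" for x v
      proof -
        have "hyp_tangent (atlas M) H x \<inter> {v. (x, v) \<in> cone M} = {0}" using H x by (auto simp: spacelike_hypersurface_def)
        then have "v \<notin> hyp_tangent (atlas M) H x" using v by blast
        then have "differential (atlas M) (map_of_chart c) x v \<bullet> b \<noteq> 0"
          using cb x unfolding hyp_tangent_def I_def by blast
        then show ?thesis by blast
      qed
    qed
    then obtain N where N: "N \<in> null_sets (coord_lborel (Basis - {b}))" "map_of_chart c ` ?X \<subseteq> N" by blast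
    have Nb: "N \<in> sets borel" using N(1) by (auto simp: null_sets_def)
    define X where "X = {x \<in> dom_of c. map_of_chart c x \<in> N}"
    have Xb: "X \<in> sets borel" unfolding X_def by (rule chart_vimage_borel[OF I(2)[OF cb] Nb])
    have sl: "slice_chart (atlas M) H c b" using cb by (simp add: I_def)
    have Xs: "X \<subseteq> dom_of c" by (auto simp: X_def)
    have "emeasure m X = (\<integral>\<^sup>+y. indicator (map_of_chart c ` (X \<inter> H)) y * ennreal (sqrt (gram_det (Basis - {b}) (local_metric M c y))) \<partial>coord_lborel (Basis - {b}))"
      using m[unfolded is_hyp_lebesgue_measure_def, THEN conjunct2, THEN conjunct2, rule_format, OF sl Xb Xs] .
    also have "\<dots> = (\<integral>\<^sup>+y. 0 \<partial>(coord_lborel (Basis - {b}) :: 'e measure))"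
    proof (rule nn_integral_cong_AE)
      have "AE y in coord_lborel (Basis - {b}). y \<notin> N" using N(1) by (rule AE_not_in)
      then show "AE y in coord_lborel (Basis - {b}). indicator (map_of_chart c ` (X \<inter> H)) y * ennreal (sqrt (gram_det (Basis - {b}) (local_metric M c y))) = 0"
        by eventually_elim (auto simp: X_def split: split_indicator)
    qed
    finally have "X \<in> null_sets m" using m Xb by (simp add: null_sets_def is_hyp_lebesgue_measure_def)
    then have "X \<in> null_sets \<mu>" using ac by (auto simp: absolutely_continuous_def)
    moreover have "?X \<subseteq> X" using N(2) by (auto simp: X_def)
    ultimately show ?thesis by blast
  qed
  have "\<forall>i\<in>I. \<exists>N\<in>null_sets \<mu>. tight_start M \<tau> \<psi> \<inter> (H \<inter> dom_of (fst i)) \<subseteq> N"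
    using null by (metis prod.collapse)
  then obtain N where N: "\<And>i. i \<in> I \<Longrightarrow> N i \<in> null_sets \<mu>" "\<And>i. i \<in> I \<Longrightarrow> tight_start M \<tau> \<psi> \<inter> (H \<inter> dom_of (fst i)) \<subseteq> N i" by metis
  have "(\<Union>i\<in>J. N i) \<in> null_sets \<mu>" using J(1,2) N(1) by (intro null_sets_UN') auto
  moreover have "UNIV - H \<in> null_sets \<mu>" using \<mu>H Hb \<mu> by (auto simp: null_sets_def)
  ultimately have "(\<Union>i\<in>J. N i) \<union> (UNIV - H) \<in> null_sets \<mu>" by (rule null_sets.Un)
  moreover have "tight_start M \<tau> \<psi> \<subseteq> (\<Union>i\<in>J. N i) \<union> (UNIV - H)"
  proof
    fix x assume x: "x \<in> tight_start M \<tau> \<psi>"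
    show "x \<in> (\<Union>i\<in>J. N i) \<union> (UNIV - H)"
    proof (cases "x \<in> H")
      case True
      then have "x \<in> (\<Union>i\<in>J. dom_of (fst i))" using cover J(3) by blast
      then obtain i where "i \<in> J" "x \<in> dom_of (fst i)" by blast
      then show ?thesis using N(2)[of i] J(2) x True by blast
    qed simp
  qed
  ultimately show ?thesis by blast
qed

section \<open>Measurability of the set of lightlike geodesics\<close>

text \<open>A curve that leaves the coordinate ball of radius \<open>r\<close> first reaches coordinate distance more than
  \<open>r/2\<close> within it, where its length dominates \<open>c\<close> times its coordinate length by \<open>metric_lower_bound\<close>.\<close>

lemma (in lf_chart) hdist_ball_in_chart:
  assumes x: "x \<in> dom_of d" and r: "r > 0" "cball (map_of_chart d x) r \<subseteq> range_of d"
  obtains \<epsilon> where "\<epsilon> > 0" "\<And>y. hdist M x y < \<epsilon> \<Longrightarrow> y \<in> dom_of d \<and> map_of_chart d y \<in> ball (map_of_chart d x) r"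
proof -
  define y0 where "y0 = map_of_chart d x"
  obtain c where c: "c > 0" "\<And>y z. y \<in> cball y0 r \<Longrightarrow> c * norm z \<le> hnorm M (inv_of d y) (T y z)"
    using metric_lower_bound[of "cball y0 r"] r(2) unfolding y0_def by (metis compact_cball)
  define V where "V = dom_of d \<inter> map_of_chart d -` ball y0 r"
  have Vo: "open V" unfolding V_def by (rule chart_vimage_open[OF ch]) simp
  show ?thesis
  proof (rule that[of "ennreal (c * (r/2))"])
    show "ennreal (c * (r/2)) > 0" using c(1) r(1) by simp
    fix y assume hd: "hdist M x y < ennreal (c * (r/2))"
    show "y \<in> dom_of d \<and> map_of_chart d y \<in> ball (map_of_chart d x) r"
    proof (rule ccontr)
      assume "\<not> ?thesis"
      then have yV: "y \<notin> V" by (auto simp: V_def y0_def)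
      obtain \<gamma> where \<gamma>: "AC_curve (atlas M) 0 1 \<gamma>" "\<gamma> 0 = x" "\<gamma> 1 = y"
        and len: "(\<integral>\<^sup>+t. ennreal (hnorm M (\<gamma> t) (velocity (atlas M) \<gamma> t)) \<partial>lebesgue_on {0..1}) < ennreal (c * (r/2))"
        using hd unfolding hdist_def INF_less_iff by blast
      have c\<gamma>: "continuous_on {0..1} \<gamma>" using \<gamma>(1) by (simp add: AC_curve_def)
      define Q where "Q = {0..1::real} \<inter> \<gamma> -` (- V)"
      have Qc: "closed Q" unfolding Q_def using c\<gamma> Vo by (intro continuous_closed_preimage) auto
      have "1 \<in> Q" using yV \<gamma>(3) by (simp add: Q_def)
      have Qb: "bdd_below Q" by (rule bdd_belowI[of _ 0]) (auto simp: Q_def)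
      define t1 where "t1 = Inf Q"
      have t1: "t1 \<in> Q" unfolding t1_def using Qc \<open>1 \<in> Q\<close> Qb by (intro closed_contains_Inf) auto
      have x0: "\<gamma> 0 \<in> V" using x r(1) \<gamma>(2) by (simp add: V_def y0_def)
      have t1p: "0 < t1" "t1 \<le> 1"
      proof -
        have "t1 \<noteq> 0" using x0 t1 by (auto simp: Q_def)
        then show "0 < t1" "t1 \<le> 1" using t1 by (auto simp: Q_def)
      qed
      have before: "\<gamma> t \<in> V" if "0 \<le> t" "t < t1" for t
      proof (rule ccontr)
        assume "\<gamma> t \<notin> V"
        then have "t \<in> Q" using that t1p by (simp add: Q_def)
        then have "t1 \<le> t" unfolding t1_def by (rule cInf_lower[OF _ Qb])
        then show False using that by simp
      qed
      \<comment> \<open>Before the first exit time t1 the curve leaves the smaller ball: otherwise it would stay in a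
          compact subset of V until t1.\<close>
      have "\<exists>t. 0 \<le> t \<and> t < t1 \<and> norm (map_of_chart d (\<gamma> t) - y0) > r/2"
      proof (rule ccontr)
        assume "\<not> ?thesis"
        then have small: "norm (map_of_chart d (\<gamma> t) - y0) \<le> r/2" if "0 \<le> t" "t < t1" for t using that by force
        define C where "C = inv_of d ` cball y0 (r/2)"
        have cs: "cball y0 (r/2) \<subseteq> range_of d" using r(1) by (intro order_trans[OF subset_cball r(2)[folded y0_def]]) simp
        have "compact C" unfolding C_def
          by (intro compact_continuous_image continuous_on_subset[OF chart_continuous(2)[OF ch] cs] compact_cball)
        then have Ccl: "closed C" by (rule compact_imp_closed)
        have inC: "\<gamma> t \<in> C" if "0 \<le> t" "t < t1" for t
        proof -
          have "\<gamma> t \<in> dom_of d" using before[OF that] by (simp add: V_def)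
          then have "\<gamma> t = inv_of d (map_of_chart d (\<gamma> t))" using ch by simp
          moreover have "map_of_chart d (\<gamma> t) \<in> cball y0 (r/2)" using small[OF that] by (simp add: dist_norm norm_minus_commute)
          ultimately show ?thesis unfolding C_def by (rule image_eqI)
        qed
        have "closed ({0..1} \<inter> \<gamma> -` C)" using Ccl c\<gamma> by (intro continuous_closed_preimage) auto
        moreover have "{0..<t1} \<subseteq> {0..1} \<inter> \<gamma> -` C" using inC t1p by auto
        ultimately have "closure {0..<t1} \<subseteq> {0..1} \<inter> \<gamma> -` C" by (rule closure_minimal[rotated])
        moreover have "t1 \<in> closure {0..<t1}" using t1p by simp
        ultimately have "\<gamma> t1 \<in> C" by blast
        then obtain q where q: "q \<in> cball y0 (r/2)" "\<gamma> t1 = inv_of d q" by (auto simp: C_def)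
        then have "\<gamma> t1 \<in> V" using cs ch r(1) by (auto simp: V_def subset_iff)
        then show False using t1 by (simp add: Q_def)
      qed
      then obtain t where t: "0 \<le> t" "t < t1" "norm (map_of_chart d (\<gamma> t) - y0) > r/2" by blast
      have dom: "\<gamma> ` {0..t} \<subseteq> dom_of d" using before t by (auto simp: V_def)
      have ac: "AC_on 0 t (map_of_chart d \<circ> \<gamma>)" using \<gamma>(1) d dom t t1p by (auto simp: AC_curve_def)
      show False
      proof (rule AC_on_density[OF ac t(1)])
        fix h assume h: "\<And>p q. 0 \<le> p \<Longrightarrow> p \<le> q \<Longrightarrow> q \<le> t \<Longrightarrow> (h has_integral ((map_of_chart d \<circ> \<gamma>) q - (map_of_chart d \<circ> \<gamma>) p)) {p..q}"
          "\<And>p q. h absolutely_integrable_on {p..q}"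
          "AE s in lebesgue. 0 < s \<and> s < t \<longrightarrow> ((map_of_chart d \<circ> \<gamma>) has_vector_derivative h s) (at s)"
        have ih: "h integrable_on {0..t}" and inh: "(\<lambda>s. norm (h s)) integrable_on {0..t}"
          using h(2)[of 0 t] by (auto simp: absolutely_integrable_on_def)
        have "map_of_chart d (\<gamma> t) - y0 = integral {0..t} h" using h(1)[of 0 t] t(1) \<gamma>(2) by (simp add: integral_unique y0_def)
        also have "norm \<dots> \<le> integral {0..t} (\<lambda>s. norm (h s))"
          using ih inh by (intro integral_norm_bound_integral) auto
        finally have 1: "r/2 < integral {0..t} (\<lambda>s. norm (h s))" using t(3) by simp
        have "((\<lambda>s. c * norm (h s)) has_integral (c * integral {0..t} (\<lambda>s. norm (h s)))) {0..t}"
          using inh by (intro has_integral_mult_right integrable_integral)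
        then have "(\<integral>\<^sup>+s. ennreal (indicator {0..t} s * (c * norm (h s))) \<partial>lborel) = ennreal (c * integral {0..t} (\<lambda>s. norm (h s)))"
          using c(1) by (intro nn_integral_has_integral_lebesgue) auto
        then have "ennreal (c * (r/2)) \<le> (\<integral>\<^sup>+s. ennreal (indicator {0..t} s * (c * norm (h s))) \<partial>lebesgue)"
          using 1 c(1) by (simp add: nn_integral_completion ennreal_leI)
        also have "\<dots> \<le> (\<integral>\<^sup>+s. ennreal (hnorm M (\<gamma> s) (velocity (atlas M) \<gamma> s)) * indicator {0..1} s \<partial>lebesgue)"
        proof (rule nn_integral_mono_AE)
          have nullpts: "AE s in lebesgue. s \<notin> {0, t}" by (rule AE_not_in) (simp add: negligible_iff_null_sets[symmetric])
          show "AE s in lebesgue. ennreal (indicator {0..t} s * (c * norm (h s))) \<le> ennreal (hnorm M (\<gamma> s) (velocity (atlas M) \<gamma> s)) * indicator {0..1} s"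
            using h(3) nullpts
          proof eventually_elim
            case (elim s)
            show ?case
            proof (cases "s \<in> {0..t}")
              case True
              then have s: "0 < s" "s < t" using elim(2) by auto
              have sV: "\<gamma> s \<in> V" using before s t by simp
              have cs: "isCont \<gamma> s" using s t t1p by (intro continuous_on_interior[OF c\<gamma>]) auto
              have ds: "\<gamma> s \<in> dom_of d" using sV by (simp add: V_def)
              have ys: "map_of_chart d (\<gamma> s) \<in> cball y0 r" using sV by (simp add: V_def)
              have yr: "map_of_chart d (\<gamma> s) \<in> range_of d" using ds ch by simp
              have "(\<gamma> s, velocity (atlas M) \<gamma> s) = (inv_of d (map_of_chart d (\<gamma> s)), T (map_of_chart d (\<gamma> s)) (h s))"
                using velocity_in_chart(2)[OF A d ds cs] elim(1) s tangent_coordinates(1)[OF yr, of "h s"] by simp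
              then have "c * norm (h s) \<le> hnorm M (\<gamma> s) (velocity (atlas M) \<gamma> s)" using c(2)[OF ys, of "h s"] by simp
              then show ?thesis using True s t t1p by (simp add: ennreal_leI)
            qed simp
          qed
        qed
        also have "\<dots> = (\<integral>\<^sup>+s. ennreal (hnorm M (\<gamma> s) (velocity (atlas M) \<gamma> s)) \<partial>lebesgue_on {0..1})"
          by (subst nn_integral_restrict_space) auto
        finally show False using len by simp
      qed
    qed
  qed
qed

text \<open>Closeness in the Riemannian distance implies closeness in the topology of the manifold; hence uniform
  neighbourhoods of curves control the evaluations.\<close>

lemma hdist_neighbourhood:
  assumes lf: "lorentz_finsler M" and U: "open U" "x \<in> U"
  obtains \<epsilon> where "\<epsilon> > 0" "\<And>y. hdist M x y < \<epsilon> \<Longrightarrow> y \<in> U"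
proof -
  have A: "smooth_atlas (atlas M)" using lf by (simp add: lorentz_finsler_def)
  define d where "d = chart_at (atlas M) x"
  have dA: "d \<in> atlas M" and xd: "x \<in> dom_of d" using atlasD[OF A] by (simp_all add: d_def)
  interpret lf_chart M d by unfold_locales (use lf dA in auto)
  have o: "open (map_of_chart d ` (dom_of d \<inter> U))" by (rule chart_image_open[OF ch U(1)])
  have "map_of_chart d x \<in> map_of_chart d ` (dom_of d \<inter> U)" using xd U(2) by blast
  then obtain r where r: "r > 0" "cball (map_of_chart d x) r \<subseteq> map_of_chart d ` (dom_of d \<inter> U)"
    using o open_contains_cball by blast
  then have sub: "cball (map_of_chart d x) r \<subseteq> range_of d" using ch by auto
  obtain \<epsilon> where e: "\<epsilon> > 0" "\<And>y. hdist M x y < \<epsilon> \<Longrightarrow> y \<in> dom_of d \<and> map_of_chart d y \<in> ball (map_of_chart d x) r"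
    using hdist_ball_in_chart[OF xd r(1) sub] by metis
  show ?thesis
  proof (rule that[OF e(1)])
    fix y assume "hdist M x y < \<epsilon>"
    then have y: "y \<in> dom_of d" "map_of_chart d y \<in> cball (map_of_chart d x) r" using e(2)[of y] by (auto intro: less_imp_le)
    then obtain y' where y': "y' \<in> dom_of d" "y' \<in> U" "map_of_chart d y = map_of_chart d y'" using r(2) by blast
    then have "y = y'" using y(1) chart_inv(1)[OF ch] by metis
    then show "y \<in> U" using y' by simp
  qed
qed

lemma space_geodesic_borel: "space (geodesic_borel M \<tau>) = geodesics M \<tau>"
  unfolding geodesic_borel_def by (rule space_measure_of) (auto simp: uniformly_open_def)

lemma uniformly_open_sets: "uniformly_open M (geodesics M \<tau>) S \<Longrightarrow> S \<in> sets (geodesic_borel M \<tau>)"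
  unfolding geodesic_borel_def by (subst sets_measure_of) (auto simp: uniformly_open_def)

lemma evaluation_measurable:
  assumes lf: "lorentz_finsler M" and t: "0 \<le> t" "t \<le> 1"
  shows "(\<lambda>\<gamma>. \<gamma> t) \<in> borel_measurable (geodesic_borel M \<tau>)"
proof (rule borel_measurableI)
  fix U :: "'a set" assume U: "open U"
  have "uniformly_open M (geodesics M \<tau>) ((\<lambda>\<gamma>. \<gamma> t) -` U \<inter> space (geodesic_borel M \<tau>))"
    unfolding uniformly_open_def space_geodesic_borel
  proof (intro conjI ballI)
    fix \<gamma> assume "\<gamma> \<in> (\<lambda>\<gamma>. \<gamma> t) -` U \<inter> geodesics M \<tau>"
    then have g: "\<gamma> t \<in> U" by simp
    obtain \<epsilon> where e: "\<epsilon> > 0" "\<And>y. hdist M (\<gamma> t) y < \<epsilon> \<Longrightarrow> y \<in> U"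
      using hdist_neighbourhood[OF lf U g] by metis
    then show "\<exists>\<epsilon>>0. \<forall>\<sigma>\<in>geodesics M \<tau>. (\<forall>t\<in>{0..1}. hdist M (\<gamma> t) (\<sigma> t) < \<epsilon>) \<longrightarrow> \<sigma> \<in> (\<lambda>\<gamma>. \<gamma> t) -` U \<inter> geodesics M \<tau>"
      using t by (intro exI[of _ \<epsilon>]) auto
  qed auto
  then show "(\<lambda>\<gamma>. \<gamma> t) -` U \<inter> space (geodesic_borel M \<tau>) \<in> sets (geodesic_borel M \<tau>)" by (rule uniformly_open_sets)
qed

text \<open>Small closed coordinate balls are compact, hence closed in the Hausdorff space.\<close>

lemma manifold_regular:
  fixes A :: "('m::{t2_space,second_countable_topology}, 'e::euclidean_space) chart set" and x :: 'm
  assumes A: "smooth_atlas A" and U: "open U" "x \<in> U"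
  obtains V where "open V" "x \<in> V" "closure V \<subseteq> U"
proof -
  define d where "d = chart_at A x"
  have dA: "d \<in> A" and xd: "x \<in> dom_of d" using atlasD[OF A] by (simp_all add: d_def)
  have ch: "is_chart d" using atlasD(1)[OF A dA] .
  have o: "open (map_of_chart d ` (dom_of d \<inter> U))" by (rule chart_image_open[OF ch U(1)])
  have "map_of_chart d x \<in> map_of_chart d ` (dom_of d \<inter> U)" using xd U(2) by blast
  then obtain r where r: "r > 0" "cball (map_of_chart d x) r \<subseteq> map_of_chart d ` (dom_of d \<inter> U)"
    using o open_contains_cball by blast
  then have sub: "cball (map_of_chart d x) r \<subseteq> range_of d" using ch by auto
  define C where "C = inv_of d ` cball (map_of_chart d x) r"
  have "compact C" unfolding C_def
    by (intro compact_continuous_image continuous_on_subset[OF chart_continuous(2)[OF ch] sub] compact_cball)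
  then have Ccl: "closed C" by (rule compact_imp_closed)
  have CU: "C \<subseteq> U"
  proof
    fix y assume "y \<in> C"
    then obtain q where q: "q \<in> cball (map_of_chart d x) r" "y = inv_of d q" by (auto simp: C_def)
    then obtain y' where "y' \<in> dom_of d" "y' \<in> U" "q = map_of_chart d y'" using r(2) by blast
    then show "y \<in> U" using q(2) ch by simp
  qed
  define V where "V = dom_of d \<inter> map_of_chart d -` ball (map_of_chart d x) r"
  show ?thesis
  proof (rule that[of V])
    show "open V" unfolding V_def by (rule chart_vimage_open[OF ch]) simp
    show "x \<in> V" using xd r(1) by (simp add: V_def)
    have "V \<subseteq> C"
    proof
      fix y assume y: "y \<in> V"
      then have "y = inv_of d (map_of_chart d y)" using ch by (simp add: V_def)
      moreover have "map_of_chart d y \<in> cball (map_of_chart d x) r" using y by (simp add: V_def)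
      ultimately show "y \<in> C" unfolding C_def by (rule image_eqI)
    qed
    then show "closure V \<subseteq> U" using closure_minimal[OF _ Ccl] CU by blast
  qed
qed

text \<open>Curves in \<open>geodesics M \<tau>\<close> carry no information outside \<open>[0, 1]\<close>; clipping the parameter makes
  evaluation a map on the whole line.\<close>

definition clip :: "real \<Rightarrow> real" where "clip t = max 0 (min 1 t)"

lemma clip_bounds: "0 \<le> clip t" "clip t \<le> 1" by (auto simp: clip_def)

lemma clip_id: "0 \<le> t \<Longrightarrow> t \<le> 1 \<Longrightarrow> clip t = t" by (auto simp: clip_def)

text \<open>Evaluation at a rounded time is measurable, since it is an evaluation at a fixed time on each of
  countably many strips. It converges to the evaluation by continuity of the curves. A limit lies in an
  open set \<open>U\<close> iff the sequence is eventually in the closure of a basic open set whose closure is in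
  \<open>U\<close>.\<close>

lemma joint_evaluation_measurable:
  fixes M :: "('m::{t2_space,second_countable_topology}, 'e::euclidean_space) lf_manifold"
  assumes lf: "lorentz_finsler M"
  shows "(\<lambda>p. fst p (clip (snd p))) \<in> borel_measurable (geodesic_borel M \<tau> \<Otimes>\<^sub>M (borel :: real measure))"
proof (rule borel_measurableI)
  have A: "smooth_atlas (atlas M)" using lf by (simp add: lorentz_finsler_def)
  fix U :: "'m set" assume U: "open U"
  let ?G = "geodesic_borel M \<tau>" and ?P = "geodesic_borel M \<tau> \<Otimes>\<^sub>M (borel :: real measure)"
  obtain Bs :: "'m set set" where Bs: "countable Bs" "topological_basis Bs" using ex_countable_basis by blast
  define VV where "VV = {V\<in>Bs. closure V \<subseteq> U}"
  have cVV: "countable VV" using Bs(1) by (simp add: VV_def)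
  have VVx: "\<exists>V\<in>VV. x \<in> V" if x: "x \<in> U" for x
  proof -
    obtain V where V: "open V" "x \<in> V" "closure V \<subseteq> U" using manifold_regular[OF A U x] by blast
    obtain V' where V': "V' \<in> Bs" "x \<in> V'" "V' \<subseteq> V" using topological_basisE[OF Bs(2) V(1,2)] by blast
    then have "V' \<in> VV" using V(3) closure_mono[OF V'(3)] by (auto simp: VV_def)
    then show ?thesis using V'(2) by blast
  qed
  have VVo: "open V" if "V \<in> VV" for V using that Bs(2) by (auto simp: VV_def topological_basis_open)
  define tn where "tn n t = clip (of_int \<lfloor>real (Suc n) * t\<rfloor> / real (Suc n))" for n t
  define S where "S V n = {p \<in> space ?P. fst p (tn n (snd p)) \<in> closure V}" for V n
  have Sm: "S V n \<in> sets ?P" for V n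
  proof -
    have "S V n = (\<Union>k::int. {\<gamma> \<in> space ?G. \<gamma> (clip (of_int k / real (Suc n))) \<in> closure V} \<times> {t. \<lfloor>real (Suc n) * t\<rfloor> = k})"
      by (auto simp: S_def tn_def space_pair_measure)
    also have "\<dots> \<in> sets ?P"
    proof (intro sets.countable_UN'' pair_measureI)
      fix k :: int
      have "(\<lambda>\<gamma>. \<gamma> (clip (of_int k / real (Suc n)))) \<in> borel_measurable ?G"
        by (rule evaluation_measurable[OF lf clip_bounds])
      from measurable_sets[OF this, of "closure V"]
      show "{\<gamma> \<in> space ?G. \<gamma> (clip (of_int k / real (Suc n))) \<in> closure V} \<in> sets ?G"
        by (simp add: vimage_def Int_def conj_commute)
      have "(\<lambda>t. \<lfloor>real (Suc n) * t\<rfloor>) \<in> borel \<rightarrow>\<^sub>M count_space UNIV" by measurable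
      from measurable_sets[OF this, of "{k}"] show "{t. \<lfloor>real (Suc n) * t\<rfloor> = k} \<in> sets borel" by (simp add: vimage_def)
    qed auto
    finally show ?thesis .
  qed
  have lim: "(\<lambda>n. \<gamma> (tn n t)) \<longlonglongrightarrow> \<gamma> (clip t)" if "\<gamma> \<in> geodesics M \<tau>" for \<gamma> t
  proof -
    have c\<gamma>: "continuous_on {0..1} \<gamma>" using that by (auto simp: geodesics_def causal_curve_def AC_curve_def)
    have "(\<lambda>n. of_int \<lfloor>real (Suc n) * t\<rfloor> / real (Suc n)) \<longlonglongrightarrow> t"
    proof (rule LIMSEQ_I)
      fix e :: real assume "e > 0"
      then obtain N where N: "inverse (real (Suc N)) < e" using reals_Archimedean by blast
      show "\<exists>no. \<forall>n\<ge>no. norm (of_int \<lfloor>real (Suc n) * t\<rfloor> / real (Suc n) - t) < e"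
      proof (intro exI[of _ N] allI impI)
        fix n assume n: "n \<ge> N"
        have "\<bar>of_int \<lfloor>real (Suc n) * t\<rfloor> - real (Suc n) * t\<bar> \<le> 1" by linarith
        then have "\<bar>(of_int \<lfloor>real (Suc n) * t\<rfloor> - real (Suc n) * t) / real (Suc n)\<bar> \<le> 1 / real (Suc n)"
          unfolding abs_divide by (simp add: divide_right_mono)
        also have "(of_int \<lfloor>real (Suc n) * t\<rfloor> - real (Suc n) * t) / real (Suc n) = of_int \<lfloor>real (Suc n) * t\<rfloor> / real (Suc n) - t"
          by (simp add: diff_divide_distrib)
        also have "1 / real (Suc n) \<le> inverse (real (Suc N))" using n by (simp add: field_simps)
        finally show "norm (of_int \<lfloor>real (Suc n) * t\<rfloor> / real (Suc n) - t) < e" using N by simp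
      qed
    qed
    then have "(\<lambda>n. tn n t) \<longlonglongrightarrow> clip t" unfolding tn_def clip_def by (intro tendsto_max tendsto_min tendsto_const)
    then show ?thesis
      by (rule continuous_on_tendsto_compose[OF c\<gamma>]) (auto simp: clip_bounds tn_def)
  qed
  have "(\<lambda>p. fst p (clip (snd p))) -` U \<inter> space ?P = (\<Union>V\<in>VV. \<Union>N. \<Inter>n. S V (N + n))"
  proof (intro equalityI subsetI)
    fix p assume p: "p \<in> (\<lambda>p. fst p (clip (snd p))) -` U \<inter> space ?P"
    then have pg: "fst p \<in> geodesics M \<tau>" by (auto simp: space_pair_measure space_geodesic_borel)
    obtain V where V: "V \<in> VV" "fst p (clip (snd p)) \<in> V" using VVx p by blast
    obtain N where "\<And>n. n \<ge> N \<Longrightarrow> fst p (tn n (snd p)) \<in> V"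
      using topological_tendstoD[OF lim[OF pg] VVo[OF V(1)] V(2)] unfolding eventually_sequentially by blast
    then have "p \<in> S V (N + n)" for n using p closure_subset[of V] by (auto simp: S_def)
    then show "p \<in> (\<Union>V\<in>VV. \<Union>N. \<Inter>n. S V (N + n))" using V(1) by blast
  next
    fix p assume "p \<in> (\<Union>V\<in>VV. \<Union>N. \<Inter>n. S V (N + n))"
    then obtain V N where V: "V \<in> VV" "\<And>n. p \<in> S V (N + n)" by blast
    have ps: "p \<in> space ?P" using V(2)[of 0] by (simp add: S_def)
    then have pg: "fst p \<in> geodesics M \<tau>" by (auto simp: space_pair_measure space_geodesic_borel)
    have "eventually (\<lambda>n. fst p (tn n (snd p)) \<in> closure V) sequentially"
      unfolding eventually_sequentially using V(2) by (intro exI[of _ N] allI impI) (auto simp: S_def le_iff_add)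
    then have "fst p (clip (snd p)) \<in> closure V"
      by (intro Lim_in_closed_set[OF closed_closure _ _ lim[OF pg]]) auto
    then show "p \<in> (\<lambda>p. fst p (clip (snd p))) -` U \<inter> space ?P" using V(1) ps by (auto simp: VV_def)
  qed
  also have "\<dots> \<in> sets ?P"
    using cVV Sm by (intro sets.countable_UN'' sets.countable_UN sets.countable_INT) auto
  finally show "(\<lambda>p. fst p (clip (snd p))) -` U \<inter> space ?P \<in> sets ?P" .
qed

text \<open>The part of the curve in the chart is covered by countably many intervals with rational endpoints, on
  each of which it is absolutely continuous.\<close>

lemma AE_chart_derivative:
  fixes A :: "('m::topological_space, 'e::euclidean_space) chart set"
  assumes \<gamma>: "AC_curve A 0 1 \<gamma>" and c: "c \<in> A" "is_chart c"
  shows "AE t in lebesgue. 0 < t \<and> t < 1 \<and> \<gamma> t \<in> dom_of c \<longrightarrow> (\<exists>w. ((map_of_chart c \<circ> \<gamma>) has_vector_derivative w) (at t))"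
proof -
  have c\<gamma>: "continuous_on {0..1} \<gamma>" using \<gamma> by (simp add: AC_curve_def)
  define R where "R = {(p, q). p \<in> \<rat> \<and> q \<in> \<rat> \<and> 0 \<le> p \<and> p \<le> q \<and> q \<le> 1 \<and> \<gamma> ` {p..q} \<subseteq> dom_of c}"
  have cR: "countable R"
    by (rule countable_subset[of _ "\<rat> \<times> \<rat>"]) (auto simp: R_def countable_rat)
  have each: "AE t in lebesgue. fst i < t \<and> t < snd i \<longrightarrow> (\<exists>w. ((map_of_chart c \<circ> \<gamma>) has_vector_derivative w) (at t))"
    if "i \<in> R" for i
  proof -
    have i: "0 \<le> fst i" "fst i \<le> snd i" "snd i \<le> 1" "\<gamma> ` {fst i..snd i} \<subseteq> dom_of c" using that by (auto simp: R_def)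
    have ac: "AC_on (fst i) (snd i) (map_of_chart c \<circ> \<gamma>)" using \<gamma> c i by (auto simp: AC_curve_def)
    show ?thesis
    proof (rule AC_on_density[OF ac i(2)])
      fix h assume "AE t in lebesgue. fst i < t \<and> t < snd i \<longrightarrow> ((map_of_chart c \<circ> \<gamma>) has_vector_derivative h t) (at t)"
      then show ?thesis by eventually_elim blast
    qed
  qed
  have "AE t in lebesgue. \<forall>i\<in>R. fst i < t \<and> t < snd i \<longrightarrow> (\<exists>w. ((map_of_chart c \<circ> \<gamma>) has_vector_derivative w) (at t))"
    unfolding AE_ball_countable[OF cR] by (rule ballI) (rule each)
  then show ?thesis
  proof eventually_elim
    case (elim t)
    show ?case
    proof
      assume t: "0 < t \<and> t < 1 \<and> \<gamma> t \<in> dom_of c"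
      obtain W where W: "open W" "t \<in> W" "\<And>s. s \<in> {0..1} \<Longrightarrow> s \<in> W \<Longrightarrow> \<gamma> s \<in> dom_of c"
        using c\<gamma>[unfolded continuous_on_topological, rule_format, of t "dom_of c"] t chart_open(1)[OF c(2)] by auto
      obtain e where e: "e > 0" "ball t e \<subseteq> W" using W(1,2) open_contains_ball by blast
      obtain p where p: "p \<in> \<rat>" "max 0 (t - e) < p" "p < t" using Rats_dense_in_real[of "max 0 (t - e)" t] t e(1) by auto
      obtain q where q: "q \<in> \<rat>" "t < q" "q < min 1 (t + e)" using Rats_dense_in_real[of t "min 1 (t + e)"] t e(1) by auto
      have "\<gamma> ` {p..q} \<subseteq> dom_of c"
      proof
        fix x assume "x \<in> \<gamma> ` {p..q}"
        then obtain s where s: "x = \<gamma> s" "p \<le> s" "s \<le> q" by auto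
        then have "s \<in> ball t e" using p q by (auto simp: dist_real_def)
        then show "x \<in> dom_of c" unfolding s(1) using e(2) p q s by (intro W(3)) auto
      qed
      then have "(p, q) \<in> R" using p q t by (auto simp: R_def)
      then show "\<exists>w. ((map_of_chart c \<circ> \<gamma>) has_vector_derivative w) (at t)" using elim p q by force
    qed
  qed
qed

text \<open>In a chart the velocity is the limit of difference quotients of the jointly measurable evaluation map,
  wherever it exists. Hence the pairs \<open>(\<gamma>, t)\<close> at which the Lorentz-Finsler function of the velocity is
  not zero form, up to null sections, a measurable set \<open>Bad\<close> of the product with the line. A curve is
  lightlike iff its section of \<open>Bad\<close> is null, which is a measurable condition.\<close>

lemma lightlike_measurable:
  fixes M :: "('m::{t2_space,second_countable_topology}, 'e::euclidean_space) lf_manifold"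
  assumes lf: "lorentz_finsler M"
  shows "lightlike_geodesics M \<tau> \<in> sets (geodesic_borel M \<tau>)"
proof -
  have A: "smooth_atlas (atlas M)" using lf by (simp add: lorentz_finsler_def)
  let ?G = "geodesic_borel M \<tau>" and ?P = "geodesic_borel M \<tau> \<Otimes>\<^sub>M (lborel :: real measure)"
  define X where "X p = fst p (clip (snd p))" for p :: "(real \<Rightarrow> 'm) \<times> real"
  have sP: "sets ?P = sets (geodesic_borel M \<tau> \<Otimes>\<^sub>M (borel :: real measure))" by (intro sets_pair_measure_cong) auto
  have Xm: "X \<in> borel_measurable ?P"
    using joint_evaluation_measurable[OF lf, of \<tau>] unfolding X_def[abs_def] by (simp cong: measurable_cong_sets add: sP)
  obtain J where J: "countable J" "J \<subseteq> atlas M" "(\<Union>c\<in>J. dom_of c) = (\<Union>c\<in>atlas M. dom_of c)"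
    using countable_cover[of "atlas M" dom_of] chart_open(1)[OF atlasD(1)[OF A]] by blast
  have Jx: "\<exists>c\<in>J. x \<in> dom_of c" for x
  proof -
    have "x \<in> (\<Union>c\<in>J. dom_of c)" using A unfolding J(3) by (simp add: smooth_atlas_def)
    then show ?thesis by blast
  qed
  \<comment> \<open>Coordinates, set to 0 outside the domain to be Borel functions on the whole manifold.\<close>
  define cc :: "('m, 'e) chart \<Rightarrow> 'm \<Rightarrow> 'e" where "cc c x = indicator (dom_of c) x *\<^sub>R map_of_chart c x" for c x
  define sh where "sh k p = (fst p, snd p + 1 / real (Suc k))" for k and p :: "(real \<Rightarrow> 'm) \<times> real"
  \<comment> \<open>Difference quotients with increment 1 / (k + 1).\<close>
  define qq where "qq c k p = real (Suc k) *\<^sub>R (cc c (X (sh k p)) - cc c (X p))" for c k p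
  define DD where "DD c p = lim (\<lambda>k. qq c k p)" for c p
  define FF where "FF c z = indicator (range_of c \<times> UNIV) z *\<^sub>R LL_chart M c z" for c z
  define bad where "bad c = {p \<in> space ?P. 0 < snd p \<and> snd p < 1 \<and> X p \<in> dom_of c \<and> FF c (cc c (X p), DD c p) \<noteq> 0}" for c
  have badm: "bad c \<in> sets ?P" if c: "c \<in> J" for c
  proof -
    have cA: "c \<in> atlas M" using c J(2) by auto
    have ch: "is_chart c" using atlasD(1)[OF A cA] .
    have db: "dom_of c \<in> sets borel" using chart_open(1)[OF ch] by simp
    have ccm: "cc c \<in> borel_measurable borel"
      unfolding cc_def by (rule borel_measurable_continuous_on_indicator[OF db chart_continuous(1)[OF ch]])
    have rb: "range_of c \<times> (UNIV :: 'e set) \<in> sets borel" using chart_open(2)[OF ch] by (intro borel_open open_Times) auto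
    have eq: "LL_chart M c = LL M \<circ> bundle_inv (atlas M) c" by (auto simp: LL_chart_def fun_eq_iff)
    have "continuous_on (range_of c \<times> UNIV) (LL_chart M c)"
      unfolding eq using lf cA unfolding lorentz_finsler_def lf_function_def by blast
    then have FFm: "FF c \<in> borel_measurable borel"
      unfolding FF_def by (rule borel_measurable_continuous_on_indicator[OF rb])
    have shm: "sh k \<in> ?P \<rightarrow>\<^sub>M ?P" for k unfolding sh_def by measurable
    have "qq c k \<in> borel_measurable ?P" for k
    proof -
      have "(\<lambda>p. cc c (X p)) \<in> borel_measurable ?P" using ccm Xm by (rule measurable_compose[rotated])
      moreover from measurable_compose[OF shm this] have "(\<lambda>p. cc c (X (sh k p))) \<in> borel_measurable ?P" .
      ultimately show ?thesis unfolding qq_def by measurable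
    qed
    then have DDm: "DD c \<in> borel_measurable ?P" unfolding DD_def by (rule borel_measurable_lim_metric)
    have ccX: "(\<lambda>p. cc c (X p)) \<in> borel_measurable ?P" using ccm Xm by (rule measurable_compose[rotated])
    have "(\<lambda>p. (cc c (X p), DD c p)) \<in> borel_measurable ?P" using ccX DDm by (rule borel_measurable_Pair)
    from measurable_compose[OF this FFm] have Fm: "(\<lambda>p. FF c (cc c (X p), DD c p)) \<in> borel_measurable ?P" .
    have 1: "{p \<in> space ?P. FF c (cc c (X p), DD c p) \<noteq> 0} \<in> sets ?P" using Fm by measurable
    have 2: "{p \<in> space ?P. X p \<in> dom_of c} \<in> sets ?P"
      using measurable_sets[OF Xm db] by (simp add: vimage_def Int_def conj_commute)
    have 3: "{p \<in> space ?P. 0 < snd p \<and> snd p < 1} \<in> sets ?P" by measurable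
    have "bad c = {p \<in> space ?P. 0 < snd p \<and> snd p < 1} \<inter> {p \<in> space ?P. X p \<in> dom_of c} \<inter> {p \<in> space ?P. FF c (cc c (X p), DD c p) \<noteq> 0}"
      by (auto simp: bad_def)
    then show ?thesis using 1 2 3 by (auto intro!: sets.Int)
  qed
  define Bad where "Bad = (\<Union>c\<in>J. bad c)"
  have Badm: "Bad \<in> sets ?P" unfolding Bad_def using J(1) badm by (rule sets.countable_UN'')
  have key: "\<gamma> \<in> lightlike_geodesics M \<tau> \<longleftrightarrow> emeasure lborel (Pair \<gamma> -` Bad) = 0" if g: "\<gamma> \<in> geodesics M \<tau>" for \<gamma>
  proof -
    have ac: "AC_curve (atlas M) 0 1 \<gamma>" and cone: "AE t in lebesgue_on {0..1}. (\<gamma> t, velocity (atlas M) \<gamma> t) \<in> cone M"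
      using g by (auto simp: geodesics_def causal_curve_def)
    have c\<gamma>: "continuous_on {0..1} \<gamma>" using ac by (simp add: AC_curve_def)
    have cone': "AE t in lebesgue. t \<in> {0..1} \<longrightarrow> (\<gamma> t, velocity (atlas M) \<gamma> t) \<in> cone M"
      using cone by (subst (asm) AE_restrict_space_iff) auto
    have der: "AE t in lebesgue. \<forall>c\<in>J. 0 < t \<and> t < 1 \<and> \<gamma> t \<in> dom_of c \<longrightarrow> (\<exists>w. ((map_of_chart c \<circ> \<gamma>) has_vector_derivative w) (at t))"
    proof -
      have "AE t in lebesgue. 0 < t \<and> t < 1 \<and> \<gamma> t \<in> dom_of c \<longrightarrow> (\<exists>w. ((map_of_chart c \<circ> \<gamma>) has_vector_derivative w) (at t))"
        if "c \<in> J" for c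
      proof -
        have cA: "c \<in> atlas M" using that J(2) by blast
        show ?thesis by (rule AE_chart_derivative[OF ac cA atlasD(1)[OF A cA]])
      qed
      then show ?thesis unfolding AE_ball_countable[OF J(1)] by (rule ballI)
    qed
    have eqv: "AE t in lebesgue. 0 < t \<and> t < 1 \<longrightarrow> (t \<in> Pair \<gamma> -` Bad \<longleftrightarrow> Lag M (\<gamma> t) (velocity (atlas M) \<gamma> t) \<noteq> 0)"
      using der cone'
    proof eventually_elim
      case (elim t)
      show ?case
      proof
        assume t: "0 < t \<and> t < 1"
        have Xt: "X (\<gamma>, t) = \<gamma> t" using t by (simp add: X_def clip_id)
        have ps: "(\<gamma>, t) \<in> space ?P" using g by (simp add: space_pair_measure space_geodesic_borel)
        have tc: "isCont \<gamma> t" using t by (intro continuous_on_interior[OF c\<gamma>]) auto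
        have one: "(\<gamma>, t) \<in> bad c \<longleftrightarrow> Lag M (\<gamma> t) (velocity (atlas M) \<gamma> t) \<noteq> 0" if c: "c \<in> J" "\<gamma> t \<in> dom_of c" for c
        proof -
          have cA: "c \<in> atlas M" using c J(2) by auto
          have ch: "is_chart c" using atlasD(1)[OF A cA] .
          interpret lf_chart M c by unfold_locales (use lf cA in auto)
          obtain w where w: "((map_of_chart c \<circ> \<gamma>) has_vector_derivative w) (at t)" using elim(1) c t by blast
          have cct: "cc c (\<gamma> t) = map_of_chart c (\<gamma> t)" using c(2) by (simp add: cc_def)
          have "(\<lambda>k. qq c k (\<gamma>, t)) \<longlonglongrightarrow> w"
          proof -
            have "(\<lambda>k. ((map_of_chart c \<circ> \<gamma>) (t + 1 / real (Suc k)) - (map_of_chart c \<circ> \<gamma>) t) /\<^sub>R (1 / real (Suc k))) \<longlonglongrightarrow> w"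
            proof (rule LIMSEQ_I)
              fix e :: real assume e: "e > 0"
              let ?g = "map_of_chart c \<circ> \<gamma>"
              obtain d where d: "d > 0" "\<And>y. norm (y - t) < d \<Longrightarrow> norm (?g y - ?g t - (y - t) *\<^sub>R w) \<le> e / 2 * norm (y - t)"
                using w[unfolded has_vector_derivative_def has_derivative_at_alt] e half_gt_zero[OF e] by blast
              obtain N where N: "inverse (real (Suc N)) < d" using reals_Archimedean[OF d(1)] by blast
              show "\<exists>no. \<forall>k\<ge>no. norm ((?g (t + 1 / real (Suc k)) - ?g t) /\<^sub>R (1 / real (Suc k)) - w) < e"
              proof (intro exI[of _ N] allI impI)
                fix k assume k: "k \<ge> N"
                define h where "h = 1 / real (Suc k)"
                have h: "h > 0" "h < d"
                proof -
                  show "h > 0" by (simp add: h_def)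
                  have "h \<le> inverse (real (Suc N))" using k by (simp add: h_def field_simps)
                  then show "h < d" using N by linarith
                qed
                have "(?g (t + h) - ?g t) /\<^sub>R h - w = (?g (t + h) - ?g t - h *\<^sub>R w) /\<^sub>R h"
                  using h(1) by (simp add: scaleR_diff_right)
                also have "norm \<dots> = norm (?g (t + h) - ?g t - h *\<^sub>R w) / h" using h(1) by (simp add: divide_inverse mult.commute)
                also have "\<dots> \<le> e / 2" using d(2)[of "t + h"] h by (simp add: field_simps)
                finally show "norm ((?g (t + 1 / real (Suc k)) - ?g t) /\<^sub>R (1 / real (Suc k)) - w) < e"
                  using e unfolding h_def by linarith
              qed
            qed
            moreover have "eventually (\<lambda>k. ((map_of_chart c \<circ> \<gamma>) (t + 1 / real (Suc k)) - (map_of_chart c \<circ> \<gamma>) t) /\<^sub>R (1 / real (Suc k)) = qq c k (\<gamma>, t)) sequentially"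
            proof -
              have lim1: "(\<lambda>k. t + 1 / real (Suc k)) \<longlonglongrightarrow> t + 0"
                by (rule tendsto_add[OF tendsto_const LIMSEQ_Suc[OF lim_1_over_n]])
              then have "(\<lambda>k. \<gamma> (t + 1 / real (Suc k))) \<longlonglongrightarrow> \<gamma> t" using isCont_tendsto_compose[OF tc] by simp
              then have "eventually (\<lambda>k. \<gamma> (t + 1 / real (Suc k)) \<in> dom_of c) sequentially"
                by (rule topological_tendstoD) (use chart_open(1)[OF ch] c(2) in auto)
              moreover have "eventually (\<lambda>k. t + 1 / real (Suc k) < 1) sequentially"
                using order_tendstoD(2)[OF lim1] t by simp
              ultimately show ?thesis
              proof eventually_elim
                case (elim k)
                have "X (sh k (\<gamma>, t)) = \<gamma> (t + 1 / real (Suc k))" using elim(2) t by (simp add: X_def sh_def clip_id)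
                then show ?case using elim(1) cct by (simp add: qq_def Xt cc_def)
              qed
            qed
            ultimately show ?thesis by (rule Lim_transform_eventually)
          qed
          then have DDw: "DD c (\<gamma>, t) = w" unfolding DD_def by (rule limI)
          have "FF c (cc c (X (\<gamma>, t)), DD c (\<gamma>, t)) = LL_chart M c (map_of_chart c (\<gamma> t), w)"
            using c(2) ch by (simp add: FF_def Xt cct DDw)
          also have "\<dots> = LL M (\<gamma> t, velocity (atlas M) \<gamma> t)" using LL_velocity(1)[OF c(2) tc w] by simp
          finally have "(\<gamma>, t) \<in> bad c \<longleftrightarrow> LL M (\<gamma> t, velocity (atlas M) \<gamma> t) \<noteq> 0"
            using ps t c(2) by (simp add: bad_def Xt)
          moreover have "(\<gamma> t, velocity (atlas M) \<gamma> t) \<in> cone M" using elim(2) t by simp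
          ultimately show ?thesis by (simp add: Lag_def zero_ereal_def)
        qed
        obtain c where c: "c \<in> J" "\<gamma> t \<in> dom_of c" using Jx by blast
        show "t \<in> Pair \<gamma> -` Bad \<longleftrightarrow> Lag M (\<gamma> t) (velocity (atlas M) \<gamma> t) \<noteq> 0"
        proof
          assume "t \<in> Pair \<gamma> -` Bad"
          then obtain c' where c': "c' \<in> J" "(\<gamma>, t) \<in> bad c'" by (auto simp: Bad_def)
          then have "\<gamma> t \<in> dom_of c'" by (simp add: bad_def Xt)
          then show "Lag M (\<gamma> t) (velocity (atlas M) \<gamma> t) \<noteq> 0" by (rule iffD1[OF one[OF c'(1)] c'(2)])
        next
          assume "Lag M (\<gamma> t) (velocity (atlas M) \<gamma> t) \<noteq> 0"
          then have "(\<gamma>, t) \<in> bad c" by (rule iffD2[OF one[OF c]])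
          then show "t \<in> Pair \<gamma> -` Bad" using c(1) by (auto simp: Bad_def)
        qed
      qed
    qed
    have Sl: "Pair \<gamma> -` Bad \<in> sets borel" using sets_Pair1[OF Badm, of \<gamma>] by simp
    have in01: "0 < t \<and> t < 1" if "t \<in> Pair \<gamma> -` Bad" for t using that by (auto simp: Bad_def bad_def)
    have nullpts: "AE t in lebesgue. t \<notin> {0, 1::real}" by (rule AE_not_in) (simp add: negligible_iff_null_sets[symmetric])
    have "\<gamma> \<in> lightlike_geodesics M \<tau> \<longleftrightarrow> (AE t in lebesgue_on {0..1}. Lag M (\<gamma> t) (velocity (atlas M) \<gamma> t) = 0)"
      using g by (simp add: lightlike_geodesics_def)
    also have "\<dots> \<longleftrightarrow> (AE t in lebesgue. t \<in> {0..1} \<longrightarrow> Lag M (\<gamma> t) (velocity (atlas M) \<gamma> t) = 0)"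
      by (subst AE_restrict_space_iff) auto
    also have "\<dots> \<longleftrightarrow> (AE t in lebesgue. t \<notin> Pair \<gamma> -` Bad)"
    proof
      assume "AE t in lebesgue. t \<in> {0..1} \<longrightarrow> Lag M (\<gamma> t) (velocity (atlas M) \<gamma> t) = 0"
      then show "AE t in lebesgue. t \<notin> Pair \<gamma> -` Bad"
        using eqv
      proof eventually_elim
        case (elim t)
        show ?case
        proof
          assume b: "t \<in> Pair \<gamma> -` Bad"
          then have t: "0 < t \<and> t < 1" by (rule in01)
          with elim(2) b have "Lag M (\<gamma> t) (velocity (atlas M) \<gamma> t) \<noteq> 0" by blast
          then show False using elim(1) t by simp
        qed
      qed
    next
      assume "AE t in lebesgue. t \<notin> Pair \<gamma> -` Bad"
      then show "AE t in lebesgue. t \<in> {0..1} \<longrightarrow> Lag M (\<gamma> t) (velocity (atlas M) \<gamma> t) = 0"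
        using eqv nullpts
      proof eventually_elim
        case (elim t)
        show ?case
        proof
          assume "t \<in> {0..1}"
          then have "0 < t \<and> t < 1" using elim(3) by simp
          then show "Lag M (\<gamma> t) (velocity (atlas M) \<gamma> t) = 0" using elim(1,2) by blast
        qed
      qed
    qed
    also have "\<dots> \<longleftrightarrow> Pair \<gamma> -` Bad \<in> null_sets lebesgue" using Sl by (intro AE_iff_null_sets[symmetric]) auto
    also have "\<dots> \<longleftrightarrow> emeasure lborel (Pair \<gamma> -` Bad) = 0" using Sl by (simp add: null_sets_def)
    finally show ?thesis .
  qed
  have "(\<lambda>\<gamma>. emeasure lborel (Pair \<gamma> -` Bad)) \<in> borel_measurable ?G"
    by (rule lborel.measurable_emeasure_Pair[OF Badm])
  then have "{\<gamma> \<in> space ?G. emeasure lborel (Pair \<gamma> -` Bad) = 0} \<in> sets ?G" by measurable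
  moreover have "{\<gamma> \<in> space ?G. emeasure lborel (Pair \<gamma> -` Bad) = 0} = lightlike_geodesics M \<tau>"
    using key by (auto simp: space_geodesic_borel lightlike_geodesics_def)
  ultimately show ?thesis by simp
qed

section \<open>Lightlike geodesics are negligible\<close>

text \<open>The complement of the support is a union of countably many open null sets.\<close>

lemma AE_in_msupport:
  fixes \<mu> :: "'m::{t2_space,second_countable_topology} measure"
  assumes "sets \<mu> = sets borel"
  shows "AE x in \<mu>. x \<in> msupport \<mu>"
proof -
  define I where "I = {U. open U \<and> emeasure \<mu> U = 0}"
  obtain J where J: "countable J" "J \<subseteq> I" "(\<Union>U\<in>J. U) = (\<Union>U\<in>I. U)"
    using countable_cover[of I "\<lambda>U. U"] by (auto simp: I_def)
  have "(\<Union>U\<in>J. U) \<in> null_sets \<mu>"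
    using J(1,2) assms by (intro null_sets_UN') (auto simp: I_def null_sets_def)
  then have "AE x in \<mu>. x \<notin> (\<Union>U\<in>I. U)" unfolding J(3) by (rule AE_not_in)
  then show ?thesis
    by eventually_elim (auto simp: msupport_def I_def zero_less_iff_neq_zero)
qed

theorem theorem2p12:
  fixes M :: "('m::{t2_space,second_countable_topology}, 'e::euclidean_space) lf_manifold"
    and B :: "('n::{t2_space,second_countable_topology}, 'f::real_normed_vector) chart set"
    and \<Phi> :: "'m \<Rightarrow> real \<times> 'n" and \<tau> :: "'m \<Rightarrow> real"
    and \<mu> \<nu> :: "'m measure" and \<psi> :: "'m \<Rightarrow> ereal" and \<Xi> :: "(real \<Rightarrow> 'm) measure"
  assumes "lorentz_finsler M"
    and "globally_hyperbolic M"
    and "splitting M B \<Phi> \<tau>"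
    and "(\<mu>, \<nu>) \<in> causal_pairs M \<tau>"
    and "msupport \<mu> \<inter> msupport \<nu> = {}"
    and "DKP_solution M \<mu> \<nu> \<psi>"
    and "(\<exists>H m. spacelike_hypersurface M H \<and> is_hyp_lebesgue_measure M H m \<and>
            emeasure \<mu> (UNIV - H) = 0 \<and> absolutely_continuous m \<mu>) \<or>
         (\<exists>m. is_lebesgue_measure M m \<and> absolutely_continuous m \<mu>)"
    and "dynamical_optimal_coupling M \<tau> \<mu> \<nu> \<Xi>"
  shows "lightlike_geodesics M \<tau> \<in> null_sets \<Xi>"
proof -
  note lf = assms(1) and sp = assms(3)
  have s\<mu>: "sets \<mu> = sets borel" and s\<nu>: "sets \<nu> = sets borel" using assms(4) by (auto simp: causal_pairs_def)
  have s\<Xi>: "sets \<Xi> = sets (geodesic_borel M \<tau>)" and \<mu>: "distr \<Xi> borel (\<lambda>\<gamma>. \<gamma> 0) = \<mu>" and \<nu>: "distr \<Xi> borel (\<lambda>\<gamma>. \<gamma> 1) = \<nu>"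
    and opt: "optimal_coupling M \<mu> \<nu> (distr \<Xi> borel (\<lambda>\<gamma>. (\<gamma> 0, \<gamma> 1)))"
    using assms(8) by (auto simp: dynamical_optimal_coupling_def)
  have m0: "(\<lambda>\<gamma>. \<gamma> 0) \<in> borel_measurable \<Xi>" and m1: "(\<lambda>\<gamma>. \<gamma> 1) \<in> borel_measurable \<Xi>"
    using evaluation_measurable[OF lf, of 0 \<tau>] evaluation_measurable[OF lf, of 1 \<tau>] s\<Xi> by (auto cong: measurable_cong_sets)
  have m01: "(\<lambda>\<gamma>. (\<gamma> 0, \<gamma> 1)) \<in> borel_measurable \<Xi>" using m0 m1 by (rule borel_measurable_Pair)
  \<comment> \<open>Almost every curve starts outside the negligible set, has its endpoints in the two supports,
      starts where \<psi> is finite, and is tight. A lightlike curve cannot satisfy all of this.\<close>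
  obtain N where N: "N \<in> null_sets \<mu>" "tight_start M \<tau> \<psi> \<subseteq> N"
    using tight_start_null[OF lf sp s\<mu> assms(7)] by blast
  have a1: "AE \<gamma> in \<Xi>. \<gamma> 0 \<notin> N"
    using AE_not_in[OF N(1)] AE_distrD[OF m0, of "\<lambda>x. x \<notin> N"] unfolding \<mu> by blast
  have a2: "AE \<gamma> in \<Xi>. \<gamma> 0 \<in> msupport \<mu>"
    using AE_in_msupport[OF s\<mu>] AE_distrD[OF m0, of "\<lambda>x. x \<in> msupport \<mu>"] unfolding \<mu> by blast
  have a3: "AE \<gamma> in \<Xi>. \<gamma> 1 \<in> msupport \<nu>"
    using AE_in_msupport[OF s\<nu>] AE_distrD[OF m1, of "\<lambda>x. x \<in> msupport \<nu>"] unfolding \<nu> by blast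
  have a4: "AE \<gamma> in \<Xi>. \<psi> (\<gamma> 0) \<noteq> \<infinity>"
    using assms(6) AE_distrD[OF m0, of "\<lambda>x. \<psi> x \<noteq> \<infinity>"] unfolding \<mu> DKP_solution_def by blast
  have "AE p in distr \<Xi> borel (\<lambda>\<gamma>. (\<gamma> 0, \<gamma> 1)). c_transform M \<psi> (snd p) - \<psi> (fst p) = cost M (fst p) (snd p)"
    using assms(6) opt unfolding DKP_solution_def by blast
  from AE_distrD[OF m01 this] have a5: "AE \<gamma> in \<Xi>. c_transform M \<psi> (\<gamma> 1) - \<psi> (\<gamma> 0) = cost M (\<gamma> 0) (\<gamma> 1)" by simp
  have mi: "\<psi> x \<noteq> - \<infinity>" for x using assms(6) by (simp add: DKP_solution_def c_convex_def)
  have "AE \<gamma> in \<Xi>. \<gamma> \<notin> lightlike_geodesics M \<tau>"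
    using a1 a2 a3 a4 a5
  proof eventually_elim
    case (elim \<gamma>)
    show ?case
    proof
      assume "\<gamma> \<in> lightlike_geodesics M \<tau>"
      moreover have "\<gamma> 1 \<noteq> \<gamma> 0" using elim(2,3) assms(5) by auto
      moreover have "\<bar>\<psi> (\<gamma> 0)\<bar> \<noteq> \<infinity>" using elim(4) mi[of "\<gamma> 0"] by (cases "\<psi> (\<gamma> 0)") auto
      ultimately have "\<gamma> 0 \<in> tight_start M \<tau> \<psi>" using elim(5) by (auto simp: tight_start_def)
      then show False using N(2) elim(1) by blast
    qed
  qed
  moreover have "lightlike_geodesics M \<tau> \<in> sets \<Xi>" using lightlike_measurable[OF lf] s\<Xi> by simp
  ultimately show ?thesis by (simp add: AE_iff_null_sets)
qed

end
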